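(* Let $p$ be a prime, $q=p^a$, $k=\mathbb{F}_q$, $K=\mathbb{Q}_q$ the unramified extension of $\mathbb{Q}_p$ of degree $a$, and $\mathcal{O}=\mathbb{Z}_q$ its ring of integers. Let $n$ be a positive integer with $p>n-1$, and let $f\in\mathbb{Z}[x_0,\ldots,x_n]$ be a homogeneous polynomial of degree $N$ (or, more generally, a homogeneous polynomial with coefficients in the ring of integers of a finite extension of $\mathbb{Q}$ unramified at $p$, viewed over $\mathcal{O}$) such that the hypersurface $X=Z(f)\subset\mathbb{P}^n_{\mathcal{O}}$ has $\tau$ equisingular ordinary double points, with associated closed subscheme $W=\coprod_{s=1}^{\tau}W_s\subset\mathbb{P}^n_{\mathcal{O}}$. Let $\rho:Y\to\mathbb{P}^n_{\mathcal{O}}$ be the blowup of $W$. Let $\widehat{X}$ be the proper transform of $X$ and $E_s$ the exceptional divisor over $W_s$. Then the preimage of $X$ with the reduced scheme structure, $$D=\rho^{-1}(X)=\widehat{X}\cup E_1\cup\cdots\cup E_\tau,$$ has irreducible components that are smooth over $\mathrm{Spec}(\mathcal{O})$ and that have normal crossings.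
   Context: Equisingular ordinary double points: the partial derivatives $\partial f/\partial x_i$, $i=0,\ldots,n$, define a morphism of sheaves $$\mathcal{O}_{\mathbb{P}^n_{\mathcal{O}}}(-N+1)^{\oplus(n+1)}\to\mathcal{O}_{\mathbb{P}^n_{\mathcal{O}}}.$$ The hypersurface $Z(f)\subset\mathbb{P}^n_{\mathcal{O}}$ is said to have ($\tau$) equisingular ordinary double points if the cokernel of this morphism is scheme-theoretically supported at a disjoint union $W=\coprod_{s=1}^{\tau}W_s$ of closed subschemes $W_s$ such that the restriction of the structure morphism $\pi:\mathbb{P}^n_{\mathcal{O}}\to\mathrm{Spec}(\mathcal{O})$ to each $W_s$ is an isomorphism. Normal crossings is understood relative to $\mathcal{O}$: at every point where several components of $D$ meet, the differentials (over $\mathcal{O}$) of their local defining equations are linearly independent. *)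

theory Defs
  imports
    "HOL-Library.Poly_Mapping"
    "HOL-Computational_Algebra.Fraction_Field"
    "HOL-Computational_Algebra.Polynomial"
    "HOL-Computational_Algebra.Primes"
    "HOL-Algebra.Embedded_Algebras"
    "HOL-Algebra.Ideal_Product"
    "HOL-Analysis.Abstract_Topology"
    "Jordan_Normal_Form.Determinant"
begin

text \<open>
  Integral separated schemes are represented as models in the sense of Zariski and Chevalley
  (Zariski--Samuel, Commutative Algebra II, Ch. VI, 17): all the schemes that occur here are
  integral, separated and birational to projective space (or are \<open>Spec \<O>\<close>), so such a scheme is the
  set of the local rings of its points, regarded as subrings of one fixed big field. A point is its
  local ring, the stalk of the structure sheaf at a point is the point itself, and the sections
  over an open set \<open>U\<close> form the intersection of the members of \<open>U\<close>.
\<close>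

section \<open>Rings of elements of an ambient ring\<close>

definition ring_of :: "'a::comm_ring_1 set \<Rightarrow> 'a ring" where
  "ring_of A = \<lparr>carrier = A, monoid.mult = (*), one = 1, ring.zero = 0, ring.add = (+)\<rparr>"

definition max_ideal :: "'f::field set \<Rightarrow> 'f set" where
  "max_ideal R = R - Units (ring_of R)"

definition localization_at :: "'f::field set \<Rightarrow> 'f set \<Rightarrow> 'f set" where
  "localization_at A P = {a / s | a s. a \<in> A \<and> s \<in> A - P}"

primrec ideal_pow :: "'f::field set \<Rightarrow> 'f set \<Rightarrow> nat \<Rightarrow> 'f set" where
  "ideal_pow R I 0 = R"
| "ideal_pow R I (Suc d) = ideal_prod (ring_of R) I (ideal_pow R I d)"


section \<open>The base: unramified extensions of the p-adic numbers\<close>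

text \<open>In a complete field the closure of the rationals is their completion.\<close>

definition closure_Q :: "('k::field_char_0 \<Rightarrow> real) \<Rightarrow> 'k set" where
  "closure_Q v = {x. \<exists>s :: nat \<Rightarrow> rat. (\<lambda>i. v (of_rat (s i) - x)) \<longlonglongrightarrow> 0}"

text \<open>
  The field \<open>'k\<close> with absolute value \<open>v\<close> is the unramified extension of degree \<open>a\<close> of \<open>\<rat>\<^sub>p\<close>:
  the conditions on \<open>v\<close> force its restriction to \<open>\<rat>\<close> to be the p-adic absolute value, so
  \<open>closure_Q v\<close> is \<open>\<rat>\<^sub>p\<close>. Unramified means ramification index 1, i.e. equal value groups; separability
  of the residue field extension is automatic, the residue field of \<open>\<rat>\<^sub>p\<close> being finite.
\<close>

definition unramified_p_adic_field :: "nat \<Rightarrow> nat \<Rightarrow> ('k::field_char_0 \<Rightarrow> real) \<Rightarrow> bool" where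
  "unramified_p_adic_field p a v \<longleftrightarrow>
     (\<forall>x. 0 \<le> v x) \<and> (\<forall>x. v x = 0 \<longleftrightarrow> x = 0) \<and>
     (\<forall>x y. v (x * y) = v x * v y) \<and>
     (\<forall>x y. v (x + y) \<le> max (v x) (v y)) \<and>
     v (of_nat p) = 1 / real p \<and>
     (\<forall>X :: nat \<Rightarrow> 'k. (\<forall>e>0. \<exists>M. \<forall>i\<ge>M. \<forall>j\<ge>M. v (X i - X j) < e) \<longrightarrow>
        (\<exists>x. (\<lambda>i. v (X i - x)) \<longlonglongrightarrow> 0)) \<and>
     ring.dimension (ring_of UNIV) a (closure_Q v) UNIV \<and>
     v ` (UNIV - {0}) = v ` (closure_Q v - {0})"

definition valuation_ring :: "('k::field_char_0 \<Rightarrow> real) \<Rightarrow> 'k set" where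
  "valuation_ring v = {x. v x \<le> 1}"

definition number_field :: "'k::field_char_0 set \<Rightarrow> bool" where
  "number_field L \<longleftrightarrow> subfield L (ring_of UNIV) \<and> ring.finite_dimension (ring_of UNIV) \<rat> L"

definition integers_of :: "'k::field_char_0 set \<Rightarrow> 'k set" where
  "integers_of L = {x \<in> L. algebraic_int x}"

text \<open>No prime of \<open>L\<close> over \<open>p\<close> occurs in \<open>(p)\<close> with exponent greater than 1.\<close>

definition unramified_at :: "nat \<Rightarrow> 'k::field_char_0 set \<Rightarrow> bool" where
  "unramified_at p L \<longleftrightarrow>
     (\<forall>P. primeideal P (ring_of (integers_of L)) \<and> of_nat p \<in> P \<longrightarrow>
          of_nat p \<notin> ideal_prod (ring_of (integers_of L)) P P)"


section \<open>Polynomials in \<open>x\<^sub>0, x\<^sub>1, \<dots>\<close> and their fraction field\<close>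

type_synonym 'k mpoly = "(nat \<Rightarrow>\<^sub>0 nat) \<Rightarrow>\<^sub>0 'k"
type_synonym 'k ratfun = "'k mpoly fract"

definition polys :: "'k::comm_ring_1 set \<Rightarrow> nat \<Rightarrow> 'k mpoly set" where
  "polys B m = {P. \<forall>\<mu>\<in>Poly_Mapping.keys P. Poly_Mapping.lookup P \<mu> \<in> B \<and> Poly_Mapping.keys \<mu> \<subseteq> {..<m}}"

definition homogeneous :: "nat \<Rightarrow> 'k::comm_ring_1 mpoly \<Rightarrow> bool" where
  "homogeneous d P \<longleftrightarrow>
     (\<forall>\<mu>\<in>Poly_Mapping.keys P. (\<Sum>i\<in>Poly_Mapping.keys \<mu>. Poly_Mapping.lookup \<mu> i) = d)"

definition const :: "'k::comm_ring_1 \<Rightarrow> 'k mpoly" where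
  "const c = Poly_Mapping.single 0 c"

definition var :: "nat \<Rightarrow> 'k::comm_ring_1 mpoly" where
  "var i = Poly_Mapping.single (Poly_Mapping.single i 1) 1"

definition partial_deriv :: "nat \<Rightarrow> 'k::comm_ring_1 mpoly \<Rightarrow> 'k mpoly" where
  "partial_deriv j P =
     (\<Sum>\<mu>\<in>Poly_Mapping.keys P.
        Poly_Mapping.single (\<mu> - Poly_Mapping.single j 1)
          (of_nat (Poly_Mapping.lookup \<mu> j) * Poly_Mapping.lookup P \<mu>))"

definition embed :: "'k::field mpoly \<Rightarrow> 'k ratfun" where
  "embed P = Fract P 1"

definition const_fun :: "'k::field \<Rightarrow> 'k ratfun" where
  "const_fun c = embed (const c)"


section \<open>Models\<close>

type_synonym 'f model = "'f set set"

definition spec :: "'f::field set \<Rightarrow> 'f model" where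
  "spec A = {localization_at A P | P. primeideal P (ring_of A)}"

text \<open>
  The Zariski topology: the domains of definition of finite sets of rational functions are a basis.
  For a separated model this is the scheme topology: for \<open>spec A\<close> open in \<open>M\<close>, with \<open>A\<close> of finite type over
  the base, \<open>spec A\<close> consists of the members of \<open>M\<close> that contain \<open>A\<close>.
\<close>

definition zariski :: "'f::field model \<Rightarrow> 'f set topology" where
  "zariski M = topology_generated_by {{R \<in> M. g \<in> R} | g. True}"

definition affine_open :: "'f::field model \<Rightarrow> 'f set \<Rightarrow> bool" where
  "affine_open M A \<longleftrightarrow> cring (ring_of A) \<and> openin (zariski M) (spec A)"

text \<open>
  The morphism to \<open>M\<close> induced by inclusions of local rings sends a point to the unique member of \<open>M\<close>
  that its local ring dominates.
\<close>

definition center :: "'f::field model \<Rightarrow> 'f set \<Rightarrow> 'f set" where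
  "center M R = (THE Q. Q \<in> M \<and> Q \<subseteq> R \<and> max_ideal R \<inter> Q = max_ideal Q)"

text \<open>
  \<open>Proj\<close> of the graded ring with homogeneous components \<open>S d\<close>, glued from the spectra of the
  degree 0 parts of the localizations at homogeneous elements \<open>g\<close> of positive degree.
\<close>

definition homogeneous_localization :: "(nat \<Rightarrow> 'f::field set) \<Rightarrow> nat \<Rightarrow> 'f \<Rightarrow> 'f set" where
  "homogeneous_localization S d g = {h / g ^ k | h k. h \<in> S (k * d)}"

definition proj :: "(nat \<Rightarrow> 'f::field set) \<Rightarrow> 'f model" where
  "proj S = (\<Union>d\<in>{1..}. \<Union>g\<in>S d - {0}. spec (homogeneous_localization S d g))"


subsection \<open>Closed subschemes\<close>

text \<open>
  An ideal sheaf is given by its stalks; a closed subscheme is the zero scheme of a quasi-coherent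
  ideal sheaf.
\<close>

type_synonym 'f ideal_sheaf = "'f set \<Rightarrow> 'f set"

definition closed_subscheme :: "'f::field model \<Rightarrow> 'f ideal_sheaf \<Rightarrow> bool" where
  "closed_subscheme M I \<longleftrightarrow>
     (\<forall>R\<in>M. \<exists>A \<aa>. affine_open M A \<and> R \<in> spec A \<and> ideal \<aa> (ring_of A) \<and>
        (\<forall>Q\<in>spec A. I Q = Idl\<^bsub>ring_of Q\<^esub> \<aa>))"

definition supp :: "'f::field model \<Rightarrow> 'f ideal_sheaf \<Rightarrow> 'f model" where
  "supp M I = {R \<in> M. I R \<noteq> R}"

definition disjoint_union_ideal :: "'i set \<Rightarrow> ('i \<Rightarrow> 'f::field ideal_sheaf) \<Rightarrow> 'f ideal_sheaf" where
  "disjoint_union_ideal T W R = R \<inter> (\<Inter>s\<in>T. W s R)"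

definition reduced_ideal :: "'f::field model \<Rightarrow> 'f model \<Rightarrow> 'f ideal_sheaf" where
  "reduced_ideal M Z R =
     {r \<in> R. \<exists>U. openin (zariski M) U \<and> R \<in> U \<and> (\<forall>Q\<in>U \<inter> Z. r \<in> max_ideal Q)}"

text \<open>
  The restriction to the closed subscheme defined by \<open>I\<close> of the structure morphism from \<open>M\<close> to the
  model \<open>N\<close> is an isomorphism of schemes: a homeomorphism that induces isomorphisms of local rings.
\<close>

definition restricts_to_iso :: "'f::field model \<Rightarrow> 'f ideal_sheaf \<Rightarrow> 'f model \<Rightarrow> bool" where
  "restricts_to_iso M I N \<longleftrightarrow>
     homeomorphic_map (subtopology (zariski M) (supp M I)) (zariski N) (center N) \<and>
     (\<forall>R\<in>supp M I.
        (\<lambda>x. I R +>\<^bsub>ring_of R\<^esub> x) \<in> ring_iso (ring_of (center N R)) (ring_of R Quot I R))"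

definition blowup :: "'f::field model \<Rightarrow> 'f ideal_sheaf \<Rightarrow> 'f model" where
  \<comment> \<open>relative \<open>Proj\<close> of the Rees algebra of \<open>I\<close>, assembled over the local rings of \<open>M\<close>\<close>
  "blowup M I = (\<Union>R\<in>M. proj (ideal_pow R (I R)))"

definition irreducible_in :: "'a topology \<Rightarrow> 'a set \<Rightarrow> bool" where
  "irreducible_in T Z \<longleftrightarrow> Z \<subseteq> topspace T \<and> Z \<noteq> {} \<and>
     (\<forall>F G. closedin T F \<and> closedin T G \<and> Z \<subseteq> F \<union> G \<longrightarrow> Z \<subseteq> F \<or> Z \<subseteq> G)"

definition irreducible_components :: "'a topology \<Rightarrow> 'a set \<Rightarrow> 'a set set" where
  "irreducible_components T D =
     {C. C \<subseteq> D \<and> irreducible_in T C \<and>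
         (\<forall>C'. C' \<subseteq> D \<and> irreducible_in T C' \<and> C \<subseteq> C' \<longrightarrow> C' = C)}"


subsection \<open>Smoothness\<close>

text \<open>
  The \<open>B\<close>-algebra \<open>(C, \<alpha>)\<close> is standard smooth: \<open>C \<cong> B[T\<^sub>0,\<dots>,T\<^sub>m\<^sub>-\<^sub>1]/(g\<^sub>0,\<dots>,g\<^sub>c\<^sub>-\<^sub>1)\<close> with
  \<open>det (\<partial>g\<^sub>i/\<partial>T\<^sub>j)\<close>, \<open>i, j < c\<close>, a unit in the quotient.
\<close>

definition standard_smooth ::
    "'k::comm_ring_1 set \<Rightarrow> 'c ring \<Rightarrow> ('k \<Rightarrow> 'c) \<Rightarrow> bool" where
  "standard_smooth B C \<alpha> \<longleftrightarrow>
     (\<exists>m c g \<phi>. c \<le> m \<and> (\<forall>i<c. g i \<in> polys B m) \<and>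
        (let S = ring_of (polys B m); J = Idl\<^bsub>S\<^esub> (g ` {..<c}) in
           \<phi> \<in> ring_iso (S Quot J) C \<and>
           (\<forall>b\<in>B. \<phi> (J +>\<^bsub>S\<^esub> const b) = \<alpha> b) \<and>
           J +>\<^bsub>S\<^esub> det (mat c c (\<lambda>(i, j). partial_deriv j (g i))) \<in> Units (S Quot J)))"

definition sections :: "'f::field ideal_sheaf \<Rightarrow> 'f set \<Rightarrow> 'f set" where
  "sections I A = {a \<in> A. \<forall>R\<in>spec A. a \<in> I R}"

text \<open>
  The closed subscheme of \<open>M\<close> defined by \<open>I\<close> is smooth over \<open>Spec B\<close>: every point has an affine open
  neighbourhood whose coordinate ring is a standard smooth \<open>B\<close>-algebra.
\<close>

definition smooth_subscheme ::
    "'k::field set \<Rightarrow> 'k ratfun model \<Rightarrow> 'k ratfun ideal_sheaf \<Rightarrow> bool" where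
  "smooth_subscheme B M I \<longleftrightarrow>
     (\<forall>R\<in>supp M I. \<exists>A. affine_open M A \<and> R \<in> spec A \<and>
        standard_smooth B (ring_of A Quot sections I A)
          (\<lambda>b. sections I A +>\<^bsub>ring_of A\<^esub> const_fun b))"


subsection \<open>Differentials and normal crossings\<close>

text \<open>
  \<open>\<Omega>\<^bsub>R/B\<^esub>\<close> is the free \<open>R\<close>-module on symbols \<open>d r\<close>, \<open>r \<in> R\<close>, modulo \<open>kaehler_relations B R\<close>; here
  \<open>Poly_Mapping.single r c\<close> stands for \<open>c d r\<close>. Dividing out also the elements with coefficients in
  the maximal ideal of \<open>R\<close> gives \<open>\<Omega>\<^bsub>R/B\<^esub> \<otimes> \<kappa>\<close> with \<open>\<kappa>\<close> the residue field.
\<close>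

inductive_set kaehler_relations :: "'f::field set \<Rightarrow> 'f set \<Rightarrow> ('f \<Rightarrow>\<^sub>0 'f) set"
  for B R :: "'f set" where
  zero: "0 \<in> kaehler_relations B R"
| add: "u \<in> kaehler_relations B R \<Longrightarrow> w \<in> kaehler_relations B R \<Longrightarrow> u + w \<in> kaehler_relations B R"
| scale: "r \<in> R \<Longrightarrow> u \<in> kaehler_relations B R \<Longrightarrow>
    Poly_Mapping.map (\<lambda>x. r * x) u \<in> kaehler_relations B R"
| d_add: "a \<in> R \<Longrightarrow> b \<in> R \<Longrightarrow>
    Poly_Mapping.single (a + b) 1 - Poly_Mapping.single a 1 - Poly_Mapping.single b 1
      \<in> kaehler_relations B R"
| d_mult: "a \<in> R \<Longrightarrow> b \<in> R \<Longrightarrow>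
    Poly_Mapping.single (a * b) 1 - Poly_Mapping.single b a - Poly_Mapping.single a b
      \<in> kaehler_relations B R"
| d_base: "b \<in> B \<Longrightarrow> Poly_Mapping.single b 1 \<in> kaehler_relations B R"

definition fibre_relations :: "'f::field set \<Rightarrow> 'f set \<Rightarrow> ('f \<Rightarrow>\<^sub>0 'f) set" where
  "fibre_relations B R =
     {u + w | u w. u \<in> kaehler_relations B R \<and>
        (\<forall>r\<in>Poly_Mapping.keys w. r \<in> R \<and> Poly_Mapping.lookup w r \<in> max_ideal R)}"

definition independent_differentials ::
    "'f::field set \<Rightarrow> 'f set \<Rightarrow> 'i set \<Rightarrow> ('i \<Rightarrow> 'f) \<Rightarrow> bool" where
  "independent_differentials B R T g \<longleftrightarrow>
     (\<forall>F c. finite F \<and> F \<subseteq> T \<and> (\<forall>i\<in>F. c i \<in> R) \<and>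
        (\<Sum>i\<in>F. Poly_Mapping.single (g i) (c i)) \<in> fibre_relations B R \<longrightarrow>
        (\<forall>i\<in>F. c i \<in> max_ideal R))"

definition normal_crossings :: "'f::field set \<Rightarrow> 'f model \<Rightarrow> 'f model \<Rightarrow> bool" where
  "normal_crossings B M D \<longleftrightarrow>
     (\<forall>R\<in>D.
        let CC = {C \<in> irreducible_components (zariski M) D. R \<in> C} in
        (\<exists>C\<in>CC. \<exists>C'\<in>CC. C \<noteq> C') \<longrightarrow>
        (\<exists>g. (\<forall>C\<in>CC. g C \<in> R \<and> reduced_ideal M C R = PIdl\<^bsub>ring_of R\<^esub> (g C)) \<and>
             independent_differentials B R CC g))"


section \<open>Projective space and nodal hypersurfaces\<close>

definition Spec_base :: "'k::field set \<Rightarrow> 'k ratfun model" where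
  "Spec_base B = spec (const_fun ` B)"

definition homogeneous_coordinate_ring :: "'k::field set \<Rightarrow> nat \<Rightarrow> nat \<Rightarrow> 'k ratfun set" where
  "homogeneous_coordinate_ring B n d = embed ` {P \<in> polys B (Suc n). homogeneous d P}"

definition proj_space :: "'k::field set \<Rightarrow> nat \<Rightarrow> 'k ratfun model" where
  "proj_space B n = proj (homogeneous_coordinate_ring B n)"

text \<open>
  The stalk at \<open>R\<close> of the sheaf \<open>\<O>(m)\<close>, inside the field of rational functions in the homogeneous
  coordinates: it is \<open>x\<^sub>i\<^sup>m R\<close> for every chart \<open>x\<^sub>i \<noteq> 0\<close> that contains \<open>R\<close>.
\<close>

definition twist :: "'k::field set \<Rightarrow> nat \<Rightarrow> int \<Rightarrow> 'k ratfun set \<Rightarrow> 'k ratfun set" where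
  "twist B n m R =
     {power_int (embed (var i)) m * r | i r. i \<le> n \<and> r \<in> R \<and>
        R \<in> spec (homogeneous_localization (homogeneous_coordinate_ring B n) 1 (embed (var i)))}"

definition hypersurface_ideal ::
    "'k::field set \<Rightarrow> nat \<Rightarrow> nat \<Rightarrow> 'k mpoly \<Rightarrow> 'k ratfun ideal_sheaf" where
  "hypersurface_ideal B n N f R = {h * embed f | h. h \<in> twist B n (- int N) R}"

definition jacobian_image ::
    "'k::field set \<Rightarrow> nat \<Rightarrow> nat \<Rightarrow> 'k mpoly \<Rightarrow> 'k ratfun ideal_sheaf" where
  "jacobian_image B n N f R =
     {\<Sum>j\<le>n. h j * embed (partial_deriv j f) | h. \<forall>j\<le>n. h j \<in> twist B n (- int N + 1) R}"

definition cokernel_annihilator :: "'f::field ideal_sheaf \<Rightarrow> 'f ideal_sheaf" where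
  \<comment> \<open>annihilator of the stalk of \<open>\<O>/J\<close>, the ideal of the scheme-theoretic support\<close>
  "cokernel_annihilator J R = {r \<in> R. \<forall>s\<in>R. r * s \<in> J R}"

definition equisingular_odps ::
    "'k::field set \<Rightarrow> nat \<Rightarrow> nat \<Rightarrow> 'k mpoly \<Rightarrow> nat \<Rightarrow> (nat \<Rightarrow> 'k ratfun ideal_sheaf) \<Rightarrow> bool" where
  "equisingular_odps B n N f \<tau> W \<longleftrightarrow>
     (\<forall>s\<in>{1..\<tau>}. closed_subscheme (proj_space B n) (W s)) \<and>
     (\<forall>s\<in>{1..\<tau>}. \<forall>t\<in>{1..\<tau>}. s \<noteq> t \<longrightarrow>
        supp (proj_space B n) (W s) \<inter> supp (proj_space B n) (W t) = {}) \<and>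
     (\<forall>R\<in>proj_space B n.
        cokernel_annihilator (jacobian_image B n N f) R = disjoint_union_ideal {1..\<tau>} W R) \<and>
     (\<forall>s\<in>{1..\<tau>}. restricts_to_iso (proj_space B n) (W s) (Spec_base B))"

end

theory Submission
  imports Defs
begin

text \<open>
  Every point of \<open>Y\<close> is a local ring of a polynomial ring \<open>\<O>[t]\<close>, where \<open>t\<close> are affine coordinates on projective
  space or on a chart of the blowup, and \<open>\<O>[t]\<close> is factorial by Gauss' lemma. If an equation \<open>G\<close> that
  vanishes at a point has a partial derivative that does not vanish there, exactly one prime factor \<open>\<pi>\<close> of \<open>G\<close> vanishes
  there. Hence the points below the local ring at \<open>\<pi>\<close> form the only component of \<open>G = 0\<close>
  through the point, and near the point this component is the spectrum of \<open>\<O>[Z, T]/(Z H - 1, \<pi>)\<close>, which is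
  standard smooth.

  Outside \<open>W\<close> the partial derivatives of the equation of \<open>X\<close> generate the unit ideal. Near \<open>W\<^sub>s\<close> the Jacobian ideal
  is the ideal \<open>(y\<^sub>0, \<dots>, y\<^sub>n\<^sub>-\<^sub>1)\<close> of the section. In the blowup chart \<open>y\<^sub>l = t\<^sub>l\<close>, \<open>y\<^sub>k = t\<^sub>l t\<^sub>k\<close> the
  equation becomes \<open>t\<^sub>l\<^sup>2 G\<close>. Writing \<open>y\<^sub>l\<close> in terms of the generators of the Jacobian ideal and dividing by
  \<open>t\<^sub>l\<close> shows that some \<open>\<partial>G/\<partial>t\<^sub>k\<close> with \<open>k \<noteq> l\<close> is a unit wherever \<open>t\<^sub>l = G = 0\<close>: the proper transform \<open>G = 0\<close> is smooth and
  crosses the exceptional divisor \<open>t\<^sub>l = 0\<close> transversally.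
\<close>

section \<open>Subrings of a field and their local rings\<close>

text \<open>Components and their ideals are defined by the topology of the blowup alone, so it does
  not suffice that a local equation is smooth at a point: one has to know which points of the whole
  model lie on the same component. Factoriality settles this. Larger local rings are generizations,
  so the closure of a point \<eta> consists of the members contained in \<eta>, a description that
  is not tied to a chart. The prime factor that vanishes at a point provides such an \<eta>, and it
  generates the ideal of the component there.

  The base is factorial as a discrete valuation ring; that p is a uniformizer is where
  unramifiedness enters.

  The blowup is given without charts, as a union of Proj over all local rings of projective space.
  Much of the work shows that local rings of \<O>[t] are points of it. They are so away from the
  other sections, whence the auxiliary functions h.

  The quadratic part of the equation is never diagonalised: the equality of the Jacobian ideal with
  the ideal of the section is used directly, so the residue characteristic 2 and the case that p
  divides N need no separate argument.\<close>

definition is_subring :: "'a::comm_ring_1 set \<Rightarrow> bool" where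
  "is_subring A \<longleftrightarrow> 1 \<in> A \<and> (\<forall>x\<in>A. \<forall>y\<in>A. x - y \<in> A) \<and> (\<forall>x\<in>A. \<forall>y\<in>A. x * y \<in> A)"

lemma is_subring_one: "is_subring A \<Longrightarrow> 1 \<in> A"
  and is_subring_diff: "is_subring A \<Longrightarrow> x \<in> A \<Longrightarrow> y \<in> A \<Longrightarrow> x - y \<in> A"
  and is_subring_mult: "is_subring A \<Longrightarrow> x \<in> A \<Longrightarrow> y \<in> A \<Longrightarrow> x * y \<in> A"
  by (auto simp: is_subring_def)

lemma is_subring_zero: "is_subring A \<Longrightarrow> 0 \<in> A"
  using is_subring_diff[of A 1 1] is_subring_one by fastforce

lemma is_subring_uminus: "is_subring A \<Longrightarrow> x \<in> A \<Longrightarrow> - x \<in> A"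
  using is_subring_diff[of A 0 x] is_subring_zero by fastforce

lemma is_subring_add: "is_subring A \<Longrightarrow> x \<in> A \<Longrightarrow> y \<in> A \<Longrightarrow> x + y \<in> A"
  using is_subring_diff[of A x "- y"] is_subring_uminus by fastforce

lemma is_subring_power: "is_subring A \<Longrightarrow> x \<in> A \<Longrightarrow> x ^ k \<in> A"
  by (induction k) (auto intro: is_subring_one is_subring_mult)

lemma is_subring_sum: "is_subring A \<Longrightarrow> (\<And>i. i \<in> S \<Longrightarrow> g i \<in> A) \<Longrightarrow> sum g S \<in> A"
  by (induction S rule: infinite_finite_induct) (auto intro: is_subring_zero is_subring_add)

lemma is_subring_prod: "is_subring A \<Longrightarrow> (\<And>i. i \<in> S \<Longrightarrow> g i \<in> A) \<Longrightarrow> prod g S \<in> A"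
  by (induction S rule: infinite_finite_induct) (auto intro: is_subring_one is_subring_mult)

lemma is_subring_of_nat: "is_subring A \<Longrightarrow> of_nat k \<in> A"
  by (induction k) (auto intro: is_subring_zero is_subring_one is_subring_add)

lemmas subring_closed = is_subring_one is_subring_zero is_subring_diff is_subring_mult
  is_subring_uminus is_subring_add is_subring_power is_subring_of_nat

lemma ring_of_simps [simp]:
  "carrier (ring_of A) = A" "x \<otimes>\<^bsub>ring_of A\<^esub> y = x * y" "x \<oplus>\<^bsub>ring_of A\<^esub> y = x + y"
  "\<one>\<^bsub>ring_of A\<^esub> = 1" "\<zero>\<^bsub>ring_of A\<^esub> = 0"
  by (simp_all add: ring_of_def)

text \<open>The operations are those of the ambient ring, so only closure is at stake; abstract
  negatives agree with the ambient ones because additive inverses are unique.\<close>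

lemma cring_ring_of_iff: "cring (ring_of A) \<longleftrightarrow> is_subring A"
proof
  assume "cring (ring_of A)"
  then interpret cring "ring_of A" .
  have neg: "- y \<in> A" if "y \<in> A" for y
  proof -
    have "\<ominus>\<^bsub>ring_of A\<^esub> y \<in> A" "y + \<ominus>\<^bsub>ring_of A\<^esub> y = 0"
      using that a_inv_closed[of y] r_neg[of y] by auto
    then show ?thesis by (metis add.inverse_unique)
  qed
  show "is_subring A"
    using neg add.m_closed m_closed one_closed unfolding is_subring_def ring_of_simps
    by (metis diff_conv_add_uminus)
next
  assume A: "is_subring A"
  show "cring (ring_of A)"
  proof (rule cringI)
    show "abelian_group (ring_of A)"
      by (rule abelian_groupI)
        (auto simp: algebra_simps subring_closed[OF A] intro: bexI[of _ "- x" for x])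
    show "comm_monoid (ring_of A)"
      by (rule comm_monoidI) (auto simp: algebra_simps subring_closed[OF A])
  qed (auto simp: algebra_simps)
qed

lemma a_inv_ring_of:
  assumes "is_subring A" "x \<in> A" shows "\<ominus>\<^bsub>ring_of A\<^esub> x = - x"
proof -
  interpret cring "ring_of A" using assms cring_ring_of_iff by blast
  show ?thesis
    using minus_equality[of "- x" x] assms is_subring_uminus by auto
qed

section \<open>Ideals and primes of subrings\<close>

definition ideal_in :: "'a::comm_ring_1 set \<Rightarrow> 'a set \<Rightarrow> bool" where
  "ideal_in I A \<longleftrightarrow> I \<subseteq> A \<and> 0 \<in> I \<and> (\<forall>x\<in>I. \<forall>y\<in>I. x + y \<in> I) \<and> (\<forall>a\<in>A. \<forall>x\<in>I. a * x \<in> I)"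

lemma ideal_in_diff:
  assumes "is_subring A" "ideal_in I A" "x \<in> I" "y \<in> I" shows "x - y \<in> I"
proof -
  have "(-1) * y \<in> I" using assms is_subring_uminus is_subring_one unfolding ideal_in_def by blast
  then have "x + (-1) * y \<in> I" using assms unfolding ideal_in_def by blast
  then show ?thesis by simp
qed

lemma ideal_in_sum:
  "ideal_in I A \<Longrightarrow> (\<And>i. i \<in> S \<Longrightarrow> g i \<in> I) \<Longrightarrow> sum g S \<in> I"
  by (induction S rule: infinite_finite_induct) (auto simp: ideal_in_def)

lemma ideal_in_restrict:
  assumes "ideal_in I R" "is_subring A" "A \<subseteq> R" shows "ideal_in (I \<inter> A) A"
  using assms(1,3) subring_closed(2,4,6)[OF assms(2)] by (auto simp: ideal_in_def)

lemma ideal_ring_of_iff: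
  assumes A: "is_subring A" shows "ideal I (ring_of A) \<longleftrightarrow> ideal_in I A"
proof
  assume "ideal I (ring_of A)"
  then interpret ideal I "ring_of A" .
  show "ideal_in I A"
    unfolding ideal_in_def
    using a_subset additive_subgroup.zero_closed[OF is_additive_subgroup]
      additive_subgroup.a_closed[OF is_additive_subgroup] I_l_closed by auto
next
  assume I: "ideal_in I A"
  interpret cring "ring_of A" using A cring_ring_of_iff by blast
  show "ideal I (ring_of A)"
  proof (rule idealI)
    show "subgroup I (add_monoid (ring_of A))"
    proof (rule add.subgroupI)
      show "\<ominus>\<^bsub>ring_of A\<^esub> x \<in> I" if "x \<in> I" for x
      proof -
        have "x \<in> A" using that I by (auto simp: ideal_in_def)
        moreover have "0 - x \<in> I" using ideal_in_diff[OF A I _ that, of 0] I unfolding ideal_in_def by blast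
        ultimately show ?thesis using a_inv_ring_of[OF A, of x] by simp
      qed
    qed (use I in \<open>auto simp: ideal_in_def\<close>)
    show "x \<otimes>\<^bsub>ring_of A\<^esub> a \<in> I" "a \<otimes>\<^bsub>ring_of A\<^esub> x \<in> I" if "a \<in> I" "x \<in> carrier (ring_of A)" for a x
      using that I by (simp_all add: ideal_in_def mult.commute[of a x])
  qed (use ring_axioms in auto)
qed

lemma primeideal_ring_of_iff:
  "primeideal P (ring_of A) \<longleftrightarrow>
     is_subring A \<and> ideal_in P A \<and> 1 \<notin> P \<and> (\<forall>a\<in>A. \<forall>b\<in>A. a * b \<in> P \<longrightarrow> a \<in> P \<or> b \<in> P)"
  (is "?L \<longleftrightarrow> ?R")
proof
  assume ?L
  then interpret primeideal P "ring_of A" .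
  have A: "is_subring A" using cring_ring_of_iff is_cring by blast
  have I: "ideal_in P A" using ideal_ring_of_iff[OF A] is_ideal by blast
  have "1 \<notin> P"
  proof
    assume "1 \<in> P"
    then have "a * 1 \<in> P" if "a \<in> A" for a using that I unfolding ideal_in_def by blast
    then show False using I_notcarr I by (auto simp: ideal_in_def)
  qed
  then show ?R using A I I_prime by auto
next
  assume R: ?R
  then show ?L
    by (intro primeidealI)
      (auto simp: ideal_ring_of_iff cring_ring_of_iff is_subring_one)
qed

text \<open>Inversion is total with \<open>inverse 0 = 0\<close>, hence the separate condition that
  x is nonzero.\<close>

definition unit_in :: "'f::field set \<Rightarrow> 'f \<Rightarrow> bool" where
  "unit_in R x \<longleftrightarrow> x \<in> R \<and> x \<noteq> 0 \<and> inverse x \<in> R"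

lemma max_ideal_eq: "max_ideal R = {x \<in> R. \<not> unit_in R x}"
proof -
  have "x \<in> Units (ring_of R) \<longleftrightarrow> unit_in R x" for x
  proof -
    have "inverse x = y" if "x * y = 1" for y using that by (rule inverse_unique)
    then show ?thesis
      unfolding Units_def unit_in_def ring_of_simps
      by (auto intro!: bexI[of _ "inverse x"])
  qed
  then show ?thesis by (auto simp: max_ideal_def)
qed

lemma unit_in_mult_iff:
  assumes "is_subring R" "x \<in> R" "y \<in> R"
  shows "unit_in R (x * y) \<longleftrightarrow> unit_in R x \<and> unit_in R y"
proof
  assume u: "unit_in R (x * y)"
  then have "inverse (x * y) * y \<in> R" "inverse (x * y) * x \<in> R" "x \<noteq> 0" "y \<noteq> 0"
    using assms is_subring_mult by (auto simp: unit_in_def)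
  then show "unit_in R x \<and> unit_in R y"
    using assms by (auto simp: unit_in_def field_simps)
qed (use assms is_subring_mult in \<open>auto simp: unit_in_def\<close>)

lemma unit_in_one: "is_subring R \<Longrightarrow> unit_in R 1"
  by (simp add: unit_in_def is_subring_one)

lemma unit_in_inverse: "unit_in R x \<Longrightarrow> unit_in R (inverse x)"
  by (simp add: unit_in_def)

lemma unit_in_mono: "unit_in R x \<Longrightarrow> R \<subseteq> R' \<Longrightarrow> unit_in R' x"
  by (auto simp: unit_in_def)

lemma unit_in_divide: "is_subring R \<Longrightarrow> x \<in> R \<Longrightarrow> unit_in R y \<Longrightarrow> x / y \<in> R"
  by (simp add: unit_in_def divide_inverse is_subring_mult)

lemma unit_in_power: "is_subring R \<Longrightarrow> unit_in R x \<Longrightarrow> unit_in R (x ^ k)"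
  by (auto simp: unit_in_def is_subring_power simp flip: power_inverse)

lemma unit_in_prod:
  "is_subring R \<Longrightarrow> (\<And>i. i \<in> S \<Longrightarrow> unit_in R (g i)) \<Longrightarrow> unit_in R (prod g S)"
proof (induction S rule: infinite_finite_induct)
  case (insert x F)
  then show ?case
    using unit_in_mult_iff[of R "g x" "prod g F"] by (auto simp: unit_in_def)
qed (auto intro: unit_in_one)

text \<open>The nonunits are closed under addition, put in contrapositive form so that no maximal
  ideal has to be named.\<close>

definition local_ring :: "'f::field set \<Rightarrow> bool" where
  "local_ring R \<longleftrightarrow> is_subring R \<and>
     (\<forall>x\<in>R. \<forall>y\<in>R. unit_in R (x + y) \<longrightarrow> unit_in R x \<or> unit_in R y)"

lemma local_ring_subring: "local_ring R \<Longrightarrow> is_subring R"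
  by (simp add: local_ring_def)

lemma local_ring_add:
  "local_ring R \<Longrightarrow> x \<in> R \<Longrightarrow> y \<in> R \<Longrightarrow> unit_in R (x + y) \<Longrightarrow> \<not> unit_in R x \<Longrightarrow> unit_in R y"
  by (auto simp: local_ring_def)

lemma ideal_in_max_ideal:
  assumes "local_ring R" shows "ideal_in (max_ideal R) R"
proof -
  have R: "is_subring R" using assms local_ring_subring by blast
  then show ?thesis
    using assms unit_in_mult_iff[OF R]
    by (auto simp: ideal_in_def max_ideal_eq subring_closed[OF R] local_ring_def unit_in_def)
qed

lemma max_ideal_add: "local_ring R \<Longrightarrow> x \<in> max_ideal R \<Longrightarrow> y \<in> max_ideal R \<Longrightarrow> x + y \<in> max_ideal R"
  and max_ideal_mult: "local_ring R \<Longrightarrow> x \<in> R \<Longrightarrow> y \<in> max_ideal R \<Longrightarrow> x * y \<in> max_ideal R"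
  and max_ideal_mult': "local_ring R \<Longrightarrow> x \<in> R \<Longrightarrow> y \<in> max_ideal R \<Longrightarrow> y * x \<in> max_ideal R"
  and max_ideal_diff: "local_ring R \<Longrightarrow> x \<in> max_ideal R \<Longrightarrow> y \<in> max_ideal R \<Longrightarrow> x - y \<in> max_ideal R"
  and max_ideal_sum: "local_ring R \<Longrightarrow> (\<And>i. i \<in> S \<Longrightarrow> g i \<in> max_ideal R) \<Longrightarrow> sum g S \<in> max_ideal R"
  and max_ideal_zero: "local_ring R \<Longrightarrow> 0 \<in> max_ideal R"
proof -
  assume R: "local_ring R"
  note I = ideal_in_max_ideal[OF R] and R' = local_ring_subring[OF R]
  show "x \<in> max_ideal R \<Longrightarrow> y \<in> max_ideal R \<Longrightarrow> x + y \<in> max_ideal R" "0 \<in> max_ideal R"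
    "x \<in> R \<Longrightarrow> y \<in> max_ideal R \<Longrightarrow> x * y \<in> max_ideal R"
    "x \<in> R \<Longrightarrow> y \<in> max_ideal R \<Longrightarrow> y * x \<in> max_ideal R"
    using I by (auto simp: ideal_in_def mult.commute)
  show "x \<in> max_ideal R \<Longrightarrow> y \<in> max_ideal R \<Longrightarrow> x - y \<in> max_ideal R"
    by (rule ideal_in_diff[OF R' I])
  show "(\<And>i. i \<in> S \<Longrightarrow> g i \<in> max_ideal R) \<Longrightarrow> sum g S \<in> max_ideal R"
    by (rule ideal_in_sum[OF I])
qed

lemma one_notin_max_ideal: "is_subring R \<Longrightarrow> 1 \<notin> max_ideal R"
  by (simp add: max_ideal_eq unit_in_one)

text \<open>
  The local rings of \<open>A\<close> at its primes, characterised without mentioning the prime: \<open>R\<close> is local and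
  consists of fractions of elements of \<open>A\<close> whose denominators are units of \<open>R\<close>.
\<close>

definition local_of :: "'f::field set \<Rightarrow> 'f set \<Rightarrow> bool" where
  "local_of A R \<longleftrightarrow> local_ring R \<and> A \<subseteq> R \<and> (\<forall>r\<in>R. \<exists>b\<in>A. \<exists>w\<in>A. unit_in R w \<and> r = b / w)"

lemma unit_in_localization_at:
  assumes P: "primeideal P (ring_of A)" and a: "a \<in> A"
  shows "unit_in (localization_at A P) a \<longleftrightarrow> a \<notin> P"
proof -
  have A: "is_subring A" and I: "ideal_in P A" and one: "1 \<notin> P"
    and pr: "\<And>a b. a \<in> A \<Longrightarrow> b \<in> A \<Longrightarrow> a * b \<in> P \<Longrightarrow> a \<in> P \<or> b \<in> P"
    using P by (auto simp: primeideal_ring_of_iff)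
  have a1: "a / 1 \<in> localization_at A P"
    unfolding localization_at_def using a A one is_subring_one by blast
  have 0: "0 \<in> P" using I by (simp add: ideal_in_def)
  show ?thesis
  proof
    assume "unit_in (localization_at A P) a"
    then obtain b w where bw: "b \<in> A" "w \<in> A - P" "inverse a = b / w" "a \<noteq> 0"
      by (auto simp: unit_in_def localization_at_def)
    then have "a * b = w" using 0 by (auto simp: field_simps)
    then show "a \<notin> P" using I bw by (auto simp: ideal_in_def mult.commute)
  next
    assume n: "a \<notin> P"
    then have "1 / a \<in> localization_at A P"
      unfolding localization_at_def using a A is_subring_one by blast
    then show "unit_in (localization_at A P) a" using a1 n 0
      by (auto simp: unit_in_def inverse_eq_divide)
  qed
qed

lemma local_of_localization_at:
  assumes P: "primeideal P (ring_of A)"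
  shows "local_of A (localization_at A P)"
proof -
  let ?R = "localization_at A P"
  have A: "is_subring A" and I: "ideal_in P A" and one: "1 \<notin> P"
    and pr: "\<And>a b. a \<in> A \<Longrightarrow> b \<in> A \<Longrightarrow> a * b \<in> P \<Longrightarrow> a \<in> P \<or> b \<in> P"
    using P by (auto simp: primeideal_ring_of_iff)
  have 0: "0 \<in> P" using I by (simp add: ideal_in_def)
  have memI: "b / w \<in> ?R" if "b \<in> A" "w \<in> A" "w \<notin> P" for b w
    using that by (auto simp: localization_at_def)
  have memE: "\<exists>b w. r = b / w \<and> b \<in> A \<and> w \<in> A \<and> w \<notin> P \<and> w \<noteq> 0" if "r \<in> ?R" for r
    using that 0 by (auto simp: localization_at_def)
  have AR: "A \<subseteq> ?R" using memI[of _ 1] A one is_subring_one by fastforce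
  have sr: "is_subring ?R"
    unfolding is_subring_def
  proof (intro conjI ballI)
    show "1 \<in> ?R" using AR A is_subring_one by blast
  next
    fix x y assume "x \<in> ?R" "y \<in> ?R"
    then obtain b w b' w' where *: "x = b / w" "b \<in> A" "w \<in> A" "w \<notin> P" "w \<noteq> 0"
      "y = b' / w'" "b' \<in> A" "w' \<in> A" "w' \<notin> P" "w' \<noteq> 0" using memE by meson
    then have ww: "w * w' \<in> A" "w * w' \<notin> P" using pr A is_subring_mult by blast+
    have "x - y = (b * w' - b' * w) / (w * w')" "x * y = (b * b') / (w * w')"
      using * by (auto simp: field_simps)
    then show "x - y \<in> ?R" "x * y \<in> ?R"
      using memI[OF _ ww] * subring_closed[OF A] by auto
  qed
  have unit: "unit_in ?R (b / w) \<longleftrightarrow> b \<notin> P" if "b \<in> A" "w \<in> A" "w \<notin> P" for b w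
  proof -
    have w: "unit_in ?R w" using unit_in_localization_at[OF P] that by blast
    have "unit_in ?R (b / w) \<longleftrightarrow> unit_in ?R (b / w) \<and> unit_in ?R w" using w by blast
    also have "\<dots> \<longleftrightarrow> unit_in ?R ((b / w) * w)"
      using unit_in_mult_iff[OF sr, of "b / w" w] memI that AR by auto
    also have "(b / w) * w = b" using w by (auto simp: unit_in_def)
    finally show ?thesis using unit_in_localization_at[OF P] that by blast
  qed
  show ?thesis
    unfolding local_of_def local_ring_def
  proof (intro conjI ballI impI)
    fix x y assume "x \<in> ?R" "y \<in> ?R" and u: "unit_in ?R (x + y)"
    then obtain b w b' w' where *: "x = b / w" "b \<in> A" "w \<in> A" "w \<notin> P" "w \<noteq> 0"
      "y = b' / w'" "b' \<in> A" "w' \<in> A" "w' \<notin> P" "w' \<noteq> 0" using memE by meson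
    then have ww: "w * w' \<in> A" "w * w' \<notin> P" using pr A is_subring_mult by blast+
    have "x + y = (b * w' + b' * w) / (w * w')" using * by (auto simp: field_simps)
    then have "b * w' + b' * w \<notin> P" using unit[OF _ ww] u * subring_closed[OF A] by auto
    then have "w' * b + w * b' \<notin> P" by (simp add: mult.commute)
    then have "b \<notin> P \<or> b' \<notin> P" using I * unfolding ideal_in_def by blast
    then show "unit_in ?R x \<or> unit_in ?R y" using unit * by auto
  next
    fix r assume "r \<in> ?R"
    then obtain b w where *: "r = b / w" "b \<in> A" "w \<in> A" "w \<notin> P" "w \<noteq> 0" using memE by meson
    then show "\<exists>b\<in>A. \<exists>w\<in>A. unit_in ?R w \<and> r = b / w"
      using unit_in_localization_at[OF P] by blast
  qed (use sr AR in auto)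
qed

text \<open>The prime can be recovered from the local ring, as the contraction of its maximal ideal.
  Membership in a spectrum thus becomes a relation between two subrings of the field.\<close>

lemma spec_iff: "R \<in> spec A \<longleftrightarrow> is_subring A \<and> local_of A R"
proof
  assume "R \<in> spec A"
  then show "is_subring A \<and> local_of A R"
    using local_of_localization_at by (auto simp: spec_def primeideal_ring_of_iff)
next
  assume *: "is_subring A \<and> local_of A R"
  then have R: "local_ring R" and AR: "A \<subseteq> R" and sr: "is_subring R"
    and fr: "\<And>r. r \<in> R \<Longrightarrow> \<exists>b\<in>A. \<exists>w\<in>A. unit_in R w \<and> r = b / w"
    by (auto simp: local_of_def local_ring_def)
  let ?P = "max_ideal R \<inter> A"
  have "ideal_in ?P A"
    using ideal_in_max_ideal[OF R] AR * by (intro ideal_in_restrict) auto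
  then have P: "primeideal ?P (ring_of A)"
    using * AR one_notin_max_ideal[OF sr] unit_in_mult_iff[OF sr]
    by (auto simp: primeideal_ring_of_iff max_ideal_eq is_subring_mult)
  have "localization_at A ?P = R"
  proof (intro equalityI subsetI)
    fix r assume "r \<in> localization_at A ?P"
    then obtain b w where "r = b / w" "b \<in> A" "w \<in> A" "unit_in R w"
      using AR by (auto simp: localization_at_def max_ideal_eq)
    then show "r \<in> R" using unit_in_divide[OF sr] AR by blast
  next
    fix r assume "r \<in> R"
    then show "r \<in> localization_at A ?P"
      using fr by (fastforce simp: localization_at_def max_ideal_eq)
  qed
  then show "R \<in> spec A" using P by (auto simp: spec_def)
qed

lemma local_of_local: "local_of A R \<Longrightarrow> local_ring R"
  and local_of_subset: "local_of A R \<Longrightarrow> A \<subseteq> R"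
  and local_of_subring: "local_of A R \<Longrightarrow> is_subring R"
  by (auto simp: local_of_def local_ring_def)

lemma local_of_fraction:
  assumes "local_of A R" "r \<in> R"
  obtains b w where "b \<in> A" "w \<in> A" "unit_in R w" "r = b / w"
  using assms by (auto simp: local_of_def)

lemma local_of_superring: "local_of A R \<Longrightarrow> A \<subseteq> A' \<Longrightarrow> A' \<subseteq> R \<Longrightarrow> local_of A' R"
  unfolding local_of_def by blast

text \<open>Fractions of fractions are fractions. This is the tool for changing charts: a point of
  A' is a point of A as soon as the elements of A' can be written over A with denominators that are
  units at the point.\<close>

lemma local_of_fractions_trans:
  assumes R: "local_of A' R" and A: "is_subring A" "A \<subseteq> R"
    and fr: "\<And>a. a \<in> A' \<Longrightarrow> \<exists>b\<in>A. \<exists>w\<in>A. unit_in R w \<and> a = b / w"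
  shows "local_of A R"
  unfolding local_of_def
proof (intro conjI ballI)
  note sr = local_of_subring[OF R]
  fix r assume "r \<in> R"
  then obtain a c where ac: "a \<in> A'" "c \<in> A'" "unit_in R c" "r = a / c"
    using local_of_fraction[OF R] by metis
  obtain b w b' w' where *: "b \<in> A" "w \<in> A" "unit_in R w" "a = b / w"
    "b' \<in> A" "w' \<in> A" "unit_in R w'" "c = b' / w'"
    using fr ac by meson
  have "c * w' = b'" using * by (auto simp: unit_in_def)
  then have "unit_in R b'" using ac(3) *(7) unit_in_mult_iff[OF sr, of c w'] by (auto simp: unit_in_def)
  moreover have "r = (b * w') / (w * b')" using ac * by simp
  ultimately have "unit_in R (w * b')" using * unit_in_mult_iff[OF sr, of w b'] by (simp add: unit_in_def)
  then show "\<exists>b\<in>A. \<exists>w\<in>A. unit_in R w \<and> r = b / w"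
    using * A \<open>r = (b * w') / (w * b')\<close> \<open>b' \<in> A\<close> is_subring_mult by blast
qed (use R A in \<open>auto simp: local_of_def\<close>)

lemma local_of_self: "local_ring R \<Longrightarrow> local_of R R"
  unfolding local_of_def
  by (metis div_by_1 is_subring_one local_ring_def subset_refl unit_in_one)

text \<open>Domination in terms of units: no nonunit of Q becomes invertible in R.
  \<open>dominates_iff\<close> identifies it with the condition on maximal ideals in
  \<open>center\<close>.\<close>

definition dominates :: "'f::field set \<Rightarrow> 'f set \<Rightarrow> bool" where
  "dominates R Q \<longleftrightarrow> Q \<subseteq> R \<and> (\<forall>x\<in>Q. unit_in R x \<longrightarrow> unit_in Q x)"

lemma dominates_iff: "dominates R Q \<longleftrightarrow> Q \<subseteq> R \<and> max_ideal R \<inter> Q = max_ideal Q"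
  by (auto simp: dominates_def max_ideal_eq unit_in_def)

lemma dominates_unit_iff: "dominates R Q \<Longrightarrow> x \<in> Q \<Longrightarrow> unit_in R x \<longleftrightarrow> unit_in Q x"
  by (auto simp: dominates_def intro: unit_in_mono)

lemma dominates_refl: "dominates R R"
  by (simp add: dominates_def)

lemma dominates_trans: "dominates R Q \<Longrightarrow> dominates Q Q' \<Longrightarrow> dominates R Q'"
  by (auto simp: dominates_def)

text \<open>The localization of A at the contraction of the maximal ideal of R, that is, the centre
  of R on the spectrum of A.\<close>

definition loc :: "'f::field set \<Rightarrow> 'f set \<Rightarrow> 'f set" where
  "loc A R = {b / w | b w. b \<in> A \<and> w \<in> A \<and> unit_in R w}"

lemma local_of_loc:
  assumes A: "is_subring A" and R: "local_ring R" and AR: "A \<subseteq> R"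
  shows "local_of A (loc A R)" "dominates R (loc A R)"
proof -
  have sr: "is_subring R" using R local_ring_subring by blast
  let ?P = "max_ideal R \<inter> A"
  have "ideal_in ?P A"
    using ideal_in_max_ideal[OF R] AR A by (intro ideal_in_restrict) auto
  then have P: "primeideal ?P (ring_of A)"
    using A AR one_notin_max_ideal[OF sr] unit_in_mult_iff[OF sr]
    by (auto simp: primeideal_ring_of_iff max_ideal_eq is_subring_mult)
  have eq: "localization_at A ?P = loc A R"
    using AR by (auto simp: localization_at_def loc_def max_ideal_eq)
  show l: "local_of A (loc A R)" using local_of_localization_at[OF P] eq by simp
  show "dominates R (loc A R)"
    unfolding dominates_def
  proof (intro conjI ballI impI)
    show sub: "loc A R \<subseteq> R" using unit_in_divide[OF sr] AR by (auto simp: loc_def)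
    fix x assume x: "x \<in> loc A R" and u: "unit_in R x"
    then obtain b w where *: "x = b / w" "b \<in> A" "w \<in> A" "unit_in R w" by (auto simp: loc_def)
    then have "b = x * w" by (auto simp: unit_in_def)
    then have "unit_in R b" using unit_in_mult_iff[OF sr, of x w] u * by (auto simp: unit_in_def)
    then have "w / b \<in> loc A R" using * by (auto simp: loc_def)
    then show "unit_in (loc A R) x" using x u * by (auto simp: unit_in_def)
  qed
qed

text \<open>Domination leaves Q and R with the same units among the elements of A, hence with the
  same admissible denominators. So the centre on an affine model is unique.\<close>

lemma local_of_dominated_eq:
  assumes Q: "local_of A Q" and d: "dominates R Q"
  shows "Q = loc A R"
proof (intro equalityI subsetI)
  fix r assume "r \<in> Q"
  then obtain b w where "b \<in> A" "w \<in> A" "unit_in Q w" "r = b / w"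
    using local_of_fraction[OF Q] by metis
  then show "r \<in> loc A R" using d unit_in_mono unfolding loc_def dominates_def by blast
next
  fix r assume "r \<in> loc A R"
  then obtain b w where *: "b \<in> A" "w \<in> A" "unit_in R w" "r = b / w" by (auto simp: loc_def)
  then show "r \<in> Q"
    using unit_in_divide[OF local_of_subring[OF Q]] local_of_subset[OF Q] d
    by (metis dominates_def subsetD)
qed

lemma center_eq:
  assumes "Q \<in> M" "dominates R Q" "\<And>Q'. Q' \<in> M \<Longrightarrow> dominates R Q' \<Longrightarrow> Q' = Q"
  shows "center M R = Q"
  unfolding center_def dominates_iff[symmetric]
proof (rule the_equality)
  show "Q \<in> M \<and> dominates R Q" using assms(1,2) by blast
  show "\<And>Q'. Q' \<in> M \<and> dominates R Q' \<Longrightarrow> Q' = Q" using assms(3) by blast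
qed

lemma center_spec:
  assumes "is_subring A" "local_ring R" "A \<subseteq> R"
  shows "center (spec A) R = loc A R"
  by (rule center_eq) (use assms local_of_loc[OF assms] local_of_dominated_eq spec_iff in blast)+

section \<open>Generated ideals and cosets\<close>

lemma genideal_ring_of:
  assumes A: "is_subring A" and S: "S \<subseteq> A"
  shows "S \<subseteq> Idl\<^bsub>ring_of A\<^esub> S" "ideal_in (Idl\<^bsub>ring_of A\<^esub> S) A"
    "\<And>I. ideal_in I A \<Longrightarrow> S \<subseteq> I \<Longrightarrow> Idl\<^bsub>ring_of A\<^esub> S \<subseteq> I"
proof -
  interpret cring "ring_of A" using A cring_ring_of_iff by blast
  show "S \<subseteq> Idl\<^bsub>ring_of A\<^esub> S" using genideal_self S by simp
  show "ideal_in (Idl\<^bsub>ring_of A\<^esub> S) A"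
    using genideal_ideal S ideal_ring_of_iff[OF A] by simp
  show "\<And>I. ideal_in I A \<Longrightarrow> S \<subseteq> I \<Longrightarrow> Idl\<^bsub>ring_of A\<^esub> S \<subseteq> I"
    using genideal_minimal ideal_ring_of_iff[OF A] by blast
qed

lemma ideal_in_eq_whole:
  assumes "ideal_in I R" "1 \<in> I" shows "I = R"
  using assms unfolding ideal_in_def by (metis mult_1_right subset_antisym subsetI)

lemma coset_ring_of: "I +>\<^bsub>ring_of A\<^esub> x = {h + x | h. h \<in> I}"
  by (auto simp: a_r_coset_def' )

lemma coset_eq_iff:
  assumes A: "is_subring A" and I: "ideal_in I A"
  shows "I +>\<^bsub>ring_of A\<^esub> x = I +>\<^bsub>ring_of A\<^esub> y \<longleftrightarrow> x - y \<in> I"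
proof
  assume "I +>\<^bsub>ring_of A\<^esub> x = I +>\<^bsub>ring_of A\<^esub> y"
  moreover have "0 + x \<in> I +>\<^bsub>ring_of A\<^esub> x" using I unfolding coset_ring_of ideal_in_def by blast
  ultimately show "x - y \<in> I" unfolding coset_ring_of by auto
next
  assume xy: "x - y \<in> I"
  then have yx: "y - x \<in> I" using ideal_in_diff[OF A I, of 0 "x - y"] I by (auto simp: ideal_in_def)
  have "h + x \<in> {h + y |h. h \<in> I}" if "h \<in> I" for h
    using xy that I unfolding ideal_in_def mem_Collect_eq
    by (intro exI[of _ "h + (x - y)"]) auto
  moreover have "h + y \<in> {h + x |h. h \<in> I}" if "h \<in> I" for h
    using yx that I unfolding ideal_in_def mem_Collect_eq
    by (intro exI[of _ "h + (y - x)"]) auto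
  ultimately show "I +>\<^bsub>ring_of A\<^esub> x = I +>\<^bsub>ring_of A\<^esub> y"
    unfolding coset_ring_of by blast
qed


section \<open>The Zariski topology of a model\<close>

lemma openin_zariski_subset: "openin (zariski M) U \<Longrightarrow> U \<subseteq> M"
  unfolding zariski_def using openin_subset by fastforce

lemma topspace_zariski: "(\<And>R. R \<in> M \<Longrightarrow> is_subring R) \<Longrightarrow> topspace (zariski M) = M"
  unfolding zariski_def topology_generated_by_topspace using is_subring_one by blast

lemma openin_zariski_basic: "openin (zariski M) {R \<in> M. g \<in> R}"
  unfolding zariski_def by (rule topology_generated_by_Basis) blast

lemma openin_zariski_contains:
  assumes "\<And>R. R \<in> M \<Longrightarrow> is_subring R" "finite T"
  shows "openin (zariski M) {R \<in> M. T \<subseteq> R}"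
  using assms(2)
proof (induction T)
  case empty
  then show ?case using openin_topspace[of "zariski M"] topspace_zariski[OF assms(1)] by simp
next
  case (insert x F)
  have "{R \<in> M. insert x F \<subseteq> R} = {R \<in> M. x \<in> R} \<inter> {R \<in> M. F \<subseteq> R}" by auto
  then show ?case using openin_Int[OF openin_zariski_basic insert.IH] by metis
qed

text \<open>A generating open set is the domain of one function, so by induction on the generation
  every neighbourhood contains the common domain of finitely many functions of R.\<close>

lemma zariski_nbhd:
  assumes "openin (zariski M) U" "R \<in> U"
  shows "\<exists>T. finite T \<and> T \<subseteq> R \<and> {Q \<in> M. T \<subseteq> Q} \<subseteq> U"
proof -
  have "generate_topology_on {{R \<in> M. g \<in> R} |g. True} U"
    using assms(1) by (simp add: zariski_def openin_topology_generated_by_iff)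
  then show ?thesis using assms(2)
  proof (induction)
    case (Int a b)
    then obtain T T' where "finite T" "T \<subseteq> R" "{Q \<in> M. T \<subseteq> Q} \<subseteq> a"
      "finite T'" "T' \<subseteq> R" "{Q \<in> M. T' \<subseteq> Q} \<subseteq> b" by auto
    then show ?case by (intro exI[of _ "T \<union> T'"]) auto
  next
    case (UN K)
    then obtain k where "k \<in> K" "R \<in> k" by auto
    then show ?case using UN.IH[of k] by blast
  next
    case (Basis s)
    then obtain g where "s = {R \<in> M. g \<in> R}" by auto
    then show ?case using Basis.prems by (intro exI[of _ "{g}"]) auto
  qed auto
qed

text \<open>Open sets are stable under generization: a larger local ring still contains the finitely
  many functions that cut out a neighbourhood.\<close>

lemma openin_zariski_upward:
  assumes "openin (zariski M) U" "R \<in> U" "R \<subseteq> R'" "R' \<in> M"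
  shows "R' \<in> U"
  using zariski_nbhd[OF assms(1,2)] assms(3,4) by blast

text \<open>The trace of the valuative criterion that is needed to recognise affine charts: no
  member of the model properly dominates another one.\<close>

definition separated :: "'f::field model \<Rightarrow> bool" where
  "separated M \<longleftrightarrow> (\<forall>R\<in>M. \<forall>Q\<in>M. dominates R Q \<longrightarrow> Q = R)"

text \<open>If R contains A, then \<open>loc A R\<close> is a member of M dominated by R, and
  separatedness forces it to be R.\<close>

lemma spec_eq_contains:
  assumes A: "is_subring A" and sub: "spec A \<subseteq> M" and M: "\<And>R. R \<in> M \<Longrightarrow> local_ring R"
    and sep: "separated M"
  shows "spec A = {R \<in> M. A \<subseteq> R}"
proof (intro equalityI subsetI)
  fix R assume R: "R \<in> {R \<in> M. A \<subseteq> R}"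
  then have "local_of A (loc A R)" "dominates R (loc A R)"
    using local_of_loc[OF A M] by auto
  then show "R \<in> spec A"
    using sep R sub A unfolding separated_def spec_iff[symmetric] by (metis (no_types, lifting) mem_Collect_eq spec_iff subsetD)
qed (use sub spec_iff local_of_subset in blast)

text \<open>T is a finite set of generators of A over the base: containing A amounts to containing
  T, which is an open condition.\<close>

lemma openin_spec:
  assumes A: "is_subring A" and sub: "spec A \<subseteq> M" and M: "\<And>R. R \<in> M \<Longrightarrow> local_ring R"
    and sep: "separated M"
    and fin: "finite T" "T \<subseteq> A" "\<And>R. R \<in> M \<Longrightarrow> T \<subseteq> R \<Longrightarrow> A \<subseteq> R"
  shows "openin (zariski M) (spec A)"
proof -
  have "spec A = {R \<in> M. T \<subseteq> R}"
    using spec_eq_contains[OF A sub M sep] fin by blast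
  then show ?thesis
    using openin_zariski_contains[OF _ fin(1), of M] M local_ring_subring by metis
qed

section \<open>Factorization into primes\<close>

definition is_unit_of :: "'a::comm_ring_1 set \<Rightarrow> 'a \<Rightarrow> bool" where
  "is_unit_of A u \<longleftrightarrow> u \<in> A \<and> (\<exists>w\<in>A. u * w = 1)"

definition divides_in :: "'a::comm_ring_1 set \<Rightarrow> 'a \<Rightarrow> 'a \<Rightarrow> bool" where
  "divides_in A a b \<longleftrightarrow> (\<exists>c\<in>A. b = a * c)"

definition prime_in :: "'a::comm_ring_1 set \<Rightarrow> 'a \<Rightarrow> bool" where
  "prime_in A \<pi> \<longleftrightarrow> \<pi> \<in> A \<and> \<pi> \<noteq> 0 \<and> \<not> is_unit_of A \<pi> \<and>
     (\<forall>a\<in>A. \<forall>b\<in>A. divides_in A \<pi> (a * b) \<longrightarrow> divides_in A \<pi> a \<or> divides_in A \<pi> b)"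

text \<open>The number of prime factors is an index because it serves as the induction measure when
  a content is extracted.\<close>

inductive prime_factors_in :: "'a::comm_ring_1 set \<Rightarrow> nat \<Rightarrow> 'a \<Rightarrow> bool" for A where
  unit: "is_unit_of A u \<Longrightarrow> prime_factors_in A 0 u"
| prime: "prime_in A \<pi> \<Longrightarrow> prime_factors_in A n a \<Longrightarrow> prime_factors_in A (Suc n) (\<pi> * a)"

definition factorial_in :: "'a::comm_ring_1 set \<Rightarrow> bool" where
  "factorial_in A \<longleftrightarrow> is_subring A \<and> (\<forall>a\<in>A. a \<noteq> 0 \<longrightarrow> (\<exists>n. prime_factors_in A n a))"

lemma prime_factors_in_mem:
  "prime_factors_in A n a \<Longrightarrow> is_subring A \<Longrightarrow> a \<in> A"
  by (induction rule: prime_factors_in.induct)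
    (auto simp: is_unit_of_def prime_in_def is_subring_mult)

lemma prime_factors_in_unit_mult:
  assumes "prime_factors_in A n b" and A: "is_subring A" and v: "is_unit_of A v"
  shows "prime_factors_in A n (v * b)"
  using assms(1)
proof induction
  case (unit u)
  obtain z where z: "u \<in> A" "z \<in> A" "u * z = 1" using unit by (auto simp: is_unit_of_def)
  obtain w where w: "v \<in> A" "w \<in> A" "v * w = 1" using v by (auto simp: is_unit_of_def)
  have "(v * u) * (w * z) = (v * w) * (u * z)" by (simp add: algebra_simps)
  then have "(v * u) * (w * z) = 1" using z w by simp
  moreover have "v * u \<in> A" "w * z \<in> A" using z w is_subring_mult[OF A] by auto
  ultimately show ?case
    by (intro prime_factors_in.unit) (auto simp: is_unit_of_def)
next
  case (prime \<pi> n a)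
  have "prime_factors_in A (Suc n) (\<pi> * (v * a))"
    using prime by (intro prime_factors_in.prime) auto
  then show ?case by (simp add: mult.left_commute)
qed

lemma prime_factors_in_mult:
  assumes "prime_factors_in A n a" "prime_factors_in A k b" and A: "is_subring A"
  shows "\<exists>l. prime_factors_in A l (a * b)"
  using assms(1)
proof induction
  case (unit u)
  then show ?case using prime_factors_in_unit_mult[OF assms(2) A] by blast
next
  case (prime \<pi> n a)
  then obtain l where "prime_factors_in A l (a * b)" by blast
  then show ?case using prime_factors_in.prime[OF prime.hyps(1), of l "a * b"]
    by (auto simp: mult.assoc)
qed

text \<open>\<rho> divides the product of \<pi> and w. If it divides \<pi>, the quotient is inverse
  to w; if it divides w, then \<pi> would be a unit.\<close>

lemma prime_in_associate:
  fixes \<pi> :: "'a::idom"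
  assumes "prime_in A \<pi>" "prime_in A \<rho>" and w: "w \<in> A" "\<rho> = \<pi> * w" and A: "is_subring A"
  shows "is_unit_of A w"
proof -
  have 0: "\<rho> \<noteq> 0" using assms(2) by (auto simp: prime_in_def)
  have \<pi>A: "\<pi> \<in> A" using assms(1) by (auto simp: prime_in_def)
  have "\<pi> * w = \<rho> * 1" using w by simp
  then have "divides_in A \<rho> (\<pi> * w)" using is_subring_one[OF A] unfolding divides_in_def by blast
  then consider "divides_in A \<rho> \<pi>" | "divides_in A \<rho> w"
    using assms(2) w \<pi>A by (auto simp: prime_in_def)
  then show ?thesis
  proof cases
    case 1
    then obtain v where v: "v \<in> A" "\<pi> = \<rho> * v" by (auto simp: divides_in_def)
    have "\<rho> * (v * w) = (\<rho> * v) * w" by (simp only: mult.assoc)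
    also have "\<dots> = \<rho> * 1" unfolding v(2)[symmetric] using w(2) by simp
    finally have "\<rho> * (v * w) = \<rho> * 1" .
    then have "v * w = 1" using 0 mult_left_cancel by blast
    then show ?thesis using v w by (auto simp: is_unit_of_def mult.commute)
  next
    case 2
    then obtain w' where w': "w' \<in> A" "w = \<rho> * w'" by (auto simp: divides_in_def)
    then have "\<rho> * (\<pi> * w') = \<rho> * 1" using w by (simp add: algebra_simps)
    then have "\<pi> * w' = 1" using 0 mult_left_cancel by blast
    then show ?thesis using w' \<pi>A assms(1) by (auto simp: is_unit_of_def prime_in_def)
  qed
qed

text \<open>Cancelling a prime lowers the number of factors by exactly one. The prime may occur in
  the given factorization only up to a unit, which is then moved to the remaining factors.\<close>

lemma prime_factors_in_cancel:
  fixes \<pi> :: "'a::idom"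
  assumes "prime_factors_in A n x" "x = \<pi> * y" and \<pi>: "prime_in A \<pi>" and y: "y \<in> A"
    and A: "is_subring A"
  shows "n > 0 \<and> prime_factors_in A (n - 1) y"
  using assms(1,2) y
proof (induction arbitrary: y)
  case (unit u)
  then obtain w where w: "w \<in> A" "u * w = 1" by (auto simp: is_unit_of_def)
  then have "\<pi> * (y * w) = 1" using unit.prems by (metis mult.assoc)
  then have "is_unit_of A \<pi>" using \<pi> w unit is_subring_mult[OF A] by (auto simp: is_unit_of_def prime_in_def)
  then show ?case using \<pi> by (simp add: prime_in_def)
next
  case (prime \<rho> n a)
  have \<rho>: "\<rho> \<in> A" and a: "a \<in> A"
    using prime.hyps prime_factors_in_mem[OF _ A] by (auto simp: prime_in_def)
  have "divides_in A \<pi> (\<rho> * a)" using prime.prems by (auto simp: divides_in_def)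
  then consider "divides_in A \<pi> a" | "divides_in A \<pi> \<rho>"
    using \<pi> \<rho> a by (auto simp: prime_in_def)
  then show ?case
  proof cases
    case 1
    then obtain a' where a': "a' \<in> A" "a = \<pi> * a'" by (auto simp: divides_in_def)
    have "\<pi> * (\<rho> * a') = \<pi> * y" using prime.prems a' by (simp add: algebra_simps)
    then have y: "y = \<rho> * a'" using \<pi> by (simp add: prime_in_def)
    have "n > 0 \<and> prime_factors_in A (n - 1) a'" using prime.IH a' by blast
    then show ?thesis using prime_factors_in.prime[OF prime.hyps(1), of "n - 1" a'] y by simp
  next
    case 2
    then obtain w where w: "w \<in> A" "\<rho> = \<pi> * w" by (auto simp: divides_in_def)
    then have "is_unit_of A w" using prime_in_associate[OF \<pi> prime.hyps(1) _ _ A] by blast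
    moreover have "\<pi> * (w * a) = \<pi> * y" using prime.prems w by (simp add: algebra_simps)
    then have "y = w * a" using \<pi> by (simp add: prime_in_def)
    ultimately show ?thesis using prime_factors_in_unit_mult[OF prime.hyps(2) A] by simp
  qed
qed

lemma prime_factors_in_unit_or_divisor:
  assumes "prime_factors_in A n x" "is_subring A"
  shows "is_unit_of A x \<or> (\<exists>\<pi>. prime_in A \<pi> \<and> divides_in A \<pi> x)"
  using assms(1)
  by cases (use prime_factors_in_mem[OF _ assms(2)] in \<open>auto simp: divides_in_def\<close>)

text \<open>Units, divisibility and primes are multiplicative notions, so a multiplicative bijection
  transports factorizations. It is applied to \<open>const\<close> and to the evaluation of a
  univariate polynomial at a new variable.\<close>

lemma factorial_in_image:
  fixes h :: "'a::idom \<Rightarrow> 'b::idom"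
  assumes fact: "factorial_in A" and bij: "bij_betw h A A'"
    and mult: "\<And>x y. x \<in> A \<Longrightarrow> y \<in> A \<Longrightarrow> h (x * y) = h x * h y"
    and one: "h 1 = 1" and zero: "h 0 = 0" and A': "is_subring A'"
  shows "factorial_in A'"
proof -
  have A: "is_subring A" using fact by (simp add: factorial_in_def)
  have im: "A' = h ` A" and inj: "inj_on h A" using bij by (auto simp: bij_betw_def)
  have unit: "is_unit_of A' (h u) \<longleftrightarrow> is_unit_of A u" if "u \<in> A" for u
  proof -
    have "h u * h w = 1 \<longleftrightarrow> u * w = 1" if "w \<in> A" for w
      using mult[of u w] one inj_on_eq_iff[OF inj, of "u * w" 1] \<open>u \<in> A\<close> that
        is_subring_mult[OF A] is_subring_one[OF A] by simp
    then show ?thesis using that by (auto simp: is_unit_of_def im)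
  qed
  have dvd: "divides_in A' (h x) (h y) \<longleftrightarrow> divides_in A x y" if "x \<in> A" "y \<in> A" for x y
  proof -
    have "h y = h x * h c \<longleftrightarrow> y = x * c" if "c \<in> A" for c
      using mult[of x c] inj_on_eq_iff[OF inj, of y "x * c"] \<open>x \<in> A\<close> \<open>y \<in> A\<close> that
        is_subring_mult[OF A] by simp
    then show ?thesis by (auto simp: divides_in_def im)
  qed
  have prime: "prime_in A' (h \<pi>)" if p: "prime_in A \<pi>" for \<pi>
    unfolding prime_in_def
  proof (intro conjI ballI impI)
    have \<pi>: "\<pi> \<in> A" "\<pi> \<noteq> 0" using p by (auto simp: prime_in_def)
    show "h \<pi> \<in> A'" using \<pi> im by blast
    show "h \<pi> \<noteq> 0" using \<pi> inj_on_eq_iff[OF inj, of \<pi> 0] zero is_subring_zero[OF A] by simp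
    show "\<not> is_unit_of A' (h \<pi>)" using unit p \<pi> by (auto simp: prime_in_def)
    fix a' b' assume *: "a' \<in> A'" "b' \<in> A'" "divides_in A' (h \<pi>) (a' * b')"
    then obtain a b where ab: "a \<in> A" "b \<in> A" "a' = h a" "b' = h b" using im by blast
    then have "divides_in A \<pi> (a * b)" using * dvd[OF \<pi>(1), of "a * b"] mult is_subring_mult[OF A] by simp
    then have "divides_in A \<pi> a \<or> divides_in A \<pi> b" using p ab by (simp add: prime_in_def)
    then show "divides_in A' (h \<pi>) a' \<or> divides_in A' (h \<pi>) b'" using dvd \<pi> ab by simp
  qed
  have "prime_factors_in A' n (h a)" if "prime_factors_in A n a" for n a
    using that
  proof induction
    case (unit u)
    then show ?case using \<open>\<And>u. u \<in> A \<Longrightarrow> is_unit_of A' (h u) = is_unit_of A u\<close>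
      by (intro prime_factors_in.unit) (auto simp: is_unit_of_def)
  next
    case (prime \<pi> n a)
    then have "h (\<pi> * a) = h \<pi> * h a" using mult prime_factors_in_mem[OF _ A] by (auto simp: prime_in_def)
    then show ?case using prime \<open>\<And>\<pi>. prime_in A \<pi> \<Longrightarrow> prime_in A' (h \<pi>)\<close>
      by (auto intro: prime_factors_in.prime)
  qed
  then show ?thesis using fact A' zero unfolding factorial_in_def im by (metis imageE)
qed


subsection \<open>Polynomials over a factorial ring\<close>

definition poly_over :: "'a::comm_ring_1 set \<Rightarrow> 'a poly set" where
  "poly_over A = {p. \<forall>i. coeff p i \<in> A}"

lemma is_subring_poly_over: "is_subring A \<Longrightarrow> is_subring (poly_over A)"
  unfolding is_subring_def[of "poly_over A"]
  by (auto simp: poly_over_def coeff_mult is_subring_diff is_subring_mult is_subring_one is_subring_zero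
      intro!: is_subring_sum)

lemma const_poly_over_iff [simp]: "is_subring A \<Longrightarrow> [:a:] \<in> poly_over A \<longleftrightarrow> a \<in> A"
  by (auto simp: poly_over_def coeff_pCons is_subring_zero split: nat.splits)

lemma poly_over_coeff: "p \<in> poly_over A \<Longrightarrow> coeff p i \<in> A"
  by (simp add: poly_over_def)

lemma divides_const_poly_iff:
  fixes \<pi> :: "'a::idom"
  assumes A: "is_subring A" and \<pi>: "\<pi> \<noteq> 0" 
  shows "divides_in (poly_over A) [:\<pi>:] p \<longleftrightarrow> (\<forall>i. divides_in A \<pi> (coeff p i))"
proof
  assume "divides_in (poly_over A) [:\<pi>:] p"
  then obtain q where "q \<in> poly_over A" "p = [:\<pi>:] * q" by (auto simp: divides_in_def)
  then show "\<forall>i. divides_in A \<pi> (coeff p i)" by (auto simp: divides_in_def poly_over_def)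
next
  assume *: "\<forall>i. divides_in A \<pi> (coeff p i)"
  \<comment> \<open>The value 0 at 0 is what \<open>coeff_map_poly\<close> requires; elsewhere any
    quotient by \<pi> will do.\<close>
  define f where "f a = (if a = 0 then 0 else SOME c. c \<in> A \<and> a = \<pi> * c)" for a
  have f: "f a \<in> A \<and> a = \<pi> * f a" if "divides_in A \<pi> a" for a
  proof (cases "a = 0")
    case False
    have "\<exists>c. c \<in> A \<and> a = \<pi> * c" using that by (auto simp: divides_in_def)
    from someI_ex[OF this] show ?thesis using False by (simp add: f_def)
  qed (simp add: f_def is_subring_zero[OF A])
  have c: "coeff (map_poly f p) i = f (coeff p i)" for i by (rule coeff_map_poly) (simp add: f_def)
  have "p = [:\<pi>:] * map_poly f p" by (rule poly_eqI) (use f * c in simp)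
  moreover have "map_poly f p \<in> poly_over A" using f * c by (simp add: poly_over_def)
  ultimately show "divides_in (poly_over A) [:\<pi>:] p" by (auto simp: divides_in_def)
qed

lemma divides_in_add: "is_subring A \<Longrightarrow> divides_in A \<pi> a \<Longrightarrow> divides_in A \<pi> b \<Longrightarrow> divides_in A \<pi> (a + b)"
  unfolding divides_in_def by (metis distrib_left is_subring_add)

lemma divides_in_diff: "is_subring A \<Longrightarrow> divides_in A \<pi> a \<Longrightarrow> divides_in A \<pi> b \<Longrightarrow> divides_in A \<pi> (a - b)"
  unfolding divides_in_def by (metis right_diff_distrib is_subring_diff)

lemma divides_in_mult_right: "is_subring A \<Longrightarrow> divides_in A \<pi> a \<Longrightarrow> b \<in> A \<Longrightarrow> divides_in A \<pi> (a * b)"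
  unfolding divides_in_def by (metis mult.assoc is_subring_mult)

lemma divides_in_mult_left: "is_subring A \<Longrightarrow> divides_in A \<pi> a \<Longrightarrow> b \<in> A \<Longrightarrow> divides_in A \<pi> (b * a)"
  using divides_in_mult_right by (metis mult.commute)

lemma divides_in_sum:
  "is_subring A \<Longrightarrow> (\<And>i. i \<in> S \<Longrightarrow> divides_in A \<pi> (g i)) \<Longrightarrow> divides_in A \<pi> (sum g S)"
proof (induction S rule: infinite_finite_induct)
  case (insert x F)
  then show ?case using divides_in_add[of A \<pi> "g x" "sum g F"] by simp
qed (auto simp: divides_in_def intro: bexI[of _ 0] is_subring_zero)

lemma unit_const_poly_iff:
  fixes u :: "'a::idom"
  assumes A: "is_subring A"
  shows "is_unit_of (poly_over A) [:u:] \<longleftrightarrow> is_unit_of A u"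
proof
  assume "is_unit_of (poly_over A) [:u:]"
  then obtain q where "u \<in> A" "q \<in> poly_over A" "[:u:] * q = 1" using A by (auto simp: is_unit_of_def)
  then have "u * coeff q 0 = 1" by (metis coeff_mult_0 coeff_pCons_0 lead_coeff_1 degree_1)
  then show "is_unit_of A u" using \<open>u \<in> A\<close> \<open>q \<in> _\<close> by (auto simp: is_unit_of_def poly_over_def)
next
  assume "is_unit_of A u"
  then obtain w where "u \<in> A" "w \<in> A" "u * w = 1" by (auto simp: is_unit_of_def)
  then show "is_unit_of (poly_over A) [:u:]"
    using A by (auto simp: is_unit_of_def one_pCons intro!: bexI[of _ "[:w:]"])
qed

text \<open>Gauss: take the first coefficients of a and b that \<pi> does not divide, at places i
  and j. In the coefficient of the product at i + j every other summand is a multiple of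
  \<pi>.\<close>

lemma prime_in_const_poly:
  fixes \<pi> :: "'a::idom"
  assumes A: "is_subring A" and p: "prime_in A \<pi>"
  shows "prime_in (poly_over A) [:\<pi>:]"
proof -
  have \<pi>: "\<pi> \<in> A" "\<pi> \<noteq> 0" "\<not> is_unit_of A \<pi>" using p by (auto simp: prime_in_def)
  note dvd = divides_const_poly_iff[OF A \<pi>(2)]
  have "divides_in (poly_over A) [:\<pi>:] a \<or> divides_in (poly_over A) [:\<pi>:] b"
    if a: "a \<in> poly_over A" and b: "b \<in> poly_over A" and ab: "divides_in (poly_over A) [:\<pi>:] (a * b)" for a b
  proof (rule ccontr)
    assume "\<not> ?thesis"
    then have ex: "\<exists>i. \<not> divides_in A \<pi> (coeff a i)" "\<exists>j. \<not> divides_in A \<pi> (coeff b j)"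
      using dvd by auto
    define i where "i = (LEAST i. \<not> divides_in A \<pi> (coeff a i))"
    define j where "j = (LEAST j. \<not> divides_in A \<pi> (coeff b j))"
    have i: "\<not> divides_in A \<pi> (coeff a i)" "\<And>k. k < i \<Longrightarrow> divides_in A \<pi> (coeff a k)"
      unfolding i_def using LeastI_ex[OF ex(1)] not_less_Least by blast+
    have j: "\<not> divides_in A \<pi> (coeff b j)" "\<And>k. k < j \<Longrightarrow> divides_in A \<pi> (coeff b k)"
      unfolding j_def using LeastI_ex[OF ex(2)] not_less_Least by blast+
    have "divides_in A \<pi> (coeff (a * b) (i + j))" using ab dvd by blast
    moreover have "coeff (a * b) (i + j)
        = coeff a i * coeff b j + (\<Sum>k\<in>{..i + j} - {i}. coeff a k * coeff b (i + j - k))"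
      unfolding coeff_mult by (subst sum.remove[of _ i]) auto
    moreover have "divides_in A \<pi> (\<Sum>k\<in>{..i + j} - {i}. coeff a k * coeff b (i + j - k))"
    proof (rule divides_in_sum[OF A])
      fix k assume k: "k \<in> {..i + j} - {i}"
      show "divides_in A \<pi> (coeff a k * coeff b (i + j - k))"
      proof (cases "k < i")
        case True
        then show ?thesis using i(2) b by (intro divides_in_mult_right[OF A]) (auto simp: poly_over_def)
      next
        case False
        then have "i + j - k < j" using k by auto
        then show ?thesis using j(2) a by (intro divides_in_mult_left[OF A]) (auto simp: poly_over_def)
      qed
    qed
    ultimately have "divides_in A \<pi> (coeff a i * coeff b j)"
      using divides_in_diff[OF A, of \<pi> "coeff (a * b) (i + j)"
          "\<Sum>k\<in>{..i + j} - {i}. coeff a k * coeff b (i + j - k)"] by simp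
    then show False using p i(1) j(1) a b by (auto simp: prime_in_def poly_over_def)
  qed
  then show ?thesis using \<pi> A unit_const_poly_iff[OF A] by (auto simp: prime_in_def)
qed

lemma prime_factors_in_const_poly:
  fixes a :: "'a::idom"
  assumes A: "is_subring A" shows "prime_factors_in A n a \<Longrightarrow> prime_factors_in (poly_over A) n [:a:]"
proof (induction rule: prime_factors_in.induct)
  case (unit u)
  then show ?case using unit_const_poly_iff[OF A] prime_factors_in.unit by blast
next
  case (prime \<pi> n a)
  then show ?case using prime_factors_in.prime[OF prime_in_const_poly[OF A prime.hyps(1)]] by fastforce
qed

text \<open>Prime constants are split off one at a time, without greatest common divisors; each of
  them takes one prime factor from the leading coefficient, so the process stops.\<close>

lemma extract_content:
  fixes F :: "'a::idom poly"
  assumes A: "is_subring A" and "prime_factors_in A n (lead_coeff F)" "F \<in> poly_over A"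
  shows "\<exists>a k F'. prime_factors_in A k a \<and> F' \<in> poly_over A \<and> F = [:a:] * F' \<and>
     (\<forall>\<pi>. prime_in A \<pi> \<longrightarrow> \<not> divides_in (poly_over A) [:\<pi>:] F')"
  using assms(2-)
proof (induction n arbitrary: F rule: less_induct)
  case (less n F)
  show ?case
  proof (cases "\<exists>\<pi>. prime_in A \<pi> \<and> divides_in (poly_over A) [:\<pi>:] F")
    case True
    then obtain \<pi> G where \<pi>: "prime_in A \<pi>" and G: "G \<in> poly_over A" "F = [:\<pi>:] * G"
      by (auto simp: divides_in_def)
    have \<pi>0: "\<pi> \<noteq> 0" using \<pi> by (simp add: prime_in_def)
    have lc: "lead_coeff F = \<pi> * lead_coeff G" using G by (simp add: lead_coeff_mult)
    have "n > 0 \<and> prime_factors_in A (n - 1) (lead_coeff G)"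
      using prime_factors_in_cancel[OF less.prems(1) lc \<pi> poly_over_coeff[OF G(1)] A] .
    then obtain a k F' where *: "prime_factors_in A k a" "F' \<in> poly_over A" "G = [:a:] * F'"
      "\<forall>\<pi>. prime_in A \<pi> \<longrightarrow> \<not> divides_in (poly_over A) [:\<pi>:] F'"
      using less.IH[of "n - 1" G] G by auto
    have "F = [:\<pi> * a:] * F'" using G * by (simp add: mult.commute)
    then show ?thesis using * prime_factors_in.prime[OF \<pi> *(1)] by blast
  next
    case False
    have "is_unit_of A 1" using is_subring_one[OF A] by (auto simp: is_unit_of_def)
    then have "prime_factors_in A 0 1" by (rule prime_factors_in.unit)
    moreover have "F = [:1:] * F" by simp
    ultimately show ?thesis using False less.prems by blast
  qed
qed

text \<open>Multiplication by the leading coefficient of D before each reduction step replaces the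
  passage to the fraction field.\<close>

lemma pseudo_division:
  fixes P D :: "'a::idom poly"
  assumes A: "is_subring A" and D: "D \<in> poly_over A" "D \<noteq> 0" and "P \<in> poly_over A"
  shows "\<exists>c Q R. c \<in> A \<and> c \<noteq> 0 \<and> Q \<in> poly_over A \<and> R \<in> poly_over A \<and> [:c:] * P = Q * D + R \<and>
     (R = 0 \<or> degree R < degree D)"
  using assms(4)
proof (induction "degree P" arbitrary: P rule: less_induct)
  case less
  note S = is_subring_poly_over[OF A]
  show ?case
  proof (cases "P = 0 \<or> degree P < degree D")
    case True
    then show ?thesis using less.prems is_subring_one[OF A] is_subring_zero[OF S]
      by (intro exI[of _ 1] exI[of _ 0] exI[of _ P]) auto
  next
    case False
    define M where "M = monom (lead_coeff P) (degree P - degree D)"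
    have M: "M \<in> poly_over A" using less.prems A by (simp add: M_def poly_over_def is_subring_zero)
    have lD: "[:lead_coeff D:] \<in> poly_over A" using A D by (simp add: poly_over_coeff)
    define P1 where "P1 = [:lead_coeff D:] * P - M * D"
    have P1: "P1 \<in> poly_over A" unfolding P1_def
      using M lD D less.prems by (intro is_subring_diff[OF S] is_subring_mult[OF S])
    have "degree M = degree P - degree D" "M \<noteq> 0" using False by (auto simp: M_def degree_monom_eq)
    then have "degree (M * D) = degree P" using False D by (simp add: degree_mult_eq)
    moreover have "lead_coeff (M * D) = lead_coeff P * lead_coeff D"
      unfolding lead_coeff_mult \<open>degree M = _\<close> by (simp add: M_def)
    ultimately have "coeff P1 (degree P) = 0" by (simp add: P1_def)
    moreover have "degree P1 \<le> degree P"
      unfolding P1_def using \<open>degree (M * D) = degree P\<close> by (intro degree_diff_le) auto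
    ultimately have lt: "P1 = 0 \<or> degree P1 < degree P"
      using leading_coeff_0_iff[of P1] by (cases "degree P1 = degree P") auto
    have "\<exists>c Q R. c \<in> A \<and> c \<noteq> 0 \<and> Q \<in> poly_over A \<and> R \<in> poly_over A \<and> [:c:] * P1 = Q * D + R \<and>
        (R = 0 \<or> degree R < degree D)"
    proof (cases "P1 = 0")
      case True
      then show ?thesis using is_subring_one[OF A] is_subring_zero[OF S]
        by (intro exI[of _ 1] exI[of _ 0] exI[of _ 0]) auto
    qed (use lt less.hyps P1 in blast)
    then obtain c Q R where *: "c \<in> A" "c \<noteq> 0" "Q \<in> poly_over A" "R \<in> poly_over A"
      "[:c:] * P1 = Q * D + R" "R = 0 \<or> degree R < degree D" by blast
    have "[:c * lead_coeff D:] * P = [:c:] * ([:lead_coeff D:] * P)"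
      by (simp add: mult.commute)
    also have "\<dots> = [:c:] * P1 + [:c:] * M * D" unfolding P1_def by (simp only: algebra_simps)
    also have "\<dots> = (Q + [:c:] * M) * D + R" unfolding *(5) by (simp only: algebra_simps)
    finally have e: "[:c * lead_coeff D:] * P = (Q + [:c:] * M) * D + R" .
    have "c * lead_coeff D \<in> A" "c * lead_coeff D \<noteq> 0"
      using * D by (auto intro: is_subring_mult[OF A] poly_over_coeff)
    moreover have "Q + [:c:] * M \<in> poly_over A"
      using * M A by (intro is_subring_add[OF S] is_subring_mult[OF S]) auto
    ultimately show ?thesis using * e by blast
  qed
qed

text \<open>Each prime factor of c remains prime among polynomials and does not divide F, so it
  divides Q and can be cancelled.\<close>

lemma cancel_const:
  fixes F :: "'a::idom poly"
  assumes A: "is_subring A" and c: "prime_factors_in A n c"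
    and nd: "\<And>\<pi>. prime_in A \<pi> \<Longrightarrow> \<not> divides_in (poly_over A) [:\<pi>:] F"
    and F: "F \<in> poly_over A" and "H \<in> poly_over A" "Q \<in> poly_over A" "[:c:] * H = F * Q"
  shows "divides_in (poly_over A) F H"
  using c assms(5-)
proof (induction arbitrary: H Q)
  case (unit u)
  note S = is_subring_poly_over[OF A]
  obtain w where w: "w \<in> A" "u * w = 1" using unit by (auto simp: is_unit_of_def)
  have "H = [:w:] * ([:u:] * H)" using w by (simp add: mult.commute)
  also have "\<dots> = F * ([:w:] * Q)" unfolding unit by (simp add: algebra_simps)
  finally show ?case using unit w is_subring_mult[OF S, of "[:w:]" Q] A
    unfolding divides_in_def by (metis const_poly_over_iff)
next
  case (prime \<pi> n a)
  note S = is_subring_poly_over[OF A]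
  have a: "[:a:] \<in> poly_over A" using prime_factors_in_mem[OF prime.hyps(2) A] A by simp
  have e: "F * Q = [:\<pi>:] * ([:a:] * H)"
    unfolding prime.prems(3)[symmetric] by (simp add: mult.commute)
  then have "divides_in (poly_over A) [:\<pi>:] (F * Q)"
    using prime.prems(1) a is_subring_mult[OF S] unfolding divides_in_def by blast
  then have "divides_in (poly_over A) [:\<pi>:] Q"
    using prime_in_const_poly[OF A prime.hyps(1)] nd[OF prime.hyps(1)] F prime.prems
    by (auto simp: prime_in_def)
  then obtain Q' where Q': "Q' \<in> poly_over A" "Q = [:\<pi>:] * Q'" by (auto simp: divides_in_def)
  have "[:\<pi>:] * ([:a:] * H) = [:\<pi>:] * (F * Q')"
    unfolding e[symmetric] Q'(2) by (simp only: mult.left_commute)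
  moreover have "[:\<pi>:] \<noteq> 0" using prime.hyps(1) by (simp add: prime_in_def)
  ultimately have "[:a:] * H = F * Q'" using mult_left_cancel by blast
  then show ?case using prime.IH prime.prems Q' by blast
qed

text \<open>Each prime factor of c divides Q or D and is cancelled there; d collects those taken
  from D. The last clause guarantees a nonzero d when D is nonzero.\<close>

lemma split_const:
  fixes F :: "'a::idom poly"
  assumes A: "is_subring A" and c: "prime_factors_in A n c" "c \<noteq> 0"
    and F: "F \<in> poly_over A" and "D \<in> poly_over A" "Q \<in> poly_over A" "[:c:] * F = Q * D"
  shows "\<exists>Q' D' d. Q' \<in> poly_over A \<and> D' \<in> poly_over A \<and> d \<in> A \<and> D = [:d:] * D' \<and>
     F = Q' * D' \<and> (d = 0 \<longrightarrow> D = 0)"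
  using c assms(5-)
proof (induction arbitrary: D Q)
  case (unit u)
  note S = is_subring_poly_over[OF A]
  obtain w where w: "w \<in> A" "u * w = 1" using unit by (auto simp: is_unit_of_def)
  have "F = [:w:] * ([:u:] * F)" using w by (simp add: mult.commute)
  also have "\<dots> = ([:w:] * Q) * D" unfolding unit by (simp add: algebra_simps)
  finally have "F = ([:w:] * Q) * D" .
  moreover have "[:w:] * Q \<in> poly_over A" using is_subring_mult[OF S, of "[:w:]" Q] w unit A by simp
  moreover have "D = [:1:] * D" by simp
  ultimately show ?case using unit is_subring_one[OF A] by (metis zero_neq_one)
next
  case (prime \<pi> n a)
  note S = is_subring_poly_over[OF A]
  have a: "[:a:] \<in> poly_over A" using prime_factors_in_mem[OF prime.hyps(2) A] A by simp
  have \<pi>0: "[:\<pi>:] \<noteq> 0" "\<pi> \<in> A" "\<pi> \<noteq> 0" using prime.hyps(1) by (auto simp: prime_in_def)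
  have e: "Q * D = [:\<pi>:] * ([:a:] * F)"
    unfolding prime.prems(4)[symmetric] by (simp add: mult.commute)
  then have "divides_in (poly_over A) [:\<pi>:] (Q * D)"
    using F a is_subring_mult[OF S] unfolding divides_in_def by blast
  then consider "divides_in (poly_over A) [:\<pi>:] Q" | "divides_in (poly_over A) [:\<pi>:] D"
    using prime_in_const_poly[OF A prime.hyps(1)] prime.prems by (auto simp: prime_in_def)
  then show ?case
  proof cases
    case 1
    then obtain Q' where Q': "Q' \<in> poly_over A" "Q = [:\<pi>:] * Q'" by (auto simp: divides_in_def)
    have "[:\<pi>:] * ([:a:] * F) = [:\<pi>:] * (Q' * D)"
      unfolding e[symmetric] Q'(2) by (simp only: mult.assoc)
    then have "[:a:] * F = Q' * D" using \<pi>0 mult_left_cancel by blast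
    then show ?thesis using prime.IH[of D Q'] prime.prems Q' by auto
  next
    case 2
    then obtain D' where D': "D' \<in> poly_over A" "D = [:\<pi>:] * D'" by (auto simp: divides_in_def)
    have "[:\<pi>:] * ([:a:] * F) = [:\<pi>:] * (Q * D')"
      unfolding e[symmetric] D'(2) by (simp only: mult.left_commute)
    then have "[:a:] * F = Q * D'" using \<pi>0 mult_left_cancel by blast
    then obtain Q'' D'' d where *: "Q'' \<in> poly_over A" "D'' \<in> poly_over A" "d \<in> A"
      "D' = [:d:] * D''" "F = Q'' * D''" "d = 0 \<longrightarrow> D' = 0"
      using prime.IH[of D' Q] prime.prems D' by auto
    have "D = [:\<pi> * d:] * D''" unfolding D'(2) *(4) by (simp add: mult.commute)
    moreover have "\<pi> * d \<in> A" using \<pi>0 * is_subring_mult[OF A] by blast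
    ultimately show ?thesis using * by (metis D'(2) mult_zero_right no_zero_divisors \<pi>0(3))
  qed
qed

text \<open>An element D of least degree in the ideal (F, G) divides both F and G up to constants.
  As F is irreducible, either D is a constant, and then F divides a constant times H, or D is F up
  to a constant, and then F divides a constant times G. The constants are removed because F is
  primitive.\<close>

lemma prime_in_poly_over:
  fixes F :: "'a::idom poly"
  assumes fact: "factorial_in A" and F: "F \<in> poly_over A" and dF: "degree F > 0"
    and nd: "\<And>\<pi>. prime_in A \<pi> \<Longrightarrow> \<not> divides_in (poly_over A) [:\<pi>:] F"
    and irr: "\<And>G H. G \<in> poly_over A \<Longrightarrow> H \<in> poly_over A \<Longrightarrow> F = G * H \<Longrightarrow> degree G = 0 \<or> degree H = 0"
  shows "prime_in (poly_over A) F"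
proof -
  have A: "is_subring A" and pf: "\<And>a. a \<in> A \<Longrightarrow> a \<noteq> 0 \<Longrightarrow> \<exists>n. prime_factors_in A n a"
    using fact by (auto simp: factorial_in_def)
  note S = is_subring_poly_over[OF A]
  have F0: "F \<noteq> 0" using dF by auto
  have "divides_in (poly_over A) F G \<or> divides_in (poly_over A) F H"
    if G: "G \<in> poly_over A" and H: "H \<in> poly_over A" and dv: "divides_in (poly_over A) F (G * H)" for G H
  proof -
    obtain E where E: "E \<in> poly_over A" "G * H = F * E" using dv by (auto simp: divides_in_def)
    define I where "I = {U * F + V * G | U V. U \<in> poly_over A \<and> V \<in> poly_over A}"
    have IS: "I \<subseteq> poly_over A" unfolding I_def
      using F G by (auto intro!: is_subring_add[OF S] is_subring_mult[OF S])
    have I_diff: "c * X - Y * Z \<in> I" if XZ: "X \<in> I" "Z \<in> I" and "c \<in> poly_over A" "Y \<in> poly_over A" for c X Y Z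
    proof -
      obtain U V U' V' where *: "X = U * F + V * G" "Z = U' * F + V' * G"
        "U \<in> poly_over A" "V \<in> poly_over A" "U' \<in> poly_over A" "V' \<in> poly_over A"
        using XZ unfolding I_def by blast
      have "c * X - Y * Z = (c * U - Y * U') * F + (c * V - Y * V') * G"
        unfolding * by (simp only: algebra_simps)
      moreover have "c * U - Y * U' \<in> poly_over A" "c * V - Y * V' \<in> poly_over A"
        using * that by (auto intro!: is_subring_diff[OF S] is_subring_mult[OF S])
      ultimately show ?thesis unfolding I_def by blast
    qed
    have FI: "F \<in> I" "G \<in> I"
      unfolding I_def mem_Collect_eq using is_subring_one[OF S] is_subring_zero[OF S]
      by (metis add.right_neutral mult_1 mult_zero_left, metis add.left_neutral mult_1 mult_zero_left)
    obtain D where D: "D \<in> I" "D \<noteq> 0" and Dmin: "\<And>X. X \<in> I \<Longrightarrow> X \<noteq> 0 \<Longrightarrow> degree D \<le> degree X"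
      using ex_has_least_nat[of "\<lambda>X. X \<in> I \<and> X \<noteq> 0" F degree] FI F0 by auto
    have DS: "D \<in> poly_over A" using D IS by blast
    have div: "\<exists>c Q. c \<in> A \<and> c \<noteq> 0 \<and> Q \<in> poly_over A \<and> [:c:] * X = Q * D" if X: "X \<in> I" for X
    proof -
      obtain c Q R where *: "c \<in> A" "c \<noteq> 0" "Q \<in> poly_over A" "R \<in> poly_over A"
        "[:c:] * X = Q * D + R" "R = 0 \<or> degree R < degree D"
        using pseudo_division[OF A DS D(2)] X IS by blast
      have "R = [:c:] * X - Q * D" using *(5) by simp
      moreover have "[:c:] * X - Q * D \<in> I" using I_diff[OF X D(1), of "[:c:]" Q] *(1,3) A const_poly_over_iff[OF A] by blast
      ultimately have "R \<in> I" by simp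
      then have "R = 0" using Dmin[of R] *(6) by linarith
      then show ?thesis using * by auto
    qed
    obtain c1 Q1 where 1: "c1 \<in> A" "c1 \<noteq> 0" "Q1 \<in> poly_over A" "[:c1:] * F = Q1 * D"
      using div FI by blast
    obtain c2 Q2 where 2: "c2 \<in> A" "c2 \<noteq> 0" "Q2 \<in> poly_over A" "[:c2:] * G = Q2 * D"
      using div FI by blast
    obtain n1 where "prime_factors_in A n1 c1" using pf 1 by blast
    then obtain Q' D' d where *: "Q' \<in> poly_over A" "D' \<in> poly_over A" "d \<in> A"
      "D = [:d:] * D'" "F = Q' * D'" "d = 0 \<longrightarrow> D = 0"
      using split_const[OF A _ 1(2) F DS 1(3,4)] by blast
    have d0: "d \<noteq> 0" using * D by blast
    have "degree Q' = 0 \<or> degree D' = 0" by (rule irr[OF *(1,2,5)])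
    then show ?thesis
    proof (elim disjE)
      assume "degree D' = 0"
      then have "degree D = 0" using *(4) d0 by simp
      then obtain \<delta> where \<delta>: "D = [:\<delta>:]" by (metis degree_eq_zeroE)
      have \<delta>A: "\<delta> \<in> A" "\<delta> \<noteq> 0" using DS D A \<delta> by auto
      obtain U V where UV: "D = U * F + V * G" "U \<in> poly_over A" "V \<in> poly_over A"
        using D by (auto simp: I_def)
      have "[:\<delta>:] * H = U * F * H + V * (G * H)" unfolding \<delta>[symmetric] UV(1) by (simp only: algebra_simps)
      also have "\<dots> = F * (U * H + V * E)" unfolding E by (simp only: algebra_simps)
      finally have e: "[:\<delta>:] * H = F * (U * H + V * E)" .
      have "U * H + V * E \<in> poly_over A"
        using UV H E by (intro is_subring_add[OF S] is_subring_mult[OF S])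
      then show ?thesis using pf[OF \<delta>A] cancel_const[OF A _ nd F H _ e] by blast
    next
      assume "degree Q' = 0"
      then obtain q where q: "Q' = [:q:]" by (metis degree_eq_zeroE)
      have qA: "q \<in> A" "q \<noteq> 0" using *(1,5) F0 A q by auto
      \<comment> \<open>A prime dividing q would divide F, which is primitive.\<close>
      have "is_unit_of A q"
      proof (rule ccontr)
        assume "\<not> is_unit_of A q"
        then obtain \<pi> where \<pi>: "prime_in A \<pi>" "divides_in A \<pi> q"
          using pf[OF qA] prime_factors_in_unit_or_divisor[OF _ A] by blast
        then obtain r where r: "r \<in> A" "q = \<pi> * r" by (auto simp: divides_in_def)
        have "F = [:\<pi>:] * ([:r:] * D')" using * q r by (simp add: mult.commute)
        moreover have "[:r:] * D' \<in> poly_over A" using * r A by (intro is_subring_mult[OF S]) auto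
        ultimately show False using nd[OF \<pi>(1)] unfolding divides_in_def by blast
      qed
      then obtain w where w: "w \<in> A" "q * w = 1" by (auto simp: is_unit_of_def)
      have "[:w:] * F = D'" using * q w by (simp add: mult.commute)
      then have "D = [:d:] * ([:w:] * F)" using * by simp
      then have "[:c2:] * G = F * (Q2 * ([:d:] * [:w:]))"
        unfolding \<open>[:c2:] * G = Q2 * D\<close> by (simp only: algebra_simps)
      moreover have "Q2 * ([:d:] * [:w:]) \<in> poly_over A"
        using \<open>Q2 \<in> _\<close> w * A by (intro is_subring_mult[OF S]) auto
      ultimately show ?thesis
        using pf[OF \<open>c2 \<in> A\<close> \<open>c2 \<noteq> 0\<close>] cancel_const[OF A _ nd F G] by blast
    qed
  qed
  moreover have "\<not> is_unit_of (poly_over A) F"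
  proof
    assume "is_unit_of (poly_over A) F"
    then obtain w where "F * w = 1" by (auto simp: is_unit_of_def)
    then show False using dF F0 degree_mult_eq[of F w] by (metis add_is_0 degree_1 mult_zero_right neq0_conv zero_neq_one)
  qed
  ultimately show ?thesis using F F0 by (auto simp: prime_in_def)
qed

text \<open>Induction on the degree: once the content is split off, the primitive part either splits
  into factors of smaller degree or is prime.\<close>

theorem factorial_in_poly_over:
  fixes A :: "'a::idom set"
  assumes fact: "factorial_in A" shows "factorial_in (poly_over A)"
proof -
  have A: "is_subring A" and pf: "\<And>a. a \<in> A \<Longrightarrow> a \<noteq> 0 \<Longrightarrow> \<exists>n. prime_factors_in A n a"
    using fact by (auto simp: factorial_in_def)
  note S = is_subring_poly_over[OF A]
  have "\<exists>n. prime_factors_in (poly_over A) n F" if "F \<in> poly_over A" "F \<noteq> 0" for F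
    using that
  proof (induction "degree F" arbitrary: F rule: less_induct)
    case less
    show ?case
    proof (cases "degree F = 0")
      case True
      then obtain a where a: "F = [:a:]" by (metis degree_eq_zeroE)
      then have "a \<in> A" "a \<noteq> 0" using less.prems A by auto
      then show ?thesis using pf prime_factors_in_const_poly[OF A] a by blast
    next
      case False
      obtain n where "prime_factors_in A n (lead_coeff F)"
        using pf less.prems by (metis leading_coeff_0_iff poly_over_coeff)
      then obtain a k F' where *: "prime_factors_in A k a" "F' \<in> poly_over A" "F = [:a:] * F'"
        "\<forall>\<pi>. prime_in A \<pi> \<longrightarrow> \<not> divides_in (poly_over A) [:\<pi>:] F'"
        using extract_content[OF A _ less.prems(1)] by blast
      have a0: "a \<noteq> 0" "F' \<noteq> 0" using *(3) less.prems by auto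
      have dF': "degree F' = degree F" using *(3) a0 by simp
      have "\<exists>n. prime_factors_in (poly_over A) n F'"
      proof (cases "\<exists>G H. G \<in> poly_over A \<and> H \<in> poly_over A \<and> F' = G * H \<and> degree G \<noteq> 0 \<and> degree H \<noteq> 0")
        case True
        then obtain G H where GH: "G \<in> poly_over A" "H \<in> poly_over A" "F' = G * H"
          "degree G \<noteq> 0" "degree H \<noteq> 0" by blast
        then have "G \<noteq> 0" "H \<noteq> 0" by auto
        then have "degree F' = degree G + degree H" using GH(3) by (simp add: degree_mult_eq)
        then have "degree G < degree F" "degree H < degree F" using GH dF' by auto
        then show ?thesis
          using less.hyps[of G] less.hyps[of H] GH \<open>G \<noteq> 0\<close> \<open>H \<noteq> 0\<close> prime_factors_in_mult[OF _ _ S] by blast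
      next
        case False
        then have "prime_in (poly_over A) F'"
          using *(4) \<open>degree F \<noteq> 0\<close> dF' by (intro prime_in_poly_over[OF fact *(2)]) auto
        moreover have "is_unit_of (poly_over A) 1" using is_subring_one[OF S] by (auto simp: is_unit_of_def)
        ultimately have "prime_factors_in (poly_over A) (Suc 0) (F' * 1)"
          by (intro prime_factors_in.prime prime_factors_in.unit)
        then show ?thesis by auto
      qed
      then show ?thesis
        using prime_factors_in_mult[OF prime_factors_in_const_poly[OF A *(1)] _ S] *(3) by metis
    qed
  qed
  then show ?thesis using S by (auto simp: factorial_in_def)
qed

section \<open>Polynomials in several variables\<close>

abbreviation lookup where "lookup \<equiv> Poly_Mapping.lookup"
abbreviation keys where "keys \<equiv> Poly_Mapping.keys"
abbreviation single where "single \<equiv> Poly_Mapping.single"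

definition ring_map :: "('a::comm_ring_1 \<Rightarrow> 'b::comm_ring_1) \<Rightarrow> bool" where
  "ring_map \<phi> \<longleftrightarrow> \<phi> 1 = 1 \<and> (\<forall>x y. \<phi> (x + y) = \<phi> x + \<phi> y) \<and> (\<forall>x y. \<phi> (x * y) = \<phi> x * \<phi> y)"

lemma ring_map_add: "ring_map \<phi> \<Longrightarrow> \<phi> (x + y) = \<phi> x + \<phi> y"
  and ring_map_mult: "ring_map \<phi> \<Longrightarrow> \<phi> (x * y) = \<phi> x * \<phi> y"
  and ring_map_one: "ring_map \<phi> \<Longrightarrow> \<phi> 1 = 1"
  by (auto simp: ring_map_def)

lemma ring_map_zero: "ring_map \<phi> \<Longrightarrow> \<phi> 0 = 0"
  using ring_map_add[of \<phi> 0 0] by simp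

lemma ring_map_uminus: "ring_map \<phi> \<Longrightarrow> \<phi> (- x) = - \<phi> x"
  using ring_map_add[of \<phi> x "- x"] ring_map_zero[of \<phi>] by (simp add: eq_neg_iff_add_eq_0 add.commute)

lemma ring_map_diff: "ring_map \<phi> \<Longrightarrow> \<phi> (x - y) = \<phi> x - \<phi> y"
  using ring_map_add[of \<phi> x "- y"] ring_map_uminus[of \<phi> y] by simp

lemma ring_map_power: "ring_map \<phi> \<Longrightarrow> \<phi> (x ^ n) = \<phi> x ^ n"
  by (induction n) (auto simp: ring_map_one ring_map_mult)

lemma ring_map_sum: "ring_map \<phi> \<Longrightarrow> \<phi> (sum g S) = (\<Sum>i\<in>S. \<phi> (g i))"
  by (induction S rule: infinite_finite_induct) (auto simp: ring_map_zero ring_map_add)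

lemma ring_map_of_nat: "ring_map \<phi> \<Longrightarrow> \<phi> (of_nat n) = of_nat n"
  by (induction n) (auto simp: ring_map_zero ring_map_add ring_map_one)

lemma ring_map_prod: "ring_map \<phi> \<Longrightarrow> \<phi> (prod g S) = (\<Prod>i\<in>S. \<phi> (g i))"
  by (induction S rule: infinite_finite_induct) (auto simp: ring_map_one ring_map_mult)

lemma ring_map_comp: "ring_map \<phi> \<Longrightarrow> ring_map \<psi> \<Longrightarrow> ring_map (\<lambda>x. \<psi> (\<phi> x))"
  by (simp add: ring_map_def)

lemma ring_map_const: "ring_map const"
  by (simp add: ring_map_def const_def single_add mult_single)

lemma ring_map_embed: "ring_map embed"
  by (simp add: ring_map_def embed_def One_fract_def)

lemma ring_map_const_fun: "ring_map const_fun"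
  unfolding const_fun_def using ring_map_comp[OF ring_map_const ring_map_embed] .

lemma embed_eq_iff [simp]: "embed P = embed Q \<longleftrightarrow> P = Q"
  by (simp add: embed_def eq_fract)

lemma embed_zero_iff [simp]: "embed P = 0 \<longleftrightarrow> P = 0"
  by (metis embed_eq_iff ring_map_zero[OF ring_map_embed])

lemma const_eq_iff [simp]: "const a = const b \<longleftrightarrow> a = b"
  unfolding const_def by (metis lookup_single_eq)

lemma const_zero_iff [simp]: "const a = 0 \<longleftrightarrow> a = 0"
  by (metis const_eq_iff ring_map_zero[OF ring_map_const])

lemma const_fun_zero_iff [simp]: "const_fun a = 0 \<longleftrightarrow> a = 0"
  by (simp add: const_fun_def)

lemma const_fun_eq_iff [simp]: "const_fun a = const_fun b \<longleftrightarrow> a = b"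
  by (simp add: const_fun_def)

definition monomial :: "(nat \<Rightarrow> 'r::comm_ring_1) \<Rightarrow> (nat \<Rightarrow>\<^sub>0 nat) \<Rightarrow> 'r" where
  "monomial t \<mu> = (\<Prod>i\<in>keys \<mu>. t i ^ lookup \<mu> i)"

text \<open>With the coefficient map as a parameter, one definition serves substitution of
  polynomials (\<open>subst\<close>) and evaluation in the field of rational functions
  (\<open>eval\<close>).\<close>

definition mpoly_eval :: "('k \<Rightarrow> 'r::comm_ring_1) \<Rightarrow> (nat \<Rightarrow> 'r) \<Rightarrow> 'k::comm_ring_1 mpoly \<Rightarrow> 'r" where
  "mpoly_eval \<phi> t P = (\<Sum>\<mu>\<in>keys P. \<phi> (lookup P \<mu>) * monomial t \<mu>)"

lemma monomial_superset: "finite S \<Longrightarrow> keys \<mu> \<subseteq> S \<Longrightarrow> monomial t \<mu> = (\<Prod>i\<in>S. t i ^ lookup \<mu> i)"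
  unfolding monomial_def by (rule prod.mono_neutral_left) (auto simp: in_keys_iff)

lemma monomial_zero [simp]: "monomial t 0 = 1"
  by (simp add: monomial_def)

lemma monomial_add: "monomial t (\<mu> + \<nu>) = monomial t \<mu> * monomial t \<nu>"
proof -
  let ?S = "keys \<mu> \<union> keys \<nu>"
  have "monomial t (\<mu> + \<nu>) = (\<Prod>i\<in>?S. t i ^ lookup (\<mu> + \<nu>) i)"
    using keys_add[of \<mu> \<nu>] by (intro monomial_superset) auto
  also have "\<dots> = (\<Prod>i\<in>?S. t i ^ lookup \<mu> i) * (\<Prod>i\<in>?S. t i ^ lookup \<nu> i)"
    by (simp add: lookup_add power_add prod.distrib)
  also have "\<dots> = monomial t \<mu> * monomial t \<nu>"
    using monomial_superset[of ?S \<mu> t] monomial_superset[of ?S \<nu> t] by simp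
  finally show ?thesis .
qed

lemma monomial_single: "monomial t (single i k) = t i ^ k"
  by (cases "k = 0") (auto simp: monomial_def)

lemma mpoly_eval_superset:
  assumes "ring_map \<phi>" "finite S" "keys P \<subseteq> S"
  shows "mpoly_eval \<phi> t P = (\<Sum>\<mu>\<in>S. \<phi> (lookup P \<mu>) * monomial t \<mu>)"
  unfolding mpoly_eval_def
  using assms by (intro sum.mono_neutral_left) (auto simp: in_keys_iff ring_map_zero)

lemma mpoly_eval_add:
  assumes "ring_map \<phi>" shows "mpoly_eval \<phi> t (P + Q) = mpoly_eval \<phi> t P + mpoly_eval \<phi> t Q"
proof -
  let ?S = "keys P \<union> keys Q"
  have "mpoly_eval \<phi> t (P + Q) = (\<Sum>\<mu>\<in>?S. \<phi> (lookup (P + Q) \<mu>) * monomial t \<mu>)"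
    using keys_add[of P Q] by (intro mpoly_eval_superset[OF assms]) auto
  also have "\<dots> = (\<Sum>\<mu>\<in>?S. \<phi> (lookup P \<mu>) * monomial t \<mu>) + (\<Sum>\<mu>\<in>?S. \<phi> (lookup Q \<mu>) * monomial t \<mu>)"
    by (simp add: lookup_add ring_map_add[OF assms] distrib_right sum.distrib)
  also have "\<dots> = mpoly_eval \<phi> t P + mpoly_eval \<phi> t Q"
    using mpoly_eval_superset[OF assms, of ?S P t] mpoly_eval_superset[OF assms, of ?S Q t] by simp
  finally show ?thesis .
qed

lemma mpoly_eval_single: "ring_map \<phi> \<Longrightarrow> mpoly_eval \<phi> t (single \<mu> c) = \<phi> c * monomial t \<mu>"
  using mpoly_eval_superset[of \<phi> "{\<mu>}" "single \<mu> c" t] by simp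

lemma mpoly_sum_single: "(P :: 'a \<Rightarrow>\<^sub>0 'b::comm_monoid_add) = (\<Sum>\<mu>\<in>keys P. single \<mu> (lookup P \<mu>))"
  by (rule poly_mapping_eqI) (auto simp: lookup_sum lookup_single when_def in_keys_iff)

lemma mpoly_induct [case_names single add]:
  fixes P :: "'a \<Rightarrow>\<^sub>0 'b::comm_monoid_add"
  assumes "\<And>\<mu> c. Q (single \<mu> c)" "\<And>P P'. Q P \<Longrightarrow> Q P' \<Longrightarrow> Q (P + P')"
  shows "Q P"
proof -
  have "finite S \<Longrightarrow> Q (\<Sum>\<mu>\<in>S. single \<mu> (lookup P \<mu>))" for S
  proof (induction S rule: finite_induct)
    case empty
    then show ?case using assms(1)[of undefined 0] by simp
  qed (use assms in auto)
  then show ?thesis using mpoly_sum_single[of P] finite_keys by metis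
qed

lemma mpoly_eval_mult:
  assumes "ring_map \<phi>" shows "mpoly_eval \<phi> t (P * Q) = mpoly_eval \<phi> t P * mpoly_eval \<phi> t Q"
proof (induction P rule: mpoly_induct)
  case (single \<mu> c)
  show ?case
  proof (induction Q rule: mpoly_induct)
    case (single \<nu> d)
    then show ?case
      by (simp add: mult_single mpoly_eval_single[OF assms] monomial_add ring_map_mult[OF assms])
  qed (simp add: distrib_left mpoly_eval_add[OF assms])
qed (simp add: distrib_right mpoly_eval_add[OF assms])

lemma mpoly_eval_const: "ring_map \<phi> \<Longrightarrow> mpoly_eval \<phi> t (const c) = \<phi> c"
  by (simp add: const_def mpoly_eval_single)

lemma mpoly_eval_var: "ring_map \<phi> \<Longrightarrow> mpoly_eval \<phi> t (var i) = t i"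
  by (simp add: var_def mpoly_eval_single monomial_single ring_map_one)

lemma const_one [simp]: "const 1 = 1"
  using ring_map_one[OF ring_map_const] .

lemma const_zero [simp]: "const 0 = 0"
  by simp

lemma ring_map_mpoly_eval: "ring_map \<phi> \<Longrightarrow> ring_map (mpoly_eval \<phi> t)"
  using mpoly_eval_const[of \<phi> t 1] mpoly_eval_add[of \<phi> t] mpoly_eval_mult[of \<phi> t]
  by (simp add: ring_map_def[of "mpoly_eval \<phi> t"] ring_map_one)

lemma mpoly_eval_hom:
  assumes "ring_map \<psi>" "ring_map \<phi>"
  shows "\<psi> (mpoly_eval \<phi> t P) = mpoly_eval (\<lambda>c. \<psi> (\<phi> c)) (\<lambda>i. \<psi> (t i)) P"
  by (simp add: mpoly_eval_def monomial_def ring_map_sum[OF assms(1)] ring_map_mult[OF assms(1)]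
      ring_map_prod[OF assms(1)] ring_map_power[OF assms(1)])

abbreviation subst :: "(nat \<Rightarrow> 'k mpoly) \<Rightarrow> 'k::comm_ring_1 mpoly \<Rightarrow> 'k mpoly" where
  "subst \<equiv> mpoly_eval const"

abbreviation eval :: "(nat \<Rightarrow> 'k ratfun) \<Rightarrow> 'k::field mpoly \<Rightarrow> 'k ratfun" where
  "eval \<equiv> mpoly_eval const_fun"

lemmas ring_map_subst = ring_map_mpoly_eval[OF ring_map_const]
lemmas ring_map_eval = ring_map_mpoly_eval[OF ring_map_const_fun]

lemma mpoly_eval_subst:
  assumes "ring_map \<phi>"
  shows "mpoly_eval \<phi> t (subst q P) = mpoly_eval \<phi> (\<lambda>i. mpoly_eval \<phi> t (q i)) P"
  using mpoly_eval_hom[OF ring_map_mpoly_eval[OF assms] ring_map_const]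
  by (simp add: mpoly_eval_const[OF assms])

lemma const_mult_single: "const c * single \<mu> d = single \<mu> (c * d)"
  by (simp add: const_def mult_single)

lemma monomial_var: "monomial var \<mu> = (single \<mu> 1 :: 'k::comm_ring_1 mpoly)"
proof -
  have pow: "(var i :: 'k mpoly) ^ n = single (single i n) 1" for i n
    by (induction n) (auto simp: var_def mult_single simp flip: single_add)
  have prod: "finite S \<Longrightarrow> (\<Prod>i\<in>S. single (g i) (1::'k)) = single (\<Sum>i\<in>S. g i) 1" for S and g :: "nat \<Rightarrow> nat \<Rightarrow>\<^sub>0 nat"
    by (induction S rule: finite_induct) (auto simp: mult_single)
  have "\<mu> = (\<Sum>i\<in>keys \<mu>. single i (lookup \<mu> i))"
    by (rule poly_mapping_eqI) (auto simp: lookup_sum lookup_single when_def in_keys_iff)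
  then show ?thesis by (simp add: monomial_def pow prod)
qed

lemma subst_var: "subst var P = P"
  by (subst (2) mpoly_sum_single)
    (simp add: mpoly_eval_def monomial_var const_mult_single)

lemma embed_eq_eval: "embed P = eval (\<lambda>i. embed (var i)) P"
  using mpoly_eval_hom[OF ring_map_embed ring_map_const, of var P]
  by (simp add: subst_var const_fun_def[abs_def])


subsection \<open>Polynomials with coefficients in a subring\<close>

lemma mpoly_eval_cong:
  assumes "P \<in> polys B m" "\<And>i. i < m \<Longrightarrow> t i = t' i"
  shows "mpoly_eval \<phi> t P = mpoly_eval \<phi> t' P"
  unfolding mpoly_eval_def monomial_def
proof (rule sum.cong[OF refl], rule arg_cong[where f = "(*) _"], rule prod.cong[OF refl])
  fix \<mu> i assume "\<mu> \<in> keys P" "i \<in> keys \<mu>"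
  then show "t i ^ lookup \<mu> i = t' i ^ lookup \<mu> i" using assms by (auto simp: polys_def subset_iff)
qed

lemma mpoly_eval_mem:
  assumes R: "is_subring R" and P: "P \<in> polys B m" and c: "\<And>b. b \<in> B \<Longrightarrow> \<phi> b \<in> R"
    and t: "\<And>i. i < m \<Longrightarrow> t i \<in> R"
  shows "mpoly_eval \<phi> t P \<in> R"
  unfolding mpoly_eval_def monomial_def
  using assms by (intro is_subring_sum is_subring_mult is_subring_prod is_subring_power)
    (auto simp: polys_def)

lemma single_polys: "c \<in> B \<Longrightarrow> keys \<mu> \<subseteq> {..<m} \<Longrightarrow> single \<mu> c \<in> polys B m"
  by (simp add: polys_def)

lemma polys_add: "is_subring B \<Longrightarrow> P \<in> polys B m \<Longrightarrow> Q \<in> polys B m \<Longrightarrow> P + Q \<in> polys B m"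
  using keys_add[of P Q] unfolding polys_def
  by (auto simp: lookup_add) (metis (no_types, lifting) UnE add.right_neutral add_0 in_keys_iff is_subring_add subsetD)+

lemma polys_lookup: "is_subring B \<Longrightarrow> P \<in> polys B m \<Longrightarrow> lookup P \<mu> \<in> B"
  by (cases "\<mu> \<in> keys P") (auto simp: polys_def in_keys_iff is_subring_zero)

lemma zero_polys [simp]: "0 \<in> polys B m"
  by (simp add: polys_def)

lemma polys_sum: "is_subring B \<Longrightarrow> (\<And>i. i \<in> S \<Longrightarrow> g i \<in> polys B m) \<Longrightarrow> sum g S \<in> polys B m"
  by (induction S rule: infinite_finite_induct) (auto intro: polys_add)

lemma is_subring_polys:
  assumes B: "is_subring B" shows "is_subring (polys B m)"
proof -
  have mult: "P * Q \<in> polys B m" if P: "P \<in> polys B m" and Q: "Q \<in> polys B m" for P Q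
  proof -
    have "P * Q = (\<Sum>\<mu>\<in>keys P. \<Sum>\<nu>\<in>keys Q. single (\<mu> + \<nu>) (lookup P \<mu> * lookup Q \<nu>))"
      by (subst mpoly_sum_single[of P], subst mpoly_sum_single[of Q])
        (simp add: sum_distrib_left sum_distrib_right mult_single sum.swap[of _ "keys Q"])
    also have "\<dots> \<in> polys B m"
    proof (intro polys_sum[OF B] single_polys)
      fix \<mu> \<nu> assume *: "\<mu> \<in> keys P" "\<nu> \<in> keys Q"
      show "lookup P \<mu> * lookup Q \<nu> \<in> B" using P Q polys_lookup[OF B] is_subring_mult[OF B] by blast
      show "keys (\<mu> + \<nu>) \<subseteq> {..<m}" using keys_add[of \<mu> \<nu>] * P Q by (auto simp: polys_def)
    qed
    finally show ?thesis .
  qed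
  have one: "1 \<in> polys B m" using single_polys[of 1 B 0 m] is_subring_one[OF B] by simp
  have neg: "- P \<in> polys B m" if "P \<in> polys B m" for P
  proof -
    have "single 0 (- 1) * P \<in> polys B m"
      using that by (intro mult single_polys) (auto simp: is_subring_uminus[OF B] is_subring_one[OF B])
    then show ?thesis by (simp add: single_uminus)
  qed
  show ?thesis unfolding is_subring_def
    using mult one neg polys_add[OF B] by (metis diff_conv_add_uminus)
qed

lemma const_polys: "b \<in> B \<Longrightarrow> const b \<in> polys B m"
  by (simp add: const_def single_polys)

lemma var_polys: "is_subring B \<Longrightarrow> i < m \<Longrightarrow> var i \<in> polys B m"
  by (simp add: var_def single_polys is_subring_one)

lemma polys_mono: "B \<subseteq> B' \<Longrightarrow> m \<le> m' \<Longrightarrow> polys B m \<subseteq> polys B' m'"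
  by (force simp: polys_def)

lemma is_subring_UNIV: "is_subring UNIV"
  by (simp add: is_subring_def)

lemma polys_induct [consumes 2, case_names const var add mult]:
  assumes P: "P \<in> polys B m" and B: "is_subring B"
    and const: "\<And>b. b \<in> B \<Longrightarrow> Q (const b)"
    and var: "\<And>i. i < m \<Longrightarrow> Q (var i)"
    and add: "\<And>P P'. P \<in> polys B m \<Longrightarrow> P' \<in> polys B m \<Longrightarrow> Q P \<Longrightarrow> Q P' \<Longrightarrow> Q (P + P')"
    and mult: "\<And>P P'. P \<in> polys B m \<Longrightarrow> P' \<in> polys B m \<Longrightarrow> Q P \<Longrightarrow> Q P' \<Longrightarrow> Q (P * P')"
  shows "Q P"
proof -
  note S = is_subring_polys[OF B, of m]
  let ?Q = "\<lambda>P. P \<in> polys B m \<and> Q P"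
  have one: "?Q 1" using const[OF is_subring_one[OF B]] const_polys[OF is_subring_one[OF B], of m] by simp
  have pow: "?Q (var i ^ k)" if "i < m" for i k
    using that by (induction k) (auto intro: one[THEN conjunct1] one[THEN conjunct2] mult var
        is_subring_mult[OF S] is_subring_power[OF S] var_polys[OF B])
  have prod: "?Q (\<Prod>i\<in>S. var i ^ g i)" if "finite S" "S \<subseteq> {..<m}" for S g
    using that by (induction S rule: finite_induct)
      (use pow one mult is_subring_mult[OF S] in auto)
  have *: "?Q (const b * monomial var \<mu>)" if "b \<in> B" "keys \<mu> \<subseteq> {..<m}" for b \<mu>
    using const[OF that(1)] const_polys[OF that(1), of m] prod[OF _ that(2), of "lookup \<mu>"] mult
      is_subring_mult[OF S]
    unfolding monomial_def by auto
  have zero: "?Q 0" using const[OF is_subring_zero[OF B]] by simp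
  have "?Q (\<Sum>\<mu>\<in>S. const (lookup P \<mu>) * monomial var \<mu>)" if "finite S" "S \<subseteq> keys P" for S
    using that
  proof (induction S rule: finite_induct)
    case (insert \<mu> S)
    then have "?Q (const (lookup P \<mu>) * monomial var \<mu>)" using P by (intro *) (auto simp: polys_def)
    then show ?case using insert add polys_add[OF B] by simp
  qed (use zero in simp)
  from this[of "keys P"] show ?thesis
    using subst_var[of P] by (simp add: mpoly_eval_def)
qed

lemma polys_0: "is_subring B \<Longrightarrow> polys B 0 = const ` B"
proof (intro equalityI subsetI)
  fix P assume B: "is_subring B" "P \<in> polys B 0"
  then have "lookup P \<mu> = lookup (const (lookup P 0)) \<mu>" for \<mu>
    by (cases "\<mu> = 0") (auto simp: polys_def const_def lookup_single when_def in_keys_iff)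
  then have "P = const (lookup P 0)" by (intro poly_mapping_eqI)
  then show "P \<in> const ` B" using polys_lookup[OF B] by blast
qed (auto intro: const_polys)

text \<open>The step from m to m + 1 variables, which carries Gauss' lemma over to several
  variables. Injectivity holds because the exponent of the new variable tells the coefficients
  apart.\<close>

lemma poly_var_bij:
  assumes B: "is_subring (B :: 'k::idom set)"
  shows "bij_betw (\<lambda>p. poly p (var m)) (poly_over (polys B m)) (polys B (Suc m))"
  unfolding bij_betw_def
proof
  note S = is_subring_polys[OF B]
  note SO = is_subring_poly_over[OF is_subring_polys[OF B, of m]]
  have pow: "(var m :: 'k mpoly) ^ n = single (single m n) 1" for n
    by (induction n) (auto simp: var_def mult_single simp flip: single_add)
  have 0: "p = 0" if p: "p \<in> poly_over (polys B m)" and e: "poly p (var m) = 0" for p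
  proof (rule ccontr)
    assume "p \<noteq> 0"
    \<comment> \<open>The coefficients do not involve the new variable, so a monomial with exponent
      i in it can only come from the i-th term.\<close>
    have lk: "lookup (coeff p j * var m ^ j) (\<mu> + single m i) = (if i = j then lookup (coeff p i) \<mu> else 0)"
      if "lookup \<mu> m = 0" for i j \<mu>
    proof -
      let ?c = "coeff p j"
      have c: "?c \<in> polys B m" using p by (simp add: poly_over_def)
      have "?c * var m ^ j = (\<Sum>\<nu>\<in>keys ?c. single (\<nu> + single m j) (lookup ?c \<nu>))"
        by (subst mpoly_sum_single[of ?c]) (simp add: pow sum_distrib_right mult_single)
      then have "lookup (?c * var m ^ j) (\<mu> + single m i)
          = (\<Sum>\<nu>\<in>keys ?c. if \<nu> + single m j = \<mu> + single m i then lookup ?c \<nu> else 0)"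
        by (simp add: lookup_sum lookup_single when_def)
      also have "\<dots> = (\<Sum>\<nu>\<in>keys ?c. if \<nu> = \<mu> \<and> i = j then lookup ?c \<nu> else 0)"
      proof (rule sum.cong[OF refl])
        fix \<nu> assume "\<nu> \<in> keys ?c"
        then have "m \<notin> keys \<nu>" using c by (auto simp: polys_def)
        then have \<nu>: "lookup \<nu> m = 0" by (simp add: in_keys_iff)
        have "\<nu> + single m j = \<mu> + single m i \<longleftrightarrow> \<nu> = \<mu> \<and> i = j"
        proof
          assume e: "\<nu> + single m j = \<mu> + single m i"
          then have "lookup (\<nu> + single m j) m = lookup (\<mu> + single m i) m" by simp
          then have "i = j" using \<nu> \<open>lookup \<mu> m = 0\<close> by (simp add: lookup_add)
          then show "\<nu> = \<mu> \<and> i = j" using e by simp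
        qed simp
        then show "(if \<nu> + single m j = \<mu> + single m i then lookup ?c \<nu> else 0)
            = (if \<nu> = \<mu> \<and> i = j then lookup ?c \<nu> else 0)" by simp
      qed
      also have "\<dots> = (if i = j then lookup ?c \<mu> else 0)"
        by (auto simp: in_keys_iff)
      finally show ?thesis by simp
    qed
    define i where "i = degree p"
    have "coeff p i \<noteq> 0" using \<open>p \<noteq> 0\<close> by (simp add: i_def)
    then obtain \<mu> where \<mu>: "\<mu> \<in> keys (coeff p i)" by (metis all_not_in_conv keys_eq_empty)
    then have "m \<notin> keys \<mu>" using poly_over_coeff[OF p, of i] by (auto simp: polys_def)
    then have \<mu>m: "lookup \<mu> m = 0" by (simp add: in_keys_iff)
    have "lookup (poly p (var m)) (\<mu> + single m i) = lookup (coeff p i) \<mu>"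
      unfolding poly_altdef lookup_sum by (simp add: lk[OF \<mu>m] i_def)
    then show False using e \<mu> by (simp add: in_keys_iff)
  qed
  show "inj_on (\<lambda>p. poly p (var m)) (poly_over (polys B m))"
  proof (rule inj_onI)
    fix p q assume "p \<in> poly_over (polys B m)" "q \<in> poly_over (polys B m)" "poly p (var m) = poly q (var m)"
    then show "p = q" using 0[of "p - q"] is_subring_diff[OF SO] by simp
  qed
  have sub: "polys B m \<subseteq> polys B (Suc m)" by (rule polys_mono) auto
  show "(\<lambda>p. poly p (var m)) ` poly_over (polys B m) = polys B (Suc m)"
  proof (intro equalityI subsetI)
    fix P assume "P \<in> (\<lambda>p. poly p (var m)) ` poly_over (polys B m)"
    then obtain p where p: "P = poly p (var m)" "p \<in> poly_over (polys B m)" by blast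
    show "P \<in> polys B (Suc m)"
      unfolding p(1) poly_altdef
      using p(2) sub var_polys[OF B, of m "Suc m"]
      by (intro is_subring_sum[OF S] is_subring_mult[OF S] is_subring_power[OF S])
        (auto simp: poly_over_def)
  next
    fix P assume "P \<in> polys B (Suc m)"
    then show "P \<in> (\<lambda>p. poly p (var m)) ` poly_over (polys B m)"
      using B
    proof (induction rule: polys_induct)
      case (const b)
      then have "[:const b:] \<in> poly_over (polys B m)" using S const_polys by simp
      then show ?case by (intro image_eqI[of _ _ "[:const b:]"]) auto
    next
      case (var i)
      show ?case
      proof (cases "i = m")
        case True
        have "[:0, 1:] \<in> poly_over (polys B m)"
          using is_subring_one[OF S] by (auto simp: poly_over_def coeff_pCons split: nat.splits)
        then show ?thesis using True by (intro image_eqI[of _ _ "[:0, 1:]"]) auto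
      next
        case False
        then have "[:var i:] \<in> poly_over (polys B m)" using var S var_polys[OF B] by simp
        then show ?thesis by (intro image_eqI[of _ _ "[:var i:]"]) auto
      qed
    next
      case (add P P')
      then obtain p p' where "p \<in> poly_over (polys B m)" "p' \<in> poly_over (polys B m)"
        "P = poly p (var m)" "P' = poly p' (var m)" by blast
      then show ?case using is_subring_add[OF SO] by (intro image_eqI[of _ _ "p + p'"]) auto
    next
      case (mult P P')
      then obtain p p' where "p \<in> poly_over (polys B m)" "p' \<in> poly_over (polys B m)"
        "P = poly p (var m)" "P' = poly p' (var m)" by blast
      then show ?case using is_subring_mult[OF SO] by (intro image_eqI[of _ _ "p * p'"]) auto
    qed
  qed
qed

lemma factorial_in_polys:
  assumes fact: "factorial_in (B :: 'k::idom set)" shows "factorial_in (polys B m)"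
proof (induction m)
  case 0
  have B: "is_subring B" using fact by (simp add: factorial_in_def)
  have "bij_betw const B (polys B 0)"
    unfolding polys_0[OF B] by (auto simp: bij_betw_def inj_on_def)
  then show ?case
    by (rule factorial_in_image[OF fact])
      (auto simp: ring_map_mult[OF ring_map_const] is_subring_polys[OF B])
next
  case (Suc m)
  have B: "is_subring B" using fact by (simp add: factorial_in_def)
  show ?case
    by (rule factorial_in_image[OF factorial_in_poly_over[OF Suc] poly_var_bij[OF B]])
      (auto simp: is_subring_polys[OF B])
qed


subsection \<open>Partial derivatives\<close>

lemma single_diff_add: "lookup \<mu> j \<noteq> 0 \<Longrightarrow> \<mu> - single j 1 + single j (1::nat) = \<mu>"
  by (rule poly_mapping_eqI) (auto simp: lookup_add lookup_minus lookup_single when_def)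

text \<open>Truncated subtraction fixes a monomial without the variable j, but such a monomial
  enters with the factor 0; on all others lowering the exponent is injective.\<close>

lemma lookup_partial_deriv:
  "lookup (partial_deriv j P) \<nu> = of_nat (Suc (lookup \<nu> j)) * lookup P (\<nu> + single j 1)"
proof -
  have "lookup (partial_deriv j P) \<nu>
      = (\<Sum>\<mu>\<in>keys P. if \<mu> - single j 1 = \<nu> then of_nat (lookup \<mu> j) * lookup P \<mu> else 0)"
    by (simp add: partial_deriv_def lookup_sum lookup_single when_def)
  also have "\<dots> = (\<Sum>\<mu>\<in>keys P. if \<mu> = \<nu> + single j 1 then of_nat (lookup \<mu> j) * lookup P \<mu> else 0)"
  proof (rule sum.cong[OF refl])
    fix \<mu>
    show "(if \<mu> - single j 1 = \<nu> then of_nat (lookup \<mu> j) * lookup P \<mu> else 0)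
      = (if \<mu> = \<nu> + single j 1 then of_nat (lookup \<mu> j) * lookup P \<mu> else 0)"
    proof (cases "lookup \<mu> j = 0")
      case True
      then have "\<mu> \<noteq> \<nu> + single j 1" by (auto simp: lookup_add)
      then show ?thesis using True by simp
    next
      case False
      have "\<mu> - single j 1 = \<nu> \<longleftrightarrow> \<mu> = \<nu> + single j 1"
        using single_diff_add[OF False] by (metis add_diff_cancel_right')
      then show ?thesis by simp
    qed
  qed
  also have "\<dots> = of_nat (Suc (lookup \<nu> j)) * lookup P (\<nu> + single j 1)"
    by (auto simp: lookup_add in_keys_iff)
  finally show ?thesis .
qed

lemma partial_deriv_add: "partial_deriv j (P + Q) = partial_deriv j P + partial_deriv j Q"
  by (rule poly_mapping_eqI) (simp add: lookup_partial_deriv lookup_add distrib_left)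

lemma partial_deriv_single:
  "partial_deriv j (single \<mu> c) = single (\<mu> - single j 1) (of_nat (lookup \<mu> j) * c)"
  by (cases "c = 0") (auto simp: partial_deriv_def)

lemma partial_deriv_mult:
  "partial_deriv j (P * Q) = partial_deriv j P * Q + P * partial_deriv j Q"
proof (induction P rule: mpoly_induct)
  case (single \<mu> c)
  show ?case
  proof (induction Q rule: mpoly_induct)
    case (single \<nu> d)
    have 1: "single (\<mu> + \<nu> - single j 1) (of_nat (lookup \<mu> j) * (c * d))
        = single (\<mu> - single j 1 + \<nu>) (of_nat (lookup \<mu> j) * (c * d))"
    proof (cases "lookup \<mu> j = 0")
      case False
      then have "\<mu> + \<nu> = (\<mu> - single j 1 + \<nu>) + single j 1"
        using single_diff_add[OF False] by (metis add.assoc add.commute)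
      then show ?thesis by (metis add_diff_cancel_right')
    qed simp
    have 2: "single (\<mu> + \<nu> - single j 1) (of_nat (lookup \<nu> j) * (c * d))
        = single (\<mu> + (\<nu> - single j 1)) (of_nat (lookup \<nu> j) * (c * d))"
    proof (cases "lookup \<nu> j = 0")
      case False
      then have "\<mu> + \<nu> = (\<mu> + (\<nu> - single j 1)) + single j 1"
        using single_diff_add[OF False] by (metis add.assoc)
      then show ?thesis by (metis add_diff_cancel_right')
    qed simp
    have "partial_deriv j (single \<mu> c * single \<nu> d)
        = single (\<mu> + \<nu> - single j 1) (of_nat (lookup \<mu> j) * (c * d))
        + single (\<mu> + \<nu> - single j 1) (of_nat (lookup \<nu> j) * (c * d))"
      by (simp add: mult_single partial_deriv_single lookup_add distrib_right flip: single_add)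
    then show ?case unfolding 1 2
      by (simp add: mult_single partial_deriv_single mult.assoc mult.left_commute)
  qed (simp add: partial_deriv_add distrib_left)
qed (simp add: partial_deriv_add distrib_right)

lemma partial_deriv_const [simp]: "partial_deriv j (const c) = 0"
  by (simp add: const_def partial_deriv_single)

lemma partial_deriv_zero [simp]: "partial_deriv j 0 = 0"
  by (simp add: partial_deriv_def)

lemma partial_deriv_var: "partial_deriv j (var i) = (if i = j then 1 else 0)"
  by (auto simp: var_def partial_deriv_single lookup_single)

lemma partial_deriv_diff: "partial_deriv j (P - Q) = partial_deriv j P - partial_deriv j Q"
  by (rule poly_mapping_eqI) (simp add: lookup_partial_deriv lookup_minus right_diff_distrib)

lemma partial_deriv_sum: "partial_deriv j (sum g S) = (\<Sum>i\<in>S. partial_deriv j (g i))"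
  by (induction S rule: infinite_finite_induct) (auto simp: partial_deriv_add)

lemma partial_deriv_polys:
  assumes B: "is_subring B" and P: "P \<in> polys B m" shows "partial_deriv j P \<in> polys B m"
  unfolding partial_deriv_def
proof (intro polys_sum[OF B] single_polys)
  fix \<mu> assume "\<mu> \<in> keys P"
  show "of_nat (lookup \<mu> j) * lookup P \<mu> \<in> B"
    using polys_lookup[OF B P] is_subring_of_nat[OF B] is_subring_mult[OF B] by blast
  have "keys (\<mu> - single j 1) \<subseteq> keys \<mu>" by (auto simp: in_keys_iff lookup_minus)
  then show "keys (\<mu> - single j 1) \<subseteq> {..<m}" using P \<open>\<mu> \<in> keys P\<close> by (auto simp: polys_def)
qed

lemma chain_rule:
  assumes "P \<in> polys UNIV m"
  shows "partial_deriv j (subst q P) = (\<Sum>k<m. subst q (partial_deriv k P) * partial_deriv j (q k))"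
  using assms is_subring_UNIV
proof (induction rule: polys_induct)
  case (const b)
  then show ?case by (simp add: mpoly_eval_const[OF ring_map_const] ring_map_zero[OF ring_map_subst])
next
  case (var i)
  have "(\<Sum>k<m. subst q (partial_deriv k (var i)) * partial_deriv j (q k))
      = (\<Sum>k<m. if k = i then partial_deriv j (q k) else 0)"
    by (rule sum.cong) (auto simp: partial_deriv_var ring_map_zero[OF ring_map_subst] ring_map_one[OF ring_map_subst])
  then show ?case using var by (simp add: mpoly_eval_var[OF ring_map_const])
next
  case (add P P')
  then show ?case
    by (simp add: partial_deriv_add ring_map_add[OF ring_map_subst] distrib_right sum.distrib)
next
  case (mult P P')
  then show ?case
    by (simp add: partial_deriv_mult ring_map_add[OF ring_map_subst] ring_map_mult[OF ring_map_subst]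
        distrib_right sum.distrib sum_distrib_left sum_distrib_right algebra_simps)
qed


subsection \<open>Homogeneous polynomials\<close>

definition total_degree :: "(nat \<Rightarrow>\<^sub>0 nat) \<Rightarrow> nat" where
  "total_degree \<mu> = (\<Sum>i\<in>keys \<mu>. lookup \<mu> i)"

lemma homogeneous_iff: "homogeneous d P \<longleftrightarrow> (\<forall>\<mu>\<in>keys P. total_degree \<mu> = d)"
  by (simp add: homogeneous_def total_degree_def)

lemma total_degree_superset: "finite S \<Longrightarrow> keys \<mu> \<subseteq> S \<Longrightarrow> total_degree \<mu> = (\<Sum>i\<in>S. lookup \<mu> i)"
  unfolding total_degree_def by (rule sum.mono_neutral_left) (auto simp: in_keys_iff)

lemma total_degree_add: "total_degree (\<mu> + \<nu>) = total_degree \<mu> + total_degree \<nu>"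
  using total_degree_superset[of "keys \<mu> \<union> keys \<nu>" \<mu>] total_degree_superset[of "keys \<mu> \<union> keys \<nu>" \<nu>]
    total_degree_superset[of "keys \<mu> \<union> keys \<nu>" "\<mu> + \<nu>"] keys_add[of \<mu> \<nu>]
  by (simp add: lookup_add sum.distrib)

lemma total_degree_single [simp]: "total_degree (single i k) = k"
  by (cases "k = 0") (auto simp: total_degree_def)

lemma homogeneous_zero [simp]: "homogeneous d 0"
  by (simp add: homogeneous_iff)

lemma homogeneous_add: "homogeneous d P \<Longrightarrow> homogeneous d Q \<Longrightarrow> homogeneous d (P + Q)"
  using keys_add[of P Q] by (auto simp: homogeneous_iff)

lemma homogeneous_single: "total_degree \<mu> = d \<Longrightarrow> homogeneous d (single \<mu> c)"
  by (simp add: homogeneous_iff)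

lemma homogeneous_sum: "(\<And>i. i \<in> S \<Longrightarrow> homogeneous d (g i)) \<Longrightarrow> homogeneous d (sum g S)"
  by (induction S rule: infinite_finite_induct) (auto intro: homogeneous_add)

lemma homogeneous_mult:
  assumes "homogeneous d P" "homogeneous e Q" shows "homogeneous (d + e) (P * Q)"
proof -
  have "P * Q = (\<Sum>\<mu>\<in>keys P. \<Sum>\<nu>\<in>keys Q. single (\<mu> + \<nu>) (lookup P \<mu> * lookup Q \<nu>))"
    by (subst mpoly_sum_single[of P], subst mpoly_sum_single[of Q])
      (simp add: sum_distrib_left sum_distrib_right mult_single sum.swap[of _ "keys Q"])
  also have "homogeneous (d + e) \<dots>"
    using assms by (intro homogeneous_sum homogeneous_single) (simp add: total_degree_add homogeneous_iff)
  finally show ?thesis .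
qed

lemma homogeneous_uminus: "homogeneous d P \<Longrightarrow> homogeneous d (- P)"
  using homogeneous_mult[of 0 "- 1" d P] by (simp add: homogeneous_iff)

lemma homogeneous_const: "homogeneous 0 (const c)"
  by (simp add: const_def homogeneous_single total_degree_def)

lemma homogeneous_var: "homogeneous 1 (var i)"
  by (simp add: var_def homogeneous_single)

lemma homogeneous_partial_deriv:
  assumes "homogeneous (Suc d) P" shows "homogeneous d (partial_deriv j P)"
  unfolding homogeneous_iff
proof
  fix \<nu> assume "\<nu> \<in> keys (partial_deriv j P)"
  then have "\<nu> + single j 1 \<in> keys P" by (auto simp: in_keys_iff lookup_partial_deriv)
  then have "total_degree (\<nu> + single j 1) = Suc d" using assms by (simp add: homogeneous_iff)
  then show "total_degree \<nu> = d" by (simp add: total_degree_add)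
qed

lemma homogeneous_eval_scale:
  assumes "homogeneous d P"
  shows "mpoly_eval \<phi> (\<lambda>i. s * t i) P = s ^ d * mpoly_eval \<phi> t P"
proof -
  have "monomial (\<lambda>i. s * t i) \<mu> = s ^ total_degree \<mu> * monomial t \<mu>" for \<mu>
    by (simp add: monomial_def total_degree_def power_mult_distrib prod.distrib power_sum)
  then show ?thesis
    using assms by (simp add: mpoly_eval_def sum_distrib_left homogeneous_iff algebra_simps)
qed

lemma euler_identity:
  assumes hom: "homogeneous N P" and P: "P \<in> polys UNIV m"
  shows "(\<Sum>j<m. var j * partial_deriv j P) = of_nat N * P"
proof -
  have *: "(\<Sum>j<m. var j * partial_deriv j (single \<mu> c)) = of_nat (total_degree \<mu>) * single \<mu> c"
    if "keys \<mu> \<subseteq> {..<m}" for \<mu> and c :: 'a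
  proof -
    have "var j * partial_deriv j (single \<mu> c) = of_nat (lookup \<mu> j) * single \<mu> c" for j
    proof (cases "lookup \<mu> j = 0")
      case False
      have "single j 1 + (\<mu> - single j 1) = \<mu>" using single_diff_add[OF False] by (simp add: add.commute)
      then show ?thesis
        by (simp add: partial_deriv_single var_def mult_single flip: single_of_nat)
    qed (simp add: partial_deriv_single)
    then show ?thesis
      using total_degree_superset[OF _ that] by (simp add: sum_distrib_right of_nat_sum)
  qed
  have "(\<Sum>j<m. var j * partial_deriv j P)
      = (\<Sum>j<m. \<Sum>\<mu>\<in>keys P. var j * partial_deriv j (single \<mu> (lookup P \<mu>)))"
    by (subst mpoly_sum_single[of P]) (simp add: partial_deriv_sum sum_distrib_left)
  also have "\<dots> = (\<Sum>\<mu>\<in>keys P. \<Sum>j<m. var j * partial_deriv j (single \<mu> (lookup P \<mu>)))"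
    by (rule sum.swap)
  also have "\<dots> = (\<Sum>\<mu>\<in>keys P. of_nat N * single \<mu> (lookup P \<mu>))"
    using hom P by (intro sum.cong) (auto simp: * homogeneous_iff polys_def)
  also have "\<dots> = of_nat N * P"
    by (subst (2) mpoly_sum_single[of P]) (simp add: sum_distrib_left)
  finally show ?thesis .
qed

section \<open>Affine coordinate rings\<close>

definition affine_ring :: "'k::field set \<Rightarrow> nat \<Rightarrow> (nat \<Rightarrow> 'k ratfun) \<Rightarrow> 'k ratfun set" where
  "affine_ring B n t = eval t ` polys B n"

text \<open>Independence over the whole coefficient field, since \<open>coord_deriv\<close>
  differentiates fractions of polynomials with arbitrary coefficients.\<close>

definition alg_independent :: "nat \<Rightarrow> (nat \<Rightarrow> 'k::field ratfun) \<Rightarrow> bool" where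
  "alg_independent n t \<longleftrightarrow> (\<forall>P\<in>polys UNIV n. eval t P = 0 \<longrightarrow> P = 0)"

definition localized_ring :: "'k::field set \<Rightarrow> nat \<Rightarrow> (nat \<Rightarrow> 'k ratfun) \<Rightarrow> 'k mpoly \<Rightarrow> 'k ratfun set" where
  "localized_ring B n t H = {eval t a / eval t H ^ k | a k. a \<in> polys B n}"

lemmas eval_simps =
  ring_map_add[OF ring_map_eval] ring_map_mult[OF ring_map_eval] ring_map_zero[OF ring_map_eval]
  ring_map_one[OF ring_map_eval] ring_map_diff[OF ring_map_eval] ring_map_power[OF ring_map_eval]
  mpoly_eval_const[OF ring_map_const_fun] mpoly_eval_var[OF ring_map_const_fun]
  ring_map_sum[OF ring_map_eval] ring_map_uminus[OF ring_map_eval] ring_map_of_nat[OF ring_map_eval]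

lemmas subst_simps =
  ring_map_add[OF ring_map_subst] ring_map_mult[OF ring_map_subst] ring_map_zero[OF ring_map_subst]
  ring_map_one[OF ring_map_subst] ring_map_diff[OF ring_map_subst] ring_map_power[OF ring_map_subst]
  mpoly_eval_const[OF ring_map_const] mpoly_eval_var[OF ring_map_const]
  ring_map_sum[OF ring_map_subst] ring_map_uminus[OF ring_map_subst]

lemma polys_UNIV: "P \<in> polys B n \<Longrightarrow> P \<in> polys UNIV n"
  by (auto simp: polys_def)

lemma alg_independent_eq:
  assumes "alg_independent n t" "P \<in> polys B n" "Q \<in> polys B' n" "eval t P = eval t Q"
  shows "P = Q"
proof -
  have "P - Q \<in> polys UNIV n"
    using assms polys_UNIV is_subring_diff[OF is_subring_polys[OF is_subring_UNIV]] by blast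
  moreover have "eval t (P - Q) = 0" using assms(4) by (simp add: eval_simps)
  ultimately have "P - Q = 0" using assms(1) unfolding alg_independent_def by blast
  then show ?thesis by simp
qed

lemma alg_independent_zero_iff:
  assumes "alg_independent n t" "P \<in> polys B n" shows "eval t P = 0 \<longleftrightarrow> P = 0"
  using assms polys_UNIV by (auto simp: alg_independent_def eval_simps)

lemma eval_affine_ring: "a \<in> polys B n \<Longrightarrow> eval t a \<in> affine_ring B n t"
  by (simp add: affine_ring_def)

lemma is_subring_affine_ring: "is_subring B \<Longrightarrow> is_subring (affine_ring B n t)"
  unfolding is_subring_def[of "affine_ring B n t"] affine_ring_def
  using is_subring_polys[of B n]
  by (auto simp: is_subring_def eval_simps[symmetric] intro!: imageI image_eqI[of 1 _ 1])

lemma affine_ring_subset: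
  assumes "is_subring R" "const_fun ` B \<subseteq> R" "\<And>i. i < n \<Longrightarrow> t i \<in> R"
  shows "affine_ring B n t \<subseteq> R"
  using mpoly_eval_mem[OF assms(1), of _ B n const_fun t] assms(2,3) by (auto simp: affine_ring_def)

lemma const_affine_ring: "const_fun ` B \<subseteq> affine_ring B n t"
  unfolding affine_ring_def using const_polys
  by (force simp: eval_simps intro!: image_eqI[of _ "eval t"])

lemma coord_affine_ring: "is_subring B \<Longrightarrow> i < n \<Longrightarrow> t i \<in> affine_ring B n t"
  unfolding affine_ring_def using var_polys by (force simp: eval_simps intro!: image_eqI[of _ "eval t"])

lemma localized_ringI: "a \<in> polys B n \<Longrightarrow> eval t a / eval t H ^ k \<in> localized_ring B n t H"
  by (auto simp: localized_ring_def)

lemma affine_ring_localized: "affine_ring B n t \<subseteq> localized_ring B n t H"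
  unfolding affine_ring_def localized_ring_def by (auto intro!: exI[of _ "0::nat"])

lemma is_subring_localized_ring:
  assumes B: "is_subring B" and H: "H \<in> polys B n" "eval t H \<noteq> 0"
  shows "is_subring (localized_ring B n t H)"
  unfolding is_subring_def
proof (intro conjI ballI)
  note S = is_subring_polys[OF B, of n]
  show "1 \<in> localized_ring B n t H"
    using affine_ring_localized is_subring_one[OF is_subring_affine_ring[OF B]] by blast
  fix x y assume "x \<in> localized_ring B n t H" "y \<in> localized_ring B n t H"
  then obtain a k b l where *: "a \<in> polys B n" "b \<in> polys B n"
    "x = eval t a / eval t H ^ k" "y = eval t b / eval t H ^ l" by (auto simp: localized_ring_def)
  have "x - y = eval t (a * H ^ l - b * H ^ k) / eval t H ^ (k + l)"
    using H unfolding *(3,4) by (simp add: eval_simps field_simps power_add)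
  then show "x - y \<in> localized_ring B n t H"
    using * H by (auto intro!: localized_ringI is_subring_diff[OF S] is_subring_mult[OF S] is_subring_power[OF S])
  have "x * y = eval t (a * b) / eval t H ^ (k + l)"
    using * H by (simp add: eval_simps power_add)
  then show "x * y \<in> localized_ring B n t H"
    using * by (auto intro!: localized_ringI is_subring_mult[OF S])
qed

lemma inverse_localized: "is_subring B \<Longrightarrow> inverse (eval t H) \<in> localized_ring B n t H"
  using localized_ringI[of 1 B n t H 1] is_subring_one[OF is_subring_polys, of B n]
  by (simp add: eval_simps inverse_eq_divide)

lemma localized_ring_subset:
  assumes "is_subring R" "affine_ring B n t \<subseteq> R" "unit_in R (eval t H)"
  shows "localized_ring B n t H \<subseteq> R"
proof
  fix x assume "x \<in> localized_ring B n t H"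
  then obtain a k where "a \<in> polys B n" "x = eval t a / eval t H ^ k" by (auto simp: localized_ring_def)
  then show "x \<in> R"
    using assms eval_affine_ring[of a B n t] unit_in_divide[OF assms(1) _ unit_in_power[OF assms(1,3)]] by blast
qed

text \<open>The points of the principal open set where H does not vanish.\<close>

lemma local_of_localized_iff:
  assumes B: "is_subring B" and H: "H \<in> polys B n" "eval t H \<noteq> 0"
  shows "local_of (localized_ring B n t H) R \<longleftrightarrow> local_of (affine_ring B n t) R \<and> unit_in R (eval t H)"
proof
  let ?L = "localized_ring B n t H" and ?A = "affine_ring B n t"
  assume R: "local_of ?L R"
  note sr = local_of_subring[OF R]
  have sub: "?A \<subseteq> R" using local_of_subset[OF R] affine_ring_localized by blast
  have u: "unit_in R (eval t H)"
    using H sub local_of_subset[OF R] inverse_localized[OF B, of t H n] eval_affine_ring[OF H(1), of t]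
    by (auto simp: unit_in_def)
  have "local_of ?A R"
  proof (rule local_of_fractions_trans[OF R is_subring_affine_ring[OF B] sub])
    fix x assume "x \<in> ?L"
    then obtain a k where *: "a \<in> polys B n" "x = eval t a / eval t H ^ k" by (auto simp: localized_ring_def)
    show "\<exists>b\<in>?A. \<exists>w\<in>?A. unit_in R w \<and> x = b / w"
      using * unit_in_power[OF sr u, of k] eval_affine_ring
        is_subring_power[OF is_subring_affine_ring[OF B] eval_affine_ring[OF H(1)]] by blast
  qed
  then show "local_of ?A R \<and> unit_in R (eval t H)" using u by blast
next
  assume *: "local_of (affine_ring B n t) R \<and> unit_in R (eval t H)"
  then show "local_of (localized_ring B n t H) R"
    using local_of_superring[OF _ affine_ring_localized
        localized_ring_subset[OF local_of_subring local_of_subset]] by blast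
qed

lemma affine_fraction:
  assumes "local_of (affine_ring B n t) R" "r \<in> R"
  obtains a w where "a \<in> polys B n" "w \<in> polys B n" "unit_in R (eval t w)" "r = eval t a / eval t w"
proof -
  obtain x y where *: "x \<in> affine_ring B n t" "y \<in> affine_ring B n t" "unit_in R y" "r = x / y"
    by (rule local_of_fraction[OF assms])
  then obtain a w where "a \<in> polys B n" "w \<in> polys B n" "x = eval t a" "y = eval t w"
    unfolding affine_ring_def by blast
  then show thesis using * that by blast
qed


subsection \<open>Prime elements and their generic points\<close>

text \<open>
  By the product rule, two factors in the maximal ideal would force every partial derivative of the product
  into it.
\<close>

lemma prime_factor_at:
  assumes B: "factorial_in B" and R: "local_ring R" and sub: "affine_ring B n t \<subseteq> R"
    and G: "G \<in> polys B n" "\<not> unit_in R (eval t G)" "unit_in R (eval t (partial_deriv j G))"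
  shows "\<exists>\<pi> u. prime_in (polys B n) \<pi> \<and> u \<in> polys B n \<and> G = \<pi> * u \<and>
    \<not> unit_in R (eval t \<pi>) \<and> unit_in R (eval t u)"
proof -
  have Bs: "is_subring B" using B by (simp add: factorial_in_def)
  note S = is_subring_polys[OF Bs, of n] and sr = local_ring_subring[OF R]
  have mem: "eval t a \<in> R" if "a \<in> polys B n" for a using sub eval_affine_ring that by blast
  have "G \<noteq> 0" using G(3) by (auto simp: eval_simps unit_in_def)
  then obtain m where "prime_factors_in (polys B n) m G"
    using factorial_in_polys[OF B, of n] G(1) by (auto simp: factorial_in_def)
  then have "\<exists>\<pi> u. prime_in (polys B n) \<pi> \<and> u \<in> polys B n \<and> G = \<pi> * u \<and> \<not> unit_in R (eval t \<pi>)"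
    using G(2)
  proof induction
    case (unit u)
    then obtain w where w: "u \<in> polys B n" "w \<in> polys B n" "u * w = 1" by (auto simp: is_unit_of_def)
    then have "eval t u * eval t w = 1" by (metis ring_map_mult ring_map_one ring_map_eval)
    then have "unit_in R (eval t u * eval t w)" using unit_in_one[OF sr] by simp
    then show ?case using unit_in_mult_iff[OF sr mem[OF w(1)] mem[OF w(2)]] unit.prems by blast
  next
    case (prime \<pi> m a)
    have \<pi>: "\<pi> \<in> polys B n" and a: "a \<in> polys B n"
      using prime.hyps prime_factors_in_mem[OF prime.hyps(2) S] by (auto simp: prime_in_def)
    show ?case
    proof (cases "unit_in R (eval t \<pi>)")
      case True
      then have "\<not> unit_in R (eval t a)"
        using prime.prems unit_in_mult_iff[OF sr mem[OF \<pi>] mem[OF a]] by (simp add: eval_simps)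
      then obtain \<rho> u where *: "prime_in (polys B n) \<rho>" "u \<in> polys B n" "a = \<rho> * u" "\<not> unit_in R (eval t \<rho>)"
        using prime.IH by blast
      have "\<pi> * a = \<rho> * (\<pi> * u)" using * by (simp add: mult.left_commute)
      then show ?thesis using * is_subring_mult[OF S \<pi>] by blast
    qed (use prime.hyps a in blast)
  qed
  then obtain \<pi> u where *: "prime_in (polys B n) \<pi>" "u \<in> polys B n" "G = \<pi> * u" "\<not> unit_in R (eval t \<pi>)"
    by blast
  have \<pi>: "\<pi> \<in> polys B n" using * by (simp add: prime_in_def)
  have "unit_in R (eval t u)"
  proof (rule ccontr)
    assume "\<not> unit_in R (eval t u)"
    then have "eval t \<pi> \<in> max_ideal R" "eval t u \<in> max_ideal R" using * \<pi> mem by (auto simp: max_ideal_eq)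
    then have "eval t (partial_deriv j G) \<in> max_ideal R"
      unfolding *(3) partial_deriv_mult eval_simps
      using mem partial_deriv_polys[OF Bs] \<pi> *(2)
      by (intro max_ideal_add[OF R] max_ideal_mult[OF R] max_ideal_mult'[OF R]) auto
    then show False using G(3) by (simp add: max_ideal_eq)
  qed
  then show ?thesis using * by blast
qed

text \<open>The local ring at the generic point of \<pi> = 0. The prime ideal is stated through
  divisibility of polynomials, which independence of the coordinates t makes meaningful for their
  values.\<close>

definition generic_point :: "'k::field set \<Rightarrow> nat \<Rightarrow> (nat \<Rightarrow> 'k ratfun) \<Rightarrow> 'k mpoly \<Rightarrow> 'k ratfun set" where
  "generic_point B n t \<pi> = localization_at (affine_ring B n t) (eval t ` {a \<in> polys B n. divides_in (polys B n) \<pi> a})"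

lemma generic_point_props:
  assumes B: "is_subring B" and t: "alg_independent n t" and \<pi>: "prime_in (polys B n) \<pi>"
  shows "local_of (affine_ring B n t) (generic_point B n t \<pi>)"
    "\<And>a. a \<in> polys B n \<Longrightarrow> unit_in (generic_point B n t \<pi>) (eval t a) \<longleftrightarrow> \<not> divides_in (polys B n) \<pi> a"
proof -
  note S = is_subring_polys[OF B, of n]
  let ?P = "eval t ` {a \<in> polys B n. divides_in (polys B n) \<pi> a}"
  have mem: "eval t a \<in> ?P \<longleftrightarrow> divides_in (polys B n) \<pi> a" if "a \<in> polys B n" for a
    using that alg_independent_eq[OF t that] by auto
  have nd1: "\<not> divides_in (polys B n) \<pi> 1"
    using \<pi> by (auto simp: prime_in_def is_unit_of_def divides_in_def)
  have P: "primeideal ?P (ring_of (affine_ring B n t))"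
    unfolding primeideal_ring_of_iff
  proof (intro conjI ballI impI)
    show "is_subring (affine_ring B n t)" using is_subring_affine_ring[OF B] .
    show "1 \<notin> ?P" using mem[OF is_subring_one[OF S]] nd1 by (simp add: eval_simps)
    show "ideal_in ?P (affine_ring B n t)"
      unfolding ideal_in_def
    proof (intro conjI ballI)
      show "?P \<subseteq> affine_ring B n t" by (auto simp: affine_ring_def)
      have "divides_in (polys B n) \<pi> 0"
        unfolding divides_in_def by (rule bexI[of _ 0]) auto
      then show "0 \<in> ?P" using mem[of 0] by (simp add: eval_simps)
      fix x assume "x \<in> ?P"
      then obtain a where a: "a \<in> polys B n" "divides_in (polys B n) \<pi> a" "x = eval t a" by blast
      { fix y assume "y \<in> ?P"
        then obtain b where b: "b \<in> polys B n" "divides_in (polys B n) \<pi> b" "y = eval t b" by blast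
        show "x + y \<in> ?P"
          using mem[OF is_subring_add[OF S a(1) b(1)]] divides_in_add[OF S a(2) b(2)] a b by (simp add: eval_simps) }
      fix y assume "y \<in> affine_ring B n t"
      then obtain b where b: "b \<in> polys B n" "y = eval t b" by (auto simp: affine_ring_def)
      show "y * x \<in> ?P"
        using mem[OF is_subring_mult[OF S b(1) a(1)]] divides_in_mult_left[OF S a(2) b(1)] a b by (simp add: eval_simps)
    qed
    fix x y assume "x \<in> affine_ring B n t" "y \<in> affine_ring B n t" "x * y \<in> ?P"
    then obtain a b where ab: "a \<in> polys B n" "b \<in> polys B n" "x = eval t a" "y = eval t b" "eval t (a * b) \<in> ?P"
      by (auto simp: affine_ring_def eval_simps)
    then have "divides_in (polys B n) \<pi> (a * b)" using mem is_subring_mult[OF S] by blast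
    then show "x \<in> ?P \<or> y \<in> ?P" using \<pi> ab mem by (simp add: prime_in_def)
  qed
  show "local_of (affine_ring B n t) (generic_point B n t \<pi>)"
    unfolding generic_point_def by (rule local_of_localization_at[OF P])
  show "\<And>a. a \<in> polys B n \<Longrightarrow> unit_in (generic_point B n t \<pi>) (eval t a) \<longleftrightarrow> \<not> divides_in (polys B n) \<pi> a"
    unfolding generic_point_def using unit_in_localization_at[OF P] mem eval_affine_ring by blast
qed

text \<open>If \<pi> vanishes at Q, no denominator of an element of Q is divisible by \<pi>, so Q
  lies in the local ring at \<pi>. Inclusion thus expresses that Q lies on the branch \<pi> =
  0.\<close>

lemma subset_generic_point_iff:
  assumes B: "is_subring B" and t: "alg_independent n t" and \<pi>: "prime_in (polys B n) \<pi>"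
    and Q: "local_of (affine_ring B n t) Q"
  shows "Q \<subseteq> generic_point B n t \<pi> \<longleftrightarrow> \<not> unit_in Q (eval t \<pi>)"
proof
  note gp = generic_point_props[OF B t \<pi>] and S = is_subring_polys[OF B, of n]
  have \<pi>p: "\<pi> \<in> polys B n" using \<pi> by (simp add: prime_in_def)
  have "divides_in (polys B n) \<pi> \<pi>" unfolding divides_in_def using is_subring_one[OF S] by force
  then show "Q \<subseteq> generic_point B n t \<pi> \<Longrightarrow> \<not> unit_in Q (eval t \<pi>)"
    using gp(2)[OF \<pi>p] unit_in_mono by blast
  assume nu: "\<not> unit_in Q (eval t \<pi>)"
  show "Q \<subseteq> generic_point B n t \<pi>"
  proof
    fix r assume "r \<in> Q"
    then obtain a w where *: "a \<in> polys B n" "w \<in> polys B n" "unit_in Q (eval t w)" "r = eval t a / eval t w"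
      using affine_fraction[OF Q] by blast
    have "\<not> divides_in (polys B n) \<pi> w"
    proof
      assume "divides_in (polys B n) \<pi> w"
      then obtain c where "c \<in> polys B n" "w = \<pi> * c" by (auto simp: divides_in_def)
      then show False
        using *(3) nu unit_in_mult_iff[OF local_of_subring[OF Q], of "eval t \<pi>" "eval t c"]
          local_of_subset[OF Q] eval_affine_ring[of _ B n t] \<pi>p by (auto simp: eval_simps)
    qed
    then have "unit_in (generic_point B n t \<pi>) (eval t w)" using gp(2) * by blast
    then show "r \<in> generic_point B n t \<pi>"
      using unit_in_divide[OF local_of_subring[OF gp(1)]] local_of_subset[OF gp(1)] eval_affine_ring * by blast
  qed
qed

text \<open>An element of R that vanishes at the generic point has a numerator divisible by \<pi>,
  and its denominator stays a unit of R: the ideal of the branch is principal.\<close>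

lemma max_ideal_generic_point_local:
  assumes B: "is_subring B" and t: "alg_independent n t" and \<pi>: "prime_in (polys B n) \<pi>"
    and R: "local_of (affine_ring B n t) R" and nu: "\<not> unit_in R (eval t \<pi>)"
  shows "R \<inter> max_ideal (generic_point B n t \<pi>) = PIdl\<^bsub>ring_of R\<^esub> (eval t \<pi>)"
proof -
  note gp = generic_point_props[OF B t \<pi>] and S = is_subring_polys[OF B, of n]
    and sr = local_of_subring[OF R]
  let ?\<eta> = "generic_point B n t \<pi>"
  have sub: "R \<subseteq> ?\<eta>" using subset_generic_point_iff[OF B t \<pi> R] nu by blast
  have \<pi>p: "\<pi> \<in> polys B n" using \<pi> by (simp add: prime_in_def)
  have \<pi>R: "eval t \<pi> \<in> R" using local_of_subset[OF R] eval_affine_ring[OF \<pi>p] by blast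
  have "divides_in (polys B n) \<pi> \<pi>" unfolding divides_in_def using is_subring_one[OF S] by force
  then have \<pi>m: "eval t \<pi> \<in> max_ideal ?\<eta>" using gp(2)[OF \<pi>p] \<pi>R sub by (auto simp: max_ideal_eq)
  have P: "PIdl\<^bsub>ring_of R\<^esub> (eval t \<pi>) = {x * eval t \<pi> | x. x \<in> R}"
    by (simp add: cgenideal_def)
  show ?thesis
    unfolding P
  proof (intro equalityI subsetI)
    fix r assume r: "r \<in> R \<inter> max_ideal ?\<eta>"
    then obtain a w where *: "a \<in> polys B n" "w \<in> polys B n" "unit_in R (eval t w)" "r = eval t a / eval t w"
      using affine_fraction[OF R] by blast
    have "eval t a = eval t w * r" using * by (simp add: unit_in_def)
    then have "eval t a \<in> max_ideal ?\<eta>"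
      using max_ideal_mult[OF local_of_local[OF gp(1)]] r *(3) sub by (auto simp: unit_in_def)
    then have "divides_in (polys B n) \<pi> a" using gp(2)[OF *(1)] by (auto simp: max_ideal_eq)
    then obtain c where c: "c \<in> polys B n" "a = \<pi> * c" by (auto simp: divides_in_def)
    then have "r = (eval t c / eval t w) * eval t \<pi>" using * by (simp add: eval_simps)
    moreover have "eval t c / eval t w \<in> R"
      using unit_in_divide[OF sr] local_of_subset[OF R] eval_affine_ring[OF c(1)] * by blast
    ultimately show "r \<in> {x * eval t \<pi> | x. x \<in> R}" by blast
  next
    fix r assume "r \<in> {x * eval t \<pi> | x. x \<in> R}"
    then obtain x where "x \<in> R" "r = x * eval t \<pi>" by blast
    then show "r \<in> R \<inter> max_ideal ?\<eta>"
      using is_subring_mult[OF sr _ \<pi>R] max_ideal_mult[OF local_of_local[OF gp(1)] _ \<pi>m] sub by blast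
  qed
qed


subsection \<open>Standard smooth quotients\<close>

lemma transpose_lt: "j < n \<Longrightarrow> i < n \<Longrightarrow> Transposition.transpose 0 j i < (n::nat)"
  by (auto simp: Transposition.transpose_def)

text \<open>
  The ring \<open>B[T, 1/H]/(\<pi>)\<close> is \<open>B[Z, T]/(Z H - 1, \<pi>)\<close>. The new variable \<open>Z\<close> is \<open>var 0\<close>, and the
  coordinates are permuted so that \<open>var 1\<close> is the one for which \<open>\<partial>\<pi>/\<partial>T\<^sub>j\<close> is invertible: the Jacobian
  matrix is then upper triangular.
\<close>

lemma standard_smooth_hypersurface:
  fixes B :: "'k::field set"
  assumes B: "is_subring B" and t: "alg_independent n t" and \<pi>: "prime_in (polys B n) \<pi>"
    and H: "H \<in> polys B n" "\<not> divides_in (polys B n) \<pi> H" and j: "j < n"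
    and A_def: "A = localized_ring B n t H"
    and unit: "unit_in A (eval t (partial_deriv j \<pi>))"
    and I_def: "I = A \<inter> max_ideal (generic_point B n t \<pi>)"
  shows "standard_smooth B (ring_of A Quot I) (\<lambda>b. I +>\<^bsub>ring_of A\<^esub> const_fun b)"
proof -
  note S = is_subring_polys[OF B] and gp = generic_point_props[OF B t \<pi>]
  have \<pi>p: "\<pi> \<in> polys B n" using \<pi> by (simp add: prime_in_def)
  have dz: "divides_in (polys B n) \<pi> 0" unfolding divides_in_def by (rule bexI[of _ 0]) auto
  then have H0: "eval t H \<noteq> 0" using H alg_independent_zero_iff[OF t H(1)] by auto
  have A: "is_subring A" unfolding A_def by (rule is_subring_localized_ring[OF B H(1) H0])
  let ?\<eta> = "generic_point B n t \<pi>"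
  note l\<eta> = local_of_local[OF gp(1)]
  have u\<eta>: "unit_in ?\<eta> (eval t H)" using gp(2)[OF H(1)] H(2) by blast
  have A\<eta>: "A \<subseteq> ?\<eta>"
    unfolding A_def using localized_ring_subset[OF local_of_subring[OF gp(1)] local_of_subset[OF gp(1)] u\<eta>] .
  have I: "ideal_in I A"
    unfolding I_def Int_commute[of A] by (rule ideal_in_restrict[OF ideal_in_max_ideal[OF l\<eta>] A A\<eta>])
  \<comment> \<open>H is a unit at the generic point, so membership in I is decided by the
    numerator.\<close>
  have I_iff: "eval t a / eval t H ^ k \<in> I \<longleftrightarrow> divides_in (polys B n) \<pi> a" if a: "a \<in> polys B n" for a k
  proof -
    have "eval t a / eval t H ^ k \<in> A" unfolding A_def using localized_ringI[OF a] .
    moreover have "unit_in ?\<eta> (eval t a / eval t H ^ k) \<longleftrightarrow> unit_in ?\<eta> (eval t a)"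
    proof -
      have "eval t a = (eval t a / eval t H ^ k) * eval t H ^ k" using H0 by simp
      moreover have "eval t a / eval t H ^ k \<in> ?\<eta>" using A\<eta> localized_ringI[OF a, of t H k] A_def by blast
      moreover have "unit_in ?\<eta> (eval t H ^ k)" using unit_in_power[OF local_of_subring[OF gp(1)] u\<eta>] .
      ultimately show ?thesis
        using unit_in_mult_iff[OF local_of_subring[OF gp(1)], of "eval t a / eval t H ^ k" "eval t H ^ k"]
        by (metis unit_in_def)
    qed
    ultimately show ?thesis using gp(2)[OF a] A\<eta> by (auto simp: I_def max_ideal_eq)
  qed
  define \<sigma> where "\<sigma> = Transposition.transpose 0 j"
  have \<sigma>\<sigma>: "\<sigma> (\<sigma> i) = i" for i by (simp add: \<sigma>_def)
  have \<sigma>n: "\<sigma> i < n" if "i < n" for i using transpose_lt[OF j that] by (simp add: \<sigma>_def)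
  define z where "z k = (case k of 0 \<Rightarrow> inverse (eval t H) | Suc i \<Rightarrow> t (\<sigma> i))" for k
  define rn where "rn = subst (\<lambda>i. var (Suc (\<sigma> i)) :: 'k mpoly)"
  have rn_polys: "rn P \<in> polys B (Suc n)" if "P \<in> polys B n" for P
    unfolding rn_def using S that
    by (rule mpoly_eval_mem) (auto intro!: const_polys var_polys[OF B] \<sigma>n)
  have eval_rn: "eval z (rn P) = eval t P" for P
    unfolding rn_def mpoly_eval_subst[OF ring_map_const_fun] by (simp add: eval_simps z_def \<sigma>\<sigma>)
  have z0: "z 0 = inverse (eval t H)" by (simp add: z_def)
  have rn_d0: "partial_deriv 0 (rn P) = 0" if "P \<in> polys B n" for P
    unfolding rn_def using chain_rule[OF polys_UNIV[OF that], of 0] by (simp add: partial_deriv_var)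
  have rn_d1: "partial_deriv 1 (rn P) = rn (partial_deriv j P)" if "P \<in> polys B n" for P
  proof -
    have "\<sigma> k = 0 \<longleftrightarrow> k = j" for k by (auto simp: \<sigma>_def Transposition.transpose_def)
    then have "partial_deriv 1 (rn P) = (\<Sum>k<n. if k = j then rn (partial_deriv k P) else 0)"
      unfolding rn_def chain_rule[OF polys_UNIV[OF that]] by (intro sum.cong) (auto simp: partial_deriv_var)
    then show ?thesis using j by simp
  qed
  define g where "g i = (if i = 0 then var 0 * rn H - 1 else rn \<pi>)" for i :: nat
  have v0: "var 0 \<in> polys B (Suc n)" using var_polys[OF B] by simp
  have g_polys: "g i \<in> polys B (Suc n)" for i
    using rn_polys \<pi>p H v0 is_subring_one[OF S]
    by (auto simp: g_def intro!: is_subring_diff[OF S] is_subring_mult[OF S])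
  define PS where "PS = ring_of (polys B (Suc n))"
  define J where "J = Idl\<^bsub>PS\<^esub> (g ` {..<2})"
  have gJ: "g ` {..<2} \<subseteq> polys B (Suc n)" using g_polys by blast
  note Jp = genideal_ring_of[OF S gJ, folded PS_def, folded J_def]
  have ev_A: "eval z u \<in> A" if "u \<in> polys B (Suc n)" for u
  proof (rule mpoly_eval_mem[OF A that])
    show "const_fun b \<in> A" if "b \<in> B" for b
      using const_affine_ring[of B n t] affine_ring_localized that unfolding A_def by blast
    show "z i \<in> A" if "i < Suc n" for i
    proof (cases i)
      case 0
      then show ?thesis using inverse_localized[OF B] by (simp add: z0 A_def)
    next
      case (Suc i')
      then have "z i = t (\<sigma> i')" "\<sigma> i' < n" using \<sigma>n that by (auto simp: z_def)
      then show ?thesis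
        using coord_affine_ring[OF B, of "\<sigma> i'" n t] subsetD[OF affine_ring_localized] unfolding A_def by metis
    qed
  qed
  \<comment> \<open>K is the kernel of the map from \<open>B[Z, T]\<close> to the quotient of A by
    I; the aim is that J, generated by the two equations, is all of K.\<close>
  define K where "K = {u \<in> polys B (Suc n). eval z u \<in> I}"
  have K: "ideal_in K (polys B (Suc n))"
    unfolding ideal_in_def K_def
    using I ev_A is_subring_add[OF S] is_subring_mult[OF S]
    by (auto simp: eval_simps ideal_in_def)
  have "divides_in (polys B n) \<pi> \<pi>"
    unfolding divides_in_def using is_subring_one[OF S] by force
  then have "eval t \<pi> / eval t H ^ 0 \<in> I" using I_iff[OF \<pi>p] by blast
  moreover have "eval z (g 0) = 0" using H0 by (simp add: g_def eval_simps eval_rn z0)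
  ultimately have "g i \<in> K" for i
    using g_polys I by (auto simp: K_def g_def eval_rn ideal_in_def)
  then have JK: "J \<subseteq> K" using Jp(3)[OF K] by blast
  have "g i \<in> J" if "i < 2" for i using Jp(1) that by blast
  from this[of 0] this[of 1] have Jmem: "g 0 \<in> J" "rn \<pi> \<in> J" by (auto simp: g_def)
  define eqv where "eqv x y \<longleftrightarrow> x - y \<in> J" for x y
  have Jadd: "x + y \<in> J" if "x \<in> J" "y \<in> J" for x y using that Jp(2) by (auto simp: ideal_in_def)
  have Jmul: "a * x \<in> J" if "a \<in> polys B (Suc n)" "x \<in> J" for a x using that Jp(2) by (auto simp: ideal_in_def)
  have eqv_refl: "eqv x x" for x using Jp(2) by (auto simp: eqv_def ideal_in_def)
  have eqv_sym: "eqv y x" if "eqv x y" for x y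
    using ideal_in_diff[OF S Jp(2), of 0 "x - y"] that Jp(2) by (auto simp: eqv_def ideal_in_def)
  have eqv_trans: "eqv x w" if "eqv x y" "eqv y w" for x y w
    using Jadd[of "x - y" "y - w"] that by (simp add: eqv_def)
  have eqv_add: "eqv (x + x') (y + y')" if "eqv x y" "eqv x' y'" for x y x' y'
    using Jadd[of "x - y" "x' - y'"] that by (simp add: eqv_def algebra_simps)
  have eqv_mult: "eqv (x * x') (y * y')"
    if "eqv x y" "eqv x' y'" "x' \<in> polys B (Suc n)" "y \<in> polys B (Suc n)" for x y x' y'
  proof -
    have "x' * (x - y) + y * (x' - y') \<in> J" using that Jadd Jmul by (simp add: eqv_def)
    then show ?thesis by (simp add: eqv_def algebra_simps)
  qed
  have vH: "var 0 * rn H \<in> polys B (Suc n)" using v0 rn_polys[OF H(1)] is_subring_mult[OF S] by blast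
  have eqv_pow: "eqv ((var 0 * rn H) ^ k) 1" for k
  proof (induction k)
    case (Suc k)
    have "eqv (var 0 * rn H) 1" using Jmem(1) by (simp add: eqv_def g_def)
    from eqv_mult[OF this Suc] show ?case using is_subring_power[OF S vH] is_subring_one[OF S] by simp
  qed (simp add: eqv_refl)
  \<comment> \<open>Modulo Z H = 1 every polynomial is a renamed polynomial times a power of Z. For
    a sum the powers are made equal by multiplying each summand with a power of Z H.\<close>
  have red: "\<exists>a\<in>polys B n. \<exists>k. eqv u (rn a * var 0 ^ k)" if "u \<in> polys B (Suc n)" for u
    using that B
  proof (induction rule: polys_induct)
    case (const b)
    then show ?case using eqv_refl[of "const b"] const_polys[of b B n]
      by (intro bexI[of _ "const b"] exI[of _ 0]) (auto simp: rn_def subst_simps)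
  next
    case (var i)
    show ?case
    proof (cases i)
      case 0
      then show ?thesis using eqv_refl is_subring_one[OF S]
        by (intro bexI[of _ 1] exI[of _ 1]) (auto simp: rn_def subst_simps)
    next
      case (Suc i')
      then show ?thesis using eqv_refl var var_polys[OF B] \<sigma>n
        by (intro bexI[of _ "var (\<sigma> i')"] exI[of _ 0]) (auto simp: rn_def subst_simps \<sigma>\<sigma>)
    qed
  next
    case (add P P')
    then obtain a k a' k' where *: "a \<in> polys B n" "eqv P (rn a * var 0 ^ k)"
      "a' \<in> polys B n" "eqv P' (rn a' * var 0 ^ k')" by blast
    have "eqv ((rn c * var 0 ^ l) * 1) ((rn c * var 0 ^ l) * (var 0 * rn H) ^ m)" if "c \<in> polys B n" for c l m
      using that v0 rn_polys is_subring_one[OF S]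
      by (intro eqv_mult eqv_refl eqv_sym[OF eqv_pow] is_subring_mult[OF S] is_subring_power[OF S]) auto
    then have "eqv (rn c * var 0 ^ l) (rn (c * H ^ m) * var 0 ^ (l + m))" if "c \<in> polys B n" for c l m
      using that by (simp add: rn_def subst_simps power_mult_distrib power_add mult_ac)
    from this[OF *(1), of k k'] this[OF *(3), of k' k]
    have "eqv (P + P') (rn (a * H ^ k') * var 0 ^ (k + k') + rn (a' * H ^ k) * var 0 ^ (k' + k))"
      using * eqv_trans by (intro eqv_add) blast+
    then have "eqv (P + P') (rn (a * H ^ k' + a' * H ^ k) * var 0 ^ (k + k'))"
      by (simp add: rn_def subst_simps algebra_simps)
    moreover have "a * H ^ k' + a' * H ^ k \<in> polys B n"
      using * H by (intro is_subring_add[OF S] is_subring_mult[OF S] is_subring_power[OF S])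
    ultimately show ?case by blast
  next
    case (mult P P')
    then obtain a k a' k' where *: "a \<in> polys B n" "eqv P (rn a * var 0 ^ k)"
      "a' \<in> polys B n" "eqv P' (rn a' * var 0 ^ k')" by blast
    have "eqv (P * P') ((rn a * var 0 ^ k) * (rn a' * var 0 ^ k'))"
      using * mult v0 rn_polys by (intro eqv_mult is_subring_mult[OF S] is_subring_power[OF S]) auto
    then have "eqv (P * P') (rn (a * a') * var 0 ^ (k + k'))"
      by (simp add: rn_def subst_simps power_add algebra_simps)
    then show ?case using * is_subring_mult[OF S] by blast
  qed
  \<comment> \<open>After reduction the numerator of an element of K is divisible by \<pi>, so the
    reduced form is a multiple of the second equation.\<close>
  have KJ: "K \<subseteq> J"
  proof
    fix u assume u: "u \<in> K"
    then obtain a k where a: "a \<in> polys B n" and e: "eqv u (rn a * var 0 ^ k)" using red[of u] unfolding K_def by blast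
    have "u - rn a * var 0 ^ k \<in> K" using e JK by (auto simp: eqv_def)
    then have "u - (u - rn a * var 0 ^ k) \<in> K" by (rule ideal_in_diff[OF S K u])
    then have "eval t a / eval t H ^ k \<in> I"
      by (simp add: K_def eval_simps eval_rn z0 divide_inverse power_inverse)
    then have "divides_in (polys B n) \<pi> a" using I_iff[OF a] by blast
    then obtain c where c: "c \<in> polys B n" "a = \<pi> * c" by (auto simp: divides_in_def)
    have "(rn c * var 0 ^ k) * rn \<pi> \<in> J"
      using c rn_polys v0 Jmem by (intro Jmul is_subring_mult[OF S] is_subring_power[OF S])
    then have "rn a * var 0 ^ k \<in> J" using c by (simp add: rn_def subst_simps algebra_simps)
    then show "u \<in> J" using Jadd[of "u - rn a * var 0 ^ k" "rn a * var 0 ^ k"] e by (simp add: eqv_def)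
  qed
  have JKeq: "J = K" using JK KJ by blast
  define hh where "hh u = I +>\<^bsub>ring_of A\<^esub> eval z u" for u
  have crP: "cring PS" using S cring_ring_of_iff by (auto simp: PS_def)
  have crA: "cring (ring_of A)" using A cring_ring_of_iff by blast
  have idI: "ideal I (ring_of A)" using I ideal_ring_of_iff[OF A] by blast
  interpret I: ideal I "ring_of A" by (rule idI)
  have idJ: "ideal J PS" using Jp(2) ideal_ring_of_iff[OF S] by (simp add: PS_def)
  interpret J: ideal J PS by (rule idJ)
  have hh_hom: "hh \<in> Ring.ring_hom PS (ring_of A Quot I)"
  proof (rule ring_hom_memI)
    fix x y assume "x \<in> carrier PS" "y \<in> carrier PS"
    then have xy: "eval z x \<in> A" "eval z y \<in> A" using ev_A by (auto simp: PS_def)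
    show "hh x \<in> carrier (ring_of A Quot I)"
      using xy by (auto simp: hh_def FactRing_def A_RCOSETS_def' )
    show "hh (x \<otimes>\<^bsub>PS\<^esub> y) = hh x \<otimes>\<^bsub>ring_of A Quot I\<^esub> hh y"
      using I.rcoset_mult_add[of "eval z x" "eval z y"] xy by (simp add: hh_def PS_def eval_simps FactRing_def)
    show "hh (x \<oplus>\<^bsub>PS\<^esub> y) = hh x \<oplus>\<^bsub>ring_of A Quot I\<^esub> hh y"
      using I.a_rcos_sum[of "eval z x" "eval z y"] xy by (simp add: hh_def PS_def eval_simps FactRing_def)
  qed (simp add: hh_def PS_def eval_simps FactRing_def)
  interpret hh: ring_hom_ring PS "ring_of A Quot I" hh
    by (rule ring_hom_ringI2[OF cring.axioms(1)[OF crP] I.quotient_is_ring hh_hom])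
  have ker: "a_kernel PS (ring_of A Quot I) hh = J"
  proof -
    have "hh u = I \<longleftrightarrow> eval z u \<in> I" if "u \<in> polys B (Suc n)" for u
    proof -
      have "I +>\<^bsub>ring_of A\<^esub> 0 = I" unfolding coset_ring_of by simp
      then show ?thesis using coset_eq_iff[OF A I, of "eval z u" 0] by (simp add: hh_def)
    qed
    then have "{u \<in> polys B (Suc n). hh u = I} = K" unfolding K_def by blast
    moreover have "a_kernel PS (ring_of A Quot I) hh = {u \<in> carrier PS. hh u = \<zero>\<^bsub>ring_of A Quot I\<^esub>}"
      unfolding a_kernel_def' ..
    moreover have "\<zero>\<^bsub>ring_of A Quot I\<^esub> = I" "carrier PS = polys B (Suc n)"
      by (simp_all add: FactRing_def PS_def)
    ultimately show ?thesis unfolding JKeq by simp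
  qed
  have surj: "hh ` carrier PS = carrier (ring_of A Quot I)"
  proof (intro equalityI subsetI)
    fix X assume "X \<in> carrier (ring_of A Quot I)"
    then obtain x where x: "x \<in> A" "X = I +>\<^bsub>ring_of A\<^esub> x"
      by (auto simp: FactRing_def A_RCOSETS_def')
    then obtain a k where a: "a \<in> polys B n" "x = eval t a / eval t H ^ k" by (auto simp: A_def localized_ring_def)
    have "x = eval z (rn a * var 0 ^ k)" using a by (simp add: eval_simps eval_rn z0 divide_inverse power_inverse)
    moreover have "rn a * var 0 ^ k \<in> polys B (Suc n)"
      using a rn_polys v0 by (intro is_subring_mult[OF S] is_subring_power[OF S])
    ultimately show "X \<in> hh ` carrier PS" using x by (auto simp: hh_def PS_def)
  qed (use hh.hom_closed in blast)
  define \<phi> where "\<phi> = (\<lambda>X. the_elem (hh ` X))"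
  have iso: "\<phi> \<in> ring_iso (PS Quot J) (ring_of A Quot I)"
    using hh.FactRing_iso_set[OF surj] unfolding ker \<phi>_def .
  have \<phi>: "\<phi> (J +>\<^bsub>PS\<^esub> x) = I +>\<^bsub>ring_of A\<^esub> eval z x" if "x \<in> polys B (Suc n)" for x
  proof -
    have "the_elem (hh ` (J +>\<^bsub>PS\<^esub> x)) = hh x"
      using hh.the_elem_simp[of x] that unfolding ker by (simp add: PS_def)
    then show ?thesis unfolding \<phi>_def by (simp add: hh_def)
  qed
  define M where "M = mat 2 2 (\<lambda>(i, j). partial_deriv j (g i))"
  have dg: "partial_deriv 0 (g 0) = rn H" "partial_deriv 0 (g (Suc 0)) = 0"
    "partial_deriv (Suc 0) (g (Suc 0)) = rn (partial_deriv j \<pi>)"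
    using rn_d0[OF H(1)] rn_d0[OF \<pi>p] rn_d1[OF \<pi>p] partial_deriv_const[of 0 "1::'k"]
    by (simp_all add: g_def partial_deriv_diff partial_deriv_mult partial_deriv_var)
  have "upper_triangular M" by (auto simp: M_def upper_triangular_def less_2_cases_iff dg)
  then have "det M = prod_list (diag_mat M)"
    by (intro det_upper_triangular[of _ 2]) (auto simp: M_def)
  also have "\<dots> = rn H * rn (partial_deriv j \<pi>)"
    by (simp add: diag_mat_def M_def numeral_2_eq_2 dg)
  finally have det: "det M = rn H * rn (partial_deriv j \<pi>)" .
  have detP: "det M \<in> polys B (Suc n)"
    unfolding det by (intro is_subring_mult[OF S] rn_polys H(1) partial_deriv_polys[OF B \<pi>p])
  have "J +>\<^bsub>PS\<^esub> det M \<in> Units (PS Quot J)"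
  proof -
    obtain e where e: "e \<in> A" "eval t (partial_deriv j \<pi>) * e = 1"
      using unit that[of "inverse (eval t (partial_deriv j \<pi>))"] by (simp add: unit_in_def)
    then obtain a k where a: "a \<in> polys B n" "e = eval t a / eval t H ^ k" by (auto simp: A_def localized_ring_def)
    \<comment> \<open>An inverse of the determinant: the first Z inverts H, and the other factor
      lifts the inverse e of the derivative of \<pi>.\<close>
    define w where "w = var 0 * (rn a * var 0 ^ k)"
    have w: "w \<in> polys B (Suc n)"
      unfolding w_def using a rn_polys v0 by (intro is_subring_mult[OF S] is_subring_power[OF S])
    have "eval z w = inverse (eval t H) * e"
      using a by (simp add: w_def eval_simps eval_rn z0 divide_inverse power_inverse)
    then have "eval z (det M * w) = (eval t H * inverse (eval t H)) * (eval t (partial_deriv j \<pi>) * e)"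
      by (simp add: det eval_simps eval_rn)
    then have "eval z (det M * w) = 1" using e H0 by simp
    then have "eval z (det M * w - 1) = 0" by (simp add: eval_simps)
    then have "det M * w - 1 \<in> J"
      using I is_subring_mult[OF S detP w] is_subring_one[OF S] is_subring_diff[OF S]
      unfolding JKeq K_def by (auto simp: ideal_in_def)
    then have "J +>\<^bsub>PS\<^esub> (det M * w) = J +>\<^bsub>PS\<^esub> 1"
      unfolding PS_def using coset_eq_iff[OF S Jp(2)] by blast
    then have 1: "(J +>\<^bsub>PS\<^esub> det M) \<otimes>\<^bsub>PS Quot J\<^esub> (J +>\<^bsub>PS\<^esub> w) = \<one>\<^bsub>PS Quot J\<^esub>"
      using J.rcoset_mult_add[of "det M" w] detP w by (simp add: FactRing_def PS_def)
    interpret Q: cring "PS Quot J" using J.quotient_is_cring[OF crP] .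
    have "J +>\<^bsub>PS\<^esub> det M \<in> carrier (PS Quot J)" "J +>\<^bsub>PS\<^esub> w \<in> carrier (PS Quot J)"
      using detP w by (auto simp: FactRing_def A_RCOSETS_def' PS_def)
    then show ?thesis using 1 Q.m_comm unfolding Units_def by force
  qed
  then have unitM: "J +>\<^bsub>PS\<^esub> det (mat 2 2 (\<lambda>(i, j). partial_deriv j (g i))) \<in> Units (PS Quot J)"
    unfolding M_def .
  have base: "\<forall>b\<in>B. \<phi> (J +>\<^bsub>PS\<^esub> const b) = I +>\<^bsub>ring_of A\<^esub> const_fun b"
    using \<phi>[OF const_polys] by (simp add: mpoly_eval_const[OF ring_map_const_fun])
  \<comment> \<open>There are two equations in n + 1 variables; n is positive because j < n.\<close>
  have "2 \<le> Suc n" using j by simp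
  then show ?thesis
    unfolding standard_smooth_def Let_def
    using g_polys iso[unfolded J_def PS_def] base[unfolded J_def PS_def] unitM[unfolded J_def PS_def]
    by blast
qed

section \<open>Derivations and differentials\<close>

text \<open>The extension of \<open>\<partial>/\<partial>t\<^sub>j\<close> to the fractions of polynomials in the coordinates \<open>t\<close>.\<close>

definition coord_deriv :: "nat \<Rightarrow> (nat \<Rightarrow> 'k::field ratfun) \<Rightarrow> nat \<Rightarrow> 'k ratfun \<Rightarrow> 'k ratfun" where
  "coord_deriv n t j r = (SOME d. \<exists>a\<in>polys UNIV n. \<exists>b\<in>polys UNIV n. eval t b \<noteq> 0 \<and> r = eval t a / eval t b \<and>
     d = (eval t (partial_deriv j a) * eval t b - eval t a * eval t (partial_deriv j b)) / eval t b ^ 2)"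

text \<open>The second hypothesis says that a / b and a' / b' are the same fraction, the first is
  its derivative. So the quotient rule does not depend on the representation.\<close>

lemma quotient_rule_cong:
  fixes a :: "'f::idom"
  assumes "A * b' + a * B' = A' * b + a' * B" "a * b' = a' * b"
  shows "(A' * b' - a' * B') * b ^ 2 = (A * b - a * B) * b' ^ 2"
proof -
  have "(A' * b' - a' * B') * b ^ 2 = (A' * b + a' * B) * b * b' - (a' * b) * b * B' - (a' * b) * B * b'"
    by (simp add: algebra_simps power2_eq_square)
  also have "\<dots> = (A * b' + a * B') * b * b' - (a * b') * b * B' - (a * b') * B * b'"
    unfolding assms ..
  also have "\<dots> = (A * b - a * B) * b' ^ 2" by (simp add: algebra_simps power2_eq_square)
  finally show ?thesis .
qed

lemma coord_deriv_fraction: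
  assumes t: "alg_independent n t" and ab: "a \<in> polys UNIV n" "b \<in> polys UNIV n" "eval t b \<noteq> 0"
  shows "coord_deriv n t j (eval t a / eval t b) =
    (eval t (partial_deriv j a) * eval t b - eval t a * eval t (partial_deriv j b)) / eval t b ^ 2"
  unfolding coord_deriv_def
proof (rule some_equality)
  show "\<exists>a'\<in>polys UNIV n. \<exists>b'\<in>polys UNIV n. eval t b' \<noteq> 0 \<and> eval t a / eval t b = eval t a' / eval t b' \<and>
     (eval t (partial_deriv j a) * eval t b - eval t a * eval t (partial_deriv j b)) / eval t b ^ 2 =
     (eval t (partial_deriv j a') * eval t b' - eval t a' * eval t (partial_deriv j b')) / eval t b' ^ 2"
    using ab by blast
  fix d assume "\<exists>a'\<in>polys UNIV n. \<exists>b'\<in>polys UNIV n. eval t b' \<noteq> 0 \<and> eval t a / eval t b = eval t a' / eval t b' \<and>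
     d = (eval t (partial_deriv j a') * eval t b' - eval t a' * eval t (partial_deriv j b')) / eval t b' ^ 2"
  then obtain a' b' where *: "a' \<in> polys UNIV n" "b' \<in> polys UNIV n" "eval t b' \<noteq> 0"
    "eval t a / eval t b = eval t a' / eval t b'"
    "d = (eval t (partial_deriv j a') * eval t b' - eval t a' * eval t (partial_deriv j b')) / eval t b' ^ 2"
    by blast
  note S = is_subring_polys[OF is_subring_UNIV]
  have e: "eval t (a * b') = eval t (a' * b)" using * ab(3) by (simp add: eval_simps field_simps)
  then have "a * b' = a' * b"
    using alg_independent_eq[OF t is_subring_mult[OF S ab(1) *(2)] is_subring_mult[OF S *(1) ab(2)]] by blast
  then have "partial_deriv j (a * b') = partial_deriv j (a' * b)" by simp
  then have "eval t (partial_deriv j a * b' + a * partial_deriv j b') = eval t (partial_deriv j a' * b + a' * partial_deriv j b)"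
    by (simp add: partial_deriv_mult)
  then have e1: "eval t (partial_deriv j a) * eval t b' + eval t a * eval t (partial_deriv j b') =
      eval t (partial_deriv j a') * eval t b + eval t a' * eval t (partial_deriv j b)" by (simp add: eval_simps)
  have e2: "eval t a * eval t b' = eval t a' * eval t b" using e by (simp add: eval_simps)
  have "(eval t (partial_deriv j a') * eval t b' - eval t a' * eval t (partial_deriv j b')) * eval t b ^ 2 =
      (eval t (partial_deriv j a) * eval t b - eval t a * eval t (partial_deriv j b)) * eval t b' ^ 2"
    using quotient_rule_cong[OF e1 e2] .
  then show "d = (eval t (partial_deriv j a) * eval t b - eval t a * eval t (partial_deriv j b)) / eval t b ^ 2"
    using *(3) ab(3) unfolding *(5) by (simp add: frac_eq_eq)
qed

lemma coord_deriv_eval: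
  assumes "alg_independent n t" "a \<in> polys B n"
  shows "coord_deriv n t j (eval t a) = eval t (partial_deriv j a)"
proof -
  have 1: "1 \<in> polys UNIV n" by (rule is_subring_one[OF is_subring_polys[OF is_subring_UNIV]])
  have d: "partial_deriv j 1 = (0 :: 'a mpoly)" using partial_deriv_const[of j 1] by simp
  show ?thesis
    using coord_deriv_fraction[OF assms(1) polys_UNIV[OF assms(2)] 1, of j] by (simp add: eval_simps d)
qed

text \<open>Elements of R have denominators that are units of R, and the quotient rule only squares
  them.\<close>

lemma coord_deriv_local:
  assumes B: "is_subring B" and t: "alg_independent n t" and R: "local_of (affine_ring B n t) R"
    and r: "r \<in> R"
  shows "coord_deriv n t j r \<in> R"
    and "s \<in> R \<Longrightarrow> coord_deriv n t j (r + s) = coord_deriv n t j r + coord_deriv n t j s"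
    and "s \<in> R \<Longrightarrow> coord_deriv n t j (r * s) = coord_deriv n t j s * r + coord_deriv n t j r * s"
proof -
  note sr = local_of_subring[OF R] and S = is_subring_polys[OF B, of n]
  obtain a w where a: "a \<in> polys B n" "w \<in> polys B n" "unit_in R (eval t w)" "r = eval t a / eval t w"
    using affine_fraction[OF R r] by blast
  have w0: "eval t w \<noteq> 0" using a by (simp add: unit_in_def)
  have mem: "eval t a \<in> R" if "a \<in> polys B n" for a
    using local_of_subset[OF R] eval_affine_ring[OF that] by blast
  note U = polys_UNIV
  note dr = coord_deriv_fraction[OF t U[OF a(1)] U[OF a(2)] w0, of j, folded a(4)]
  show "coord_deriv n t j r \<in> R"
    unfolding dr
    by (intro unit_in_divide[OF sr] unit_in_power[OF sr] is_subring_diff[OF sr] is_subring_mult[OF sr]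
        mem partial_deriv_polys[OF B] a)
  assume s: "s \<in> R"
  obtain b v where b: "b \<in> polys B n" "v \<in> polys B n" "unit_in R (eval t v)" "s = eval t b / eval t v"
    using affine_fraction[OF R s] by blast
  have v0: "eval t v \<noteq> 0" using b by (simp add: unit_in_def)
  note ds = coord_deriv_fraction[OF t U[OF b(1)] U[OF b(2)] v0, of j, folded b(4)]
  have wv: "w * v \<in> polys B n" "eval t (w * v) \<noteq> 0" using a b w0 v0 is_subring_mult[OF S] by (auto simp: eval_simps)
  have "a * v + b * w \<in> polys B n" using a b by (intro is_subring_add[OF S] is_subring_mult[OF S])
  note d1 = coord_deriv_fraction[OF t U[OF this] U[OF wv(1)] wv(2), of j]
  have "r + s = eval t (a * v + b * w) / eval t (w * v)"
    unfolding a(4) b(4) using w0 v0 by (simp add: eval_simps add_frac_eq)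
  then have "coord_deriv n t j (r + s) = coord_deriv n t j (eval t (a * v + b * w) / eval t (w * v))" by simp
  then show "coord_deriv n t j (r + s) = coord_deriv n t j r + coord_deriv n t j s"
    unfolding d1 dr ds using w0 v0
    by (simp add: eval_simps partial_deriv_add partial_deriv_mult field_simps power2_eq_square)
  have "a * b \<in> polys B n" using a b by (intro is_subring_mult[OF S])
  note d2 = coord_deriv_fraction[OF t U[OF this] U[OF wv(1)] wv(2), of j]
  have "r * s = eval t (a * b) / eval t (w * v)"
    using a(4) b(4) by (simp add: eval_simps)
  then have "coord_deriv n t j (r * s) = coord_deriv n t j (eval t (a * b) / eval t (w * v))" by simp
  also have "\<dots> = (eval t (partial_deriv j b) * eval t v - eval t b * eval t (partial_deriv j v)) / (eval t v)\<^sup>2 * (eval t a / eval t w)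
      + (eval t (partial_deriv j a) * eval t w - eval t a * eval t (partial_deriv j w)) / (eval t w)\<^sup>2 * (eval t b / eval t v)"
    unfolding d2 using w0 v0 by (simp add: eval_simps partial_deriv_mult field_simps power2_eq_square)
  also have "\<dots> = coord_deriv n t j s * r + coord_deriv n t j r * s"
    unfolding dr ds unfolding a(4) b(4) ..
  finally show "coord_deriv n t j (r * s) = coord_deriv n t j s * r + coord_deriv n t j r * s" .
qed

text \<open>A derivation \<open>\<delta>\<close> of \<open>R\<close> over \<open>B\<close> induces the \<open>R\<close>-linear form \<open>c d r \<mapsto> c \<delta>(r)\<close> on differentials.\<close>

definition differential_form :: "('f \<Rightarrow> 'f) \<Rightarrow> ('f::field \<Rightarrow>\<^sub>0 'f) \<Rightarrow> 'f" where
  "differential_form \<delta> u = (\<Sum>r\<in>keys u. lookup u r * \<delta> r)"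

lemma differential_form_superset:
  "finite S \<Longrightarrow> keys u \<subseteq> S \<Longrightarrow> differential_form \<delta> u = (\<Sum>r\<in>S. lookup u r * \<delta> r)"
  unfolding differential_form_def by (rule sum.mono_neutral_left) (auto simp: in_keys_iff)

lemma differential_form_add: "differential_form \<delta> (u + w) = differential_form \<delta> u + differential_form \<delta> w"
  using differential_form_superset[of "keys u \<union> keys w" u \<delta>] differential_form_superset[of "keys u \<union> keys w" w \<delta>]
    differential_form_superset[of "keys u \<union> keys w" "u + w" \<delta>] keys_add[of u w]
  by (simp add: lookup_add distrib_right sum.distrib)

lemma differential_form_single: "differential_form \<delta> (single r c) = c * \<delta> r"
  using differential_form_superset[of "{r}" "single r c" \<delta>] by simp

lemma differential_form_diff: "differential_form \<delta> (u - w) = differential_form \<delta> u - differential_form \<delta> w"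
  using differential_form_add[of \<delta> "u - w" w] by simp

lemma differential_form_sum: "differential_form \<delta> (sum g S) = (\<Sum>i\<in>S. differential_form \<delta> (g i))"
  by (induction S rule: infinite_finite_induct) (auto simp: differential_form_add differential_form_def[of \<delta> 0])

lemma differential_form_scale: "differential_form \<delta> (Poly_Mapping.map (\<lambda>x. r * x) u) = r * differential_form \<delta> u"
proof -
  have "differential_form \<delta> (Poly_Mapping.map (\<lambda>x. r * x) u) = (\<Sum>k\<in>keys u. lookup (Poly_Mapping.map (\<lambda>x. r * x) u) k * \<delta> k)"
    by (rule differential_form_superset) (auto simp: in_keys_iff map.rep_eq)
  then show ?thesis by (simp add: map.rep_eq differential_form_def sum_distrib_left mult.assoc when_def in_keys_iff)
qed

text \<open>The linear form given by a derivation kills the Kaehler relations and sends coefficients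
  in the maximal ideal into the maximal ideal. A relation between differentials thus becomes one
  between partial derivatives, and independence can be read off a Jacobian matrix.\<close>

lemma fibre_relations_deriv:
  assumes B: "is_subring B" and t: "alg_independent n t" and R: "local_of (affine_ring B n t) R"
    and F: "finite F" "\<And>i. i \<in> F \<Longrightarrow> g i \<in> polys B n"
    and rel: "(\<Sum>i\<in>F. single (eval t (g i)) (c i)) \<in> fibre_relations (const_fun ` B) R"
  shows "(\<Sum>i\<in>F. c i * eval t (partial_deriv j (g i))) \<in> max_ideal R"
proof -
  note sr = local_of_subring[OF R] and locR = local_of_local[OF R]
  let ?\<delta> = "coord_deriv n t j"
  note \<delta> = coord_deriv_local[OF B t R]
  have 1: "differential_form ?\<delta> u = 0" if "u \<in> kaehler_relations (const_fun ` B) R" for u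
    using that
  proof induction
    case (d_base b)
    then obtain b' where "b' \<in> B" "b = const_fun b'" by blast
    then show ?case
      using coord_deriv_eval[OF t const_polys[of b' B n], of j]
      by (simp add: differential_form_single eval_simps)
  qed (simp_all add: differential_form_add differential_form_diff differential_form_single
      differential_form_scale \<delta> differential_form_def[of _ 0])
  obtain u w where uw: "(\<Sum>i\<in>F. single (eval t (g i)) (c i)) = u + w"
    "u \<in> kaehler_relations (const_fun ` B) R" "\<And>r. r \<in> keys w \<Longrightarrow> r \<in> R \<and> lookup w r \<in> max_ideal R"
    using rel unfolding fibre_relations_def by blast
  have "(\<Sum>i\<in>F. c i * eval t (partial_deriv j (g i))) = differential_form ?\<delta> (\<Sum>i\<in>F. single (eval t (g i)) (c i))"
    by (simp add: differential_form_sum differential_form_single coord_deriv_eval[OF t F(2)])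
  also have "\<dots> = differential_form ?\<delta> w" unfolding uw(1) differential_form_add using 1[OF uw(2)] by simp
  also have "\<dots> \<in> max_ideal R"
    unfolding differential_form_def using uw(3) \<delta>(1)
    by (intro max_ideal_sum[OF locR] max_ideal_mult'[OF locR]) auto
  finally show ?thesis .
qed


section \<open>Components of a divisor given by local equations\<close>

text \<open>Instantiated with projective space and with the blowup; the structure of components then
  rests on local equations only.\<close>

locale separated_model =
  fixes B :: "'k::field_char_0 set" and M :: "'k ratfun model"
  assumes B_factorial: "factorial_in B"
    and M_local: "\<And>R. R \<in> M \<Longrightarrow> local_ring R"
    and M_const: "\<And>R. R \<in> M \<Longrightarrow> const_fun ` B \<subseteq> R"
    and M_separated: "separated M"
begin

lemma B_subring: "is_subring B"
  using B_factorial by (simp add: factorial_in_def)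

lemma M_subring: "R \<in> M \<Longrightarrow> is_subring R"
  using M_local local_ring_subring by blast

lemma topspace_M: "topspace (zariski M) = M"
  using topspace_zariski M_subring by blast

lemma openin_spec_localized:
  assumes H: "H \<in> polys B n" "eval t H \<noteq> 0" and sub: "spec (localized_ring B n t H) \<subseteq> M"
  shows "openin (zariski M) (spec (localized_ring B n t H))"
proof (rule openin_spec[OF is_subring_localized_ring[OF B_subring H] sub M_local M_separated])
  let ?T = "insert (inverse (eval t H)) (t ` {..<n})"
  show "finite ?T" by simp
  show "?T \<subseteq> localized_ring B n t H"
    using inverse_localized[OF B_subring, of t H n] coord_affine_ring[OF B_subring, of _ n t]
      subsetD[OF affine_ring_localized, of _ B n t H] by auto
  fix R assume R: "R \<in> M" "?T \<subseteq> R"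
  have "affine_ring B n t \<subseteq> R"
    using R M_const by (intro affine_ring_subset M_subring) auto
  then show "localized_ring B n t H \<subseteq> R"
    using R H eval_affine_ring[OF H(1), of t]
    by (intro localized_ring_subset M_subring) (auto simp: unit_in_def)
qed

text \<open>The complement is the union of the domains of the functions that do not lie in
  \<eta>.\<close>

lemma closedin_below: "closedin (zariski M) {Q \<in> M. Q \<subseteq> \<eta>}"
proof -
  have "M - {Q \<in> M. Q \<subseteq> \<eta>} = \<Union>{{Q \<in> M. g \<in> Q} | g. g \<notin> \<eta>}" by auto
  moreover have "openin (zariski M) (\<Union>{{Q \<in> M. g \<in> Q} | g. g \<notin> \<eta>})"
    using openin_zariski_basic by (intro openin_Union) blast
  ultimately show ?thesis by (simp add: closedin_def topspace_M)
qed

lemma closedin_downward: "closedin (zariski M) F \<Longrightarrow> \<eta> \<in> F \<Longrightarrow> Q \<in> M \<Longrightarrow> Q \<subseteq> \<eta> \<Longrightarrow> Q \<in> F"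
  using openin_zariski_upward[of M "M - F" Q \<eta>] by (auto simp: closedin_def topspace_M)

lemma irreducible_below: "\<eta> \<in> M \<Longrightarrow> irreducible_in (zariski M) {Q \<in> M. Q \<subseteq> \<eta>}"
  unfolding irreducible_in_def topspace_M using closedin_downward by blast

lemma irreducible_finite_union:
  assumes Z: "irreducible_in T Z" and "finite I" "\<And>i. i \<in> I \<Longrightarrow> closedin T (F i)" "Z \<subseteq> (\<Union>i\<in>I. F i)"
  shows "\<exists>i\<in>I. Z \<subseteq> F i"
  using assms(2-)
proof (induction I rule: finite_induct)
  case empty
  then show ?case using Z by (auto simp: irreducible_in_def)
next
  case (insert x I)
  have "closedin T (F x)" "closedin T (\<Union>i\<in>I. F i)" "Z \<subseteq> F x \<union> (\<Union>i\<in>I. F i)"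
    using insert by (auto intro!: closedin_Union)
  then have "Z \<subseteq> F x \<or> Z \<subseteq> (\<Union>i\<in>I. F i)" using Z unfolding irreducible_in_def by blast
  then show ?case using insert by blast
qed

text \<open>Every neighbourhood of R contains its generization \<eta>, so vanishing near R on the
  component implies vanishing at \<eta>. Conversely, an element of Q that becomes a nonunit in the
  larger ring \<eta> was a nonunit in Q.\<close>

lemma reduced_ideal_below:
  assumes "\<eta> \<in> M" "R \<in> M" "R \<subseteq> \<eta>"
  shows "reduced_ideal M {Q \<in> M. Q \<subseteq> \<eta>} R = R \<inter> max_ideal \<eta>"
proof (intro equalityI subsetI)
  fix r assume "r \<in> reduced_ideal M {Q \<in> M. Q \<subseteq> \<eta>} R"
  then obtain U where "r \<in> R" "openin (zariski M) U" "R \<in> U" "\<forall>Q\<in>U \<inter> {Q \<in> M. Q \<subseteq> \<eta>}. r \<in> max_ideal Q"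
    by (auto simp: reduced_ideal_def)
  then show "r \<in> R \<inter> max_ideal \<eta>" using openin_zariski_upward assms by blast
next
  fix r assume r: "r \<in> R \<inter> max_ideal \<eta>"
  have "openin (zariski M) {Q \<in> M. r \<in> Q}" by (rule openin_zariski_basic)
  moreover have "r \<in> max_ideal Q" if "Q \<in> {Q \<in> M. r \<in> Q} \<inter> {Q \<in> M. Q \<subseteq> \<eta>}" for Q
    using that r unit_in_mono[of Q r \<eta>] by (auto simp: max_ideal_eq)
  ultimately show "r \<in> reduced_ideal M {Q \<in> M. Q \<subseteq> \<eta>} R"
    using r assms unfolding reduced_ideal_def by blast
qed

text \<open>A function of R that is not in \<eta> has a domain that misses the component, so the
  vanishing condition is empty there.\<close>

lemma reduced_ideal_outside:
  assumes "R \<in> M" "\<not> R \<subseteq> \<eta>"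
  shows "reduced_ideal M {Q \<in> M. Q \<subseteq> \<eta>} R = R"
proof -
  obtain g where "g \<in> R" "g \<notin> \<eta>" using assms by blast
  then have "openin (zariski M) {Q \<in> M. g \<in> Q}" "R \<in> {Q \<in> M. g \<in> Q}"
    "{Q \<in> M. g \<in> Q} \<inter> {Q \<in> M. Q \<subseteq> \<eta>} = {}"
    using assms openin_zariski_basic by auto
  then show ?thesis unfolding reduced_ideal_def by blast
qed

text \<open>
  Local equations \<open>Gs\<close> of \<open>D\<close> at \<open>R\<close> in coordinates \<open>t\<close>, valid where \<open>h\<close> is invertible: either one
  smooth branch, or a coordinate hyperplane crossed by a branch transversal to it.
\<close>

definition local_equations where
  "local_equations D n R t h Gs \<longleftrightarrow>
     alg_independent n t \<and> h \<in> polys B n \<and> local_of (affine_ring B n t) R \<and> unit_in R (eval t h) \<and>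
     spec (localized_ring B n t h) \<subseteq> M \<and> Gs \<subseteq> polys B n \<and> (\<forall>G\<in>Gs. \<not> unit_in R (eval t G)) \<and>
     (\<forall>Q\<in>spec (localized_ring B n t h). Q \<in> D \<longleftrightarrow> (\<exists>G\<in>Gs. \<not> unit_in Q (eval t G))) \<and>
     ((\<exists>G. Gs = {G} \<and> (\<exists>j<n. unit_in R (eval t (partial_deriv j G)))) \<or>
      (\<exists>l G. Gs = {var l, G} \<and> l < n \<and> (\<exists>j<n. j \<noteq> l \<and> unit_in R (eval t (partial_deriv j G)))))"

lemma local_equations_props:
  assumes L: "local_equations D n R t h Gs"
  shows "eval t h \<noteq> 0" "finite Gs" "\<forall>G\<in>Gs. \<exists>j<n. unit_in R (eval t (partial_deriv j G))" "R \<in> M"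
    "R \<in> spec (localized_ring B n t h)" "openin (zariski M) (spec (localized_ring B n t h))"
proof -
  show h0: "eval t h \<noteq> 0" using L by (auto simp: local_equations_def unit_in_def)
  show "finite Gs" using L by (auto simp: local_equations_def)
  have R: "local_of (affine_ring B n t) R" using L by (simp add: local_equations_def)
  have "unit_in R (eval t (partial_deriv l (var l)))" for l
    using unit_in_one[OF local_of_subring[OF R]] by (simp add: partial_deriv_var eval_simps)
  then show "\<forall>G\<in>Gs. \<exists>j<n. unit_in R (eval t (partial_deriv j G))"
    using L unfolding local_equations_def by blast
  show 1: "R \<in> spec (localized_ring B n t h)"
    using L h0 local_of_localized_iff[OF B_subring, of h n t R] is_subring_localized_ring[OF B_subring, of h n t]
    unfolding spec_iff local_equations_def by blast
  then show "R \<in> M" using L by (auto simp: local_equations_def)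
  show "openin (zariski M) (spec (localized_ring B n t h))"
    using L h0 openin_spec_localized unfolding local_equations_def by blast
qed

text \<open>Each equation is the product of a prime that vanishes at R and a cofactor that does
  not.\<close>

definition local_primes where
  "local_primes n R t Gs \<pi> u \<longleftrightarrow>
     (\<forall>G\<in>Gs. prime_in (polys B n) (\<pi> G) \<and> u G \<in> polys B n \<and> G = \<pi> G * u G \<and>
        \<not> unit_in R (eval t (\<pi> G)) \<and> unit_in R (eval t (u G)))"

lemma local_primes_exist:
  assumes L: "local_equations D n R t h Gs"
  shows "\<exists>\<pi> u. local_primes n R t Gs \<pi> u"
proof -
  have R: "local_of (affine_ring B n t) R" using L by (simp add: local_equations_def)
  have "\<exists>\<pi> u. prime_in (polys B n) \<pi> \<and> u \<in> polys B n \<and> G = \<pi> * u \<and>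
        \<not> unit_in R (eval t \<pi>) \<and> unit_in R (eval t u)" if G: "G \<in> Gs" for G
  proof -
    obtain j where "unit_in R (eval t (partial_deriv j G))" using local_equations_props(3)[OF L] G by blast
    moreover have "G \<in> polys B n" "\<not> unit_in R (eval t G)" using L G by (auto simp: local_equations_def)
    ultimately show ?thesis
      using prime_factor_at[OF B_factorial local_of_local[OF R] local_of_subset[OF R]] by blast
  qed
  then show ?thesis unfolding local_primes_def by metis
qed

text \<open>Near R the divisor is covered by the closures of the generic points of the primes. C is
  irreducible, so it lies in one of these closures or in the complement of the neighbourhood; R
  excludes the latter, and maximality of C gives equality.\<close>

lemma component_local:
  assumes L: "local_equations D n R t h Gs" and P: "local_primes n R t Gs \<pi> u"
    and D: "closedin (zariski M) D" and C: "C \<in> irreducible_components (zariski M) D" and R: "R \<in> C"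
  shows "\<exists>G\<in>Gs. C = {Q \<in> M. Q \<subseteq> generic_point B n t (\<pi> G)}"
    and "\<And>G. G \<in> Gs \<Longrightarrow> generic_point B n t (\<pi> G) \<in> M"
proof -
  note Lp = local_equations_props[OF L]
  let ?\<eta> = "\<lambda>G. generic_point B n t (\<pi> G)" and ?S = "spec (localized_ring B n t h)"
  have t: "alg_independent n t" and h: "h \<in> polys B n" and lR: "local_of (affine_ring B n t) R"
    and uh: "unit_in R (eval t h)" and sub: "?S \<subseteq> M" and Gs: "Gs \<subseteq> polys B n"
    and DQ: "\<And>Q. Q \<in> ?S \<Longrightarrow> Q \<in> D \<longleftrightarrow> (\<exists>G\<in>Gs. \<not> unit_in Q (eval t G))"
    using L by (auto simp: local_equations_def)
  have P': "prime_in (polys B n) (\<pi> G)" "u G \<in> polys B n" "G = \<pi> G * u G" "\<not> unit_in R (eval t (\<pi> G))"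
    "unit_in R (eval t (u G))" if "G \<in> Gs" for G
    using P that unfolding local_primes_def by blast+
  have spec: "Q \<in> ?S \<longleftrightarrow> local_of (affine_ring B n t) Q \<and> unit_in Q (eval t h)" for Q
    unfolding spec_iff local_of_localized_iff[OF B_subring h Lp(1)]
    using is_subring_localized_ring[OF B_subring h Lp(1)] by blast
  have \<eta>: "?\<eta> G \<in> ?S" "R \<subseteq> ?\<eta> G" "?\<eta> G \<in> D" if G: "G \<in> Gs" for G
  proof -
    note gp = generic_point_props[OF B_subring t P'(1)[OF G]]
    show R\<eta>: "R \<subseteq> ?\<eta> G" using subset_generic_point_iff[OF B_subring t P'(1)[OF G] lR] P'(4)[OF G] by blast
    show 1: "?\<eta> G \<in> ?S" unfolding spec using gp(1) unit_in_mono[OF uh R\<eta>] by blast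
    have "divides_in (polys B n) (\<pi> G) G" using P'(2,3)[OF G] unfolding divides_in_def by blast
    then show "?\<eta> G \<in> D" unfolding DQ[OF 1] using gp(2) G Gs by blast
  qed
  then show "\<And>G. G \<in> Gs \<Longrightarrow> ?\<eta> G \<in> M" using sub by blast
  \<comment> \<open>On U all cofactors are invertible, so a point of D in U lies on one of the
    vanishing primes.\<close>
  define U where "U = ?S \<inter> {Q \<in> M. (\<lambda>G. inverse (eval t (u G))) ` Gs \<subseteq> Q}"
  have U: "openin (zariski M) U"
    unfolding U_def using Lp(6) openin_zariski_contains[OF M_subring] Lp(2) by (intro openin_Int) auto
  have RU: "R \<in> U" using Lp(4,5) P'(5) by (auto simp: U_def unit_in_def)
  have CD: "C \<subseteq> D" and Cirr: "irreducible_in (zariski M) C"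
    and Cmax: "\<And>C'. C' \<subseteq> D \<Longrightarrow> irreducible_in (zariski M) C' \<Longrightarrow> C \<subseteq> C' \<Longrightarrow> C' = C"
    using C by (auto simp: irreducible_components_def)
  \<comment> \<open>\<open>None\<close> stands for the complement of U; together with the closures
    of the generic points it covers C.\<close>
  define F where "F i = (case i of None \<Rightarrow> M - U | Some G \<Rightarrow> {Q \<in> M. Q \<subseteq> ?\<eta> G})" for i
  have cover: "Q \<in> (\<Union>i\<in>insert None (Some ` Gs). F i)" if Q: "Q \<in> C" for Q
  proof (cases "Q \<in> U")
    case True
    then have QS: "Q \<in> ?S" and inv: "\<And>G. G \<in> Gs \<Longrightarrow> inverse (eval t (u G)) \<in> Q" by (auto simp: U_def)
    then obtain G where G: "G \<in> Gs" "\<not> unit_in Q (eval t G)" using DQ Q CD by blast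
    have lQ: "local_of (affine_ring B n t) Q" using QS spec by blast
    have mem: "eval t a \<in> Q" if "a \<in> polys B n" for a
      using local_of_subset[OF lQ] eval_affine_ring[OF that] by blast
    have "unit_in Q (eval t (u G))"
      using mem[OF P'(2)] inv P'(5) G by (auto simp: unit_in_def)
    moreover have "eval t G = eval t (\<pi> G) * eval t (u G)" using P'(3)[OF G(1)] by (metis ring_map_mult ring_map_eval)
    moreover have "\<pi> G \<in> polys B n" using P'(1)[OF G(1)] by (simp add: prime_in_def)
    ultimately have "\<not> unit_in Q (eval t (\<pi> G))"
      using G(2) unit_in_mult_iff[OF local_of_subring[OF lQ] mem mem] P'(2)[OF G(1)] by metis
    then have "Q \<subseteq> ?\<eta> G" using subset_generic_point_iff[OF B_subring t P'(1)[OF G(1)] lQ] by blast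
    then show ?thesis using G QS sub by (auto simp: F_def)
  next
    case False
    then show ?thesis using Q Cirr topspace_M by (auto simp: F_def irreducible_in_def)
  qed
  have "\<exists>i\<in>insert None (Some ` Gs). C \<subseteq> F i"
  proof (rule irreducible_finite_union[OF Cirr])
    show "closedin (zariski M) (F i)" for i
      using closedin_below U unfolding F_def
      by (auto split: option.splits simp: closedin_def topspace_M openin_zariski_subset double_diff)
  qed (use Lp(2) cover in auto)
  then obtain G where G: "G \<in> Gs" "C \<subseteq> {Q \<in> M. Q \<subseteq> ?\<eta> G}" using R RU by (auto simp: F_def)
  have "{Q \<in> M. Q \<subseteq> ?\<eta> G} \<subseteq> D" using closedin_downward[OF D \<eta>(3)[OF G(1)]] by blast
  then have "{Q \<in> M. Q \<subseteq> ?\<eta> G} = C"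
    using Cmax irreducible_below \<eta>(1)[OF G(1)] sub G(2) by blast
  then show "\<exists>G\<in>Gs. C = {Q \<in> M. Q \<subseteq> ?\<eta> G}" using G by blast
qed

text \<open>In the chart at a given point the component is the zero set of one prime, with the
  contracted maximal ideal of its generic point as ideal of sections, so the computation of a
  standard smooth hypersurface applies.\<close>

lemma component_smooth:
  assumes D: "closedin (zariski M) D"
    and L: "\<And>R. R \<in> D \<Longrightarrow> \<exists>t h Gs. local_equations D n R t h Gs"
    and C: "C \<in> irreducible_components (zariski M) D"
  shows "smooth_subscheme B M (reduced_ideal M C)"
  unfolding smooth_subscheme_def
proof
  have CD: "C \<subseteq> D" and Cirr: "irreducible_in (zariski M) C"
    using C by (auto simp: irreducible_components_def)
  \<comment> \<open>Any point of C serves to write C as the closure of a single \<eta>. Outside such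
    a closure the reduced ideal is the whole local ring, which places the support inside C.\<close>
  then obtain R0 where R0: "R0 \<in> C" by (auto simp: irreducible_in_def)
  then obtain t0 h0 Gs0 where L0: "local_equations D n R0 t0 h0 Gs0" using L CD by blast
  obtain \<pi>0 u0 where P0: "local_primes n R0 t0 Gs0 \<pi>0 u0" using local_primes_exist[OF L0] by blast
  obtain \<eta> where \<eta>: "\<eta> \<in> M" "C = {Q \<in> M. Q \<subseteq> \<eta>}"
    using component_local[OF L0 P0 D C R0] by blast
  fix R assume "R \<in> supp M (reduced_ideal M C)"
  then have R: "R \<in> M" "reduced_ideal M C R \<noteq> R" by (auto simp: supp_def)
  then have RC: "R \<in> C" using reduced_ideal_outside[of R \<eta>] \<eta> by auto
  then obtain t h Gs where L1: "local_equations D n R t h Gs" using L CD by blast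
  then obtain \<pi>' u' where P1: "local_primes n R t Gs \<pi>' u'" using local_primes_exist by blast
  note Lp = local_equations_props[OF L1]
  have t: "alg_independent n t" and h: "h \<in> polys B n" and lR: "local_of (affine_ring B n t) R"
    and uh: "unit_in R (eval t h)" and sub: "spec (localized_ring B n t h) \<subseteq> M" and Gs: "Gs \<subseteq> polys B n"
    using L1 by (auto simp: local_equations_def)
  obtain G where G: "G \<in> Gs" "C = {Q \<in> M. Q \<subseteq> generic_point B n t (\<pi>' G)}" "generic_point B n t (\<pi>' G) \<in> M"
    using component_local[OF L1 P1 D C RC] by blast
  define \<pi> where "\<pi> = \<pi>' G"
  define u where "u = u' G"
  have \<pi>: "prime_in (polys B n) \<pi>" and u: "u \<in> polys B n" and G_eq: "G = \<pi> * u"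
    and nu: "\<not> unit_in R (eval t \<pi>)" and uu: "unit_in R (eval t u)"
    using P1 G(1) unfolding local_primes_def \<pi>_def u_def by blast+
  let ?\<eta> = "generic_point B n t \<pi>"
  note gp = generic_point_props[OF B_subring t \<pi>] and S = is_subring_polys[OF B_subring, of n]
  have \<pi>p: "\<pi> \<in> polys B n" using \<pi> by (simp add: prime_in_def)
  have C_eq: "C = {Q \<in> M. Q \<subseteq> ?\<eta>}" and \<eta>M: "?\<eta> \<in> M" using G by (simp_all add: \<pi>_def)
  obtain j where j: "j < n" "unit_in R (eval t (partial_deriv j G))" using Lp(3) G(1) by blast
  note locR = local_of_local[OF lR]
  have mem: "eval t a \<in> R" if "a \<in> polys B n" for a
    using local_of_subset[OF lR] eval_affine_ring[OF that] by blast
  note pd = partial_deriv_polys[OF B_subring]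
  \<comment> \<open>By the product rule the derivatives of G and of \<pi>, the latter times the unit
    u, differ by a multiple of \<pi>, which is a nonunit at R.\<close>
  have "eval t \<pi> * eval t (partial_deriv j u) \<in> max_ideal R"
    using nu mem \<pi>p pd[OF u] by (intro max_ideal_mult'[OF locR]) (auto simp: max_ideal_eq)
  then have n1: "\<not> unit_in R (eval t \<pi> * eval t (partial_deriv j u))" by (simp add: max_ideal_eq)
  have "eval t (partial_deriv j G) = eval t \<pi> * eval t (partial_deriv j u) + eval t (partial_deriv j \<pi>) * eval t u"
    by (simp add: G_eq partial_deriv_mult eval_simps)
  then have "unit_in R (eval t (partial_deriv j \<pi>) * eval t u)"
    using local_ring_add[OF locR _ _ _ n1] j(2) mem \<pi>p u pd is_subring_mult[OF local_of_subring[OF lR]] by metis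
  then have ud: "unit_in R (eval t (partial_deriv j \<pi>))"
    using unit_in_mult_iff[OF local_of_subring[OF lR] mem mem] pd[OF \<pi>p] u by blast
  \<comment> \<open>The chart is shrunk until the derivative of \<pi> is a unit in its whole
    coordinate ring and not only at R.\<close>
  define H where "H = h * partial_deriv j \<pi>"
  have H: "H \<in> polys B n" unfolding H_def using h pd[OF \<pi>p] is_subring_mult[OF S] by blast
  have uH: "unit_in R (eval t H)"
    unfolding H_def eval_simps using uh ud unit_in_mult_iff[OF local_of_subring[OF lR] mem mem] h pd[OF \<pi>p] by blast
  then have H0: "eval t H \<noteq> 0" by (simp add: unit_in_def)
  define A where "A = localized_ring B n t H"
  have A: "is_subring A" unfolding A_def by (rule is_subring_localized_ring[OF B_subring H H0])
  have spec: "Q \<in> spec A \<longleftrightarrow> local_of (affine_ring B n t) Q \<and> unit_in Q (eval t H)" for Q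
    unfolding spec_iff A_def local_of_localized_iff[OF B_subring H H0]
    using is_subring_localized_ring[OF B_subring H H0] by blast
  have specM: "spec A \<subseteq> M"
  proof
    fix Q assume Q: "Q \<in> spec A"
    then have lQ: "local_of (affine_ring B n t) Q" using spec by blast
    have "eval t h \<in> Q" "eval t (partial_deriv j \<pi>) \<in> Q"
      using local_of_subset[OF lQ] eval_affine_ring h pd[OF \<pi>p] by blast+
    then have "unit_in Q (eval t h)"
      using Q unit_in_mult_iff[OF local_of_subring[OF lQ]] unfolding spec H_def eval_simps by blast
    then have "Q \<in> spec (localized_ring B n t h)"
      unfolding spec_iff local_of_localized_iff[OF B_subring h Lp(1)]
      using lQ is_subring_localized_ring[OF B_subring h Lp(1)] by blast
    then show "Q \<in> M" using sub by blast
  qed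
  have open_A: "openin (zariski M) (spec A)"
    unfolding A_def using openin_spec_localized[OF H H0] specM A_def by blast
  have RA: "R \<in> spec A" unfolding spec using lR uH by blast
  have R\<eta>: "R \<subseteq> ?\<eta>" using RC C_eq by blast
  have u\<eta>H: "unit_in ?\<eta> (eval t H)" using uH R\<eta> unit_in_mono by blast
  have \<eta>A: "?\<eta> \<in> spec A" unfolding spec using gp(1) u\<eta>H by blast
  have A\<eta>: "A \<subseteq> ?\<eta>" using \<eta>A spec_iff local_of_subset by blast
  have sec: "sections (reduced_ideal M C) A = A \<inter> max_ideal ?\<eta>"
  proof (intro equalityI subsetI)
    fix a assume "a \<in> sections (reduced_ideal M C) A"
    then have "a \<in> A" "a \<in> reduced_ideal M C ?\<eta>" using \<eta>A by (auto simp: sections_def)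
    then show "a \<in> A \<inter> max_ideal ?\<eta>" using reduced_ideal_below[OF \<eta>M \<eta>M] unfolding C_eq by auto
  next
    fix a assume a: "a \<in> A \<inter> max_ideal ?\<eta>"
    have "a \<in> reduced_ideal M C Q" if Q: "Q \<in> spec A" for Q
    proof -
      have "Q \<in> M" "a \<in> Q" using Q specM spec_iff local_of_subset a by blast+
      then show ?thesis
        using reduced_ideal_below[OF \<eta>M, of Q] reduced_ideal_outside[of Q ?\<eta>] a unfolding C_eq by blast
    qed
    then show "a \<in> sections (reduced_ideal M C) A" using a by (auto simp: sections_def)
  qed
  have "\<not> divides_in (polys B n) \<pi> H" using gp(2)[OF H] u\<eta>H by blast
  moreover have "unit_in A (eval t (partial_deriv j \<pi>))"
  proof -
    have m: "eval t h \<in> A" "eval t (partial_deriv j \<pi>) \<in> A" "eval t H \<in> A"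
      unfolding A_def using affine_ring_localized eval_affine_ring h pd[OF \<pi>p] H by blast+
    have "unit_in A (eval t H)"
      using m(3) H0 inverse_localized[OF B_subring, of t H n] by (simp add: unit_in_def A_def)
    then show ?thesis using unit_in_mult_iff[OF A m(1,2)] unfolding H_def eval_simps by blast
  qed
  ultimately have "standard_smooth B (ring_of A Quot (A \<inter> max_ideal ?\<eta>))
      (\<lambda>b. (A \<inter> max_ideal ?\<eta>) +>\<^bsub>ring_of A\<^esub> const_fun b)"
    using standard_smooth_hypersurface[OF B_subring t \<pi> H _ j(1) A_def] by blast
  then show "\<exists>A. affine_open M A \<and> R \<in> spec A \<and>
        standard_smooth B (ring_of A Quot sections (reduced_ideal M C) A)
          (\<lambda>b. sections (reduced_ideal M C) A +>\<^bsub>ring_of A\<^esub> const_fun b)"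
    using open_A RA A cring_ring_of_iff unfolding affine_open_def sec[symmetric] by blast
qed


text \<open>Modulo the maximal ideal the Jacobian matrix with respect to the coordinates j and l is
  triangular: the differential of the hyperplane has a component only along l, that of the other
  branch has a nonzero one along j.\<close>

lemma normal_crossings_local_equations:
  assumes D: "closedin (zariski M) D"
    and L: "\<And>R. R \<in> D \<Longrightarrow> \<exists>t h Gs. local_equations D n R t h Gs"
  shows "normal_crossings (const_fun ` B) M D"
  unfolding normal_crossings_def Let_def
proof (intro ballI impI)
  fix R assume RD: "R \<in> D"
  define CC where "CC = {C \<in> irreducible_components (zariski M) D. R \<in> C}"
  assume "\<exists>C\<in>{C \<in> irreducible_components (zariski M) D. R \<in> C}.
           \<exists>C'\<in>{C \<in> irreducible_components (zariski M) D. R \<in> C}. C \<noteq> C'"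
  then obtain C1 C2 where C12: "C1 \<in> CC" "C2 \<in> CC" "C1 \<noteq> C2" unfolding CC_def by blast
  obtain t h Gs where L1: "local_equations D n R t h Gs" using L RD by blast
  obtain \<pi> u where P1: "local_primes n R t Gs \<pi> u" using local_primes_exist[OF L1] by blast
  have t: "alg_independent n t" and lR: "local_of (affine_ring B n t) R" and Gs: "Gs \<subseteq> polys B n"
    using L1 by (auto simp: local_equations_def)
  note RM = local_equations_props(4)[OF L1] and locR = local_of_local[OF lR] and sr = local_of_subring[OF lR]
  have P: "prime_in (polys B n) (\<pi> G)" "u G \<in> polys B n" "G = \<pi> G * u G" "\<not> unit_in R (eval t (\<pi> G))"
    "unit_in R (eval t (u G))" if "G \<in> Gs" for G
    using P1 that unfolding local_primes_def by blast+
  have \<pi>p: "\<pi> G \<in> polys B n" if "G \<in> Gs" for G using P(1)[OF that] by (simp add: prime_in_def)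
  let ?\<eta> = "\<lambda>G. generic_point B n t (\<pi> G)"
  have ex: "\<exists>G. G \<in> Gs \<and> C = {Q \<in> M. Q \<subseteq> ?\<eta> G}" if "C \<in> CC" for C
    using component_local(1)[OF L1 P1 D, of C] that unfolding CC_def by blast
  \<comment> \<open>A component is determined by its prime, so \<open>eq\<close> is injective on the
    components through R.\<close>
  define eq where "eq C = (SOME G. G \<in> Gs \<and> C = {Q \<in> M. Q \<subseteq> ?\<eta> G})" for C
  have eq: "eq C \<in> Gs" "C = {Q \<in> M. Q \<subseteq> ?\<eta> (eq C)}" if "C \<in> CC" for C
    using someI_ex[OF ex[OF that]] unfolding eq_def by blast+
  have inj: "C = C'" if "C \<in> CC" "C' \<in> CC" "eq C = eq C'" for C C'
    using eq(2)[OF that(1)] eq(2)[OF that(2)] that(3) by simp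
  have "eq C1 \<noteq> eq C2" using inj C12 by blast
  \<comment> \<open>Two components require two different equations, which selects the second
    alternative of \<open>local_equations\<close>.\<close>
  then have "\<not> (\<exists>G. Gs = {G})" using eq(1) C12 by (metis singletonD)
  then obtain l G0 where G0: "Gs = {var l, G0}" "l < n" "\<exists>j<n. j \<noteq> l \<and> unit_in R (eval t (partial_deriv j G0))"
    using L1 unfolding local_equations_def by blast
  then obtain j where j: "j < n" "j \<noteq> l" "unit_in R (eval t (partial_deriv j G0))" by blast
  have mem: "eval t a \<in> R" if "a \<in> polys B n" for a
    using local_of_subset[OF lR] eval_affine_ring[OF that] by blast
  note pd = partial_deriv_polys[OF B_subring]
  text \<open>Modulo the maximal ideal, the differential of \<open>\<pi> G\<close> is that of \<open>G\<close> up to the unit \<open>u G\<close>.\<close>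
  have unit_pd: "unit_in R (eval t (partial_deriv i (\<pi> G))) \<longleftrightarrow> unit_in R (eval t (partial_deriv i G))"
    if G: "G \<in> Gs" for i G
  proof -
    let ?x = "eval t (partial_deriv i (\<pi> G)) * eval t (u G)" and ?y = "eval t (\<pi> G) * eval t (partial_deriv i (u G))"
    have y: "?y \<in> max_ideal R"
      using P(4)[OF G] mem[OF \<pi>p[OF G]] mem[OF pd[OF P(2)[OF G]]]
      by (intro max_ideal_mult'[OF locR]) (auto simp: max_ideal_eq)
    have xy: "eval t (partial_deriv i G) = ?x + ?y"
      by (subst P(3)[OF G]) (simp add: partial_deriv_mult eval_simps)
    have xR: "?x \<in> R" using mem pd \<pi>p P(2) G is_subring_mult[OF sr] by blast
    have "unit_in R (?x + ?y) \<longleftrightarrow> unit_in R ?x"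
    proof
      show "unit_in R (?x + ?y) \<Longrightarrow> unit_in R ?x"
        using local_ring_add[OF locR, of ?y ?x] y xR by (simp add: max_ideal_eq add.commute)
      assume ux: "unit_in R ?x"
      show "unit_in R (?x + ?y)"
      proof (rule ccontr)
        assume "\<not> unit_in R (?x + ?y)"
        then have "?x + ?y \<in> max_ideal R" using xR y is_subring_add[OF sr] by (auto simp: max_ideal_eq)
        then have "?x + ?y - ?y \<in> max_ideal R" using max_ideal_diff[OF locR _ y] by blast
        then show False using ux by (simp add: max_ideal_eq)
      qed
    qed
    also have "\<dots> \<longleftrightarrow> unit_in R (eval t (partial_deriv i (\<pi> G)))"
      using unit_in_mult_iff[OF sr mem mem] pd[OF \<pi>p[OF G]] P(2,5)[OF G] by blast
    finally show ?thesis by (simp add: xy)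
  qed
  have dl: "unit_in R (eval t (partial_deriv i (\<pi> (var l)))) \<longleftrightarrow> i = l" for i
    using unit_pd[of "var l" i] G0 unit_in_one[OF sr] by (auto simp: partial_deriv_var eval_simps unit_in_def)
  have dj: "unit_in R (eval t (partial_deriv j (\<pi> G0)))" using unit_pd[of G0 j] G0 j by blast
  define g where "g C = eval t (\<pi> (eq C))" for C
  have gR: "g C \<in> R" if "C \<in> CC" for C using mem \<pi>p eq(1)[OF that] by (simp add: g_def)
  have "reduced_ideal M C R = PIdl\<^bsub>ring_of R\<^esub> (g C)" if C: "C \<in> CC" for C
  proof -
    note e = eq[OF C]
    have "R \<subseteq> ?\<eta> (eq C)"
      using subset_generic_point_iff[OF B_subring t P(1)[OF e(1)] lR] P(4)[OF e(1)] by blast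
    moreover have "?\<eta> (eq C) \<in> M"
      using component_local(2)[OF L1 P1 D _ _ e(1), of C] C unfolding CC_def by blast
    ultimately have "reduced_ideal M {Q \<in> M. Q \<subseteq> ?\<eta> (eq C)} R = R \<inter> max_ideal (?\<eta> (eq C))"
      using reduced_ideal_below[OF _ RM] by blast
    then have "reduced_ideal M C R = R \<inter> max_ideal (?\<eta> (eq C))"
      by (rule trans[OF arg_cong[OF e(2), of "\<lambda>Z. reduced_ideal M Z R"]])
    also have "\<dots> = PIdl\<^bsub>ring_of R\<^esub> (g C)"
      unfolding g_def by (rule max_ideal_generic_point_local[OF B_subring t P(1)[OF e(1)] lR P(4)[OF e(1)]])
    finally show ?thesis .
  qed
  moreover have "independent_differentials (const_fun ` B) R CC g"
    unfolding independent_differentials_def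
  proof (intro allI impI)
    fix F c assume "finite F \<and> F \<subseteq> CC \<and> (\<forall>i\<in>F. c i \<in> R) \<and>
      (\<Sum>i\<in>F. Poly_Mapping.single (g i) (c i)) \<in> fibre_relations (const_fun ` B) R"
    then have F: "finite F" "F \<subseteq> CC" and c: "\<And>i. i \<in> F \<Longrightarrow> c i \<in> R"
      and rel: "(\<Sum>i\<in>F. Poly_Mapping.single (g i) (c i)) \<in> fibre_relations (const_fun ` B) R" by blast+
    have sum: "(\<Sum>C\<in>F. c C * eval t (partial_deriv i (\<pi> (eq C)))) \<in> max_ideal R" for i
    proof (rule fibre_relations_deriv[OF B_subring t lR F(1) _ rel[unfolded g_def]])
      show "\<pi> (eq C) \<in> polys B n" if "C \<in> F" for C using \<pi>p eq(1) F(2) that by blast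
    qed
    \<comment> \<open>A coefficient can be isolated if, for some derivative i, its own factor is a
      unit and all other terms are in the maximal ideal.\<close>
    have split: "c C \<in> max_ideal R"
      if C: "C \<in> F" and un: "unit_in R (eval t (partial_deriv i (\<pi> (eq C))))"
        and others: "\<And>C'. C' \<in> F \<Longrightarrow> C' \<noteq> C \<Longrightarrow> c C' * eval t (partial_deriv i (\<pi> (eq C'))) \<in> max_ideal R" for C i
    proof -
      let ?d = "\<lambda>C. eval t (partial_deriv i (\<pi> (eq C)))"
      have "(\<Sum>C'\<in>F - {C}. c C' * ?d C') \<in> max_ideal R" using others by (intro max_ideal_sum[OF locR]) auto
      then have "(\<Sum>C'\<in>F. c C' * ?d C') - (\<Sum>C'\<in>F - {C}. c C' * ?d C') \<in> max_ideal R"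
        using max_ideal_diff[OF locR sum[of i]] by blast
      then have "c C * ?d C \<in> max_ideal R" using F(1) C by (simp add: sum.remove)
      moreover have "?d C \<in> R" using un by (simp add: unit_in_def)
      ultimately show ?thesis using un c[OF C] unit_in_mult_iff[OF sr c[OF C]] by (auto simp: max_ideal_eq)
    qed
    have eqF: "eq C = var l \<or> eq C = G0" if "C \<in> F" for C using eq(1) F(2) G0(1) that by blast
    have 1: "c C \<in> max_ideal R" if C: "C \<in> F" "eq C \<noteq> var l" for C
    proof (rule split[OF C(1), of j])
      show "unit_in R (eval t (partial_deriv j (\<pi> (eq C))))" using dj eqF C by metis
      fix C' assume C': "C' \<in> F" "C' \<noteq> C"
      then have "eq C' = var l" using eqF C inj F(2) by (metis subsetD)
      moreover have "eval t (partial_deriv j (\<pi> (eq C'))) \<in> R" using mem pd \<pi>p eq(1) C' F(2) by blast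
      ultimately have "eval t (partial_deriv j (\<pi> (eq C'))) \<in> max_ideal R"
        using dl[of j] j(2) by (simp add: max_ideal_eq)
      then show "c C' * eval t (partial_deriv j (\<pi> (eq C'))) \<in> max_ideal R"
        using max_ideal_mult[OF locR c[OF C'(1)]] by blast
    qed
    \<comment> \<open>Along l the transversal branch may also contribute, but its coefficient is in
      the maximal ideal by the previous step.\<close>
    have 2: "c C \<in> max_ideal R" if C: "C \<in> F" "eq C = var l" for C
    proof (rule split[OF C(1), of l])
      show "unit_in R (eval t (partial_deriv l (\<pi> (eq C))))" using dl C by simp
      fix C' assume C': "C' \<in> F" "C' \<noteq> C"
      then have "eq C' \<noteq> var l" using C inj F(2) by (metis subsetD)
      moreover have "eval t (partial_deriv l (\<pi> (eq C'))) \<in> R" using mem pd \<pi>p eq(1) C' F(2) by blast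
      ultimately show "c C' * eval t (partial_deriv l (\<pi> (eq C'))) \<in> max_ideal R"
        using max_ideal_mult'[OF locR _ 1[OF C'(1)]] by blast
    qed
    show "\<forall>i\<in>F. c i \<in> max_ideal R" using 1 2 by blast
  qed
  ultimately show "\<exists>g. (\<forall>C\<in>{C \<in> irreducible_components (zariski M) D. R \<in> C}.
       g C \<in> R \<and> reduced_ideal M C R = PIdl\<^bsub>ring_of R\<^esub> (g C)) \<and>
       independent_differentials (const_fun ` B) R {C \<in> irreducible_components (zariski M) D. R \<in> C} g"
    using gR unfolding CC_def by blast
qed

end

section \<open>Proj of a graded ring generated in degree one\<close>

lemma local_of_trans:
  assumes R: "local_of A R" and R': "local_of R R'" and A: "is_subring A"
  shows "local_of A R'"
proof (rule local_of_fractions_trans[OF R' A])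
  show "A \<subseteq> R'" using local_of_subset[OF R] local_of_subset[OF R'] by blast
  fix r assume "r \<in> R"
  then obtain b w where "b \<in> A" "w \<in> A" "unit_in R w" "r = b / w" by (rule local_of_fraction[OF R])
  then show "\<exists>b\<in>A. \<exists>w\<in>A. unit_in R' w \<and> r = b / w"
    using unit_in_mono[OF _ local_of_subset[OF R']] by blast
qed

text \<open>The degree is an index and not a property of an element: in a Rees algebra the
  components are nested ideals of one ring. The homogeneous coordinate ring, Rees algebras and the
  constant family R with generator 1 are instances.\<close>

locale graded =
  fixes S :: "nat \<Rightarrow> 'f::field set" and I :: "'i set" and e :: "'i \<Rightarrow> 'f"
  assumes S_zero: "0 \<in> S d" and S_diff: "x \<in> S d \<Longrightarrow> y \<in> S d \<Longrightarrow> x - y \<in> S d"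
    and S_mult: "x \<in> S a \<Longrightarrow> y \<in> S b \<Longrightarrow> x * y \<in> S (a + b)"
    and S_one: "1 \<in> S 0" and fin: "finite I" and e_S: "i \<in> I \<Longrightarrow> e i \<in> S 1"
    and S_gen: "x \<in> S (Suc d) \<Longrightarrow> \<exists>y. (\<forall>i\<in>I. y i \<in> S d) \<and> x = (\<Sum>i\<in>I. e i * y i)"
begin

abbreviation "chart i \<equiv> homogeneous_localization S 1 (e i)"

lemma S_power: "x \<in> S d \<Longrightarrow> x ^ k \<in> S (k * d)"
  by (induction k) (use S_one S_mult[of x d] in auto)

lemma homogeneous_localizationI: "h \<in> S (k * d) \<Longrightarrow> h / g ^ k \<in> homogeneous_localization S d g"
  by (auto simp: homogeneous_localization_def)

lemma is_subring_homogeneous_localization: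
  assumes g: "g \<in> S d" "g \<noteq> 0" shows "is_subring (homogeneous_localization S d g)"
  unfolding is_subring_def
proof (intro conjI ballI)
  show "1 \<in> homogeneous_localization S d g" using homogeneous_localizationI[of 1 0 d g] S_one by simp
  fix x y assume "x \<in> homogeneous_localization S d g" "y \<in> homogeneous_localization S d g"
  then obtain h k h' k' where *: "h \<in> S (k * d)" "x = h / g ^ k" "h' \<in> S (k' * d)" "y = h' / g ^ k'"
    by (auto simp: homogeneous_localization_def)
  have "h * g ^ k' \<in> S ((k + k') * d)" "h' * g ^ k \<in> S ((k + k') * d)" "h * h' \<in> S ((k + k') * d)"
    using S_mult[OF *(1) S_power[OF g(1), of k']] S_mult[OF *(3) S_power[OF g(1), of k]] S_mult[OF *(1,3)]
    by (simp_all add: add_mult_distrib add.commute)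
  then have "(h * g ^ k' - h' * g ^ k) / g ^ (k + k') \<in> homogeneous_localization S d g"
    "h * h' / g ^ (k + k') \<in> homogeneous_localization S d g"
    using S_diff by (auto intro!: homogeneous_localizationI)
  moreover have "x - y = (h * g ^ k' - h' * g ^ k) / g ^ (k + k')" "x * y = h * h' / g ^ (k + k')"
    unfolding * using g by (simp_all add: field_simps power_add)
  ultimately show "x - y \<in> homogeneous_localization S d g" "x * y \<in> homogeneous_localization S d g" by simp_all
qed

lemma S_0_homogeneous_localization: "S 0 \<subseteq> homogeneous_localization S d g"
  using homogeneous_localizationI[of _ 0 d g] by fastforce

text \<open>Where \<open>f ^ d / g\<close> is a unit, fractions over powers of f and of g can be
  converted into each other.\<close>

lemma chart_change:
  assumes R: "local_of (homogeneous_localization S d g) R" and g: "g \<in> S d" "g \<noteq> 0" and d: "d \<ge> 1"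
    and f: "f \<in> S 1" and u: "unit_in R (f ^ d / g)"
  shows "local_of (homogeneous_localization S 1 f) R"
proof (rule local_of_fractions_trans[OF R])
  note sr = local_of_subring[OF R]
  have f0: "f \<noteq> 0" using u d by (auto simp: unit_in_def power_0_left)
  show "is_subring (homogeneous_localization S 1 f)" using is_subring_homogeneous_localization[OF f f0] .
  have u': "unit_in R (g / f ^ d)" using unit_in_inverse[OF u] by simp
  show "homogeneous_localization S 1 f \<subseteq> R"
  proof
    fix x assume "x \<in> homogeneous_localization S 1 f"
    then obtain h k where h: "h \<in> S k" "x = h / f ^ k" by (auto simp: homogeneous_localization_def)
    \<comment> \<open>The exponent fills the degree of h up to k d, so that division by the k-th
      power of g is homogeneous.\<close>
    have "h * f ^ (k * (d - 1)) \<in> S (k + k * (d - 1))"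
      using S_mult[OF h(1) S_power[OF f, of "k * (d - 1)"]] by simp
    moreover have kd: "k + k * (d - 1) = k * d" using d by (cases d) auto
    ultimately have "h * f ^ (k * (d - 1)) / g ^ k \<in> R"
      using homogeneous_localizationI local_of_subset[OF R] by (metis subsetD)
    moreover have "(g / f ^ d) ^ k \<in> R" using unit_in_power[OF sr u', of k] by (simp add: unit_in_def)
    moreover have "x = (h * f ^ (k * (d - 1)) / g ^ k) * (g / f ^ d) ^ k"
    proof -
      have "f ^ (k * (d - 1)) * f ^ k = (f ^ d) ^ k"
        using kd by (metis add.commute power_add power_mult mult.commute)
      moreover have "(h * f ^ (k * (d - 1)) / g ^ k) * (g / f ^ d) ^ k = h * f ^ (k * (d - 1)) / (f ^ d) ^ k"
        using g by (simp add: power_divide)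
      ultimately have "(h * f ^ (k * (d - 1)) / g ^ k) * (g / f ^ d) ^ k = h * f ^ (k * (d - 1)) / (f ^ (k * (d - 1)) * f ^ k)"
        by (simp only:)
      then show ?thesis using f0 h(2) by simp
    qed
    ultimately show "x \<in> R" using is_subring_mult[OF sr] by metis
  qed
  fix a assume "a \<in> homogeneous_localization S d g"
  then obtain h k where h: "h \<in> S (k * d)" "a = h / g ^ k" by (auto simp: homogeneous_localization_def)
  have "h / f ^ (k * d) \<in> homogeneous_localization S 1 f" "g ^ k / f ^ (k * d) \<in> homogeneous_localization S 1 f"
    using h S_power[OF g(1), of k] homogeneous_localizationI[of _ "k * d" 1 f] by simp_all
  moreover have "unit_in R (g ^ k / f ^ (k * d))"
    using unit_in_power[OF sr u', of k] by (simp add: power_divide power_mult[symmetric] mult.commute)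
  moreover have "a = (h / f ^ (k * d)) / (g ^ k / f ^ (k * d))" using h f0 by simp
  ultimately show "\<exists>b\<in>homogeneous_localization S 1 f. \<exists>w\<in>homogeneous_localization S 1 f. unit_in R w \<and> a = b / w"
    by blast
qed

text \<open>
  If all \<open>e\<^sub>i\<^sup>d / g\<close> were in the maximal ideal, then so would be \<open>x / g\<close> for every \<open>x\<close> of degree \<open>d\<close>, in particular
  \<open>g / g\<close>: this is clear for the \<open>d\<close>-th power of a monomial.
\<close>

lemma unit_generator:
  assumes R: "local_of (homogeneous_localization S d g) R" and g: "g \<in> S d" "g \<noteq> 0" and d: "d \<ge> 1"
  shows "\<exists>i\<in>I. unit_in R (e i ^ d / g)"
proof (rule ccontr)
  assume none: "\<not> ?thesis"
  note sr = local_of_subring[OF R] and lR = local_of_local[OF R]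
  have mem: "x / g \<in> R" if "x \<in> S d" for x
    using homogeneous_localizationI[of x 1 d g] that local_of_subset[OF R] by auto
  have ei: "e i ^ d / g \<in> max_ideal R" if "i \<in> I" for i
    using that none mem[OF S_power[OF e_S[OF that], of d, simplified]] by (auto simp: max_ideal_eq)
  have prodS: "prod_list (map e is) \<in> S (length is)" if "set is \<subseteq> I" for "is"
    using that by (induction "is") (use S_one S_mult[OF e_S] in auto)
  \<comment> \<open>Induction on the degree j still to be split into generators, with the list of
    generators already split off as a prefix.\<close>
  have main: "prod_list (map e is) * y / g \<in> max_ideal R"
    if "set is \<subseteq> I" "length is + j = d" "y \<in> S j" for "is" j y
    using that
  proof (induction j arbitrary: "is" y)
    case 0
    let ?z = "prod_list (map e is) * y / g"
    have zR: "?z \<in> R" using mem S_mult[OF prodS[OF 0(1)] 0(3)] 0(2) by simp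
    have yR: "y \<in> R" using S_0_homogeneous_localization local_of_subset[OF R] 0(3) by blast
    have pl: "prod_list (map e js) ^ d / g ^ length js = prod_list (map (\<lambda>i. e i ^ d / g) js)" for js
    proof (induction js)
      case (Cons i js)
      have "prod_list (map e (i # js)) ^ d / g ^ length (i # js)
          = (e i ^ d / g) * (prod_list (map e js) ^ d / g ^ length js)"
        by (simp add: power_mult_distrib)
      then show ?case unfolding Cons by simp
    qed simp
    \<comment> \<open>The d-th power distributes the d factors g in the denominator over the d
      generators.\<close>
    have eq: "?z ^ d = y ^ d * prod_list (map (\<lambda>i. e i ^ d / g) is)"
    proof -
      have "?z ^ d = y ^ d * (prod_list (map e is) ^ d / g ^ d)"
        by (simp add: power_mult_distrib power_divide)
      moreover have "length is = d" using 0(2) by simp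
      ultimately show ?thesis using pl[of "is"] by metis
    qed
    have plm: "prod_list (map (\<lambda>i. e i ^ d / g) js) \<in> R \<and>
        (js \<noteq> [] \<longrightarrow> prod_list (map (\<lambda>i. e i ^ d / g) js) \<in> max_ideal R)" if "set js \<subseteq> I" for js
      using that
    proof (induction js)
      case (Cons i js)
      then have "prod_list (map (\<lambda>i. e i ^ d / g) (i # js)) \<in> max_ideal R"
        using max_ideal_mult'[OF lR _ ei[of i]] by simp
      then show ?case by (auto simp: max_ideal_eq)
    qed (simp add: is_subring_one[OF sr])
    have "is \<noteq> []" using 0(2) d by auto
    then have "?z ^ d \<in> max_ideal R"
      unfolding eq using plm[OF 0(1)] is_subring_power[OF sr yR] max_ideal_mult[OF lR] by blast
    then have "\<not> unit_in R ?z" using unit_in_power[OF sr] by (auto simp: max_ideal_eq)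
    then show ?case using zR by (simp add: max_ideal_eq)
  next
    case (Suc j)
    obtain y' where y': "\<forall>i\<in>I. y' i \<in> S j" "y = (\<Sum>i\<in>I. e i * y' i)" using S_gen[OF Suc.prems(3)] by blast
    have "prod_list (map e is) * y / g = (\<Sum>i\<in>I. prod_list (map e (i # is)) * y' i / g)"
      unfolding y'(2) by (simp add: sum_distrib_left sum_divide_distrib mult.left_commute mult.assoc)
    also have "\<dots> \<in> max_ideal R"
    proof (rule max_ideal_sum[OF lR])
      fix i assume "i \<in> I"
      then show "prod_list (map e (i # is)) * y' i / g \<in> max_ideal R"
        using y' Suc.prems by (intro Suc.IH) auto
    qed
    finally show ?case .
  qed
  have "1 \<in> max_ideal R" using main[of "[]" d g] g by simp
  then show False using one_notin_max_ideal[OF sr] by blast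
qed

lemma proj_iff: "R \<in> proj S \<longleftrightarrow> (\<exists>i\<in>I. e i \<noteq> 0 \<and> local_of (chart i) R)"
proof
  assume "R \<in> proj S"
  then obtain d g where *: "d \<ge> 1" "g \<in> S d" "g \<noteq> 0" "local_of (homogeneous_localization S d g) R"
    by (auto simp: proj_def spec_iff)
  obtain i where i: "i \<in> I" "unit_in R (e i ^ d / g)" using unit_generator[OF *(4,2,3,1)] by blast
  then have "e i \<noteq> 0" using *(1) by (auto simp: unit_in_def power_0_left)
  then show "\<exists>i\<in>I. e i \<noteq> 0 \<and> local_of (chart i) R"
    using chart_change[OF *(4,2,3,1) e_S[OF i(1)] i(2)] i(1) by blast
next
  assume "\<exists>i\<in>I. e i \<noteq> 0 \<and> local_of (chart i) R"
  then obtain i where i: "i \<in> I" "e i \<noteq> 0" "local_of (chart i) R" by blast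
  then have "R \<in> spec (chart i)" using is_subring_homogeneous_localization[OF e_S] by (simp add: spec_iff)
  then show "R \<in> proj S" unfolding proj_def using i e_S by fastforce
qed

lemma proj_local: "R \<in> proj S \<Longrightarrow> local_ring R"
  using proj_iff local_of_local by blast

lemma proj_S_0: "R \<in> proj S \<Longrightarrow> S 0 \<subseteq> R"
  using proj_iff local_of_subset S_0_homogeneous_localization by blast

lemma ratio_chart: "i \<in> I \<Longrightarrow> j \<in> I \<Longrightarrow> e j / e i \<in> chart i"
  using homogeneous_localizationI[of "e j" 1 1 "e i"] e_S by simp

text \<open>Q lies in some chart k. The ratio of \<open>e i\<close> and \<open>e k\<close> is in Q
  and its inverse is in R, so it is a unit of R and by domination a unit of Q already.\<close>

lemma dominated_in_chart:
  assumes Q: "Q \<in> proj S" and d: "dominates R Q" and i: "i \<in> I" "e i \<noteq> 0"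
    and r: "\<And>j. j \<in> I \<Longrightarrow> e j / e i \<in> R"
  shows "local_of (chart i) Q"
proof -
  obtain k where k: "k \<in> I" "e k \<noteq> 0" "local_of (chart k) Q" using Q proj_iff by blast
  have "e i / e k \<in> Q" using ratio_chart[OF k(1) i(1)] local_of_subset[OF k(3)] by blast
  moreover have "unit_in R (e i / e k)"
    using calculation d r[OF k(1)] i k by (auto simp: unit_in_def dominates_def)
  ultimately have "unit_in Q (e i / e k)" using d by (simp add: dominates_def)
  then show ?thesis using chart_change[OF k(3) e_S[OF k(1)] k(2) _ e_S[OF i(1)]] by simp
qed

text \<open>Proj is separated: two points dominated by the same ring lie in a common chart, where
  the centre is unique.\<close>

lemma proj_dominated_unique:
  assumes "Q \<in> proj S" "Q' \<in> proj S" "dominates R Q" "dominates R Q'"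
  shows "Q = Q'"
proof -
  obtain i where i: "i \<in> I" "e i \<noteq> 0" "local_of (chart i) Q" using assms proj_iff by blast
  have "e j / e i \<in> R" if "j \<in> I" for j
    using ratio_chart[OF i(1) that] local_of_subset[OF i(3)] assms(3) by (auto simp: dominates_def)
  then have "local_of (chart i) Q'" using dominated_in_chart[OF assms(2,4) i(1,2)] by blast
  then show ?thesis using local_of_dominated_eq i(3) assms by metis
qed

lemma proj_localization:
  assumes "R \<in> proj S" "local_of R R'" shows "R' \<in> proj S"
  using assms local_of_trans is_subring_homogeneous_localization[OF e_S] unfolding proj_iff by blast

end


section \<open>Coordinates on projective space\<close>

abbreviation (input) xvar :: "nat \<Rightarrow> 'k::field ratfun" where "xvar i \<equiv> embed (var i)"

lemma var_nonzero [simp]: "var i \<noteq> (0 :: 'k::comm_ring_1 mpoly)"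
  unfolding var_def by (metis lookup_single_eq lookup_zero zero_neq_one)

lemma homogeneous_generated:
  assumes B: "is_subring B" and P: "P \<in> polys B m" "homogeneous (Suc d) P"
  shows "\<exists>Y. (\<forall>i<m. Y i \<in> polys B m \<and> homogeneous d (Y i)) \<and> P = (\<Sum>i<m. var i * Y i)"
proof -
  let ?Q = "\<lambda>P. \<exists>Y. (\<forall>i<m. Y i \<in> polys B m \<and> homogeneous d (Y i)) \<and> P = (\<Sum>i<m. var i * Y i)"
  have mono: "?Q (single \<mu> c)" if "c \<in> B" "keys \<mu> \<subseteq> {..<m}" "total_degree \<mu> = Suc d" for \<mu> c
  proof -
    have "\<exists>j. lookup \<mu> j \<noteq> 0"
    proof (rule ccontr)
      assume "\<not> ?thesis"
      then have "total_degree \<mu> = 0" by (simp add: total_degree_def)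
      then show False using that by simp
    qed
    then obtain j where j: "lookup \<mu> j \<noteq> 0" by blast
    then have jm: "j < m" using that by (auto simp: in_keys_iff subset_iff)
    let ?Y = "\<lambda>i. if i = j then single (\<mu> - single j 1) c else 0"
    have e: "\<mu> - single j 1 + single j 1 = \<mu>" using single_diff_add[OF j] .
    have "keys (\<mu> - single j 1) \<subseteq> keys \<mu>" by (auto simp: in_keys_iff lookup_minus)
    moreover have "total_degree (\<mu> - single j 1) = d"
      using total_degree_add[of "\<mu> - single j 1" "single j 1"] e that by simp
    ultimately have "\<forall>i<m. ?Y i \<in> polys B m \<and> homogeneous d (?Y i)"
      using that by (auto intro!: single_polys homogeneous_single)
    moreover have "(\<Sum>i<m. var i * ?Y i) = (\<Sum>i<m. if i = j then var j * single (\<mu> - single j 1) c else 0)"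
      by (rule sum.cong) auto
    then have "single \<mu> c = (\<Sum>i<m. var i * ?Y i)"
      using jm e by (simp add: var_def mult_single add.commute)
    ultimately show ?thesis by (intro exI[of _ ?Y]) simp
  qed
  have sum: "?Q (\<Sum>\<mu>\<in>A. single \<mu> (lookup P \<mu>))" if "finite A" "A \<subseteq> keys P" for A
    using that
  proof (induction A rule: finite_induct)
    case empty
    then show ?case by (intro exI[of _ "\<lambda>_. 0"]) simp
  next
    case (insert \<mu> A)
    then obtain Y where Y: "\<forall>i<m. Y i \<in> polys B m \<and> homogeneous d (Y i)"
      "(\<Sum>\<mu>\<in>A. single \<mu> (lookup P \<mu>)) = (\<Sum>i<m. var i * Y i)" by auto
    obtain Y' where Y': "\<forall>i<m. Y' i \<in> polys B m \<and> homogeneous d (Y' i)"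
      "single \<mu> (lookup P \<mu>) = (\<Sum>i<m. var i * Y' i)"
      using mono[of "lookup P \<mu>" \<mu>] insert.prems P by (auto simp: polys_def homogeneous_iff)
    show ?case
      using insert.hyps Y Y'
      by (intro exI[of _ "\<lambda>i. Y' i + Y i"]) (simp add: distrib_left sum.distrib polys_add[OF B] homogeneous_add)
  qed
  from sum[of "keys P"] show ?thesis using mpoly_sum_single[of P] by simp
qed

lemma graded_homogeneous_coordinate_ring:
  assumes B: "is_subring B"
  shows "graded (homogeneous_coordinate_ring B n) {..n} xvar"
proof
  let ?S = "homogeneous_coordinate_ring B n"
  note S = is_subring_polys[OF B, of "Suc n"]
  show "0 \<in> ?S d" for d
    unfolding homogeneous_coordinate_ring_def
    using ring_map_zero[OF ring_map_embed] by (auto intro!: image_eqI[of _ _ 0])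
  show "x - y \<in> ?S d" if xy: "x \<in> ?S d" "y \<in> ?S d" for x y d
  proof -
    obtain P Q where PQ: "x = embed P" "y = embed Q" "P \<in> polys B (Suc n)" "Q \<in> polys B (Suc n)"
      "homogeneous d P" "homogeneous d Q"
      using xy by (auto simp: homogeneous_coordinate_ring_def)
    have "P - Q \<in> polys B (Suc n)" using PQ is_subring_diff[OF S] by blast
    moreover have "homogeneous d (P - Q)" using homogeneous_add[OF PQ(5) homogeneous_uminus[OF PQ(6)]] by simp
    ultimately show ?thesis
      using PQ ring_map_diff[OF ring_map_embed, of P Q]
      by (auto simp: homogeneous_coordinate_ring_def intro!: image_eqI[of _ _ "P - Q"])
  qed
  show "x * y \<in> ?S (a + b)" if xy: "x \<in> ?S a" "y \<in> ?S b" for x y a b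
  proof -
    obtain P Q where PQ: "x = embed P" "y = embed Q" "P \<in> polys B (Suc n)" "Q \<in> polys B (Suc n)"
      "homogeneous a P" "homogeneous b Q"
      using xy by (auto simp: homogeneous_coordinate_ring_def)
    have "P * Q \<in> {P \<in> polys B (Suc n). homogeneous (a + b) P}"
      using is_subring_mult[OF S PQ(3,4)] homogeneous_mult[OF PQ(5,6)] by blast
    then show ?thesis
      unfolding homogeneous_coordinate_ring_def PQ(1,2) ring_map_mult[OF ring_map_embed, symmetric] by blast
  qed
  show "1 \<in> ?S 0"
    unfolding homogeneous_coordinate_ring_def
    using ring_map_one[OF ring_map_embed] is_subring_one[OF S] homogeneous_const[of 1]
    by (auto intro!: image_eqI[of _ _ 1])
  show "xvar i \<in> ?S 1" if "i \<in> {..n}" for i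
    unfolding homogeneous_coordinate_ring_def
    using that var_polys[OF B, of i "Suc n"] homogeneous_var[of i] by auto
  show "\<exists>y. (\<forall>i\<in>{..n}. y i \<in> ?S d) \<and> x = (\<Sum>i\<in>{..n}. xvar i * y i)" if x: "x \<in> ?S (Suc d)" for x d
  proof -
    obtain P where P: "x = embed P" "P \<in> polys B (Suc n)" "homogeneous (Suc d) P"
      using x by (auto simp: homogeneous_coordinate_ring_def)
    obtain Y where Y: "\<forall>i<Suc n. Y i \<in> polys B (Suc n) \<and> homogeneous d (Y i)" "P = (\<Sum>i<Suc n. var i * Y i)"
      using homogeneous_generated[OF B P(2,3)] by blast
    have "x = (\<Sum>i\<in>{..n}. xvar i * embed (Y i))"
      unfolding P(1) Y(2) lessThan_Suc_atMost
      by (simp add: ring_map_sum[OF ring_map_embed] ring_map_mult[OF ring_map_embed])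
    moreover have "\<forall>i\<in>{..n}. embed (Y i) \<in> ?S d"
      unfolding homogeneous_coordinate_ring_def using Y(1) by auto
    ultimately show ?thesis by (intro exI[of _ "\<lambda>i. embed (Y i)"]) simp
  qed
qed simp

text \<open>
  On the chart \<open>x\<^sub>i \<noteq> 0\<close> the coordinates are \<open>x\<^sub>k / x\<^sub>i\<close>, with \<open>x\<^sub>n\<close> taking the place of \<open>x\<^sub>i\<close>, translated so
  that the point with coordinates \<open>c\<close> becomes the origin.
\<close>

abbreviation (input) swap :: "nat \<Rightarrow> nat \<Rightarrow> nat \<Rightarrow> nat" where "swap \<equiv> Transposition.transpose"

lemma const_fun_0 [simp]: "const_fun 0 = 0"
  by simp

lemma swap_le: "i \<le> n \<Longrightarrow> k < n \<Longrightarrow> swap i n k \<le> n \<and> swap i n k \<noteq> i"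
  by (auto simp: Transposition.transpose_def)

lemma swap_lt: "i \<le> n \<Longrightarrow> k \<le> n \<Longrightarrow> k \<noteq> i \<Longrightarrow> swap i n k < n"
  by (auto simp: Transposition.transpose_def)

definition chart_coord :: "nat \<Rightarrow> nat \<Rightarrow> (nat \<Rightarrow> 'k) \<Rightarrow> nat \<Rightarrow> 'k::field ratfun" where
  "chart_coord n i c k = xvar (swap i n k) / xvar i - const_fun (c k)"

text \<open>The transposition is its own inverse, so the one that numbers the affine coordinates
  also translates back; the constants c undo the translation of the origin.\<close>

definition dehomogenize :: "nat \<Rightarrow> nat \<Rightarrow> (nat \<Rightarrow> 'k) \<Rightarrow> 'k::comm_ring_1 mpoly \<Rightarrow> 'k mpoly" where
  "dehomogenize n i c = subst (\<lambda>k. if k = i then 1 else var (swap i n k) + const (c (swap i n k)))"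

lemma dehomogenize_polys:
  assumes B: "is_subring B" and c: "\<And>k. k < n \<Longrightarrow> c k \<in> B" and i: "i \<le> n" and P: "P \<in> polys B (Suc n)"
  shows "dehomogenize n i c P \<in> polys B n"
  unfolding dehomogenize_def
proof (rule mpoly_eval_mem[OF is_subring_polys[OF B] P const_polys])
  fix k assume "k < Suc n"
  then show "(if k = i then 1 else var (swap i n k) + const (c (swap i n k))) \<in> polys B n"
    using swap_lt[OF i, of k] c is_subring_one[OF is_subring_polys[OF B]]
    by (auto intro!: polys_add[OF B] var_polys[OF B] const_polys)
qed

lemma eval_dehomogenize:
  assumes i: "i \<le> n" and P: "P \<in> polys B (Suc n)"  and hom: "homogeneous d P"
  shows "eval (chart_coord n i c) (dehomogenize n i c P) = embed P / xvar i ^ d"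
proof -
  have "eval (chart_coord n i c) (dehomogenize n i c P)
      = eval (\<lambda>k. eval (chart_coord n i c) (if k = i then 1 else var (swap i n k) + const (c (swap i n k)))) P"
    unfolding dehomogenize_def by (rule mpoly_eval_subst[OF ring_map_const_fun])
  also have "\<dots> = eval (\<lambda>k. inverse (xvar i) * xvar k) P"
    by (rule mpoly_eval_cong[OF P]) (auto simp: eval_simps chart_coord_def field_simps)
  also have "\<dots> = inverse (xvar i) ^ d * embed P"
    unfolding homogeneous_eval_scale[OF hom] embed_eq_eval[symmetric] ..
  finally show ?thesis by (simp add: divide_inverse power_inverse mult.commute)
qed

lemma partial_deriv_dehomogenize:
  assumes i: "i \<le> n" and j: "j < n" and P: "P \<in> polys B (Suc n)"
  shows "partial_deriv j (dehomogenize n i c P) = dehomogenize n i c (partial_deriv (swap i n j) P)"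
proof -
  let ?q = "\<lambda>k. if k = i then 1 else var (swap i n k) + const (c (swap i n k))"
  have one: "partial_deriv j 1 = (0 :: 'a mpoly)" using partial_deriv_const[of j "1::'a"] by simp
  have "partial_deriv j (?q k) = (if k = swap i n j then 1 else 0)" if "k < Suc n" for k
  proof (cases "k = i")
    case True
    then show ?thesis using swap_le[OF i j] one by simp
  next
    case False
    have "swap i n k = j \<longleftrightarrow> k = swap i n j" by (metis transpose_involutory)
    then show ?thesis using False by (simp add: partial_deriv_add partial_deriv_var)
  qed
  then have "partial_deriv j (subst ?q P) = (\<Sum>k<Suc n. if k = swap i n j then subst ?q (partial_deriv k P) else 0)"
    unfolding chain_rule[OF polys_UNIV[OF P]] by (intro sum.cong) auto
  also have "\<dots> = subst ?q (partial_deriv (swap i n j) P)" using swap_le[OF i j] by simp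
  finally show ?thesis by (simp add: dehomogenize_def)
qed

text \<open>P' is P with denominators cleared by s in the coordinates t'. If P vanishes at t, then
  P' is 0, and the substitution q recovers P from it up to the nonzero factor r.\<close>

lemma alg_independent_transfer:
  assumes t': "alg_independent m t'"
    and ex: "\<And>P. P \<in> polys UNIV n \<Longrightarrow> \<exists>P'\<in>polys UNIV m. \<exists>s r. s \<noteq> 0 \<and> r \<noteq> 0 \<and>
       s * eval t P = eval t' P' \<and> subst q P' = r * P"
  shows "alg_independent n t"
  unfolding alg_independent_def
proof (intro ballI impI)
  fix P :: "'a mpoly" assume P: "P \<in> polys UNIV n" and 0: "eval t P = 0"
  obtain P' s r where *: "P' \<in> polys UNIV m" "r \<noteq> 0" "s * eval t P = eval t' P'" "subst q P' = r * P"
    using ex[OF P] by blast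
  then have "P' = 0" using t' 0 by (auto simp: alg_independent_def)
  then show "P = 0" using * by (simp add: subst_simps)
qed

lemma alg_independent_xvar: "alg_independent n xvar"
  by (auto simp: alg_independent_def simp flip: embed_eq_eval)

lemma alg_independent_chart_coord_0:
  assumes i: "i \<le> n" shows "alg_independent n (chart_coord n i (\<lambda>_. 0))"
proof (rule alg_independent_transfer[OF alg_independent_xvar])
  let ?t = "chart_coord n i (\<lambda>_. 0)"
  let ?q = "\<lambda>k. if k = i then 1 else var (swap i n k) :: 'a mpoly"
  note S = is_subring_polys[OF is_subring_UNIV, of "Suc n"]
  fix P :: "'a mpoly" assume "P \<in> polys UNIV n"
  then have "\<exists>P'\<in>polys UNIV (Suc n). \<exists>m. xvar i ^ m * eval ?t P = embed P' \<and> subst ?q P' = P"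
    using is_subring_UNIV
  proof (induction rule: polys_induct)
    case (const b)
    then show ?case
      by (intro bexI[of _ "const b"] exI[of _ 0] const_polys)
        (simp_all add: eval_simps subst_simps, simp add: const_fun_def)
  next
    case (var k)
    then show ?case
      using swap_le[OF i var] i
      by (intro bexI[of _ "var (swap i n k)"] exI[of _ 1] var_polys is_subring_UNIV)
        (auto simp: eval_simps subst_simps chart_coord_def)
  next
    case (add P1 P2)
    then obtain P1' m1 P2' m2 where *: "P1' \<in> polys UNIV (Suc n)" "xvar i ^ m1 * eval ?t P1 = embed P1'" "subst ?q P1' = P1"
      "P2' \<in> polys UNIV (Suc n)" "xvar i ^ m2 * eval ?t P2 = embed P2'" "subst ?q P2' = P2" by blast
    let ?P = "var i ^ m2 * P1' + var i ^ m1 * P2'"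
    have "?P \<in> polys UNIV (Suc n)"
      using * i by (intro is_subring_add[OF S] is_subring_mult[OF S] is_subring_power[OF S] var_polys is_subring_UNIV) auto
    moreover have "xvar i ^ (m1 + m2) * eval ?t (P1 + P2) = embed ?P"
      by (simp add: eval_simps ring_map_add[OF ring_map_embed] ring_map_mult[OF ring_map_embed]
          ring_map_power[OF ring_map_embed] *(2,5)[symmetric] algebra_simps power_add)
    moreover have "subst ?q ?P = P1 + P2" using * by (simp add: subst_simps)
    ultimately show ?case by blast
  next
    case (mult P1 P2)
    then obtain P1' m1 P2' m2 where *: "P1' \<in> polys UNIV (Suc n)" "xvar i ^ m1 * eval ?t P1 = embed P1'" "subst ?q P1' = P1"
      "P2' \<in> polys UNIV (Suc n)" "xvar i ^ m2 * eval ?t P2 = embed P2'" "subst ?q P2' = P2" by blast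
    have "P1' * P2' \<in> polys UNIV (Suc n)" using * is_subring_mult[OF S] by blast
    moreover have "xvar i ^ (m1 + m2) * eval ?t (P1 * P2) = embed (P1' * P2')"
      by (simp add: eval_simps ring_map_mult[OF ring_map_embed] *(2,5)[symmetric] algebra_simps power_add)
    moreover have "subst ?q (P1' * P2') = P1 * P2" using * by (simp add: subst_simps)
    ultimately show ?case by blast
  qed
  then obtain P' m where "P' \<in> polys UNIV (Suc n)" "xvar i ^ m * eval ?t P = embed P'" "subst ?q P' = P" by blast
  then show "\<exists>P'\<in>polys UNIV (Suc n). \<exists>s r. s \<noteq> 0 \<and> r \<noteq> 0 \<and> s * eval ?t P = eval xvar P' \<and> subst ?q P' = r * P"
    by (intro bexI[of _ P'] exI[of _ "xvar i ^ m"] exI[of _ 1]) (auto simp flip: embed_eq_eval)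
qed

lemma alg_independent_chart_coord:
  assumes i: "i \<le> n" shows "alg_independent n (chart_coord n i c)"
proof (rule alg_independent_transfer[OF alg_independent_chart_coord_0[OF i]])
  fix P :: "'a mpoly" assume P: "P \<in> polys UNIV n"
  let ?P' = "subst (\<lambda>k. var k - const (c k)) P"
  have "?P' \<in> polys UNIV n"
    using P by (rule mpoly_eval_mem[OF is_subring_polys[OF is_subring_UNIV]])
      (auto intro!: const_polys is_subring_diff[OF is_subring_polys[OF is_subring_UNIV]] var_polys is_subring_UNIV)
  moreover have "1 * eval (chart_coord n i c) P = eval (chart_coord n i (\<lambda>_. 0)) ?P'"
    unfolding mpoly_eval_subst[OF ring_map_const_fun]
    by (simp add: eval_simps chart_coord_def[abs_def] ring_map_zero[OF ring_map_const_fun])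
  moreover have "subst (\<lambda>k. var k + const (c k)) ?P' = 1 * P"
    unfolding mpoly_eval_subst[OF ring_map_const] by (simp add: subst_simps subst_var)
  ultimately show "\<exists>P'\<in>polys UNIV n. \<exists>s r. s \<noteq> 0 \<and> r \<noteq> 0 \<and> s * eval (chart_coord n i c) P =
      eval (chart_coord n i (\<lambda>_. 0)) P' \<and> subst (\<lambda>k. var k + const (c k)) P' = r * P"
    by (intro bexI[of _ ?P'] exI[of _ 1]) auto
qed

lemma proj_space_chart:
  assumes B: "is_subring B" and c: "\<And>k. k < n \<Longrightarrow> c k \<in> B" and i: "i \<le> n"
  shows "homogeneous_localization (homogeneous_coordinate_ring B n) 1 (xvar i) = affine_ring B n (chart_coord n i c)"
proof -
  interpret graded "homogeneous_coordinate_ring B n" "{..n}" xvar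
    by (rule graded_homogeneous_coordinate_ring[OF B])
  have sr: "is_subring (chart i)"
    using is_subring_homogeneous_localization[OF e_S[of i]] i by simp
  have const: "const_fun ` B \<subseteq> chart i"
  proof
    fix x assume "x \<in> const_fun ` B"
    then obtain b where "b \<in> B" "x = embed (const b)" by (auto simp: const_fun_def)
    then have "x \<in> homogeneous_coordinate_ring B n 0"
      using const_polys[of b B "Suc n"] homogeneous_const[of b] by (auto simp: homogeneous_coordinate_ring_def)
    then show "x \<in> chart i" using S_0_homogeneous_localization by blast
  qed
  show ?thesis
  proof (intro equalityI subsetI)
    fix x assume "x \<in> chart i"
    then obtain P d where P: "x = embed P / xvar i ^ d" "P \<in> polys B (Suc n)" "homogeneous d P"
      by (auto simp: homogeneous_localization_def homogeneous_coordinate_ring_def)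
    have "dehomogenize n i c P \<in> polys B n" by (rule dehomogenize_polys[OF B c i P(2)])
    then show "x \<in> affine_ring B n (chart_coord n i c)"
      using eval_dehomogenize[OF i P(2,3), of c] eval_affine_ring P(1) by metis
  next
    have "chart_coord n i c k \<in> chart i" if "k < n" for k
      unfolding chart_coord_def
      using swap_le[OF i that] ratio_chart[of i "swap i n k"] const c[OF that] i by (intro is_subring_diff[OF sr]) auto
    then have "affine_ring B n (chart_coord n i c) \<subseteq> chart i" using const by (intro affine_ring_subset[OF sr]) auto
    then show "x \<in> affine_ring B n (chart_coord n i c) \<Longrightarrow> x \<in> chart i" for x by blast
  qed
qed

definition blowup_coord :: "(nat \<Rightarrow> 'f::field) \<Rightarrow> nat \<Rightarrow> nat \<Rightarrow> 'f" where
  "blowup_coord y l k = (if k = l then y l else y k / y l)"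

lemma alg_independent_blowup_coord:
  fixes y :: "nat \<Rightarrow> 'k::field ratfun"
  assumes y: "alg_independent n y" and l: "l < n"
  shows "alg_independent n (blowup_coord y l)"
proof (rule alg_independent_transfer[OF y])
  let ?t = "blowup_coord y l"
  let ?q = "\<lambda>k. if k = l then var l else var k * var l :: 'k mpoly"
  note S = is_subring_polys[OF is_subring_UNIV, of n]
  have vl: "var l \<in> polys (UNIV :: 'k set) n" using var_polys[OF is_subring_UNIV l] .
  have yl: "y l \<noteq> 0" using alg_independent_zero_iff[OF y vl] by (simp add: eval_simps)
  fix P :: "'k mpoly" assume "P \<in> polys UNIV n"
  then have "\<exists>P'\<in>polys UNIV n. \<exists>m. y l ^ m * eval ?t P = eval y P' \<and> subst ?q P' = var l ^ m * P"
    using is_subring_UNIV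
  proof (induction rule: polys_induct)
    case (const b)
    then show ?case
      by (intro bexI[of _ "const b"] exI[of _ 0] const_polys) (auto simp: eval_simps subst_simps)
  next
    case (var k)
    show ?case
    proof (cases "k = l")
      case True
      then show ?thesis using vl
        by (intro bexI[of _ "var l"] exI[of _ 0]) (auto simp: eval_simps subst_simps blowup_coord_def)
    next
      case False
      then show ?thesis using var yl
        by (intro bexI[of _ "var k"] exI[of _ 1] var_polys is_subring_UNIV)
          (auto simp: eval_simps subst_simps blowup_coord_def)
    qed
  next
    case (add P1 P2)
    then obtain P1' m1 P2' m2 where *: "P1' \<in> polys UNIV n" "y l ^ m1 * eval ?t P1 = eval y P1'" "subst ?q P1' = var l ^ m1 * P1"
      "P2' \<in> polys UNIV n" "y l ^ m2 * eval ?t P2 = eval y P2'" "subst ?q P2' = var l ^ m2 * P2" by blast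
    let ?P = "var l ^ m2 * P1' + var l ^ m1 * P2'"
    have "?P \<in> polys UNIV n"
      using * vl by (intro is_subring_add[OF S] is_subring_mult[OF S] is_subring_power[OF S])
    moreover have "y l ^ (m1 + m2) * eval ?t (P1 + P2) = eval y ?P"
      by (simp add: eval_simps *(2,5)[symmetric] algebra_simps power_add)
    moreover have "subst ?q ?P = var l ^ (m1 + m2) * (P1 + P2)"
      using *(3,6) by (simp add: subst_simps power_add algebra_simps)
    ultimately show ?case by blast
  next
    case (mult P1 P2)
    then obtain P1' m1 P2' m2 where *: "P1' \<in> polys UNIV n" "y l ^ m1 * eval ?t P1 = eval y P1'" "subst ?q P1' = var l ^ m1 * P1"
      "P2' \<in> polys UNIV n" "y l ^ m2 * eval ?t P2 = eval y P2'" "subst ?q P2' = var l ^ m2 * P2" by blast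
    have "P1' * P2' \<in> polys UNIV n" using * is_subring_mult[OF S] by blast
    moreover have "y l ^ (m1 + m2) * eval ?t (P1 * P2) = eval y (P1' * P2')"
      by (simp add: eval_simps *(2,5)[symmetric] algebra_simps power_add)
    moreover have "subst ?q (P1' * P2') = var l ^ (m1 + m2) * (P1 * P2)"
      using *(3,6) by (simp add: subst_simps power_add algebra_simps)
    ultimately show ?case by blast
  qed
  then obtain P' m where "P' \<in> polys UNIV n" "y l ^ m * eval ?t P = eval y P'" "subst ?q P' = var l ^ m * P" by blast
  then show "\<exists>P'\<in>polys UNIV n. \<exists>s r. s \<noteq> 0 \<and> r \<noteq> 0 \<and> s * eval ?t P = eval y P' \<and> subst ?q P' = r * P"
    using yl by (intro bexI[of _ P'] exI[of _ "y l ^ m"] exI[of _ "var l ^ m"]) auto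
qed

section \<open>The singular sections\<close>

text \<open>The fractions with numerator in the ideal and unit denominator already form an ideal of
  Q that contains the given one.\<close>

lemma genideal_fraction:
  assumes A: "is_subring A" and Q: "local_of A Q" and a: "ideal_in \<aa> A" and x: "x \<in> Idl\<^bsub>ring_of Q\<^esub> \<aa>"
  shows "\<exists>a\<in>\<aa>. \<exists>w\<in>A. unit_in Q w \<and> x = a / w"
proof -
  let ?I = "{a / w | a w. a \<in> \<aa> \<and> w \<in> A \<and> unit_in Q w}"
  note sr = local_of_subring[OF Q]
  have aQ: "\<aa> \<subseteq> Q" using a local_of_subset[OF Q] by (auto simp: ideal_in_def)
  have I: "a / w \<in> ?I" if "a \<in> \<aa>" "w \<in> A" "unit_in Q w" for a w using that by blast
  have "ideal_in ?I Q"
    unfolding ideal_in_def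
  proof (intro conjI ballI)
    show "?I \<subseteq> Q" using aQ unit_in_divide[OF sr] by blast
    have "0 / 1 \<in> ?I" using a is_subring_one[OF A] unit_in_one[OF sr] by (intro I) (auto simp: ideal_in_def)
    then show "0 \<in> ?I" by simp
    fix x assume "x \<in> ?I"
    then obtain a1 w where 1: "x = a1 / w" "a1 \<in> \<aa>" "w \<in> A" "unit_in Q w" by blast
    { fix y assume "y \<in> ?I"
      then obtain a2 v where 2: "y = a2 / v" "a2 \<in> \<aa>" "v \<in> A" "unit_in Q v" by blast
      have "v * a1 + w * a2 \<in> \<aa>" using a 1 2 by (auto simp: ideal_in_def)
      moreover have "w * v \<in> A" "unit_in Q (w * v)"
        using 1 2 is_subring_mult[OF A] unit_in_mult_iff[OF sr, of w v] by (auto simp: unit_in_def)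
      ultimately have "(v * a1 + w * a2) / (w * v) \<in> ?I" by (rule I)
      moreover have "x + y = (v * a1 + w * a2) / (w * v)"
        using 1 2 by (simp add: unit_in_def add_frac_eq mult.commute)
      ultimately show "x + y \<in> ?I" by simp }
    fix r assume "r \<in> Q"
    then obtain b v where 2: "b \<in> A" "v \<in> A" "unit_in Q v" "r = b / v" by (rule local_of_fraction[OF Q])
    have "b * a1 \<in> \<aa>" using a 1 2 by (auto simp: ideal_in_def)
    moreover have "v * w \<in> A" "unit_in Q (v * w)"
      using 1 2 is_subring_mult[OF A] unit_in_mult_iff[OF sr, of v w] by (auto simp: unit_in_def)
    ultimately have "(b * a1) / (v * w) \<in> ?I" by (rule I)
    then show "r * x \<in> ?I" using 1 2 by simp
  qed
  moreover have "\<aa> \<subseteq> ?I" using I[of _ 1] is_subring_one[OF A] unit_in_one[OF sr] by fastforce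
  ultimately have "Idl\<^bsub>ring_of Q\<^esub> \<aa> \<subseteq> ?I" using genideal_ring_of(3)[OF sr aQ] by blast
  then show ?thesis using x by blast
qed

lemma polys_split_at_0:
  assumes B: "is_subring B" and P: "P \<in> polys B n"
  shows "\<exists>Y. (\<forall>k<n. Y k \<in> polys B n) \<and> P = const (lookup P 0) + (\<Sum>k<n. var k * Y k)"
  using P B
proof (induction rule: polys_induct)
  note S = is_subring_polys[OF B, of n]
  case (const b)
  then show ?case by (intro exI[of _ "\<lambda>_. 0"]) (simp add: const_def)
next
  case (var i)
  have "(\<Sum>k<n. var k * (if k = i then 1 else 0)) = (\<Sum>k<n. if k = i then var i else (0 :: 'a mpoly))"
    by (rule sum.cong) auto
  moreover have "lookup (var i) 0 = (0::'a)"
  proof -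
    have "single i (1::nat) \<noteq> 0" by (metis lookup_single_eq lookup_zero zero_neq_one)
    then show ?thesis unfolding var_def by (simp add: lookup_single when_def)
  qed
  ultimately show ?case
    using var is_subring_one[OF is_subring_polys[OF B, of n]] by (intro exI[of _ "\<lambda>k. if k = i then 1 else 0"]) auto
next
  case (add P P')
  then obtain Y Y' where *: "\<forall>k<n. Y k \<in> polys B n" "P = const (lookup P 0) + (\<Sum>k<n. var k * Y k)"
    "\<forall>k<n. Y' k \<in> polys B n" "P' = const (lookup P' 0) + (\<Sum>k<n. var k * Y' k)" by blast
  have "P + P' = const (lookup (P + P') 0) + (\<Sum>k<n. var k * (Y k + Y' k))"
    by (subst *(2), subst *(4)) (simp add: lookup_add ring_map_add[OF ring_map_const] distrib_left sum.distrib)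
  then show ?case using * polys_add[OF B] by (intro exI[of _ "\<lambda>k. Y k + Y' k"]) blast
next
  case (mult P P')
  then obtain Y Y' where *: "\<forall>k<n. Y k \<in> polys B n" "P = const (lookup P 0) + (\<Sum>k<n. var k * Y k)"
    "\<forall>k<n. Y' k \<in> polys B n" "P' = const (lookup P' 0) + (\<Sum>k<n. var k * Y' k)" by blast
  let ?Z = "\<lambda>k. Y k * P' + const (lookup P 0) * Y' k"
  have e: "P * P' = const (lookup P 0 * lookup P' 0) + (\<Sum>k<n. var k * ?Z k)"
  proof -
    have "P * P' = const (lookup P 0) * P' + (\<Sum>k<n. var k * (Y k * P'))"
      by (subst *(2)) (simp add: distrib_right sum_distrib_right mult.assoc)
    also have "const (lookup P 0) * P' = const (lookup P 0) * const (lookup P' 0) + (\<Sum>k<n. var k * (const (lookup P 0) * Y' k))"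
      by (subst *(4)) (simp add: distrib_left sum_distrib_left mult.left_commute)
    finally show ?thesis by (simp add: ring_map_mult[OF ring_map_const] distrib_left sum.distrib)
  qed
  \<comment> \<open>Constant terms are read off by substituting 0 for all variables.\<close>
  have zero: "lookup (\<Sum>k<n. var k * Z k) 0 = 0" for Z :: "nat \<Rightarrow> 'a mpoly"
  proof -
    have "subst (\<lambda>_. 0) Q = const (lookup Q 0)" for Q :: "'a mpoly"
    proof -
      have "monomial (\<lambda>_. 0 :: 'a mpoly) \<mu> = (if \<mu> = 0 then 1 else 0)" for \<mu>
      proof (cases "\<mu> = 0")
        case False
        then obtain i where i: "i \<in> keys \<mu>" using keys_eq_empty by blast
        have "monomial (\<lambda>_. 0 :: 'a mpoly) \<mu> = 0"
          unfolding monomial_def using i by (intro prod_zero bexI[of _ i]) (auto simp: in_keys_iff power_0_left)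
        then show ?thesis using False by simp
      qed simp
      then have "subst (\<lambda>_. 0) Q = (\<Sum>\<mu>\<in>keys Q. if \<mu> = 0 then const (lookup Q 0) else 0)"
        unfolding mpoly_eval_def by (intro sum.cong) auto
      then show ?thesis by (auto simp: in_keys_iff)
    qed
    then have "const (lookup (\<Sum>k<n. var k * Z k) 0) = subst (\<lambda>_. 0) (\<Sum>k<n. var k * Z k)" by simp
    also have "\<dots> = 0" by (simp add: subst_simps)
    finally show ?thesis by simp
  qed
  have "lookup (P * P') 0 = lookup P 0 * lookup P' 0"
    by (subst e) (simp add: lookup_add zero const_def)
  then show ?case using e *(1,3) mult is_subring_mult[OF is_subring_polys[OF B, of n]] polys_add[OF B]
      const_polys[OF polys_lookup[OF B]]
    by (intro exI[of _ ?Z]) auto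
qed

lemma ideal_generated_mem:
  assumes "ideal_in I R" "\<And>k. k < (n::nat) \<Longrightarrow> y k \<in> I" "\<And>k. k < n \<Longrightarrow> r k \<in> R"
  shows "(\<Sum>k<n. r k * y k) \<in> I"
  using assms by (intro ideal_in_sum[OF assms(1)]) (auto simp: ideal_in_def)

definition generated_ideal :: "nat \<Rightarrow> (nat \<Rightarrow> 'f::field) \<Rightarrow> 'f set \<Rightarrow> 'f set" where
  "generated_ideal n y R = {\<Sum>k<n. r k * y k | r. \<forall>k<n. r k \<in> R}"

lemma ideal_in_generated_ideal:
  assumes R: "is_subring R" and y: "\<And>k. k < n \<Longrightarrow> y k \<in> R" shows "ideal_in (generated_ideal n y R) R"
  unfolding ideal_in_def
proof (intro conjI ballI)
  show "generated_ideal n y R \<subseteq> R"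
    using y by (auto simp: generated_ideal_def intro!: is_subring_sum[OF R] is_subring_mult[OF R])
  show "0 \<in> generated_ideal n y R"
    unfolding generated_ideal_def using is_subring_zero[OF R] by (auto intro!: exI[of _ "\<lambda>_. 0"])
  fix x assume "x \<in> generated_ideal n y R"
  then obtain r where r: "\<forall>k<n. r k \<in> R" "x = (\<Sum>k<n. r k * y k)" by (auto simp: generated_ideal_def)
  { fix x' assume "x' \<in> generated_ideal n y R"
    then obtain r' where r': "\<forall>k<n. r' k \<in> R" "x' = (\<Sum>k<n. r' k * y k)" by (auto simp: generated_ideal_def)
    then show "x + x' \<in> generated_ideal n y R"
      using r is_subring_add[OF R] unfolding generated_ideal_def
      by (auto intro!: exI[of _ "\<lambda>k. r k + r' k"] simp: distrib_right sum.distrib) }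
  fix a assume "a \<in> R"
  then show "a * x \<in> generated_ideal n y R"
    using r is_subring_mult[OF R] unfolding generated_ideal_def
    by (auto intro!: exI[of _ "\<lambda>k. a * r k"] simp: sum_distrib_left mult.assoc)
qed

lemma generator_mem:
  assumes "is_subring R" "k < n" shows "y k \<in> generated_ideal n y R"
proof -
  have "(\<Sum>j<n. (if j = k then 1 else 0) * y j) = (\<Sum>j<n. if j = k then y k else 0)"
    by (rule sum.cong) auto
  then show ?thesis unfolding generated_ideal_def
    using assms is_subring_one is_subring_zero by (auto intro!: exI[of _ "\<lambda>j. if j = k then 1 else 0"])
qed

text \<open>The geometry takes place over a factorial local ring; these are the properties of the
  ring of integers that enter it.\<close>

locale nodal =
  fixes B :: "'k::field_char_0 set" and n N \<tau> :: nat and f :: "'k mpoly"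
    and W :: "nat \<Rightarrow> 'k ratfun ideal_sheaf"
  assumes base_factorial: "factorial_in B" and base_local: "local_ring B"
    and n_pos: "n > 0" and f_polys: "f \<in> polys B (Suc n)" and f_hom: "homogeneous N f"
    and odps: "equisingular_odps B n N f \<tau> W"
begin

abbreviation "P \<equiv> proj_space B n"
abbreviation "y_coord \<equiv> chart_coord n"
abbreviation "B\<^sub>0 \<equiv> const_fun ` B"

lemma base_subring: "is_subring B"
  using base_factorial by (simp add: factorial_in_def)

sublocale G: graded "homogeneous_coordinate_ring B n" "{..n}" xvar
  by (rule graded_homogeneous_coordinate_ring[OF base_subring])

lemma chart_eq: "i \<le> n \<Longrightarrow> (\<And>k. k < n \<Longrightarrow> c k \<in> B) \<Longrightarrow> G.chart i = affine_ring B n (y_coord i c)"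
  using proj_space_chart[OF base_subring] by blast

lemma P_iff: "R \<in> P \<longleftrightarrow> (\<exists>i\<le>n. local_of (G.chart i) R)"
  unfolding proj_space_def G.proj_iff by auto

lemma base_zero: "0 \<in> B" using is_subring_zero[OF base_subring] .

lemma P_local: "R \<in> P \<Longrightarrow> local_ring R"
  using G.proj_local by (simp add: proj_space_def)

lemma P_subring: "R \<in> P \<Longrightarrow> is_subring R"
  using P_local local_ring_subring by blast

lemma P_const: assumes "R \<in> P" shows "B\<^sub>0 \<subseteq> R"
proof -
  obtain i where "i \<le> n" "local_of (G.chart i) R" using P_iff assms by blast
  then show ?thesis
    using chart_eq[of i "\<lambda>_. 0"] base_zero const_affine_ring[of B n] local_of_subset by blast
qed

lemma P_separated: "separated P"
  unfolding separated_def proj_space_def using G.proj_dominated_unique dominates_refl by blast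

lemma P_localization: "R \<in> P \<Longrightarrow> local_of R R' \<Longrightarrow> R' \<in> P"
  unfolding proj_space_def by (rule G.proj_localization)

lemma P_chartI: "i \<le> n \<Longrightarrow> local_of (G.chart i) R \<Longrightarrow> R \<in> P"
  using P_iff by blast

lemma topspace_P: "topspace (zariski P) = P"
  using topspace_zariski P_subring by blast

sublocale PM: separated_model B P
  using base_factorial P_local P_const P_separated by unfold_locales

lemma B0_subring: "is_subring B\<^sub>0"
  unfolding is_subring_def
proof (intro conjI ballI)
  show "1 \<in> B\<^sub>0"
    using is_subring_one[OF base_subring] ring_map_one[OF ring_map_const_fun] by (metis imageI)
  fix x y assume "x \<in> B\<^sub>0" "y \<in> B\<^sub>0"
  then obtain a b where *: "a \<in> B" "b \<in> B" "x = const_fun a" "y = const_fun b" by blast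
  then have "x - y = const_fun (a - b)" "x * y = const_fun (a * b)"
    by (simp_all add: ring_map_diff[OF ring_map_const_fun] ring_map_mult[OF ring_map_const_fun])
  then show "x - y \<in> B\<^sub>0" "x * y \<in> B\<^sub>0"
    using * is_subring_diff[OF base_subring] is_subring_mult[OF base_subring] by simp_all
qed

lemma const_fun_inverse: "const_fun (inverse b) = inverse (const_fun b)"
proof (cases "b = 0")
  case False
  then have "const_fun b * const_fun (inverse b) = 1"
    using ring_map_mult[OF ring_map_const_fun, of b "inverse b"] ring_map_one[OF ring_map_const_fun]
    by (metis False right_inverse)
  then show ?thesis by (metis inverse_unique)
qed simp

lemma unit_in_B0: "unit_in B\<^sub>0 (const_fun b) \<longleftrightarrow> unit_in B b"
  by (auto simp: unit_in_def const_fun_inverse[symmetric] image_iff)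

lemma B0_local: "local_ring B\<^sub>0"
  using base_local B0_subring
  by (auto simp: local_ring_def unit_in_B0 ring_map_add[OF ring_map_const_fun, symmetric])

text \<open>A local ring is its own local ring at the closed point, and it lies in every other point
  of its spectrum.\<close>

lemma B0_closed_point: "B\<^sub>0 \<in> Spec_base B"
  using local_of_self[OF B0_local] B0_subring by (simp add: Spec_base_def spec_iff)

lemma Spec_base_above: "Q \<in> Spec_base B \<Longrightarrow> B\<^sub>0 \<subseteq> Q"
  using local_of_subset by (auto simp: Spec_base_def spec_iff)

lemma center_Spec_base: "R \<in> P \<Longrightarrow> center (Spec_base B) R = loc B\<^sub>0 R"
  unfolding Spec_base_def using center_spec[OF B0_subring P_local P_const] by blast

context
  fixes s assumes s: "s \<in> {1..\<tau>}"
begin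

section \<open>The ideal of a single section\<close>

abbreviation "Z \<equiv> supp P (W s)"

lemma W_closed: "closed_subscheme P (W s)"
  and W_iso: "restricts_to_iso P (W s) (Spec_base B)"
  using odps s by (auto simp: equisingular_odps_def)

lemma W_local:
  assumes "R \<in> P"
  obtains A \<aa> where "is_subring A" "openin (zariski P) (spec A)" "R \<in> spec A" "ideal_in \<aa> A"
    "\<forall>Q\<in>spec A. W s Q = Idl\<^bsub>ring_of Q\<^esub> \<aa>"
proof -
  obtain A \<aa> where "affine_open P A" "R \<in> spec A" "ideal \<aa> (ring_of A)"
    "\<forall>Q\<in>spec A. W s Q = Idl\<^bsub>ring_of Q\<^esub> \<aa>"
    using W_closed assms unfolding closed_subscheme_def by blast
  then show thesis
    using that[of A \<aa>] cring_ring_of_iff[of A] ideal_ring_of_iff[of A \<aa>] unfolding affine_open_def by blast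
qed

lemma ideal_in_W: assumes "R \<in> P" shows "ideal_in (W s R) R"
proof -
  obtain A \<aa> where *: "is_subring A" "openin (zariski P) (spec A)" "R \<in> spec A" "ideal_in \<aa> A"
    "\<forall>Q\<in>spec A. W s Q = Idl\<^bsub>ring_of Q\<^esub> \<aa>" by (rule W_local[OF assms])
  have "\<aa> \<subseteq> R" using *(3,4) local_of_subset by (auto simp: spec_iff ideal_in_def)
  then show ?thesis using genideal_ring_of(2)[OF P_subring[OF assms], of \<aa>] *(5)[rule_format, OF *(3)] by simp
qed

lemma Z_subset: "Z \<subseteq> P"
  by (auto simp: supp_def)

lemma W_max_ideal: assumes "R \<in> Z" shows "W s R \<subseteq> max_ideal R"
proof
  have R: "R \<in> P" "W s R \<noteq> R" using assms by (auto simp: supp_def)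
  note I = ideal_in_W[OF R(1)]
  fix x assume x: "x \<in> W s R"
  show "x \<in> max_ideal R"
  proof (rule ccontr)
    assume "x \<notin> max_ideal R"
    then have "unit_in R x" using x I by (auto simp: max_ideal_eq ideal_in_def)
    then have "inverse x * x \<in> W s R" "x \<noteq> 0" using x I unfolding ideal_in_def unit_in_def by blast+
    then show False using ideal_in_eq_whole[OF I] R by simp
  qed
qed

text \<open>Where the stalk is the whole ring, some element of the local ideal is a unit; the domain
  of its inverse is a neighbourhood on which the stalk remains the whole ring.\<close>

lemma closed_Z: "closedin (zariski P) Z"
  unfolding closedin_def topspace_P
proof (intro conjI Z_subset)
  show "openin (zariski P) (P - Z)"
  proof (subst openin_subopen, intro ballI)
    fix R assume "R \<in> P - Z"
    then have R: "R \<in> P" "W s R = R" by (auto simp: supp_def)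
    obtain A \<aa> where *: "is_subring A" "openin (zariski P) (spec A)" "R \<in> spec A" "ideal_in \<aa> A"
      "\<forall>Q\<in>spec A. W s Q = Idl\<^bsub>ring_of Q\<^esub> \<aa>" by (rule W_local[OF R(1)])
    have lR: "local_of A R" using *(3) by (simp add: spec_iff)
    have "1 \<in> Idl\<^bsub>ring_of R\<^esub> \<aa>" using *(5)[rule_format, OF *(3)] R is_subring_one[OF P_subring] by simp
    then obtain a w where a: "a \<in> \<aa>" "w \<in> A" "unit_in R w" "1 = a / w"
      using genideal_fraction[OF *(1) lR *(4)] by blast
    then have aw: "a = w" by (auto simp: unit_in_def field_simps)
    let ?U = "spec A \<inter> {Q \<in> P. inverse a \<in> Q}"
    have "openin (zariski P) ?U" using *(2) openin_zariski_basic by blast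
    moreover have "R \<in> ?U" using *(3) R a aw by (auto simp: unit_in_def)
    moreover have "?U \<subseteq> P - Z"
    proof
      fix Q assume Q: "Q \<in> ?U"
      then have lQ: "local_of A Q" by (simp add: spec_iff)
      have "\<aa> \<subseteq> Q" using *(4) local_of_subset[OF lQ] by (auto simp: ideal_in_def)
      then have "a \<in> W s Q" using genideal_ring_of(1)[OF local_of_subring[OF lQ]] *(5) Q a(1) by blast
      moreover have QP: "Q \<in> P" using Q by blast
      ultimately have "inverse a * a \<in> W s Q" using ideal_in_W[OF QP] Q by (auto simp: ideal_in_def)
      moreover have "a \<noteq> 0" using a aw by (auto simp: unit_in_def)
      ultimately have "W s Q = Q" using ideal_in_eq_whole[OF ideal_in_W[OF QP]] by simp
      then show "Q \<in> P - Z" using QP by (simp add: supp_def)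
    qed
    ultimately show "\<exists>U. openin (zariski P) U \<and> R \<in> U \<and> U \<subseteq> P - Z" by blast
  qed
qed

text \<open>The stalks of the section are isomorphic to local rings of the base, so no nonzero
  constant vanishes on it. This takes the place of flatness over the base.\<close>

lemma W_const_zero:
  assumes R: "R \<in> Z" and b: "b \<in> B" "const_fun b \<in> W s R" shows "b = 0"
proof -
  have RP: "R \<in> P" using R Z_subset by blast
  have C: "center (Spec_base B) R = loc B\<^sub>0 R" by (rule center_Spec_base[OF RP])
  have "(\<lambda>x. W s R +>\<^bsub>ring_of R\<^esub> x) \<in> ring_iso (ring_of (loc B\<^sub>0 R)) (ring_of R Quot W s R)"
    using W_iso R C unfolding restricts_to_iso_def by metis
  then have inj: "inj_on (\<lambda>x. W s R +>\<^bsub>ring_of R\<^esub> x) (loc B\<^sub>0 R)"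
    by (auto simp: ring_iso_def bij_betw_def)
  have lo: "local_of B\<^sub>0 (loc B\<^sub>0 R)" using local_of_loc[OF B0_subring P_local[OF RP] P_const[OF RP]] by blast
  have "const_fun b \<in> loc B\<^sub>0 R" "0 \<in> loc B\<^sub>0 R"
    using local_of_subset[OF lo] b is_subring_zero[OF local_of_subring[OF lo]] by auto
  moreover have "W s R +>\<^bsub>ring_of R\<^esub> const_fun b = W s R +>\<^bsub>ring_of R\<^esub> 0"
    using coset_eq_iff[OF P_subring[OF RP] ideal_in_W[OF RP]] b by simp
  ultimately have "const_fun b = 0" using inj by (auto dest: inj_onD)
  then show ?thesis by simp
qed

text \<open>
  Every open set that contains the closed point \<open>R\<^sub>s\<close> of the section contains the whole section, so a chart
  at \<open>R\<^sub>s\<close> suffices. As the structure sheaf of the section is that of the base, the coordinates of this chart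
  are congruent to constants \<open>c\<close> modulo the ideal of the section.
\<close>

lemma W_section:
  obtains i c R\<^sub>s where "i \<le> n" "\<And>k. k < n \<Longrightarrow> c k \<in> B" "R\<^sub>s \<in> Z" "\<And>R. R \<in> Z \<Longrightarrow> R\<^sub>s \<subseteq> R"
    "\<And>R. R \<in> Z \<longleftrightarrow> local_of (affine_ring B n (y_coord i c)) R \<and> (\<forall>k<n. y_coord i c k \<in> max_ideal R)"
    "\<And>R. R \<in> Z \<Longrightarrow> W s R = generated_ideal n (y_coord i c) R"
proof -
  have homeo: "homeomorphic_map (subtopology (zariski P) Z) (zariski (Spec_base B)) (center (Spec_base B))"
    using W_iso by (simp add: restricts_to_iso_def)
  have topZ: "topspace (subtopology (zariski P) Z) = Z" using Z_subset topspace_P by auto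
  have topS: "topspace (zariski (Spec_base B)) = Spec_base B"
    by (rule topspace_zariski) (auto simp: Spec_base_def spec_iff local_of_subring)
  have surj: "center (Spec_base B) ` Z = Spec_base B"
    using homeomorphic_imp_surjective_map[OF homeo] topZ topS by simp
  then obtain Rs where Rs: "Rs \<in> Z" "center (Spec_base B) Rs = B\<^sub>0" using B0_closed_point by (metis imageE)
  have RsP: "Rs \<in> P" using Rs Z_subset by blast
  have Rs_loc: "loc B\<^sub>0 Rs = B\<^sub>0" using Rs center_Spec_base[OF RsP] by simp
  \<comment> \<open>The image of the neighbourhood is open in the spectrum of the base and contains
    the closed point, hence every point.\<close>
  have nbhd: "Z \<subseteq> U" if U: "openin (zariski P) U" "Rs \<in> U" for U
  proof
    fix R assume R: "R \<in> Z"
    have "openin (subtopology (zariski P) Z) (U \<inter> Z)" using U by (metis openin_subtopology)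
    then have op: "openin (zariski (Spec_base B)) (center (Spec_base B) ` (U \<inter> Z))"
      using homeomorphic_imp_open_map[OF homeo] by (auto simp: open_map_def)
    have "B\<^sub>0 \<in> center (Spec_base B) ` (U \<inter> Z)" using Rs U by (metis IntI imageI)
    moreover have "center (Spec_base B) R \<in> Spec_base B" using surj R by blast
    ultimately have "center (Spec_base B) R \<in> center (Spec_base B) ` (U \<inter> Z)"
      using openin_zariski_upward[OF op] Spec_base_above by blast
    then obtain R' where "R' \<in> U \<inter> Z" "center (Spec_base B) R = center (Spec_base B) R'" by blast
    then show "R \<in> U"
      using homeomorphic_imp_injective_map[OF homeo] R topZ by (metis IntD1 IntD2 inj_onD)
  qed
  obtain i where i: "i \<le> n" "local_of (G.chart i) Rs" using RsP P_iff by blast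
  \<comment> \<open>Surjectivity of the isomorphism at the closed point: modulo the ideal of the
    section every function is a constant.\<close>
  have "\<exists>b\<in>B. x - const_fun b \<in> W s Rs" if x: "x \<in> Rs" for x
  proof -
    have "(\<lambda>x. W s Rs +>\<^bsub>ring_of Rs\<^esub> x) \<in> ring_iso (ring_of B\<^sub>0) (ring_of Rs Quot W s Rs)"
      using W_iso Rs unfolding restricts_to_iso_def by metis
    then have "(\<lambda>x. W s Rs +>\<^bsub>ring_of Rs\<^esub> x) ` B\<^sub>0 = carrier (ring_of Rs Quot W s Rs)"
      by (auto simp: ring_iso_def bij_betw_def)
    moreover have "W s Rs +>\<^bsub>ring_of Rs\<^esub> x \<in> carrier (ring_of Rs Quot W s Rs)"
      using x by (auto simp: FactRing_def A_RCOSETS_def')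
    ultimately have "W s Rs +>\<^bsub>ring_of Rs\<^esub> x \<in> (\<lambda>x. W s Rs +>\<^bsub>ring_of Rs\<^esub> x) ` B\<^sub>0" by simp
    then obtain b where "b \<in> B" "W s Rs +>\<^bsub>ring_of Rs\<^esub> x = W s Rs +>\<^bsub>ring_of Rs\<^esub> const_fun b" by blast
    then show ?thesis using coset_eq_iff[OF P_subring[OF RsP] ideal_in_W[OF RsP]] by blast
  qed
  moreover have "y_coord i (\<lambda>_. 0) k \<in> Rs" if "k < n" for k
    using coord_affine_ring[OF base_subring that, of "y_coord i (\<lambda>_. 0)"] chart_eq[OF i(1), of "\<lambda>_. 0"] base_zero
      local_of_subset[OF i(2)] by blast
  ultimately have "\<forall>k<n. \<exists>b\<in>B. y_coord i (\<lambda>_. 0) k - const_fun b \<in> W s Rs" by blast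
  then obtain c where c: "\<And>k. k < n \<Longrightarrow> c k \<in> B" "\<And>k. k < n \<Longrightarrow> y_coord i (\<lambda>_. 0) k - const_fun (c k) \<in> W s Rs"
    by metis
  let ?y = "y_coord i c"
  let ?A = "affine_ring B n ?y"
  have y_W: "?y k \<in> W s Rs" if "k < n" for k using c(2)[OF that] by (simp add: chart_coord_def)
  have chart: "G.chart i = ?A" by (rule chart_eq[OF i(1) c(1)])
  have lRs: "local_of ?A Rs" using i(2) chart by simp
  have A: "is_subring ?A" by (rule is_subring_affine_ring[OF base_subring])
  have y_R: "?y k \<in> R" if "k < n" "R \<in> Z" for k R
    using nbhd[OF openin_zariski_basic, of "?y k"] RsP that y_W[OF that(1)] ideal_in_W[OF RsP] by (auto simp: ideal_in_def)
  have loc_R: "local_of ?A R" if R: "R \<in> Z" for R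
  proof -
    have RP: "R \<in> P" using R Z_subset by blast
    have "?A \<subseteq> R" using y_R[OF _ R] P_const[OF RP] by (intro affine_ring_subset[OF P_subring[OF RP]])
    then have "xvar j / xvar i \<in> R" if "j \<le> n" for j using G.ratio_chart[of i j] i(1) that chart by auto
    then show ?thesis
      using G.dominated_in_chart[OF _ dominates_refl, of R i] RP i(1) chart by (simp add: proj_space_def)
  qed
  obtain A1 \<aa> where A1: "is_subring A1" "openin (zariski P) (spec A1)" "Rs \<in> spec A1" "ideal_in \<aa> A1"
    "\<forall>Q\<in>spec A1. W s Q = Idl\<^bsub>ring_of Q\<^esub> \<aa>" by (rule W_local[OF RsP])
  have aa_sub: "\<aa> \<subseteq> W s Q" if "Q \<in> spec A1" for Q
  proof -
    have "\<aa> \<subseteq> Q" using A1(4) that local_of_subset by (auto simp: ideal_in_def spec_iff)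
    then show ?thesis using genideal_ring_of(1)[of Q \<aa>] A1(5)[rule_format, OF that] that local_of_subring by (auto simp: spec_iff)
  qed
  \<comment> \<open>Quasi-coherence carries the relation from the closed point to R: the coordinate
    is a fraction with numerator in the local ideal, and the inverse of its denominator is defined
    along the whole section.\<close>
  have y_WR: "?y k \<in> W s R" if k: "k < n" and R: "R \<in> Z" for k R
  proof -
    have lo: "local_of A1 Rs" using A1(3) by (simp add: spec_iff)
    have "?y k \<in> Idl\<^bsub>ring_of Rs\<^esub> \<aa>" using y_W[OF k] A1(5)[rule_format, OF A1(3)] by simp
    then obtain a w where aw: "a \<in> \<aa>" "w \<in> A1" "unit_in Rs w" "?y k = a / w"
      using genideal_fraction[OF A1(1) lo A1(4)] by blast
    have "R \<in> spec A1" using nbhd[OF A1(2,3)] R by blast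
    moreover have "inverse w \<in> R"
      using nbhd[OF openin_zariski_basic, of "inverse w"] RsP aw(3) R by (auto simp: unit_in_def)
    moreover have "ideal_in (W s R) R" using ideal_in_W R Z_subset by blast
    ultimately have "inverse w * a \<in> W s R" using aa_sub aw(1) unfolding ideal_in_def by blast
    then show ?thesis using aw(4) by (simp add: divide_inverse mult.commute)
  qed
  \<comment> \<open>The numerator of an element of the ideal is expanded at the origin. Its part in
    the ideal of the coordinates lies in \<open>W s R\<close>, so the constant term does too and
    must be 0.\<close>
  have W_eq: "W s R = generated_ideal n ?y R" if R: "R \<in> Z" for R
  proof (intro equalityI subsetI)
    have RP: "R \<in> P" using R Z_subset by blast
    note I = ideal_in_W[OF RP] and lR = loc_R[OF R] and sr = P_subring[OF RP]
    show "x \<in> generated_ideal n ?y R \<Longrightarrow> x \<in> W s R" for x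
      unfolding generated_ideal_def using ideal_generated_mem[OF I, of n ?y] y_WR[OF _ R] by auto
    fix r assume r: "r \<in> W s R"
    then have "r \<in> R" using I by (auto simp: ideal_in_def)
    then obtain a w where aw: "a \<in> polys B n" "w \<in> polys B n" "unit_in R (eval ?y w)" "r = eval ?y a / eval ?y w"
      using affine_fraction[OF lR] by blast
    obtain Y where Y: "\<forall>k<n. Y k \<in> polys B n" "a = const (lookup a 0) + (\<Sum>k<n. var k * Y k)"
      using polys_split_at_0[OF base_subring aw(1)] by blast
    have mem: "eval ?y a \<in> R" if "a \<in> polys B n" for a
      using local_of_subset[OF lR] eval_affine_ring[OF that] by blast
    have ea: "eval ?y a = const_fun (lookup a 0) + (\<Sum>k<n. eval ?y (Y k) * ?y k)"
      by (subst Y(2)) (simp add: eval_simps mult.commute)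
    have "eval ?y a = eval ?y w * r" using aw by (simp add: unit_in_def)
    then have "eval ?y a \<in> W s R" using r I mem[OF aw(2)] by (auto simp: ideal_in_def)
    moreover have "(\<Sum>k<n. eval ?y (Y k) * ?y k) \<in> W s R"
      using ideal_generated_mem[OF I, of n ?y "\<lambda>k. eval ?y (Y k)"] y_WR[OF _ R] mem Y(1) by blast
    ultimately have "eval ?y a - (\<Sum>k<n. eval ?y (Y k) * ?y k) \<in> W s R" by (rule ideal_in_diff[OF sr I])
    then have "const_fun (lookup a 0) \<in> W s R" unfolding ea by simp
    then have "lookup a 0 = 0" using W_const_zero[OF R polys_lookup[OF base_subring aw(1)]] by blast
    then have "r = (\<Sum>k<n. (eval ?y (Y k) / eval ?y w) * ?y k)"
      unfolding aw(4) ea by (simp add: sum_divide_distrib)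
    moreover have "\<forall>k<n. eval ?y (Y k) / eval ?y w \<in> R" using Y(1) mem aw(3) unit_in_divide[OF sr] by blast
    ultimately show "r \<in> generated_ideal n ?y R"
      unfolding generated_ideal_def by (intro CollectI exI[of _ "\<lambda>k. eval ?y (Y k) / eval ?y w"]) simp
  qed
  have yRs_max: "?y k \<in> max_ideal R" if "k < n" "R \<in> Z" for k R
    using y_WR[OF that] W_max_ideal[OF that(2)] by blast
  \<comment> \<open>A denominator at the closed point has a constant term that is a unit of the
    base, hence it is a unit wherever all coordinates are nonunits.\<close>
  have above: "Rs \<subseteq> Q" if lQ: "local_of ?A Q" and yQ: "\<forall>k<n. ?y k \<in> max_ideal Q" for Q
  proof
    fix r assume "r \<in> Rs"
    then obtain a w where aw: "a \<in> polys B n" "w \<in> polys B n" "unit_in Rs (eval ?y w)" "r = eval ?y a / eval ?y w"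
      using affine_fraction[OF lRs] by blast
    obtain Y where Y: "\<forall>k<n. Y k \<in> polys B n" "w = const (lookup w 0) + (\<Sum>k<n. var k * Y k)"
      using polys_split_at_0[OF base_subring aw(2)] by blast
    let ?b = "lookup w 0" and ?z = "\<Sum>k<n. eval ?y (Y k) * ?y k"
    have ew: "eval ?y w = const_fun ?b + ?z"
      by (subst Y(2)) (simp add: eval_simps mult.commute)
    have bB: "?b \<in> B" using polys_lookup[OF base_subring aw(2)] .
    have z: "?z \<in> max_ideal R" if "local_of ?A R" "\<forall>k<n. ?y k \<in> max_ideal R" for R
      using that Y(1) local_of_subset[OF that(1)] eval_affine_ring
      by (intro max_ideal_sum max_ideal_mult local_of_local[OF that(1)]) blast+
    have "?z \<in> max_ideal Rs" using z[OF lRs] yRs_max Rs(1) by blast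
    then have "unit_in Rs (const_fun ?b)"
      using local_ring_add[OF P_local[OF RsP], of ?z "const_fun ?b"] aw(3) ew P_const[OF RsP] bB
      by (auto simp: max_ideal_eq add.commute)
    moreover have "dominates Rs B\<^sub>0"
      using local_of_loc(2)[OF B0_subring P_local[OF RsP] P_const[OF RsP]] Rs_loc by simp
    ultimately have "unit_in B\<^sub>0 (const_fun ?b)" using bB by (auto simp: dominates_def)
    then have uQ: "unit_in Q (const_fun ?b)"
      using unit_in_mono const_affine_ring[of B n ?y] local_of_subset[OF lQ] by (metis subset_trans)
    have zQ: "?z \<in> max_ideal Q" by (rule z[OF lQ yQ])
    have "unit_in Q (eval ?y w)"
    proof (rule ccontr)
      assume "\<not> ?thesis"
      then have "eval ?y w \<in> max_ideal Q"
        using local_of_subset[OF lQ] eval_affine_ring[OF aw(2)] by (auto simp: max_ideal_eq)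
      then have "eval ?y w - ?z \<in> max_ideal Q" using zQ max_ideal_diff[OF local_of_local[OF lQ]] by blast
      then show False using uQ ew by (simp add: max_ideal_eq)
    qed
    then show "r \<in> Q"
      unfolding aw(4) using unit_in_divide[OF local_of_subring[OF lQ]] local_of_subset[OF lQ] eval_affine_ring[OF aw(1)] by blast
  qed
  have Z_iff: "R \<in> Z \<longleftrightarrow> local_of ?A R \<and> (\<forall>k<n. ?y k \<in> max_ideal R)" for R
  proof
    show "R \<in> Z \<Longrightarrow> local_of ?A R \<and> (\<forall>k<n. ?y k \<in> max_ideal R)" using loc_R yRs_max by blast
    assume R: "local_of ?A R \<and> (\<forall>k<n. ?y k \<in> max_ideal R)"
    then have RP: "R \<in> P" using P_chartI[OF i(1)] chart by simp
    have sub: "Rs \<subseteq> R" using above R by blast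
    have RA1: "R \<in> spec A1" using openin_zariski_upward[OF A1(2,3) sub RP] .
    have "\<aa> \<subseteq> max_ideal R"
    proof
      fix a assume "a \<in> \<aa>"
      then have "a \<in> generated_ideal n ?y Rs" using aa_sub[OF A1(3)] W_eq[OF Rs(1)] by blast
      then obtain r where "\<forall>k<n. r k \<in> Rs" "a = (\<Sum>k<n. r k * ?y k)" by (auto simp: generated_ideal_def)
      then show "a \<in> max_ideal R"
        using ideal_generated_mem[OF ideal_in_max_ideal[OF P_local[OF RP]], of n ?y r] R sub by blast
    qed
    moreover have "max_ideal R \<subseteq> R" by (auto simp: max_ideal_eq)
    ultimately have "W s R \<subseteq> max_ideal R"
      using genideal_ring_of(3)[OF P_subring[OF RP], of \<aa> "max_ideal R"] ideal_in_max_ideal[OF P_local[OF RP]] A1(5)[rule_format, OF RA1] by simp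
    then have "W s R \<noteq> R" using one_notin_max_ideal[OF P_subring[OF RP]] is_subring_one[OF P_subring[OF RP]] by blast
    then show "R \<in> Z" using RP by (simp add: supp_def)
  qed
  show thesis
    using that[OF i(1) c(1) Rs(1) _ Z_iff W_eq] above loc_R yRs_max by blast
qed

end

end

section \<open>The Jacobian ideal at the points of projective space\<close>

lemma power_int_mem: "is_subring R \<Longrightarrow> unit_in R u \<Longrightarrow> power_int u m \<in> R"
  using is_subring_power[of R u "nat m"] is_subring_power[of R "inverse u" "nat (- m)"]
  by (auto simp: power_int_def unit_in_def)

lemma sum_swap:
  fixes g :: "nat \<Rightarrow> 'a::comm_monoid_add"
  assumes i: "i \<le> n" shows "(\<Sum>j\<le>n. g j) = g i + (\<Sum>k<n. g (swap i n k))"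
proof -
  have "bij_betw (swap i n) {..<n} ({..n} - {i})"
    by (rule bij_betw_byWitness[where f' = "swap i n"]) (use i in \<open>auto simp: Transposition.transpose_def\<close>)
  then have "(\<Sum>k<n. g (swap i n k)) = (\<Sum>j\<in>{..n} - {i}. g j)" by (rule sum.reindex_bij_betw)
  then show ?thesis using i by (simp add: sum.remove[of "{..n}" i])
qed

lemma total_degree_0_iff: "total_degree \<mu> = 0 \<longleftrightarrow> \<mu> = 0"
proof
  assume "total_degree \<mu> = 0"
  then have "lookup \<mu> k = 0" for k by (cases "k \<in> keys \<mu>") (auto simp: total_degree_def in_keys_iff)
  then show "\<mu> = 0" by (intro poly_mapping_eqI) simp
qed (simp add: total_degree_def)

lemma total_degree_1:
  assumes "total_degree \<mu> = 1" shows "\<exists>k. \<mu> = single k 1"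
proof -
  have "\<mu> \<noteq> 0" using assms by (auto simp: total_degree_def)
  then obtain k where k: "k \<in> keys \<mu>" using keys_eq_empty by blast
  then have e: "\<mu> - single k 1 + single k 1 = \<mu>" by (intro single_diff_add) (simp add: in_keys_iff)
  then have "total_degree (\<mu> - single k 1) + 1 = 1"
    using assms total_degree_add[of "\<mu> - single k 1" "single k 1"] by simp
  then have "\<mu> - single k 1 = 0" using total_degree_0_iff by simp
  then show ?thesis using e by (metis add_0)
qed

definition blowup_subst :: "nat \<Rightarrow> nat \<Rightarrow> 'k::comm_ring_1 mpoly" where
  "blowup_subst l k = (if k = l then var l else var k * var l)"

text \<open>The substitution is the variable l times another one, so a monomial of total degree d
  acquires that variable to the power d.\<close>

lemma blowup_subst_divisible:
  assumes B: "is_subring B" and l: "l < n" and P: "P \<in> polys B n" and deg: "\<And>\<mu>. \<mu> \<in> keys P \<Longrightarrow> m \<le> total_degree \<mu>"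
  shows "\<exists>G\<in>polys B n. subst (blowup_subst l) P = var l ^ m * G"
proof -
  note S = is_subring_polys[OF B, of n]
  let ?q' = "\<lambda>k. if k = l then 1 else var k :: 'a mpoly"
  let ?G = "\<lambda>\<mu>. var l ^ (total_degree \<mu> - m) * subst ?q' (single \<mu> (lookup P \<mu>))"
  have q: "blowup_subst l = (\<lambda>k. var l * ?q' k)" by (auto simp: blowup_subst_def mult.commute)
  have "subst (blowup_subst l) (single \<mu> (lookup P \<mu>)) = var l ^ m * ?G \<mu>" if "\<mu> \<in> keys P" for \<mu>
  proof -
    have "subst (blowup_subst l) (single \<mu> (lookup P \<mu>)) = var l ^ total_degree \<mu> * subst ?q' (single \<mu> (lookup P \<mu>))"
      unfolding q by (rule homogeneous_eval_scale[OF homogeneous_single[OF refl]])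
    also have "var l ^ total_degree \<mu> = var l ^ m * var l ^ (total_degree \<mu> - m)"
      using deg[OF that] by (simp flip: power_add)
    finally show ?thesis by (simp add: mult.assoc)
  qed
  then have "(\<Sum>\<mu>\<in>keys P. subst (blowup_subst l) (single \<mu> (lookup P \<mu>))) = var l ^ m * (\<Sum>\<mu>\<in>keys P. ?G \<mu>)"
    unfolding sum_distrib_left by (intro sum.cong) auto
  then have "subst (blowup_subst l) P = var l ^ m * (\<Sum>\<mu>\<in>keys P. ?G \<mu>)"
    using ring_map_sum[OF ring_map_subst, of "blowup_subst l" "\<lambda>\<mu>. single \<mu> (lookup P \<mu>)" "keys P"] mpoly_sum_single[of P]
    by simp
  moreover have "(\<Sum>\<mu>\<in>keys P. ?G \<mu>) \<in> polys B n"
  proof (intro polys_sum[OF B] is_subring_mult[OF S] is_subring_power[OF S] var_polys[OF B l])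
    fix \<mu> assume "\<mu> \<in> keys P"
    then have "single \<mu> (lookup P \<mu>) \<in> polys B n" using P by (auto simp: polys_def)
    then show "subst ?q' (single \<mu> (lookup P \<mu>)) \<in> polys B n"
      by (rule mpoly_eval_mem[OF S]) (auto intro: const_polys is_subring_one[OF S] var_polys[OF B])
  qed
  ultimately show ?thesis by blast
qed

lemma blowup_subst_polys:
  assumes B: "is_subring B" and l: "l < n" and P: "P \<in> polys B n"
  shows "subst (blowup_subst l) P \<in> polys B n"
  using blowup_subst_divisible[OF assms, of 0] by auto

lemma eval_blowup_subst:
  assumes "y l \<noteq> 0" shows "eval (blowup_coord y l) (subst (blowup_subst l) P) = eval y P"
proof -
  have "(\<lambda>k. eval (blowup_coord y l) (blowup_subst l k)) = y"
    using assms by (auto simp: blowup_subst_def blowup_coord_def eval_simps)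
  then show ?thesis by (simp add: mpoly_eval_subst[OF ring_map_const_fun])
qed

context nodal
begin

section \<open>The Jacobian ideal in affine charts\<close>

abbreviation "Ws s \<equiv> supp P (W s)"
abbreviation "I\<^sub>W \<equiv> disjoint_union_ideal {1..\<tau>} W"
abbreviation "J \<equiv> jacobian_image B n N f"
abbreviation "X \<equiv> supp P (hypersurface_ideal B n N f)"
abbreviation "F i c \<equiv> dehomogenize n i c f"
abbreviation "A\<^sub>0 i c \<equiv> affine_ring B n (y_coord i c)"

lemma W_mem: "R \<in> P \<Longrightarrow> s \<in> {1..\<tau>} \<Longrightarrow> W s R \<subseteq> R"
  using ideal_in_W[of s R] unfolding ideal_in_def by blast

lemma Ws_disjoint: "s \<in> {1..\<tau>} \<Longrightarrow> t \<in> {1..\<tau>} \<Longrightarrow> s \<noteq> t \<Longrightarrow> R \<in> Ws s \<Longrightarrow> R \<notin> Ws t"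
  using odps unfolding equisingular_odps_def by blast

lemma W_outside: "R \<in> P \<Longrightarrow> R \<notin> Ws s \<Longrightarrow> W s R = R"
  by (simp add: supp_def)

lemma IW_outside:
  assumes "R \<in> P" "\<And>s. s \<in> {1..\<tau>} \<Longrightarrow> R \<notin> Ws s" shows "I\<^sub>W R = R"
  using W_outside[OF assms(1)] assms(2) by (auto simp: disjoint_union_ideal_def)

lemma IW_on:
  assumes s: "s \<in> {1..\<tau>}" and R: "R \<in> Ws s" shows "I\<^sub>W R = W s R"
proof -
  have RP: "R \<in> P" using R by (simp add: supp_def)
  have "W t R = R" if "t \<in> {1..\<tau>}" "t \<noteq> s" for t using W_outside[OF RP] Ws_disjoint[OF s] that R by metis
  then show ?thesis using W_mem[OF RP s] s unfolding disjoint_union_ideal_def by blast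
qed

lemma supp_IW: "supp P I\<^sub>W = (\<Union>s\<in>{1..\<tau>}. Ws s)"
proof (intro equalityI subsetI)
  fix R assume "R \<in> supp P I\<^sub>W"
  then show "R \<in> (\<Union>s\<in>{1..\<tau>}. Ws s)" using IW_outside by (auto simp: supp_def)
next
  fix R assume "R \<in> (\<Union>s\<in>{1..\<tau>}. Ws s)"
  then obtain s where s: "s \<in> {1..\<tau>}" "R \<in> Ws s" by blast
  then show "R \<in> supp P I\<^sub>W" using IW_on[OF s] by (simp add: supp_def)
qed

text \<open>On the overlap of two charts the ratio of the two variables is a unit, so any chart
  containing R gives the same stalk.\<close>

lemma twist_chart:
  assumes i: "i \<le> n" and R: "local_of (G.chart i) R"
  shows "twist B n m R = {power_int (xvar i) m * r | r. r \<in> R}"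
proof (intro equalityI subsetI)
  note sr = local_of_subring[OF R]
  fix x assume "x \<in> twist B n m R"
  then obtain i' r where *: "x = power_int (xvar i') m * r" "i' \<le> n" "r \<in> R" "local_of (G.chart i') R"
    by (auto simp: twist_def spec_iff)
  have "xvar i' / xvar i \<in> R" "xvar i / xvar i' \<in> R"
    using G.ratio_chart[of i i'] G.ratio_chart[of i' i] i *(2) local_of_subset[OF R] local_of_subset[OF *(4)] by auto
  then have "unit_in R (xvar i' / xvar i)" by (simp add: unit_in_def)
  then have "power_int (xvar i' / xvar i) m * r \<in> R" using power_int_mem[OF sr] is_subring_mult[OF sr] *(3) by blast
  moreover have "x = power_int (xvar i) m * (power_int (xvar i' / xvar i) m * r)"
    unfolding *(1) by (simp add: power_int_divide_distrib)
  ultimately show "x \<in> {power_int (xvar i) m * r | r. r \<in> R}" by blast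
next
  fix x assume "x \<in> {power_int (xvar i) m * r | r. r \<in> R}"
  moreover have "R \<in> spec (G.chart i)"
    using R G.is_subring_homogeneous_localization[OF G.e_S[of i]] i by (simp add: spec_iff)
  ultimately show "x \<in> twist B n m R" using i unfolding twist_def by blast
qed

text \<open>The j-th generator of the Jacobian image in the trivialisation of the chart i. The
  exponent is an integer because it is 1 for N = 0.\<close>

definition dpart :: "nat \<Rightarrow> nat \<Rightarrow> 'k ratfun" where
  "dpart i j = power_int (xvar i) (- int N + 1) * embed (partial_deriv j f)"

lemma J_chart:
  assumes i: "i \<le> n" and R: "local_of (G.chart i) R"
  shows "J R = {\<Sum>j\<le>n. r j * dpart i j | r. \<forall>j\<le>n. r j \<in> R}"
proof (intro equalityI subsetI)
  fix x assume "x \<in> J R"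
  then obtain h where h: "\<forall>j\<le>n. h j \<in> twist B n (- int N + 1) R" "x = (\<Sum>j\<le>n. h j * embed (partial_deriv j f))"
    by (auto simp: jacobian_image_def)
  then have "\<forall>j\<le>n. \<exists>r\<in>R. h j = power_int (xvar i) (- int N + 1) * r" unfolding twist_chart[OF i R] by blast
  then obtain r where r: "\<forall>j\<le>n. r j \<in> R \<and> h j = power_int (xvar i) (- int N + 1) * r j" by metis
  then have "x = (\<Sum>j\<le>n. r j * dpart i j)"
    unfolding h(2) by (intro sum.cong) (auto simp: dpart_def)
  then show "x \<in> {\<Sum>j\<le>n. r j * dpart i j | r. \<forall>j\<le>n. r j \<in> R}" using r by blast
next
  fix x assume "x \<in> {\<Sum>j\<le>n. r j * dpart i j | r. \<forall>j\<le>n. r j \<in> R}"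
  then obtain r where r: "\<forall>j\<le>n. r j \<in> R" "x = (\<Sum>j\<le>n. r j * dpart i j)" by blast
  then have "x = (\<Sum>j\<le>n. (power_int (xvar i) (- int N + 1) * r j) * embed (partial_deriv j f))"
    by (simp add: dpart_def mult_ac)
  then show "x \<in> J R" unfolding jacobian_image_def twist_chart[OF i R] using r(1)
    by (intro CollectI exI[of _ "\<lambda>j. power_int (xvar i) (- int N + 1) * r j"]) auto
qed

lemma chart_eq': "i \<le> n \<Longrightarrow> \<forall>k<n. c k \<in> B \<Longrightarrow> G.chart i = A\<^sub>0 i c"
  using chart_eq by blast

lemma F_polys: "i \<le> n \<Longrightarrow> \<forall>k<n. c k \<in> B \<Longrightarrow> F i c \<in> polys B n"
  using dehomogenize_polys[OF base_subring _ _ f_polys] by blast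

lemma eval_F: "i \<le> n \<Longrightarrow> eval (y_coord i c) (F i c) = embed f / xvar i ^ N"
  using eval_dehomogenize[OF _ f_polys f_hom] by blast

lemma dpart_eq:
  assumes i: "i \<le> n" and k: "k < n"
  shows "dpart i (swap i n k) = eval (y_coord i c) (partial_deriv k (F i c))"
proof (cases N)
  case 0
  \<comment> \<open>In degree 0 the exponent in \<open>dpart\<close> is positive, but then f is
    constant and all derivatives vanish.\<close>
  have "partial_deriv j f = 0" for j
  proof (rule poly_mapping_eqI)
    fix \<nu>
    have "total_degree (\<nu> + single j 1) \<noteq> N" by (simp add: total_degree_add 0)
    then have "lookup f (\<nu> + single j 1) = 0" using f_hom by (auto simp: homogeneous_iff in_keys_iff)
    then show "lookup (partial_deriv j f) \<nu> = lookup 0 \<nu>" by (simp add: lookup_partial_deriv)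
  qed
  then show ?thesis
    unfolding partial_deriv_dehomogenize[OF i k f_polys] by (simp add: dpart_def dehomogenize_def subst_simps eval_simps)
next
  case (Suc M)
  have "partial_deriv (swap i n k) f \<in> polys B (Suc n)" "homogeneous M (partial_deriv (swap i n k) f)"
    using partial_deriv_polys[OF base_subring f_polys] homogeneous_partial_deriv f_hom Suc by auto
  then have "eval (y_coord i c) (partial_deriv k (F i c)) = embed (partial_deriv (swap i n k) f) / xvar i ^ M"
    unfolding partial_deriv_dehomogenize[OF i k f_polys] using eval_dehomogenize[OF i] by blast
  moreover have "power_int (xvar i :: 'k ratfun) (- int N + 1) = inverse (xvar i ^ M)"
    using Suc by (simp add: power_int_minus)
  ultimately show ?thesis by (simp add: dpart_def divide_inverse mult.commute)
qed

text \<open>The derivative along the homogenising variable has no counterpart in the chart; Euler's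
  identity expresses it by the equation and the other derivatives.\<close>

lemma dpart_euler:
  assumes i: "i \<le> n"
  shows "dpart i i = of_nat N * (embed f / xvar i ^ N) - (\<Sum>k<n. (xvar (swap i n k) / xvar i) * dpart i (swap i n k))"
proof -
  let ?p = "power_int (xvar i :: 'k ratfun) (- int N + 1)"
  have "(\<Sum>j\<le>n. xvar j * embed (partial_deriv j f)) = of_nat N * embed f"
    using arg_cong[OF euler_identity[OF f_hom polys_UNIV[OF f_polys]], of embed]
    by (simp add: ring_map_sum[OF ring_map_embed] ring_map_mult[OF ring_map_embed] ring_map_of_nat[OF ring_map_embed]
        lessThan_Suc_atMost)
  moreover have "(\<Sum>j\<le>n. (xvar j / xvar i) * dpart i j) = (?p / xvar i) * (\<Sum>j\<le>n. xvar j * embed (partial_deriv j f))"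
    unfolding sum_distrib_left dpart_def by (intro sum.cong) (simp_all add: divide_inverse mult_ac)
  ultimately have "(\<Sum>j\<le>n. (xvar j / xvar i) * dpart i j) = (?p / xvar i) * (of_nat N * embed f)" by simp
  also have "?p = power_int (xvar i) (- int N) * xvar i"
    using power_int_add[of "xvar i :: 'k ratfun" "- int N" 1] by simp
  also have "power_int (xvar i) (- int N) * xvar i / xvar i = 1 / xvar i ^ N"
    by (simp add: power_int_minus divide_inverse)
  finally have "(\<Sum>j\<le>n. (xvar j / xvar i) * dpart i j) = of_nat N * (embed f / xvar i ^ N)" by simp
  then show ?thesis unfolding sum_swap[OF i] by (simp add: algebra_simps)
qed

lemma dpart_mem:
  assumes i: "i \<le> n" and R: "local_of (G.chart i) R" and j: "j \<le> n" shows "dpart i j \<in> R"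
proof -
  note sr = local_of_subring[OF R]
  have A: "G.chart i = A\<^sub>0 i (\<lambda>_. 0)" using chart_eq'[OF i, of "\<lambda>_. 0"] base_zero by blast
  have mem: "eval (y_coord i (\<lambda>_. 0)) a \<in> R" if "a \<in> polys B n" for a
    using local_of_subset[OF R] eval_affine_ring[OF that] unfolding A by blast
  have F: "F i (\<lambda>_. 0) \<in> polys B n" using F_polys[OF i, of "\<lambda>_. 0"] base_zero by blast
  have 1: "dpart i (swap i n k) \<in> R" if "k < n" for k
    unfolding dpart_eq[OF i that, of "\<lambda>_. 0"] using mem partial_deriv_polys[OF base_subring F] by blast
  have rat: "xvar (swap i n k) / xvar i \<in> R" if "k < n" for k
    using G.ratio_chart[of i "swap i n k"] local_of_subset[OF R] swap_le[OF i that] i by auto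
  show ?thesis
  proof (cases "j = i")
    case True
    show ?thesis
      unfolding True dpart_euler[OF i] eval_F[OF i, of "\<lambda>_. 0", symmetric]
      using 1 rat mem[OF F] is_subring_of_nat[OF sr]
      by (intro is_subring_diff[OF sr] is_subring_sum[OF sr] is_subring_mult[OF sr]) auto
  next
    case False
    then have "swap i n (swap i n j) = j" "swap i n j < n" using swap_lt[OF i j] by simp_all
    then show ?thesis using 1 by metis
  qed
qed

lemma ideal_in_J:
  assumes i: "i \<le> n" and R: "local_of (G.chart i) R" shows "ideal_in (J R) R"
proof -
  have "J R = generated_ideal (Suc n) (dpart i) R"
    unfolding J_chart[OF i R] generated_ideal_def by (simp only: lessThan_Suc_atMost less_Suc_eq_le)
  then show ?thesis using ideal_in_generated_ideal[OF local_of_subring[OF R], of "Suc n" "dpart i"] dpart_mem[OF i R] by simp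
qed

text \<open>The annihilator of the cyclic module R / J is J itself, so the hypothesis on the support
  describes the Jacobian ideal.\<close>

lemma J_eq_IW:
  assumes R: "R \<in> P" shows "J R = I\<^sub>W R"
proof -
  obtain i where i: "i \<le> n" "local_of (G.chart i) R" using R P_iff by blast
  note I = ideal_in_J[OF i]
  have "cokernel_annihilator J R = J R"
  proof (intro equalityI subsetI)
    fix r assume "r \<in> cokernel_annihilator J R"
    then have "r * 1 \<in> J R" using is_subring_one[OF P_subring[OF R]] unfolding cokernel_annihilator_def by blast
    then show "r \<in> J R" by simp
  next
    fix r assume r: "r \<in> J R"
    have "s * r \<in> J R" if "s \<in> R" for s using I r that unfolding ideal_in_def by blast
    then have "\<forall>s\<in>R. r * s \<in> J R" by (simp add: mult.commute)
    then show "r \<in> cokernel_annihilator J R" using r I unfolding cokernel_annihilator_def ideal_in_def by blast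
  qed
  then show ?thesis using odps R unfolding equisingular_odps_def by metis
qed

lemma X_iff:
  assumes i: "i \<le> n" and R: "local_of (G.chart i) R"
  shows "R \<in> X \<longleftrightarrow> \<not> unit_in R (embed f / xvar i ^ N)"
proof -
  let ?\<phi> = "embed f / xvar i ^ N"
  note sr = local_of_subring[OF R]
  have RP: "R \<in> P" using P_chartI i R by blast
  have A: "G.chart i = A\<^sub>0 i (\<lambda>_. 0)" using chart_eq'[OF i, of "\<lambda>_. 0"] base_zero by blast
  have \<phi>: "?\<phi> \<in> R"
    using eval_affine_ring[OF F_polys[OF i], of "\<lambda>_. 0" "y_coord i (\<lambda>_. 0)"] base_zero local_of_subset[OF R]
    unfolding A eval_F[OF i] by blast
  have H: "hypersurface_ideal B n N f R = {r * ?\<phi> | r. r \<in> R}"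
    unfolding hypersurface_ideal_def twist_chart[OF i R] power_int_minus
    by (auto simp: divide_inverse mult_ac)
  have "{r * ?\<phi> | r. r \<in> R} = R \<longleftrightarrow> unit_in R ?\<phi>"
  proof
    assume "{r * ?\<phi> | r. r \<in> R} = R"
    then obtain r where r: "r \<in> R" "1 = r * ?\<phi>" using is_subring_one[OF sr] by blast
    have "?\<phi> \<noteq> 0" using r(2) by (metis mult_zero_right zero_neq_one)
    then have "inverse ?\<phi> = r" using r(2) by (metis inverse_unique mult.commute)
    then show "unit_in R ?\<phi>" using \<phi> r \<open>?\<phi> \<noteq> 0\<close> by (simp add: unit_in_def)
  next
    assume u: "unit_in R ?\<phi>"
    show "{r * ?\<phi> | r. r \<in> R} = R"
    proof (intro equalityI subsetI)
      fix r assume r: "r \<in> R"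
      have "r = (r / ?\<phi>) * ?\<phi>" using u by (simp add: unit_in_def)
      moreover have "r / ?\<phi> \<in> R" using unit_in_divide[OF sr r u] .
      ultimately show "r \<in> {r * ?\<phi> | r. r \<in> R}" by blast
    qed (use \<phi> is_subring_mult[OF sr] in blast)
  qed
  then show ?thesis using RP H by (simp add: supp_def)
qed

text \<open>If all affine derivatives vanished together with the equation, Euler's identity would
  make the remaining generator vanish as well, whereas the Jacobian ideal is the unit ideal
  here.\<close>

lemma smooth_point:
  assumes i: "i \<le> n" and c: "\<forall>k<n. c k \<in> B" and R: "local_of (A\<^sub>0 i c) R"
    and out: "R \<notin> supp P I\<^sub>W" and X: "R \<in> X"
  shows "\<exists>k<n. unit_in R (eval (y_coord i c) (partial_deriv k (F i c)))"
proof (rule ccontr)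
  assume none: "\<not> ?thesis"
  have R': "local_of (G.chart i) R" using R chart_eq'[OF i c] by simp
  then have RP: "R \<in> P" using P_chartI i by blast
  note lR = local_of_local[OF R] and sr = local_of_subring[OF R]
  have m: "dpart i (swap i n k) \<in> max_ideal R" if "k < n" for k
    using none that dpart_mem[OF i R', of "swap i n k"] swap_le[OF i that] dpart_eq[OF i that, of c]
    by (auto simp: max_ideal_eq)
  have \<phi>: "embed f / xvar i ^ N \<in> max_ideal R"
    using X_iff[OF i R'] X local_of_subset[OF R] eval_affine_ring[OF F_polys[OF i c], of "y_coord i c"]
    unfolding eval_F[OF i] max_ideal_eq by blast
  have rat: "xvar (swap i n k) / xvar i \<in> R" if "k < n" for k
    using G.ratio_chart[of i "swap i n k"] local_of_subset[OF R'] swap_le[OF i that] i by auto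
  have "dpart i i \<in> max_ideal R"
    unfolding dpart_euler[OF i] using m \<phi> rat is_subring_of_nat[OF sr]
    by (intro max_ideal_diff[OF lR] max_ideal_sum[OF lR] max_ideal_mult[OF lR]) auto
  have all: "dpart i j \<in> max_ideal R" if "j \<le> n" for j
  proof (cases "j = i")
    case False
    then have "swap i n (swap i n j) = j" "swap i n j < n" using swap_lt[OF i that] by simp_all
    then show ?thesis using m by metis
  qed (use \<open>dpart i i \<in> max_ideal R\<close> in simp)
  have "1 \<in> J R"
    using out RP J_eq_IW[OF RP] is_subring_one[OF sr] by (auto simp: supp_def)
  then obtain r where r: "\<forall>j\<le>n. r j \<in> R" "1 = (\<Sum>j\<le>n. r j * dpart i j)" unfolding J_chart[OF i R'] by blast
  have "(\<Sum>j\<le>n. r j * dpart i j) \<in> max_ideal R"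
    using r(1) all by (intro max_ideal_sum[OF lR] max_ideal_mult[OF lR]) auto
  then show False using r(2) one_notin_max_ideal[OF sr] by simp
qed


subsection \<open>Equations near a singular section\<close>

definition section_at where
  "section_at s i c \<longleftrightarrow> i \<le> n \<and> (\<forall>k<n. c k \<in> B) \<and> (\<exists>R\<^sub>s\<in>Ws s. \<forall>R\<in>Ws s. R\<^sub>s \<subseteq> R) \<and>
     (\<forall>R. R \<in> Ws s \<longleftrightarrow> local_of (A\<^sub>0 i c) R \<and> (\<forall>k<n. y_coord i c k \<in> max_ideal R)) \<and>
     (\<forall>R\<in>Ws s. W s R = generated_ideal n (y_coord i c) R)"

lemma section_exists: assumes "s \<in> {1..\<tau>}" shows "\<exists>i c. section_at s i c"
proof -
  show ?thesis
  proof (rule W_section[OF assms])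
    fix i c R\<^sub>s
    assume *: "i \<le> n" "\<And>k. k < n \<Longrightarrow> c k \<in> B" "R\<^sub>s \<in> Ws s" "\<And>R. R \<in> Ws s \<Longrightarrow> R\<^sub>s \<subseteq> R"
      "\<And>R. R \<in> Ws s \<longleftrightarrow> local_of (A\<^sub>0 i c) R \<and> (\<forall>k<n. y_coord i c k \<in> max_ideal R)"
      "\<And>R. R \<in> Ws s \<Longrightarrow> W s R = generated_ideal n (y_coord i c) R"
    have "section_at s i c"
      unfolding section_at_def
    proof (intro conjI allI impI ballI)
      show "\<exists>R\<^sub>s\<in>Ws s. \<forall>R\<in>Ws s. R\<^sub>s \<subseteq> R" using *(3,4) by blast
    qed (rule *; assumption)+
    then show ?thesis by blast
  qed
qed

context
  fixes s i c R
  assumes s: "s \<in> {1..\<tau>}" and sec: "section_at s i c" and R: "R \<in> Ws s"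
begin

lemma sec_i: "i \<le> n" and sec_c: "\<forall>k<n. c k \<in> B"
  and sec_loc: "local_of (A\<^sub>0 i c) R" and sec_max: "k < n \<Longrightarrow> y_coord i c k \<in> max_ideal R"
  and sec_W: "W s R = generated_ideal n (y_coord i c) R"
  using sec R unfolding section_at_def by blast+

lemma sec_P: "R \<in> P"
  using R by (simp add: supp_def)

lemma sec_chart: "local_of (G.chart i) R"
  using sec_loc chart_eq'[OF sec_i sec_c] by simp

lemma sec_F: "F i c \<in> polys B n"
  using F_polys[OF sec_i sec_c] by blast

lemma sec_J: "J R = W s R"
  using J_eq_IW[OF sec_P] IW_on[OF s R] by simp

lemma sec_y_nonzero: "l < n \<Longrightarrow> y_coord i c l \<noteq> 0"
  using alg_independent_zero_iff[OF alg_independent_chart_coord[OF sec_i] var_polys[OF base_subring], of l c]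
  by (simp add: eval_simps)

text \<open>The polynomial differs from its constant term by an element of the ideal of the section,
  and a constant in that ideal is 0.\<close>

lemma sec_constant_term:
  assumes a: "a \<in> polys B n" and W: "eval (y_coord i c) a \<in> W s R" shows "lookup a 0 = 0"
proof -
  note I = ideal_in_W[OF s sec_P] and sr = local_of_subring[OF sec_loc]
  obtain Y where Y: "\<forall>k<n. Y k \<in> polys B n" "a = const (lookup a 0) + (\<Sum>k<n. var k * Y k)"
    using polys_split_at_0[OF base_subring a] by blast
  have ea: "eval (y_coord i c) a = const_fun (lookup a 0) + (\<Sum>k<n. eval (y_coord i c) (Y k) * y_coord i c k)"
    by (subst Y(2)) (simp add: eval_simps mult.commute)
  have "\<forall>k<n. eval (y_coord i c) (Y k) \<in> R" using Y(1) local_of_subset[OF sec_loc] eval_affine_ring by blast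
  then have "(\<Sum>k<n. eval (y_coord i c) (Y k) * y_coord i c k) \<in> W s R"
    unfolding sec_W generated_ideal_def by (intro CollectI exI[of _ "\<lambda>k. eval (y_coord i c) (Y k)"]) simp
  then have "eval (y_coord i c) a - (\<Sum>k<n. eval (y_coord i c) (Y k) * y_coord i c k) \<in> W s R"
    by (rule ideal_in_diff[OF sr I W])
  then have "const_fun (lookup a 0) \<in> W s R" unfolding ea by simp
  then show ?thesis using W_const_zero[OF s R polys_lookup[OF base_subring a]] by blast
qed

lemma sec_dpart: "j \<le> n \<Longrightarrow> dpart i j \<in> W s R"
  unfolding sec_J[symmetric] J_chart[OF sec_i sec_chart]
  using is_subring_one[OF P_subring[OF sec_P]] is_subring_zero[OF P_subring[OF sec_P]]
    generator_mem[OF P_subring[OF sec_P], of j "Suc n" "dpart i"]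
  by (simp add: generated_ideal_def lessThan_Suc_atMost less_Suc_eq_le)

text \<open>For a constant f the Jacobian ideal would be 0, but it contains the nonzero first
  coordinate.\<close>

lemma sec_N: "N \<noteq> 0"
proof
  assume N: "N = 0"
  have "dpart i j = 0" for j
  proof -
    have "partial_deriv j f = 0"
    proof (rule poly_mapping_eqI)
      fix \<nu>
      have "total_degree (\<nu> + single j 1) \<noteq> N" by (simp add: total_degree_add N)
      then have "lookup f (\<nu> + single j 1) = 0" using f_hom by (auto simp: homogeneous_iff in_keys_iff)
      then show "lookup (partial_deriv j f) \<nu> = lookup 0 \<nu>" by (simp add: lookup_partial_deriv)
    qed
    then show ?thesis by (simp add: dpart_def)
  qed
  then have "W s R \<subseteq> {0}" unfolding sec_J[symmetric] J_chart[OF sec_i sec_chart] by auto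
  moreover have "y_coord i c 0 \<in> W s R" unfolding sec_W using generator_mem[OF P_subring[OF sec_P] n_pos] .
  ultimately show False using sec_y_nonzero[OF n_pos] by blast
qed

text \<open>
  The equation vanishes on the section although \<open>p\<close> may divide \<open>N\<close>: \<open>N f\<close> does by Euler's identity, and the
  section is flat over the base.
\<close>

lemma sec_F_order: "\<mu> \<in> keys (F i c) \<Longrightarrow> 2 \<le> total_degree \<mu>"
proof (rule ccontr)
  note I = ideal_in_W[OF s sec_P] and sr = P_subring[OF sec_P]
  assume \<mu>: "\<mu> \<in> keys (F i c)" and "\<not> 2 \<le> total_degree \<mu>"
  then consider "total_degree \<mu> = 0" | "total_degree \<mu> = 1" by linarith
  then show False
  proof cases
    case 1
    have rat: "xvar (swap i n k) / xvar i \<in> R" if "k < n" for k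
      using G.ratio_chart[of i "swap i n k"] local_of_subset[OF sec_chart] swap_le[OF sec_i that] sec_i by auto
    have "(\<Sum>k<n. (xvar (swap i n k) / xvar i) * dpart i (swap i n k)) \<in> W s R"
    proof (rule ideal_generated_mem[OF I])
      show "dpart i (swap i n k) \<in> W s R" if "k < n" for k using sec_dpart swap_le[OF sec_i that] by blast
    qed (rule rat)
    moreover have "dpart i i \<in> W s R" using sec_dpart sec_i by blast
    ultimately have "dpart i i + (\<Sum>k<n. (xvar (swap i n k) / xvar i) * dpart i (swap i n k)) \<in> W s R"
      using I unfolding ideal_in_def by blast
    then have "eval (y_coord i c) (of_nat N * F i c) \<in> W s R"
      unfolding dpart_euler[OF sec_i] by (simp add: eval_simps eval_F[OF sec_i])
    moreover have "of_nat N * F i c \<in> polys B n"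
      using is_subring_mult[OF is_subring_polys[OF base_subring] is_subring_of_nat[OF is_subring_polys[OF base_subring]] sec_F] .
    ultimately have "lookup (of_nat N * F i c) 0 = 0" using sec_constant_term by blast
    moreover have "of_nat N * F i c = const (of_nat N) * F i c" by (simp add: ring_map_of_nat[OF ring_map_const])
    moreover have "lookup (const a * Q) 0 = a * lookup Q 0" for a and Q :: "'k mpoly"
      by (simp add: const_def mult_map_scale_conv_mult[symmetric] map.rep_eq when_def)
    ultimately have "lookup (F i c) 0 = 0" using sec_N by simp
    then show False using \<mu> 1 total_degree_0_iff by (simp add: in_keys_iff)
  next
    case 2
    \<comment> \<open>The coefficient of a linear monomial is the constant term of a partial
      derivative, which lies in the ideal of the section.\<close>
    then obtain k where k: "\<mu> = single k 1" using total_degree_1 by blast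
    have kn: "k < n" using \<mu> sec_F k by (auto simp: polys_def)
    have "eval (y_coord i c) (partial_deriv k (F i c)) \<in> W s R"
      using sec_dpart[of "swap i n k"] swap_le[OF sec_i kn] dpart_eq[OF sec_i kn, of c] by simp
    then have "lookup (partial_deriv k (F i c)) 0 = 0"
      using sec_constant_term partial_deriv_polys[OF base_subring sec_F] by blast
    then show False using \<mu> k by (simp add: lookup_partial_deriv in_keys_iff)
  qed
qed

lemma sec_X: "R \<in> X"
proof -
  obtain Y where Y: "\<forall>k<n. Y k \<in> polys B n" "F i c = const (lookup (F i c) 0) + (\<Sum>k<n. var k * Y k)"
    using polys_split_at_0[OF base_subring sec_F] by blast
  have "lookup (F i c) 0 = 0" using sec_F_order[of 0] total_degree_0_iff[of 0] by (auto simp: in_keys_iff)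
  then have "F i c = (\<Sum>k<n. var k * Y k)" using Y(2) by simp
  then have "eval (y_coord i c) (F i c) = (\<Sum>k<n. eval (y_coord i c) (Y k) * y_coord i c k)"
    by (simp add: eval_simps mult.commute)
  also have "\<dots> \<in> max_ideal R"
    using Y(1) sec_max local_of_subset[OF sec_loc] eval_affine_ring
    by (intro max_ideal_sum max_ideal_mult local_of_local[OF sec_loc]) blast+
  finally show ?thesis unfolding X_iff[OF sec_i sec_chart] eval_F[OF sec_i] by (simp add: max_ideal_eq)
qed

text \<open>The coordinate lies in the Jacobian ideal. Eliminating the derivative along the
  homogenising variable by Euler's identity produces the coefficient \<open>r0\<close>, a multiple
  of N.\<close>

lemma sec_coordinate_jacobian:
  assumes l: "l < n"
  obtains r r0 where "\<forall>k<n. r k \<in> R" "r0 \<in> R"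
    "y_coord i c l = (\<Sum>k<n. r k * eval (y_coord i c) (partial_deriv k (F i c))) + r0 * eval (y_coord i c) (F i c)"
proof -
  note sr = P_subring[OF sec_P]
  have "y_coord i c l \<in> J R" unfolding sec_J sec_W using generator_mem[OF sr l] .
  then obtain a where a: "\<forall>j\<le>n. a j \<in> R" "y_coord i c l = (\<Sum>j\<le>n. a j * dpart i j)"
    unfolding J_chart[OF sec_i sec_chart] by blast
  let ?x = "\<lambda>k. xvar (swap i n k) / xvar i"
  have rat: "?x k \<in> R" if "k < n" for k
    using G.ratio_chart[of i "swap i n k"] local_of_subset[OF sec_chart] swap_le[OF sec_i that] sec_i by auto
  let ?r = "\<lambda>k. a (swap i n k) - a i * ?x k"
  have "y_coord i c l = a i * dpart i i + (\<Sum>k<n. a (swap i n k) * dpart i (swap i n k))"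
    unfolding a(2) sum_swap[OF sec_i] ..
  also have "\<dots> = (\<Sum>k<n. ?r k * dpart i (swap i n k)) + (a i * of_nat N) * (embed f / xvar i ^ N)"
    unfolding dpart_euler[OF sec_i]
    by (simp add: algebra_simps sum_subtractf sum_distrib_left sum.distrib)
  also have "(\<Sum>k<n. ?r k * dpart i (swap i n k)) = (\<Sum>k<n. ?r k * eval (y_coord i c) (partial_deriv k (F i c)))"
    by (rule sum.cong) (auto simp: dpart_eq[OF sec_i, of _ c])
  finally have "y_coord i c l = (\<Sum>k<n. ?r k * eval (y_coord i c) (partial_deriv k (F i c)))
      + (a i * of_nat N) * eval (y_coord i c) (F i c)" unfolding eval_F[OF sec_i] .
  moreover have "\<forall>k<n. ?r k \<in> R"
  proof (intro allI impI is_subring_diff[OF sr] is_subring_mult[OF sr])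
    fix k assume "k < n"
    then show "a (swap i n k) \<in> R" "a i \<in> R" "?x k \<in> R" using a(1) rat sec_i swap_le[OF sec_i] by blast+
  qed
  moreover have "a i * of_nat N \<in> R" using a(1) sec_i by (auto intro!: is_subring_mult[OF sr] is_subring_of_nat[OF sr])
  ultimately show thesis by (rule that[rotated 2])
qed

end

text \<open>
  In the chart \<open>y\<^sub>k = t\<^sub>l t\<^sub>k\<close> of the blowup, \<open>F = t\<^sub>l\<^sup>2 G\<close> and \<open>\<partial>F/\<partial>y\<^sub>k = t\<^sub>l E\<^sub>k\<close> with \<open>E\<^sub>k = \<partial>G/\<partial>t\<^sub>k\<close> for \<open>k \<noteq> l\<close>. Dividing by
  \<open>t\<^sub>l\<close> an expression of \<open>y\<^sub>l\<close> in terms of \<open>F\<close> and its partial derivatives shows that the \<open>E\<^sub>k\<close> have no common zero, and \<open>E\<^sub>l\<close> is a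
  combination of \<open>G\<close>, \<open>t\<^sub>l\<close> and the other \<open>E\<^sub>k\<close>.
\<close>

lemma strict_transform_equation:
  assumes s: "s \<in> {1..\<tau>}" and sec: "section_at s i c" and l: "l < n"
  shows "\<exists>G\<in>polys B n. eval (y_coord i c) (F i c) = y_coord i c l ^ 2 * eval (blowup_coord (y_coord i c) l) G \<and>
    (\<forall>R R'. R \<in> Ws s \<longrightarrow> R \<subseteq> R' \<longrightarrow> local_of (affine_ring B n (blowup_coord (y_coord i c) l)) R' \<longrightarrow>
       \<not> unit_in R' (y_coord i c l) \<longrightarrow> \<not> unit_in R' (eval (blowup_coord (y_coord i c) l) G) \<longrightarrow>
       (\<exists>j<n. j \<noteq> l \<and> unit_in R' (eval (blowup_coord (y_coord i c) l) (partial_deriv j G))))"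
proof -
  obtain Rs where Rs: "Rs \<in> Ws s" using sec unfolding section_at_def by blast
  note i = sec_i[OF s sec Rs] and cB = sec_c[OF s sec Rs]
  let ?y = "y_coord i c"
  let ?t = "blowup_coord ?y l"
  let ?q = "subst (blowup_subst l) :: 'k mpoly \<Rightarrow> 'k mpoly"
  have Fp: "F i c \<in> polys B n" by (rule sec_F[OF s sec Rs])
  note ord = sec_F_order[OF s sec Rs] and yl = sec_y_nonzero[OF s sec Rs l]
  have pd: "partial_deriv k (F i c) \<in> polys B n" for k using partial_deriv_polys[OF base_subring Fp] .
  obtain G where G: "G \<in> polys B n" "?q (F i c) = var l ^ 2 * G"
    using blowup_subst_divisible[OF base_subring l Fp ord] by blast
  have "\<exists>E\<in>polys B n. ?q (partial_deriv k (F i c)) = var l ^ 1 * E" for k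
  proof (rule blowup_subst_divisible[OF base_subring l pd])
    fix \<nu> assume "\<nu> \<in> keys (partial_deriv k (F i c))"
    then have "\<nu> + single k 1 \<in> keys (F i c)" by (auto simp: in_keys_iff lookup_partial_deriv)
    then show "1 \<le> total_degree \<nu>" using ord[of "\<nu> + single k 1"] by (simp add: total_degree_add)
  qed
  then obtain E where E: "\<And>k. E k \<in> polys B n" "\<And>k. ?q (partial_deriv k (F i c)) = var l * E k"
    by (metis power_one_right)
  note ev = eval_blowup_subst[of ?y l, OF yl]
  have tl: "?t l = ?y l" by (simp add: blowup_coord_def)
  have eF: "eval ?y (F i c) = ?y l ^ 2 * eval ?t G"
    using ev[of "F i c"] G(2) by (simp add: eval_simps tl)
  have eD: "eval ?y (partial_deriv k (F i c)) = ?y l * eval ?t (E k)" for k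
    using ev[of "partial_deriv k (F i c)"] E(2)[of k] by (simp add: eval_simps tl)
  have vl: "(var l :: 'k mpoly) \<noteq> 0" by simp
  \<comment> \<open>The pullback of F, which is the square of the exceptional coordinate times G, is
    differentiated in two ways: by the chain rule, and by the product rule. Comparison yields
    \<open>Ej\<close> and \<open>El\<close>.\<close>
  have d_q: "partial_deriv j (?q (F i c)) = (\<Sum>k<n. var l * E k * partial_deriv j (blowup_subst l k))" for j
    unfolding chain_rule[OF polys_UNIV[OF Fp]] E(2) ..
  have d_G: "partial_deriv j (?q (F i c)) = (if j = l then 2 * var l * G else 0) + var l ^ 2 * partial_deriv j G" for j
    unfolding G(2) power2_eq_square by (simp add: partial_deriv_mult partial_deriv_var algebra_simps)
  have Ej: "partial_deriv j G = E j" if j: "j < n" "j \<noteq> l" for j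
  proof -
    have "(\<Sum>k<n. var l * E k * partial_deriv j (blowup_subst l k)) = (\<Sum>k<n. if k = j then var l * E j * var l else 0)"
      using j by (intro sum.cong) (auto simp: blowup_subst_def partial_deriv_mult partial_deriv_var)
    then have "var l ^ 2 * partial_deriv j G = var l ^ 2 * E j"
      using d_q[of j] d_G[of j] j by (simp add: power2_eq_square mult_ac)
    then show ?thesis using vl by simp
  qed
  have El: "E l = 2 * G + var l * partial_deriv l G - (\<Sum>k\<in>{..<n} - {l}. var k * E k)"
  proof -
    have "(\<Sum>k<n. var l * E k * partial_deriv l (blowup_subst l k)) = var l * E l + (\<Sum>k\<in>{..<n} - {l}. var l * (var k * E k))"
      using l by (subst sum.remove[of _ l])
        (auto simp: blowup_subst_def partial_deriv_mult partial_deriv_var mult_ac intro!: sum.cong)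
    then have "var l * (E l + (\<Sum>k\<in>{..<n} - {l}. var k * E k)) = var l * (2 * G + var l * partial_deriv l G)"
      using d_q[of l] d_G[of l] by (simp add: algebra_simps sum_distrib_left power2_eq_square)
    then have "E l + (\<Sum>k\<in>{..<n} - {l}. var k * E k) = 2 * G + var l * partial_deriv l G" using vl mult_left_cancel by blast
    then show ?thesis by (simp add: eq_diff_eq)
  qed
  show ?thesis
  proof (intro bexI[of _ G] conjI allI impI eF G(1), rule ccontr)
    fix R R' assume R: "R \<in> Ws s" and RR': "R \<subseteq> R'" and R': "local_of (affine_ring B n ?t) R'"
      and ny: "\<not> unit_in R' (?y l)" and nG: "\<not> unit_in R' (eval ?t G)"
      and none: "\<not> (\<exists>j<n. j \<noteq> l \<and> unit_in R' (eval ?t (partial_deriv j G)))"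
    note lR = local_of_local[OF R'] and sr = local_of_subring[OF R']
    have mem: "eval ?t a \<in> R'" if "a \<in> polys B n" for a
      using local_of_subset[OF R'] eval_affine_ring[OF that] by blast
    have ym: "?y l \<in> max_ideal R'"
      using ny mem[OF var_polys[OF base_subring l]] by (simp add: max_ideal_eq eval_simps tl)
    have Gm: "eval ?t G \<in> max_ideal R'" using nG mem[OF G(1)] by (simp add: max_ideal_eq)
    have Ejm: "eval ?t (E j) \<in> max_ideal R'" if "j < n" "j \<noteq> l" for j
      using none Ej[OF that] that mem[OF E(1)] by (auto simp: max_ideal_eq)
    have "eval ?t (E l) = of_nat 2 * eval ?t G + ?y l * eval ?t (partial_deriv l G)
        - (\<Sum>k\<in>{..<n} - {l}. eval ?t (var k) * eval ?t (E k))"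
    proof -
      have "eval ?t (2 * G) = of_nat 2 * eval ?t G"
        using ring_map_add[OF ring_map_eval, of ?t G G] by (simp only: mult_2 of_nat_numeral)
      moreover have "eval ?t (E l) = eval ?t (2 * G) + eval ?t (var l) * eval ?t (partial_deriv l G)
          - (\<Sum>k\<in>{..<n} - {l}. eval ?t (var k) * eval ?t (E k))"
        unfolding El ring_map_diff[OF ring_map_eval] ring_map_add[OF ring_map_eval]
          ring_map_sum[OF ring_map_eval] ring_map_mult[OF ring_map_eval] ..
      ultimately show ?thesis by (simp only: mpoly_eval_var[OF ring_map_const_fun] tl)
    qed
    also have "\<dots> \<in> max_ideal R'"
    proof (rule max_ideal_diff[OF lR max_ideal_add[OF lR] max_ideal_sum[OF lR]])
      show "of_nat 2 * eval ?t G \<in> max_ideal R'" by (rule max_ideal_mult[OF lR is_subring_of_nat[OF sr] Gm])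
      show "?y l * eval ?t (partial_deriv l G) \<in> max_ideal R'"
        by (rule max_ideal_mult'[OF lR mem[OF partial_deriv_polys[OF base_subring G(1)]] ym])
      show "eval ?t (var k) * eval ?t (E k) \<in> max_ideal R'" if "k \<in> {..<n} - {l}" for k
        using that by (intro max_ideal_mult[OF lR mem[OF var_polys[OF base_subring]] Ejm]) auto
    qed
    finally have Em: "eval ?t (E k) \<in> max_ideal R'" if "k < n" for k using Ejm that by (cases "k = l") auto
    obtain r r0 where r: "\<forall>k<n. r k \<in> R" "r0 \<in> R"
      "?y l = (\<Sum>k<n. r k * eval ?y (partial_deriv k (F i c))) + r0 * eval ?y (F i c)"
      by (rule sec_coordinate_jacobian[OF s sec R l])
    \<comment> \<open>One factor of the exceptional coordinate cancels. The equation contributes its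
      square, so the term with G keeps one factor and is still an element of the local ring.\<close>
    have "?y l * 1 = ?y l * ((\<Sum>k<n. r k * eval ?t (E k)) + r0 * ?y l * eval ?t G)"
      by (subst r(3)) (simp add: eF eD sum_distrib_left algebra_simps power2_eq_square)
    then have "1 = (\<Sum>k<n. r k * eval ?t (E k)) + r0 * ?y l * eval ?t G" using yl mult_left_cancel by blast
    also have "\<dots> \<in> max_ideal R'"
    proof (intro max_ideal_add[OF lR] max_ideal_sum[OF lR] max_ideal_mult[OF lR] Gm)
      show "r0 * ?y l \<in> R'" using r(2) RR' ym is_subring_mult[OF sr] by (auto simp: max_ideal_eq)
    qed (use r(1) RR' Em in auto)
    finally show False using one_notin_max_ideal[OF sr] by blast
  qed
qed

end

section \<open>The blowup of the singular sections\<close>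

lemma ideal_in_ideal_pow:
  assumes R: "is_subring R" and I: "ideal_in I R" shows "ideal_in (ideal_pow R I d) R"
proof (induction d)
  case 0
  then show ?case using subring_closed[OF R] by (auto simp: ideal_in_def)
next
  case (Suc d)
  interpret cring "ring_of R" using R cring_ring_of_iff by blast
  show ?case using ideal_prod_is_ideal[of I "ideal_pow R I d"] I Suc ideal_ring_of_iff[OF R] by simp
qed

lemma ideal_pow_mult:
  assumes R: "is_subring R" and I: "ideal_in I R" and x: "x \<in> ideal_pow R I a" and y: "y \<in> ideal_pow R I b"
  shows "x * y \<in> ideal_pow R I (a + b)"
  using x
proof (induction a arbitrary: x)
  case 0
  then show ?case using ideal_in_ideal_pow[OF R I, of b] y by (auto simp: ideal_in_def)
next
  case (Suc a)
  then have "x \<in> ideal_prod (ring_of R) I (ideal_pow R I a)" by simp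
  then have "x * y \<in> ideal_prod (ring_of R) I (ideal_pow R I (a + b))"
  proof induction
    case (prod i j)
    then show ?case using ideal_prod.prod[of i I "j * y" "ideal_pow R I (a + b)" "ring_of R"] Suc.IH
      by (simp add: mult.assoc)
  next
    case (sum s1 s2)
    then show ?case using ideal_prod.sum[of "s1 * y" "ring_of R" I "ideal_pow R I (a + b)" "s2 * y"]
      by (simp add: distrib_right)
  qed
  then show ?case by simp
qed

lemma graded_rees:
  assumes R: "is_subring R" and y: "\<And>k. k < n \<Longrightarrow> y k \<in> R"
  shows "graded (ideal_pow R (generated_ideal n y R)) {..<n} y"
proof
  let ?I = "generated_ideal n y R"
  have I: "ideal_in ?I R" using ideal_in_generated_ideal[OF R, of n y] y by blast
  note pow = ideal_in_ideal_pow[OF R I]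
  show "0 \<in> ideal_pow R ?I d" for d using pow by (auto simp: ideal_in_def)
  show "a - b \<in> ideal_pow R ?I d" if "a \<in> ideal_pow R ?I d" "b \<in> ideal_pow R ?I d" for a b d
    using ideal_in_diff[OF R pow that] .
  show "x * z \<in> ideal_pow R ?I (a + b)" if "x \<in> ideal_pow R ?I a" "z \<in> ideal_pow R ?I b" for x z a b
    using ideal_pow_mult[OF R I that] .
  show "1 \<in> ideal_pow R ?I 0" using is_subring_one[OF R] by simp
  show "y i \<in> ideal_pow R ?I 1" if "i \<in> {..<n}" for i
    using ideal_prod.prod[of "y i" ?I 1 R "ring_of R"] generator_mem[OF R, of i n y] that is_subring_one[OF R] by simp
  show "\<exists>z. (\<forall>i\<in>{..<n}. z i \<in> ideal_pow R ?I d) \<and> x = (\<Sum>i\<in>{..<n}. y i * z i)"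
    if x: "x \<in> ideal_pow R ?I (Suc d)" for x d
  proof -
    have "x \<in> ideal_prod (ring_of R) ?I (ideal_pow R ?I d)" using x by simp
    then show ?thesis
    proof induction
      case (prod i j)
      then obtain r where r: "\<forall>k<n. r k \<in> R" "i = (\<Sum>k<n. r k * y k)" by (auto simp: generated_ideal_def)
      have "\<forall>k\<in>{..<n}. r k * j \<in> ideal_pow R ?I d" using r(1) prod(2) pow[of d] by (auto simp: ideal_in_def)
      moreover have "i \<otimes>\<^bsub>ring_of R\<^esub> j = (\<Sum>k<n. y k * (r k * j))"
        using r(2) by (simp add: sum_distrib_right sum_distrib_left mult_ac)
      ultimately show ?case by (intro exI[of _ "\<lambda>k. r k * j"]) blast
    next
      case (sum s1 s2)
      then obtain z z' where *: "\<forall>i\<in>{..<n}. z i \<in> ideal_pow R ?I d" "s1 = (\<Sum>i\<in>{..<n}. y i * z i)"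
        "\<forall>i\<in>{..<n}. z' i \<in> ideal_pow R ?I d" "s2 = (\<Sum>i\<in>{..<n}. y i * z' i)" by blast
      then have "\<forall>i\<in>{..<n}. z i + z' i \<in> ideal_pow R ?I d" using pow[of d] unfolding ideal_in_def by blast
      moreover have "s1 \<oplus>\<^bsub>ring_of R\<^esub> s2 = (\<Sum>i\<in>{..<n}. y i * (z i + z' i))"
        using * by (simp add: distrib_left sum.distrib)
      ultimately show ?case by (intro exI[of _ "\<lambda>i. z i + z' i"]) blast
    qed
  qed
qed simp

lemma rees_element_divided:
  assumes C: "is_subring C" and RC: "R \<subseteq> C" and rat: "\<And>j. j < n \<Longrightarrow> y j / y l \<in> C" and yl: "y l \<noteq> 0"
    and x: "x \<in> ideal_pow R (generated_ideal n y R) k"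
  shows "x / y l ^ k \<in> C"
  using x
proof (induction k arbitrary: x)
  case 0
  then show ?case using RC by auto
next
  case (Suc k)
  then have "x \<in> ideal_prod (ring_of R) (generated_ideal n y R) (ideal_pow R (generated_ideal n y R) k)" by simp
  then show ?case
  proof induction
    case (prod i j)
    then obtain r where r: "\<forall>k<n. r k \<in> R" "i = (\<Sum>k<n. r k * y k)" by (auto simp: generated_ideal_def)
    have "i / y l = (\<Sum>k<n. r k * (y k / y l))" unfolding r(2) sum_divide_distrib by simp
    also have "\<dots> \<in> C" using r(1) RC rat by (intro is_subring_sum[OF C] is_subring_mult[OF C]) auto
    finally have "(i / y l) * (j / y l ^ k) \<in> C" using Suc.IH[OF prod(2)] is_subring_mult[OF C] by blast
    then show ?case by simp
  next
    case (sum s1 s2)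
    then show ?case using is_subring_add[OF C] by (simp add: add_divide_distrib)
  qed
qed

lemma affine_ring_blowup_subset:
  assumes B: "is_subring B" and l: "l < n" and yl: "y l \<noteq> 0"
  shows "affine_ring B n y \<subseteq> affine_ring B n (blowup_coord y l)"
proof (rule affine_ring_subset[OF is_subring_affine_ring[OF B] const_affine_ring])
  let ?A = "affine_ring B n (blowup_coord y l)"
  fix k assume k: "k < n"
  have t: "blowup_coord y l k \<in> ?A" if "k < n" for k using coord_affine_ring[OF B that] .
  show "y k \<in> ?A"
  proof (cases "k = l")
    case False
    then have "y k = blowup_coord y l k * blowup_coord y l l" using yl by (simp add: blowup_coord_def)
    then show ?thesis using t[OF k] t[OF l] is_subring_mult[OF is_subring_affine_ring[OF B]] by simp
  qed (use t[OF l] in \<open>simp add: blowup_coord_def\<close>)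
qed

lemma ratio_affine_ring_blowup:
  assumes B: "is_subring B" and j: "j < n" and yl: "y l \<noteq> 0"
  shows "y j / y l \<in> affine_ring B n (blowup_coord y l)"
  using coord_affine_ring[OF B j, of "blowup_coord y l"] is_subring_one[OF is_subring_affine_ring[OF B]] yl
  by (cases "j = l") (auto simp: blowup_coord_def)

text \<open>The Rees chart over a local ring R contains the affine ring of the blowup coordinates
  properly in general. Its elements are fractions over that ring whose denominators come from units
  of R, and these are units of R'. So both rings have the same local ring at R'.\<close>

lemma rees_chart_iff:
  assumes B: "is_subring B" and R: "local_of (affine_ring B n y) R" and RR': "R \<subseteq> R'" and l: "l < n" and yl: "y l \<noteq> 0"
  shows "local_of (homogeneous_localization (ideal_pow R (generated_ideal n y R)) 1 (y l)) R' \<longleftrightarrow>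
    local_of (affine_ring B n (blowup_coord y l)) R'"
proof -
  let ?S = "ideal_pow R (generated_ideal n y R)" and ?A = "affine_ring B n (blowup_coord y l)"
  let ?H = "homogeneous_localization ?S 1 (y l)"
  note sr = local_of_subring[OF R]
  have y: "y k \<in> R" if "k < n" for k using coord_affine_ring[OF B that, of y] local_of_subset[OF R] by blast
  interpret graded ?S "{..<n}" y by (rule graded_rees[OF sr y])
  have H: "is_subring ?H" using is_subring_homogeneous_localization[OF e_S yl] l by simp
  have RH: "R \<subseteq> ?H" using S_0_homogeneous_localization by simp
  have A: "is_subring ?A" by (rule is_subring_affine_ring[OF B])
  have AH: "?A \<subseteq> ?H"
  proof (rule affine_ring_subset[OF H])
    show "const_fun ` B \<subseteq> ?H" using const_affine_ring local_of_subset[OF R] RH by blast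
    show "blowup_coord y l k \<in> ?H" if "k < n" for k
      using y[OF l] RH ratio_chart[of l k] l that by (auto simp: blowup_coord_def)
  qed
  have HC: "?H \<subseteq> C" if C: "is_subring C" "R \<subseteq> C" "\<And>j. j < n \<Longrightarrow> y j / y l \<in> C" for C
  proof
    fix x assume "x \<in> ?H"
    then obtain h k where "h \<in> ?S k" "x = h / y l ^ k" by (auto simp: homogeneous_localization_def)
    then show "x \<in> C" 
      using rees_element_divided[where y = y and l = l and n = n and C = C and R = R and x = h and k = k, OF C yl] by blast
  qed
  show ?thesis
  proof
    assume R': "local_of ?H R'"
    have AR': "?A \<subseteq> R'" using AH local_of_subset[OF R'] by blast
    \<comment> \<open>This localization contains R and the ratios of the coordinates, hence the
      whole Rees chart.\<close>
    let ?C = "loc ?A R'"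
    have lo: "local_of ?A ?C" by (rule local_of_loc(1)[OF A local_of_local[OF R'] AR'])
    have AC: "?A \<subseteq> ?C" using local_of_subset[OF lo] .
    have "R \<subseteq> ?C"
    proof
      fix r assume "r \<in> R"
      then obtain b w where "b \<in> affine_ring B n y" "w \<in> affine_ring B n y" "unit_in R w" "r = b / w"
        by (rule local_of_fraction[OF R])
      then show "r \<in> ?C"
        using affine_ring_blowup_subset[OF B, where y = y and l = l, OF l yl] unit_in_mono[OF _ RR'] unfolding loc_def by blast
    qed
    then have HC': "?H \<subseteq> ?C"
      using HC[OF local_of_subring[OF lo]] AC ratio_affine_ring_blowup[OF B, where y = y and l = l, OF _ yl] by blast
    show "local_of ?A R'"
    proof (rule local_of_fractions_trans[OF R' A AR'])
      fix a assume "a \<in> ?H"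
      then show "\<exists>b\<in>?A. \<exists>w\<in>?A. unit_in R' w \<and> a = b / w" using HC' unfolding loc_def by blast
    qed
  next
    assume R': "local_of ?A R'"
    have "?H \<subseteq> R'"
      using HC[OF local_of_subring[OF R'] RR'] local_of_subset[OF R'] ratio_affine_ring_blowup[OF B, where y = y and l = l, OF _ yl] by blast
    then show "local_of ?H R'" using local_of_superring[OF R' AH] by blast
  qed
qed

lemma ideal_pow_whole: "is_subring R \<Longrightarrow> ideal_pow R R d = R"
proof (induction d)
  case (Suc d)
  interpret cring "ring_of R" using Suc.prems cring_ring_of_iff by blast
  have "ideal R (ring_of R)"
    using Suc.prems subring_closed[OF Suc.prems] by (auto simp: ideal_ring_of_iff[OF Suc.prems] ideal_in_def)
  then have "ideal_prod (ring_of R) R R \<subseteq> R" using ideal_prod_in_carrier[of R R] by simp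
  moreover have "x \<in> ideal_prod (ring_of R) R R" if "x \<in> R" for x
    using ideal_prod.prod[of x R 1 R "ring_of R"] that is_subring_one[OF Suc.prems] by simp
  ultimately show ?case using Suc by auto
qed simp

text \<open>Blowing up the unit ideal changes nothing: all components are R, and the single
  generator 1 gives one chart, R itself.\<close>

lemma proj_whole_ideal:
  assumes R: "is_subring R" shows "R' \<in> proj (ideal_pow R R) \<longleftrightarrow> local_of R R'"
proof -
  interpret graded "ideal_pow R R" "{()}" "\<lambda>_. 1"
  proof
    fix x d assume "x \<in> ideal_pow R R (Suc d)"
    then show "\<exists>y. (\<forall>i\<in>{()}. y i \<in> ideal_pow R R d) \<and> x = (\<Sum>i\<in>{()}. 1 * y i)"
      unfolding ideal_pow_whole[OF R] by (intro exI[of _ "\<lambda>_. x"]) simp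
  qed (use subring_closed[OF R] in \<open>simp_all only: ideal_pow_whole[OF R] finite.emptyI finite_insert\<close>)
  have "chart () = R" by (auto simp: homogeneous_localization_def ideal_pow_whole[OF R])
  then show ?thesis using proj_iff by simp
qed

context nodal
begin

section \<open>Points of the blowup and their centres\<close>

abbreviation "Y \<equiv> blowup P I\<^sub>W"
abbreviation "t_coord i c l \<equiv> blowup_coord (y_coord i c) l"
abbreviation "T\<^sub>0 i c l \<equiv> affine_ring B n (t_coord i c l)"

lemma closed_supp_IW: "closedin (zariski P) (supp P I\<^sub>W)"
  unfolding supp_IW using closed_Z by (intro closedin_Union) auto

lemma outside_upward: "closedin (zariski P) C \<Longrightarrow> R \<in> P \<Longrightarrow> R \<notin> C \<Longrightarrow> R \<subseteq> R' \<Longrightarrow> R' \<in> P \<Longrightarrow> R' \<notin> C"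
  using PM.closedin_downward by blast

lemma section_y_nonzero: assumes "s \<in> {1..\<tau>}" "section_at s i c" "l < n" shows "y_coord i c l \<noteq> 0"
proof -
  obtain R where "R \<in> Ws s" using assms(2) unfolding section_at_def by blast
  then show ?thesis using sec_y_nonzero assms by blast
qed

lemma section_props:
  assumes "section_at s i c"
  shows "i \<le> n" "\<forall>k<n. c k \<in> B" "R \<in> Ws s \<longleftrightarrow> local_of (A\<^sub>0 i c) R \<and> (\<forall>k<n. y_coord i c k \<in> max_ideal R)"
    "R \<in> Ws s \<Longrightarrow> W s R = generated_ideal n (y_coord i c) R"
  using assms unfolding section_at_def by blast+

lemma center_P: "Q \<in> P \<Longrightarrow> dominates R Q \<Longrightarrow> center P R = Q"
  using center_eq[of Q P R] G.proj_dominated_unique[of _ Q R] unfolding proj_space_def by blast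

lemma chart_in_P: "i \<le> n \<Longrightarrow> \<forall>k<n. c k \<in> B \<Longrightarrow> local_of (A\<^sub>0 i c) R \<Longrightarrow> R \<in> P"
  using P_chartI chart_eq' by metis

text \<open>Each coordinate y_k is a multiple of y_l in the chart, so where y_l vanishes all
  coordinates vanish and the centre lies on the section.\<close>

lemma blowup_chart_center:
  assumes s: "s \<in> {1..\<tau>}" and sec: "section_at s i c" and l: "l < n" and R: "local_of (T\<^sub>0 i c l) R"
  defines "C \<equiv> loc (A\<^sub>0 i c) R"
  shows "local_of (A\<^sub>0 i c) C" "dominates R C" "C \<in> P" "center P R = C"
    "\<not> unit_in R (y_coord i c l) \<Longrightarrow> C \<in> Ws s"
proof -
  let ?y = "y_coord i c"
  note yl = section_y_nonzero[OF s sec l] and i = section_props(1)[OF sec] and cB = section_props(2)[OF sec]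
  have A: "is_subring (A\<^sub>0 i c)" by (rule is_subring_affine_ring[OF base_subring])
  have AT: "A\<^sub>0 i c \<subseteq> R" using affine_ring_blowup_subset[OF base_subring, where y = "y_coord i c" and l = l, OF l yl] local_of_subset[OF R] by blast
  show lo: "local_of (A\<^sub>0 i c) C" and d: "dominates R C"
    unfolding C_def using local_of_loc[OF A local_of_local[OF R] AT] by blast+
  show CP: "C \<in> P" using chart_in_P[OF i cB lo] .
  show "center P R = C" using center_P[OF CP d] .
  assume nu: "\<not> unit_in R (?y l)"
  have "?y k \<in> max_ideal C" if k: "k < n" for k
  proof -
    have "?y k / ?y l \<in> R" using ratio_affine_ring_blowup[OF base_subring, where y = "y_coord i c" and l = l, OF k yl] local_of_subset[OF R] by blast
    moreover have "?y l \<in> max_ideal R" using nu coord_affine_ring[OF base_subring l, of ?y] AT by (auto simp: max_ideal_eq)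
    ultimately have "(?y k / ?y l) * ?y l \<in> max_ideal R" by (rule max_ideal_mult[OF local_of_local[OF R]])
    then have "\<not> unit_in R (?y k)" using yl by (simp add: max_ideal_eq)
    moreover have "?y k \<in> C" using coord_affine_ring[OF base_subring k, of ?y] local_of_subset[OF lo] by blast
    ultimately show ?thesis using dominates_unit_iff[OF d] by (simp add: max_ideal_eq)
  qed
  then show "C \<in> Ws s" using section_props(3)[OF sec] lo by blast
qed

lemma outside_in_Y: "Q \<in> P \<Longrightarrow> Q \<notin> supp P I\<^sub>W \<Longrightarrow> Q \<in> Y"
proof -
  assume Q: "Q \<in> P" "Q \<notin> supp P I\<^sub>W"
  then have "I\<^sub>W Q = Q" unfolding supp_def by blast
  then have "Q \<in> proj (ideal_pow Q (I\<^sub>W Q))"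
    using proj_whole_ideal[OF P_subring[OF Q(1)]] local_of_self[OF P_local[OF Q(1)]] by simp
  then show "Q \<in> Y" unfolding blowup_def using Q(1) by blast
qed

lemma proj_rees_section:
  assumes s: "s \<in> {1..\<tau>}" and sec: "section_at s i c" and l: "l < n" and R: "local_of (T\<^sub>0 i c l) R"
    and C: "C \<in> Ws s" "C \<subseteq> R"
  shows "R \<in> proj (ideal_pow C (I\<^sub>W C))"
proof -
  note yl = section_y_nonzero[OF s sec l]
  have lC: "local_of (A\<^sub>0 i c) C" using section_props(3)[OF sec] C by blast
  have y: "y_coord i c k \<in> C" if "k < n" for k
    using coord_affine_ring[OF base_subring that] local_of_subset[OF lC] by blast
  interpret graded "ideal_pow C (generated_ideal n (y_coord i c) C)" "{..<n}" "y_coord i c"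
    by (rule graded_rees[OF local_of_subring[OF lC] y])
  have eq: "I\<^sub>W C = generated_ideal n (y_coord i c) C" using IW_on[OF s C(1)] section_props(4)[OF sec C(1)] by (rule trans)
  have "local_of (chart l) R" using rees_chart_iff[OF base_subring lC C(2) l yl] R by blast
  then show ?thesis unfolding eq proj_iff using l yl by blast
qed

text \<open>The chart is built from one section only, whereas Y also blows up the others; hence the
  condition on the centre. If the centre is off this section as well, y_l is a unit there and R
  equals its centre.\<close>

lemma blowup_chart_in_Y:
  assumes s: "s \<in> {1..\<tau>}" and sec: "section_at s i c" and l: "l < n" and R: "local_of (T\<^sub>0 i c l) R"
    and other: "\<And>u. u \<in> {1..\<tau>} \<Longrightarrow> u \<noteq> s \<Longrightarrow> loc (A\<^sub>0 i c) R \<notin> Ws u"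
  shows "R \<in> Y"
proof -
  let ?C = "loc (A\<^sub>0 i c) R" and ?y = "y_coord i c"
  note C = blowup_chart_center[OF s sec l R] and yl = section_y_nonzero[OF s sec l]
  have CR: "?C \<subseteq> R" using C(2) by (simp add: dominates_def)
  show ?thesis
  proof (cases "?C \<in> Ws s")
    case True
    then show ?thesis using proj_rees_section[OF s sec l R True CR] C(3) unfolding blowup_def by blast
  next
    case False
    then obtain k where k: "k < n" "?y k \<notin> max_ideal ?C" using section_props(3)[OF sec] C(1) by blast
    have yC: "?y j \<in> ?C" if "j < n" for j using coord_affine_ring[OF base_subring that] local_of_subset[OF C(1)] by blast
    have "unit_in R (?y k)" using k yC unit_in_mono[OF _ CR] by (auto simp: max_ideal_eq)
    moreover have "?y k = (?y k / ?y l) * ?y l" using yl by simp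
    moreover have "?y k / ?y l \<in> R" using ratio_affine_ring_blowup[OF base_subring, where y = "y_coord i c" and l = l, OF k(1) yl] local_of_subset[OF R] by blast
    ultimately have "unit_in R (?y l)"
      using unit_in_mult_iff[OF local_of_subring[OF R], of "?y k / ?y l" "?y l"] yC[OF l] CR by auto
    then have u: "unit_in ?C (?y l)" using C(2) yC[OF l] by (simp add: dominates_def)
    have T: "T\<^sub>0 i c l \<subseteq> ?C"
    proof (rule affine_ring_subset[OF local_of_subring[OF C(1)]])
      show "B\<^sub>0 \<subseteq> ?C" using const_affine_ring local_of_subset[OF C(1)] by blast
      show "t_coord i c l j \<in> ?C" if "j < n" for j
        using yC[OF that] yC[OF l] unit_in_divide[OF local_of_subring[OF C(1)] _ u] by (simp add: blowup_coord_def)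
    qed
    have "R \<subseteq> ?C"
    proof
      fix r assume "r \<in> R"
      then obtain b w where "b \<in> T\<^sub>0 i c l" "w \<in> T\<^sub>0 i c l" "unit_in R w" "r = b / w" by (rule local_of_fraction[OF R])
      then show "r \<in> ?C"
        using T C(2) unit_in_divide[OF local_of_subring[OF C(1)]] unfolding dominates_def by blast
    qed
    then have "R = ?C" using CR by blast
    moreover have "?C \<notin> supp P I\<^sub>W" unfolding supp_IW using False other by blast
    ultimately show ?thesis using outside_in_Y C(3) by metis
  qed
qed

text \<open>A point of a Rees chart at which y_l is a unit is a point of projective space outside W,
  so the exceptional case can be restricted to points on the exceptional divisor.\<close>

lemma Y_cases:
  assumes R: "R \<in> Y"
  obtains (outside) "R \<in> P" "R \<notin> supp P I\<^sub>W"
  | (exceptional) s i c l where "s \<in> {1..\<tau>}" "section_at s i c" "l < n" "local_of (T\<^sub>0 i c l) R"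
      "\<not> unit_in R (y_coord i c l)"
proof -
  obtain Q where Q: "Q \<in> P" "R \<in> proj (ideal_pow Q (I\<^sub>W Q))" using R unfolding blowup_def by blast
  show thesis
  proof (cases "Q \<in> supp P I\<^sub>W")
    case False
    then have "local_of Q R" using Q proj_whole_ideal[OF P_subring[OF Q(1)]] by (auto simp: supp_def)
    then have "R \<in> P" "Q \<subseteq> R" using P_localization[OF Q(1)] local_of_subset by blast+
    then show thesis using outside outside_upward[OF closed_supp_IW Q(1) False] by blast
  next
    case True
    then obtain s where s: "s \<in> {1..\<tau>}" "Q \<in> Ws s" unfolding supp_IW by blast
    obtain i c where sec: "section_at s i c" using section_exists[OF s(1)] by blast
    let ?y = "y_coord i c"
    have lQ: "local_of (A\<^sub>0 i c) Q" using section_props(3)[OF sec] s by blast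
    have y: "?y k \<in> Q" if "k < n" for k
      using coord_affine_ring[OF base_subring that] local_of_subset[OF lQ] by blast
    interpret rees: graded "ideal_pow Q (generated_ideal n ?y Q)" "{..<n}" ?y
      by (rule graded_rees[OF local_of_subring[OF lQ] y])
    have eq: "I\<^sub>W Q = generated_ideal n ?y Q" using IW_on[OF s] section_props(4)[OF sec s(2)] by simp
    have Rp: "R \<in> proj (ideal_pow Q (generated_ideal n ?y Q))" using Q(2) eq by simp
    have QR: "Q \<subseteq> R" using rees.proj_S_0[OF Rp] by simp
    obtain l where l: "l < n" "local_of (rees.chart l) R" using Rp rees.proj_iff by auto
    note yl = section_y_nonzero[OF s(1) sec l(1)]
    have lR: "local_of (T\<^sub>0 i c l) R" using rees_chart_iff[OF base_subring lQ QR l(1) yl] l(2) by blast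
    show thesis
    proof (cases "unit_in R (?y l)")
      case False
      then show thesis using exceptional s(1) sec l(1) lR by blast
    next
      case True
      note C = blowup_chart_center[OF s(1) sec l(1) lR]
      have A: "is_subring (A\<^sub>0 i c)" by (rule is_subring_affine_ring[OF base_subring])
      have uC: "unit_in (loc (A\<^sub>0 i c) R) (?y l)"
        using C(2) True coord_affine_ring[OF base_subring l(1), of ?y] local_of_subset[OF C(1)] by (auto simp: dominates_def)
      have yC: "?y j \<in> loc (A\<^sub>0 i c) R" if "j < n" for j
        using coord_affine_ring[OF base_subring that] local_of_subset[OF C(1)] by blast
      have T: "T\<^sub>0 i c l \<subseteq> loc (A\<^sub>0 i c) R"
      proof (rule affine_ring_subset[OF local_of_subring[OF C(1)]])
        show "B\<^sub>0 \<subseteq> loc (A\<^sub>0 i c) R" using const_affine_ring local_of_subset[OF C(1)] by blast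
        show "t_coord i c l j \<in> loc (A\<^sub>0 i c) R" if "j < n" for j
          using yC[OF that] yC[OF l(1)] unit_in_divide[OF local_of_subring[OF C(1)] _ uC] by (simp add: blowup_coord_def)
      qed
      have "local_of (A\<^sub>0 i c) R"
      proof (rule local_of_fractions_trans[OF lR A])
        show "A\<^sub>0 i c \<subseteq> R" using local_of_subset[OF lQ] QR by blast
        fix a assume "a \<in> T\<^sub>0 i c l"
        then show "\<exists>b\<in>A\<^sub>0 i c. \<exists>w\<in>A\<^sub>0 i c. unit_in R w \<and> a = b / w" using T unfolding loc_def by blast
      qed
      then have RP: "R \<in> P" using chart_in_P section_props(1,2)[OF sec] by blast
      have "R \<notin> Ws s" using section_props(3)[OF sec] True l(1) by (auto simp: max_ideal_eq)
      moreover have "R \<notin> Ws u" if "u \<in> {1..\<tau>}" "u \<noteq> s" for u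
        using outside_upward[OF closed_Z[OF that(1)] Q(1) _ QR RP] Ws_disjoint[OF s(1) that(1)] that(2) s(2) by blast
      ultimately have "R \<notin> supp P I\<^sub>W" unfolding supp_IW by blast
      then show thesis using outside RP by blast
    qed
  qed
qed

lemma Y_center:
  assumes R: "R \<in> Y"
  shows "center P R \<in> P" "dominates R (center P R)" "local_ring R" "B\<^sub>0 \<subseteq> R"
    "center P R \<notin> supp P I\<^sub>W \<Longrightarrow> center P R = R"
    "center P R \<in> supp P I\<^sub>W \<Longrightarrow> R \<in> proj (ideal_pow (center P R) (I\<^sub>W (center P R)))"
proof -
  have "center P R \<in> P \<and> dominates R (center P R) \<and> local_ring R \<and> B\<^sub>0 \<subseteq> R \<and>
    (center P R \<notin> supp P I\<^sub>W \<longrightarrow> center P R = R) \<and>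
    (center P R \<in> supp P I\<^sub>W \<longrightarrow> R \<in> proj (ideal_pow (center P R) (I\<^sub>W (center P R))))"
    using R
  proof (cases rule: Y_cases)
    case outside
    then show ?thesis using center_P[OF outside(1) dominates_refl] P_local P_const dominates_refl by simp
  next
    case (exceptional s i c l)
    note C = blowup_chart_center[OF exceptional(1-4)]
    have "center P R \<in> Ws s" using C(4,5) exceptional(5) by simp
    moreover have "center P R \<subseteq> R" using C(2,4) by (simp add: dominates_def)
    ultimately have "R \<in> proj (ideal_pow (center P R) (I\<^sub>W (center P R)))" "center P R \<in> supp P I\<^sub>W"
      using proj_rees_section[OF exceptional(1-4)] exceptional(1) unfolding supp_IW by blast+
    moreover have "B\<^sub>0 \<subseteq> R" using const_affine_ring local_of_subset[OF exceptional(4)] by blast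
    ultimately show ?thesis using C local_of_local[OF exceptional(4)] by simp
  qed
  then show "center P R \<in> P" "dominates R (center P R)" "local_ring R" "B\<^sub>0 \<subseteq> R"
    "center P R \<notin> supp P I\<^sub>W \<Longrightarrow> center P R = R"
    "center P R \<in> supp P I\<^sub>W \<Longrightarrow> R \<in> proj (ideal_pow (center P R) (I\<^sub>W (center P R)))" by blast+
qed

text \<open>A point and one that it dominates have the same centre. Outside W they equal it; over a
  section both belong to the same Proj of a Rees algebra, which is separated.\<close>

lemma Y_separated: "separated Y"
  unfolding separated_def
proof (intro ballI impI)
  fix R Q assume R: "R \<in> Y" and Q: "Q \<in> Y" and d: "dominates R Q"
  have eq: "center P R = center P Q"
    using center_P[OF Y_center(1)[OF Q] dominates_trans[OF d Y_center(2)[OF Q]]] .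
  show "Q = R"
  proof (cases "center P R \<in> supp P I\<^sub>W")
    case False
    then show ?thesis using Y_center(5)[OF R] Y_center(5)[OF Q] eq by simp
  next
    case True
    then obtain s where s: "s \<in> {1..\<tau>}" "center P R \<in> Ws s" unfolding supp_IW by blast
    obtain i c where sec: "section_at s i c" using section_exists[OF s(1)] by blast
    let ?C = "center P R" and ?y = "y_coord i c"
    have lC: "local_of (A\<^sub>0 i c) ?C" using section_props(3)[OF sec] s by blast
    have y: "?y k \<in> ?C" if "k < n" for k
      using coord_affine_ring[OF base_subring that] local_of_subset[OF lC] by blast
    interpret rees: graded "ideal_pow ?C (generated_ideal n ?y ?C)" "{..<n}" ?y
      by (rule graded_rees[OF local_of_subring[OF lC] y])
    have IC: "I\<^sub>W ?C = generated_ideal n ?y ?C" using IW_on[OF s] section_props(4)[OF sec s(2)] by (rule trans)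
    have "R \<in> proj (ideal_pow ?C (generated_ideal n ?y ?C))" using Y_center(6)[OF R True] unfolding IC .
    moreover have "Q \<in> proj (ideal_pow ?C (generated_ideal n ?y ?C))"
      using Y_center(6)[OF Q] True unfolding eq[symmetric] IC by blast
    ultimately show ?thesis using rees.proj_dominated_unique[OF _ _ d dominates_refl] by blast
  qed
qed

sublocale YM: separated_model B Y
  using base_factorial Y_center(3,4) Y_separated by unfold_locales

section \<open>The preimage of the hypersurface and its local equations\<close>

abbreviation "D \<equiv> {y \<in> Y. center P y \<in> X}"

lemma dominated_point_in_chart:
  assumes Q: "Q \<in> P" and d: "dominates R Q" and i: "i \<le> n" and cB: "\<forall>k<n. c k \<in> B" and A: "A\<^sub>0 i c \<subseteq> R"
  shows "local_of (G.chart i) Q"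
proof -
  have "xvar j / xvar i \<in> R" if "j \<le> n" for j
    using G.ratio_chart[of i j] chart_eq'[OF i cB] i that A by auto
  then show ?thesis using G.dominated_in_chart[OF _ d, of i] Q i by (auto simp: proj_space_def)
qed

text \<open>Domination preserves units and nonunits of the centre, so the condition on the centre
  can be tested in R itself.\<close>

lemma D_iff:
  assumes R: "R \<in> Y" and i: "i \<le> n" and cB: "\<forall>k<n. c k \<in> B" and A: "A\<^sub>0 i c \<subseteq> R"
  shows "R \<in> D \<longleftrightarrow> \<not> unit_in R (eval (y_coord i c) (F i c))"
proof -
  note C = Y_center(1,2)[OF R]
  have ch: "local_of (G.chart i) (center P R)" by (rule dominated_point_in_chart[OF C i cB A])
  then have lC: "local_of (A\<^sub>0 i c) (center P R)" using chart_eq'[OF i cB] by simp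
  have "eval (y_coord i c) (F i c) \<in> center P R"
    using local_of_subset[OF lC] eval_affine_ring[OF F_polys[OF i cB]] by blast
  then show ?thesis
    using X_iff[OF i ch] dominates_unit_iff[OF C(2)] R unfolding eval_F[OF i] by simp
qed

lemma affine_ring_subset_iff:
  assumes "R \<in> Y" shows "affine_ring B n t \<subseteq> R \<longleftrightarrow> t ` {..<n} \<subseteq> R"
proof
  show "affine_ring B n t \<subseteq> R \<Longrightarrow> t ` {..<n} \<subseteq> R" using coord_affine_ring[OF base_subring] by blast
  show "t ` {..<n} \<subseteq> R \<Longrightarrow> affine_ring B n t \<subseteq> R"
    using affine_ring_subset[OF local_ring_subring[OF Y_center(3)[OF assms]] Y_center(4)[OF assms]] by blast
qed

lemma closed_D: "closedin (zariski Y) D"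
  unfolding closedin_def YM.topspace_M
proof (intro conjI)
  show "openin (zariski Y) (Y - D)"
  proof (subst openin_subopen, intro ballI)
    fix R assume "R \<in> Y - D"
    then have R: "R \<in> Y" "R \<notin> D" by blast+
    note C = Y_center(1,2)[OF R(1)]
    obtain i where i: "i \<le> n" "local_of (G.chart i) (center P R)" using C(1) P_iff by blast
    let ?c = "\<lambda>_ :: nat. 0 :: 'k"
    have cB: "\<forall>k<n. ?c k \<in> B" using base_zero by blast
    have "A\<^sub>0 i ?c \<subseteq> center P R" using i(2) unfolding chart_eq'[OF i(1) cB] by (rule local_of_subset)
    then have A: "A\<^sub>0 i ?c \<subseteq> R" using C(2) unfolding dominates_def by blast
    let ?\<phi> = "eval (y_coord i ?c) (F i ?c)"
    let ?U = "{Q \<in> Y. insert (inverse ?\<phi>) (y_coord i ?c ` {..<n}) \<subseteq> Q}"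
    have u: "unit_in R ?\<phi>" using D_iff[OF R(1) i(1) cB A] R(2) by blast
    have "openin (zariski Y) ?U" by (rule openin_zariski_contains[OF YM.M_subring]) simp_all
    moreover have "R \<in> ?U" using R(1) u A affine_ring_subset_iff[OF R(1)] by (auto simp: unit_in_def)
    moreover have "?U \<subseteq> Y - D"
    proof
      fix Q assume Q: "Q \<in> ?U"
      then have QY: "Q \<in> Y" and AQ: "A\<^sub>0 i ?c \<subseteq> Q" using affine_ring_subset_iff by auto
      have "?\<phi> \<in> Q" using AQ eval_affine_ring[OF F_polys[OF i(1) cB]] by blast
      then have "unit_in Q ?\<phi>" using Q u by (auto simp: unit_in_def)
      then show "Q \<in> Y - D" using D_iff[OF QY i(1) cB AQ] QY by blast
    qed
    ultimately show "\<exists>U. openin (zariski Y) U \<and> R \<in> U \<and> U \<subseteq> Y - D" by blast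
  qed
qed blast

text \<open>The product of the denominators of finitely many functions defining a neighbourhood
  inverts them all at once.\<close>

lemma principal_nbhd:
  assumes R: "local_of (affine_ring B n t) R" and U: "openin (zariski P) U" "R \<in> U"
  shows "\<exists>h\<in>polys B n. unit_in R (eval t h) \<and>
    (\<forall>Q\<in>P. affine_ring B n t \<subseteq> Q \<longrightarrow> unit_in Q (eval t h) \<longrightarrow> Q \<in> U)"
proof -
  note S = is_subring_polys[OF base_subring, of n]
  obtain T where T: "finite T" "T \<subseteq> R" "{Q \<in> P. T \<subseteq> Q} \<subseteq> U" using zariski_nbhd[OF U] by blast
  have "\<forall>g\<in>T. \<exists>a\<in>polys B n. \<exists>w\<in>polys B n. unit_in R (eval t w) \<and> g = eval t a / eval t w"
    using T(2) affine_fraction[OF R] by (metis subsetD)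
  then obtain a w where aw: "\<And>g. g \<in> T \<Longrightarrow> a g \<in> polys B n" "\<And>g. g \<in> T \<Longrightarrow> w g \<in> polys B n"
    "\<And>g. g \<in> T \<Longrightarrow> unit_in R (eval t (w g))" "\<And>g. g \<in> T \<Longrightarrow> g = eval t (a g) / eval t (w g)" by metis
  let ?h = "\<Prod>g\<in>T. w g"
  have eh: "eval t ?h = (\<Prod>g\<in>T. eval t (w g))" by (rule ring_map_prod[OF ring_map_eval])
  have "?h \<in> polys B n" using aw(2) by (rule is_subring_prod[OF S])
  moreover have "unit_in R (eval t ?h)" unfolding eh using aw(3) by (rule unit_in_prod[OF local_of_subring[OF R]])
  moreover have "Q \<in> U" if Q: "Q \<in> P" "affine_ring B n t \<subseteq> Q" "unit_in Q (eval t ?h)" for Q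
  proof -
    note sQ = P_subring[OF Q(1)]
    have mem: "eval t b \<in> Q" if "b \<in> polys B n" for b using Q(2) eval_affine_ring[OF that] by blast
    have "g \<in> Q" if g: "g \<in> T" for g
    proof -
      have "eval t ?h = eval t (w g) * eval t (\<Prod>g\<in>T - {g}. w g)"
        using T(1) g by (simp add: prod.remove eval_simps)
      moreover have "(\<Prod>g\<in>T - {g}. w g) \<in> polys B n" using aw(2) by (intro is_subring_prod[OF S]) auto
      ultimately have "unit_in Q (eval t (w g))"
        using Q(3) unit_in_mult_iff[OF sQ mem[OF aw(2)[OF g]] mem] by metis
      then show ?thesis using aw(4)[OF g] unit_in_divide[OF sQ mem[OF aw(1)[OF g]]] by metis
    qed
    then show ?thesis using T(3) Q(1) by blast
  qed
  ultimately show ?thesis by blast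
qed

text \<open>h removes W from the affine chart, so that all its local rings are points of Y.\<close>

lemma local_equations_outside:
  assumes R: "R \<in> D" "R \<in> P" "R \<notin> supp P I\<^sub>W"
  shows "\<exists>t h Gs. YM.local_equations D n R t h Gs"
proof -
  obtain i where i: "i \<le> n" "local_of (G.chart i) R" using R(2) P_iff by blast
  let ?c = "\<lambda>_ :: nat. 0 :: 'k"
  have cB: "\<forall>k<n. ?c k \<in> B" using base_zero by blast
  let ?t = "y_coord i ?c"
  have lR: "local_of (A\<^sub>0 i ?c) R" using i(2) chart_eq'[OF i(1) cB] by simp
  have "openin (zariski P) (P - supp P I\<^sub>W)" using closed_supp_IW topspace_P by (simp add: closedin_def)
  moreover have "R \<in> P - supp P I\<^sub>W" using R by blast
  ultimately have "\<exists>h\<in>polys B n. unit_in R (eval ?t h) \<and>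
      (\<forall>Q\<in>P. A\<^sub>0 i ?c \<subseteq> Q \<longrightarrow> unit_in Q (eval ?t h) \<longrightarrow> Q \<in> P - supp P I\<^sub>W)"
    by (rule principal_nbhd[OF lR])
  then obtain h where h: "h \<in> polys B n" "unit_in R (eval ?t h)"
    "\<forall>Q\<in>P. A\<^sub>0 i ?c \<subseteq> Q \<longrightarrow> unit_in Q (eval ?t h) \<longrightarrow> Q \<in> P - supp P I\<^sub>W"
    by (elim bexE conjE)
  have h0: "eval ?t h \<noteq> 0" using h by (simp add: unit_in_def)
  have spec: "local_of (A\<^sub>0 i ?c) Q \<and> unit_in Q (eval ?t h)" if "Q \<in> spec (localized_ring B n ?t h)" for Q
    using that unfolding spec_iff local_of_localized_iff[OF base_subring h(1) h0] by blast
  have QY: "Q \<in> Y" "A\<^sub>0 i ?c \<subseteq> Q" if "Q \<in> spec (localized_ring B n ?t h)" for Q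
  proof -
    show "A\<^sub>0 i ?c \<subseteq> Q" using spec[OF that] local_of_subset by blast
    moreover have "Q \<in> P" using spec[OF that] chart_in_P[OF i(1) cB] by blast
    ultimately show "Q \<in> Y" using h(3) spec[OF that] outside_in_Y by blast
  qed
  have RA: "A\<^sub>0 i ?c \<subseteq> R" using local_of_subset[OF lR] .
  have RX: "R \<in> X" using R center_P[OF R(2) dominates_refl] by simp
  have "YM.local_equations D n R ?t h {F i ?c}"
    unfolding YM.local_equations_def
  proof (intro conjI)
    show "alg_independent n ?t" by (rule alg_independent_chart_coord[OF i(1)])
    show "spec (localized_ring B n ?t h) \<subseteq> Y" using QY by blast
    show "{F i ?c} \<subseteq> polys B n" using F_polys[OF i(1) cB] by blast
    show "\<forall>G\<in>{F i ?c}. \<not> unit_in R (eval ?t G)" using D_iff[OF _ i(1) cB RA] R(1) by blast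
    show "\<forall>Q\<in>spec (localized_ring B n ?t h). (Q \<in> D) = (\<exists>G\<in>{F i ?c}. \<not> unit_in Q (eval ?t G))"
      using D_iff[OF QY(1) i(1) cB QY(2)] by blast
    show "(\<exists>G. {F i ?c} = {G} \<and> (\<exists>j<n. unit_in R (eval ?t (partial_deriv j G)))) \<or>
      (\<exists>l G. {F i ?c} = {var l, G} \<and> l < n \<and> (\<exists>j<n. j \<noteq> l \<and> unit_in R (eval ?t (partial_deriv j G))))"
      using smooth_point[OF i(1) cB lR R(3) RX] by blast
  qed (use h lR in auto)
  then show ?thesis by blast
qed

lemma local_equations_exceptional:
  assumes s: "s \<in> {1..\<tau>}" and sec: "section_at s i c" and l: "l < n" and R: "local_of (T\<^sub>0 i c l) R"
    and nu: "\<not> unit_in R (y_coord i c l)"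
  shows "\<exists>t h Gs. YM.local_equations D n R t h Gs"
proof -
  let ?y = "y_coord i c" and ?t = "t_coord i c l"
  note yl = section_y_nonzero[OF s sec l] and i = section_props(1)[OF sec] and cB = section_props(2)[OF sec]
  note C = blowup_chart_center[OF s sec l R] and S = is_subring_polys[OF base_subring, of n]
  have t: "alg_independent n ?t" by (rule alg_independent_blowup_coord[OF alg_independent_chart_coord[OF i] l])
  have CZ: "loc (A\<^sub>0 i c) R \<in> Ws s" using C(5) nu by blast
  \<comment> \<open>h is chosen at the closed point of the section: a unit there is a unit at every
    point over the section, in particular at R.\<close>
  obtain Rs where Rs: "Rs \<in> Ws s" "Rs \<subseteq> loc (A\<^sub>0 i c) R" using sec CZ unfolding section_at_def by blast
  have lRs: "local_of (A\<^sub>0 i c) Rs" using section_props(3)[OF sec] Rs(1) by blast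
  have RsP: "Rs \<in> P" using Rs(1) by (simp add: supp_def)
  have RsR: "Rs \<subseteq> R" using Rs(2) C(2) by (auto simp: dominates_def)
  let ?U = "P - (\<Union>u\<in>{1..\<tau>} - {s}. Ws u)"
  have "closedin (zariski P) (\<Union>u\<in>{1..\<tau>} - {s}. Ws u)" using closed_Z by (intro closedin_Union) auto
  then have "openin (zariski P) ?U" using topspace_P by (simp add: closedin_def)
  moreover have "Rs \<in> ?U" using RsP Ws_disjoint[OF s] Rs(1) by blast
  ultimately have "\<exists>h\<in>polys B n. unit_in Rs (eval ?y h) \<and>
      (\<forall>Q\<in>P. A\<^sub>0 i c \<subseteq> Q \<longrightarrow> unit_in Q (eval ?y h) \<longrightarrow> Q \<in> ?U)"
    by (rule principal_nbhd[OF lRs])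
  then obtain h where h: "h \<in> polys B n" "unit_in Rs (eval ?y h)"
    "\<forall>Q\<in>P. A\<^sub>0 i c \<subseteq> Q \<longrightarrow> unit_in Q (eval ?y h) \<longrightarrow> Q \<in> ?U"
    by (elim bexE conjE)
  \<comment> \<open>The same function in the coordinates of the blowup chart.\<close>
  define h' where "h' = subst (blowup_subst l) h"
  have h': "h' \<in> polys B n" "eval ?t h' = eval ?y h"
    unfolding h'_def using blowup_subst_polys[OF base_subring l h(1)] eval_blowup_subst[where y = "y_coord i c" and l = l, OF yl] by blast+
  have uh: "unit_in R (eval ?t h')" unfolding h'(2) using unit_in_mono[OF h(2) RsR] .
  obtain G where G: "G \<in> polys B n" "eval ?y (F i c) = ?y l ^ 2 * eval ?t G"
    "\<And>R R'. R \<in> Ws s \<Longrightarrow> R \<subseteq> R' \<Longrightarrow> local_of (T\<^sub>0 i c l) R' \<Longrightarrow> \<not> unit_in R' (?y l) \<Longrightarrow>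
       \<not> unit_in R' (eval ?t G) \<Longrightarrow> \<exists>j<n. j \<noteq> l \<and> unit_in R' (eval ?t (partial_deriv j G))"
    using strict_transform_equation[OF s sec l] by blast
  have tl: "eval ?t (var l) = ?y l" by (simp add: eval_simps blowup_coord_def)
  have inY: "Q \<in> Y" "A\<^sub>0 i c \<subseteq> Q" if Q: "local_of (T\<^sub>0 i c l) Q" "unit_in Q (eval ?t h')" for Q
  proof -
    note CQ = blowup_chart_center[OF s sec l Q(1)]
    have AC: "A\<^sub>0 i c \<subseteq> loc (A\<^sub>0 i c) Q" using local_of_subset[OF CQ(1)] .
    then show "A\<^sub>0 i c \<subseteq> Q" using CQ(2) by (auto simp: dominates_def)
    have "eval ?y h \<in> loc (A\<^sub>0 i c) Q" using AC eval_affine_ring[OF h(1)] by blast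
    then have "unit_in (loc (A\<^sub>0 i c) Q) (eval ?y h)" using Q(2) CQ(2) h'(2) by (simp add: dominates_def)
    then have "loc (A\<^sub>0 i c) Q \<in> ?U" using h(3)[rule_format, OF CQ(3) AC] by blast
    then show "Q \<in> Y" using blowup_chart_in_Y[OF s sec l Q(1)] by blast
  qed
  have D_Q: "Q \<in> D \<longleftrightarrow> \<not> unit_in Q (eval ?t (var l)) \<or> \<not> unit_in Q (eval ?t G)"
    if Q: "local_of (T\<^sub>0 i c l) Q" "unit_in Q (eval ?t h')" for Q
  proof -
    note sQ = local_of_subring[OF Q(1)]
    have mem: "eval ?t a \<in> Q" if "a \<in> polys B n" for a
      using local_of_subset[OF Q(1)] eval_affine_ring[OF that] by blast
    have yQ: "?y l \<in> Q" using mem[OF var_polys[OF base_subring l]] unfolding tl .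
    have "unit_in Q (eval ?y (F i c)) \<longleftrightarrow> unit_in Q (?y l) \<and> unit_in Q (eval ?t G)"
      unfolding G(2) power2_eq_square
      using unit_in_mult_iff[OF sQ is_subring_mult[OF sQ yQ yQ] mem[OF G(1)]] unit_in_mult_iff[OF sQ yQ yQ] by blast
    then show ?thesis using D_iff[OF inY(1)[OF Q] i cB inY(2)[OF Q]] unfolding tl by blast
  qed
  have nR: "\<not> unit_in R (eval ?t (var l))" using nu unfolding tl .
  have memR: "eval ?t a \<in> R" if "a \<in> polys B n" for a
    using local_of_subset[OF R] eval_affine_ring[OF that] by blast
  have specI: "local_of (T\<^sub>0 i c l) Q \<and> unit_in Q (eval ?t H)"
    if "Q \<in> spec (localized_ring B n ?t H)" "H \<in> polys B n" "unit_in R (eval ?t H)" for Q H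
  proof -
    have "eval ?t H \<noteq> 0" using that(3) by (simp add: unit_in_def)
    then show ?thesis using that(1) local_of_localized_iff[OF base_subring that(2)] unfolding spec_iff by blast
  qed
  show ?thesis
  \<comment> \<open>Either R also lies on the proper transform, and both equations occur, or G is
    inverted and only the exceptional divisor remains.\<close>
  proof (cases "unit_in R (eval ?t G)")
    case False
    have sp: "local_of (T\<^sub>0 i c l) Q" "unit_in Q (eval ?t h')" if "Q \<in> spec (localized_ring B n ?t h')" for Q
      using specI[OF that h'(1) uh] by blast+
    have "YM.local_equations D n R ?t h' {var l, G}"
      unfolding YM.local_equations_def
    proof (intro conjI disjI2)
      show "spec (localized_ring B n ?t h') \<subseteq> Y" using sp inY(1) by blast
      show "\<forall>Q\<in>spec (localized_ring B n ?t h'). (Q \<in> D) = (\<exists>G\<in>{var l, G}. \<not> unit_in Q (eval ?t G))"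
        using D_Q[OF sp] by blast
      show "\<exists>l' G'. {var l, G} = {var l', G'} \<and> l' < n \<and> (\<exists>j<n. j \<noteq> l' \<and> unit_in R (eval ?t (partial_deriv j G')))"
        using G(3)[OF Rs(1) RsR R nu False] l by blast
    qed (use t h' R uh False nR G(1) var_polys[OF base_subring l] in auto)
    then show ?thesis by blast
  next
    case True
    let ?H = "h' * G"
    have H: "?H \<in> polys B n" "unit_in R (eval ?t ?H)"
      using is_subring_mult[OF S h'(1) G(1)] unit_in_mult_iff[OF local_of_subring[OF R] memR[OF h'(1)] memR[OF G(1)]] uh True
      by (simp_all add: eval_simps)
    have sp: "local_of (T\<^sub>0 i c l) Q" "unit_in Q (eval ?t h')" "unit_in Q (eval ?t G)"
      if "Q \<in> spec (localized_ring B n ?t ?H)" for Q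
    proof -
      show lQ: "local_of (T\<^sub>0 i c l) Q" using specI[OF that H] by blast
      have "eval ?t h' \<in> Q" "eval ?t G \<in> Q"
        using local_of_subset[OF lQ] eval_affine_ring h'(1) G(1) by blast+
      then show "unit_in Q (eval ?t h')" "unit_in Q (eval ?t G)"
        using specI[OF that H] unit_in_mult_iff[OF local_of_subring[OF lQ]] by (simp_all add: eval_simps)
    qed
    have "YM.local_equations D n R ?t ?H {var l}"
      unfolding YM.local_equations_def
    proof (intro conjI disjI1)
      show "spec (localized_ring B n ?t ?H) \<subseteq> Y" using sp(1,2) inY(1) by blast
      show "\<forall>Q\<in>spec (localized_ring B n ?t ?H). (Q \<in> D) = (\<exists>G\<in>{var l}. \<not> unit_in Q (eval ?t G))"
        using D_Q[OF sp(1,2)] sp(3) by blast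
      show "\<exists>G'. {var l} = {G'} \<and> (\<exists>j<n. unit_in R (eval ?t (partial_deriv j G')))"
        using l unit_in_one[OF local_of_subring[OF R]]
        by (intro exI[of _ "var l"] conjI refl exI[of _ l]) (simp_all add: partial_deriv_var eval_simps)
    qed (use t H R nR var_polys[OF base_subring l] in auto)
    then show ?thesis by blast
  qed
qed

lemma local_equations_exist:
  assumes "R \<in> D" shows "\<exists>t h Gs. YM.local_equations D n R t h Gs"
proof -
  have "R \<in> Y" using assms by blast
  then show ?thesis
  proof (cases rule: Y_cases)
    case outside
    then show ?thesis using local_equations_outside assms by blast
  next
    case (exceptional s i c l)
    then show ?thesis by (rule local_equations_exceptional)
  qed
qed

lemma Ws_subset_X: assumes "s \<in> {1..\<tau>}" shows "Ws s \<subseteq> X"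
proof -
  obtain i c where "section_at s i c" using section_exists[OF assms] by blast
  then show ?thesis using sec_X[OF assms] by blast
qed

theorem divisor_components:
  "D = (zariski Y closure_of {y \<in> Y. center P y \<in> X - supp P I\<^sub>W}) \<union> (\<Union>s\<in>{1..\<tau>}. {y \<in> Y. center P y \<in> Ws s}) \<and>
   (\<forall>C\<in>irreducible_components (zariski Y) D. smooth_subscheme B Y (reduced_ideal Y C)) \<and>
   normal_crossings B\<^sub>0 Y D"
proof (intro conjI)
  let ?V = "{y \<in> Y. center P y \<in> X - supp P I\<^sub>W}"
  show "D = (zariski Y closure_of ?V) \<union> (\<Union>s\<in>{1..\<tau>}. {y \<in> Y. center P y \<in> Ws s})" (is "_ = ?cl \<union> ?E")
  proof (intro equalityI subsetI)
    fix y assume y: "y \<in> D"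
    show "y \<in> ?cl \<union> ?E"
    proof (cases "center P y \<in> supp P I\<^sub>W")
      case True
      then show ?thesis using y unfolding supp_IW by blast
    next
      case False
      then have "y \<in> ?V" using y by blast
      moreover have "?V \<subseteq> ?cl" by (rule closure_of_subset) (unfold YM.topspace_M, blast)
      ultimately show ?thesis by blast
    qed
  next
    fix y assume "y \<in> ?cl \<union> ?E"
    \<comment> \<open>D is closed and contains the points over X outside W; the exceptional divisors
      lie in D because the sections lie on X.\<close>
    moreover have "?cl \<subseteq> D" by (rule closure_of_minimal[OF _ closed_D]) blast
    ultimately show "y \<in> D" using Ws_subset_X by blast
  qed
  show "\<forall>C\<in>irreducible_components (zariski Y) D. smooth_subscheme B Y (reduced_ideal Y C)"
    using YM.component_smooth[OF closed_D local_equations_exist] by blast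
  show "normal_crossings B\<^sub>0 Y D"
    by (rule YM.normal_crossings_local_equations[OF closed_D local_equations_exist])
qed

end

section \<open>The ring of integers of an unramified extension\<close>

text \<open>Discreteness of the valuation is derived: the value group equals that of the closure of
  the rationals, where it can be computed by approximation.\<close>

locale p_adic_value =
  fixes v :: "'k::field_char_0 \<Rightarrow> real" and p :: nat
  assumes p: "prime p"
    and v_nonneg: "0 \<le> v x" and v_zero_iff: "v x = 0 \<longleftrightarrow> x = 0"
    and v_mult: "v (x * y) = v x * v y" and v_add: "v (x + y) \<le> max (v x) (v y)"
    and v_p: "v (of_nat p) = 1 / real p"
    and v_values: "v ` (UNIV - {0}) = v ` (closure_Q v - {0})"
begin

lemma v_pos: "x \<noteq> 0 \<Longrightarrow> 0 < v x"
  using v_nonneg[of x] v_zero_iff[of x] by linarith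

lemma v_one: "v 1 = 1"
  using v_mult[of 1 1] v_zero_iff[of 1] by simp

lemma v_uminus: "v (- x) = v x"
proof -
  have "v (- 1) * v (- 1) = 1" using v_mult[of "- 1" "- 1"] v_one by simp
  then have "v (- 1) = 1" using v_nonneg[of "- 1"] by (simp add: square_eq_1_iff)
  then show ?thesis using v_mult[of "- 1" x] by simp
qed

lemma v_diff: "v (x - y) \<le> max (v x) (v y)"
  using v_add[of x "- y"] v_uminus[of y] by simp

lemma v_power: "v (x ^ n) = v x ^ n"
  by (induction n) (simp_all add: v_one v_mult)

lemma v_inverse: "x \<noteq> 0 \<Longrightarrow> v (inverse x) = inverse (v x)"
  using v_mult[of x "inverse x"] v_one v_zero_iff[of x] by (simp add: field_simps)

lemma v_close: assumes "v (y - x) < v x" shows "v y = v x"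
proof -
  have "v y \<le> max (v (y - x)) (v x)" using v_add[of "y - x" x] by simp
  moreover have "v x \<le> max (v y) (v (y - x))" using v_diff[of y "y - x"] by simp
  ultimately show ?thesis using assms by linarith
qed

lemma is_subring_valuation_ring: "is_subring (valuation_ring v)"
  unfolding is_subring_def valuation_ring_def mem_Collect_eq
proof (intro conjI ballI)
  fix x y assume *: "x \<in> {x. v x \<le> 1}" "y \<in> {x. v x \<le> 1}"
  show "v (x - y) \<le> 1" using v_diff[of x y] * by auto
  show "v (x * y) \<le> 1" unfolding v_mult using * v_nonneg by (intro mult_le_one) auto
qed (simp add: v_one)

lemma unit_valuation_ring: "unit_in (valuation_ring v) x \<longleftrightarrow> v x = 1"
proof (cases "x = 0")
  case False
  then have "0 < v x" using v_pos by blast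
  then show ?thesis
    using False by (auto simp: unit_in_def valuation_ring_def v_inverse inverse_le_1_iff)
next
  case True
  then show ?thesis using v_zero_iff[of 0] by (simp add: unit_in_def)
qed

lemma local_valuation_ring: "local_ring (valuation_ring v)"
  unfolding local_ring_def unit_valuation_ring
proof (intro conjI ballI impI is_subring_valuation_ring)
  fix x y assume "x \<in> valuation_ring v" "y \<in> valuation_ring v" "v (x + y) = 1"
  then show "v x = 1 \<or> v y = 1" using v_add[of x y] by (auto simp: valuation_ring_def)
qed

lemma v_of_int: "v (of_int m) \<le> 1"
proof -
  have nat: "v (of_nat k) \<le> 1" for k
    using is_subring_of_nat[OF is_subring_valuation_ring, of k] by (simp add: valuation_ring_def)
  show ?thesis by (cases m rule: int_cases2) (use nat v_uminus in auto)
qed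

text \<open>In a Bezout relation the term with p has value less than 1, so the other term must have
  value 1.\<close>

lemma v_of_int_coprime: assumes "coprime m (int p)" shows "v (of_int m) = 1"
proof -
  obtain a b where "a * m + b * int p = 1" using assms bezout_int[of m "int p"] by auto
  then have "of_int (a * m + b * int p) = (1 :: 'k)" by simp
  then have e: "of_int a * of_int m + of_int b * of_nat p = (1 :: 'k)" by simp
  have "v (of_int b * of_nat p) \<le> 1 / real p"
    unfolding v_mult v_p using v_of_int[of b] prime_gt_0_nat[OF p] by (simp add: divide_right_mono)
  moreover have "1 / real p < 1" using prime_gt_1_nat[OF p] by simp
  ultimately have "1 \<le> v (of_int a * of_int m)"
    using v_add[of "of_int a * of_int m" "of_int b * of_nat p"] e v_one by auto
  moreover have "v (of_int a * of_int m) \<le> v (of_int m)"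
    unfolding v_mult using v_of_int[of a] v_nonneg[of "of_int m"] by (simp add: mult_left_le_one_le v_nonneg)
  ultimately show ?thesis using v_of_int[of m] by linarith
qed

lemma v_of_int_power: assumes "m \<noteq> 0" shows "\<exists>k. v (of_int m) = (1 / real p) ^ k"
proof -
  have pr: "prime (int p)" using p by simp
  then obtain m' where m': "m = int p ^ multiplicity (int p) m * m'" "\<not> int p dvd m'"
    using multiplicity_decompose'[of m "int p"] assms by (metis not_prime_unit)
  have "coprime m' (int p)" using pr m'(2) by (metis coprime_commute prime_imp_coprime)
  then have "v (of_int m') = 1" by (rule v_of_int_coprime)
  moreover have "of_int m = (of_nat p ^ multiplicity (int p) m * of_int m' :: 'k)"
    by (subst m'(1)) simp
  ultimately have "v (of_int m) = (1 / real p) ^ multiplicity (int p) m"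
    by (simp only: v_mult v_power v_p mult_1_right)
  then show ?thesis by blast
qed

text \<open>The value is that of an element of the closure of the rationals, hence of a rational
  number close to it. Natural exponents on both sides stand for one integer exponent.\<close>

lemma v_power_of_p: assumes "x \<noteq> 0" shows "\<exists>k l. v x * (1 / real p) ^ k = (1 / real p) ^ l"
proof -
  have "v x \<in> v ` (closure_Q v - {0})" using assms v_values by blast
  then obtain z where z: "z \<in> closure_Q v" "z \<noteq> 0" "v x = v z" by auto
  then obtain s :: "nat \<Rightarrow> rat" where s: "(\<lambda>i. v (of_rat (s i) - z)) \<longlonglongrightarrow> 0" by (auto simp: closure_Q_def)
  have "\<forall>\<^sub>F i in sequentially. v (of_rat (s i) - z) < v z"
    using order_tendstoD(2)[OF s v_pos[OF z(2)]] .
  then obtain i where "v (of_rat (s i) - z) < v z" by (auto simp: eventually_sequentially)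
  then have vz: "v (of_rat (s i)) = v z" by (rule v_close)
  obtain a b where ab: "quotient_of (s i) = (a, b)" by fastforce
  then have q: "s i = of_int a / of_int b" "b > 0" using quotient_of_div quotient_of_denom_pos by blast+
  have "of_rat (s i) * of_int b = (of_int a :: 'k)" using q by (simp add: of_rat_divide)
  then have e: "v z * v (of_int b) = v (of_int a)" using v_mult[of "of_rat (s i)" "of_int b"] vz by simp
  have "a \<noteq> 0" using q vz z(2) v_zero_iff[of z] v_zero_iff[of 0] by auto
  then obtain l where "v (of_int a) = (1 / real p) ^ l" using v_of_int_power by blast
  moreover obtain k where "v (of_int b) = (1 / real p) ^ k" using v_of_int_power[of b] q(2) by auto
  ultimately show ?thesis using e z(3) by metis
qed

lemma valuation_ring_factor:
  assumes x: "x \<in> valuation_ring v" "x \<noteq> 0"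
  shows "\<exists>k u. v u = 1 \<and> x = of_nat p ^ k * u"
proof -
  let ?q = "1 / real p"
  have q: "0 < ?q" "?q < 1" using prime_gt_1_nat[OF p] by auto
  obtain k l where kl: "v x * ?q ^ k = ?q ^ l" using v_power_of_p[OF x(2)] by blast
  have "?q ^ l \<le> ?q ^ k" using kl x(1) q v_nonneg[of x] by (metis valuation_ring_def mem_Collect_eq mult_left_le_one_le zero_less_power less_imp_le)
  then have "k \<le> l" using q power_strict_decreasing[of l k ?q] by (meson not_le)
  then have "v x * ?q ^ k = ?q ^ (l - k) * ?q ^ k" using kl by (simp flip: power_add)
  then have vx: "v x = ?q ^ (l - k)" using q by simp
  let ?P = "of_nat p ^ (l - k) :: 'k"
  have P0: "?P \<noteq> 0" using prime_gt_0_nat[OF p] by simp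
  have "v (x / ?P) = 1"
    using vx P0 q by (simp add: divide_inverse v_mult v_inverse v_power v_p power_inverse)
  moreover have "x = ?P * (x / ?P)" using P0 by simp
  ultimately show ?thesis by blast
qed

lemma unit_of_valuation_ring: "is_unit_of (valuation_ring v) x \<longleftrightarrow> v x = 1"
proof
  assume "is_unit_of (valuation_ring v) x"
  then obtain y where "x \<in> valuation_ring v" "y \<in> valuation_ring v" "x * y = 1"
    by (auto simp: is_unit_of_def)
  then have "x \<noteq> 0" "inverse x = y" by (auto intro: inverse_unique)
  then show "v x = 1"
    using \<open>x \<in> _\<close> \<open>y \<in> _\<close> unit_valuation_ring by (auto simp: unit_in_def)
next
  assume "v x = 1"
  then have "unit_in (valuation_ring v) x" using unit_valuation_ring by blast
  then show "is_unit_of (valuation_ring v) x"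
    unfolding is_unit_of_def unit_in_def by (metis right_inverse)
qed

text \<open>Every nonzero element is a power of p times a unit. So p divides exactly the elements of
  value less than 1, which makes it prime.\<close>

lemma factorial_valuation_ring: "factorial_in (valuation_ring v)"
proof -
  let ?R = "valuation_ring v" and ?p = "of_nat p :: 'k"
  have vp: "v ?p < 1" "?p \<noteq> 0" using v_p prime_gt_1_nat[OF p] by auto
  have "prime_in ?R ?p"
    unfolding prime_in_def unit_of_valuation_ring
  proof (intro conjI ballI impI)
    show "?p \<in> ?R" using vp by (simp add: valuation_ring_def)
    show "?p \<noteq> 0" "v ?p \<noteq> 1" using vp by auto
    fix a b assume a: "a \<in> ?R" and b: "b \<in> ?R" and d: "divides_in ?R ?p (a * b)"
    have dvd: "divides_in ?R ?p x" if x: "x \<in> ?R" "v x \<noteq> 1" for x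
    proof (cases "x = 0")
      case True
      then show ?thesis using is_subring_zero[OF is_subring_valuation_ring] by (auto simp: divides_in_def)
    next
      case False
      then obtain k u where ku: "v u = 1" "x = ?p ^ k * u" using valuation_ring_factor x by blast
      then have "k \<noteq> 0" using x(2) by (metis mult_1 power_0)
      then obtain k' where "k = Suc k'" by (cases k) auto
      then have "x = ?p * (?p ^ k' * u)" using ku by simp
      moreover have "?p ^ k' * u \<in> ?R"
        using ku \<open>?p \<in> ?R\<close> is_subring_valuation_ring
        by (intro is_subring_mult is_subring_power) (auto simp: valuation_ring_def)
      ultimately show ?thesis by (auto simp: divides_in_def)
    qed
    have "v (a * b) < 1"
    proof -
      obtain c where "c \<in> ?R" "a * b = ?p * c" using d by (auto simp: divides_in_def)
      then have "v (a * b) = v ?p * v c" "v c \<le> 1" by (auto simp: v_mult valuation_ring_def)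
      then show ?thesis using vp v_nonneg[of ?p] by (metis mult_left_le order_le_less_trans)
    qed
    then have "v a \<noteq> 1 \<or> v b \<noteq> 1" unfolding v_mult by auto
    then show "divides_in ?R ?p a \<or> divides_in ?R ?p b" using dvd a b by blast
  qed
  then have "prime_factors_in ?R k (?p ^ k * u)" if "v u = 1" for k u
  proof (induction k)
    case 0
    then show ?case using that by (auto intro: prime_factors_in.unit simp: unit_of_valuation_ring)
  next
    case (Suc k)
    then show ?case using prime_factors_in.prime[of ?R ?p k "?p ^ k * u"] by (simp add: mult.assoc)
  qed
  then show ?thesis
    unfolding factorial_in_def using is_subring_valuation_ring valuation_ring_factor by metis
qed

text \<open>If x had value greater than 1, the leading term of a monic integral equation would
  exceed all the others in value.\<close>

lemma algebraic_int_valuation_ring: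
  assumes "algebraic_int x" shows "x \<in> valuation_ring v"
proof (rule ccontr)
  assume "x \<notin> valuation_ring v"
  then have x: "1 < v x" by (simp add: valuation_ring_def)
  obtain P where P: "lead_coeff P = 1" "\<forall>i. coeff P i \<in> \<int>" "poly P x = 0"
    using assms by (auto simp: algebraic_int.simps)
  define d where "d = degree P"
  have d: "d > 0"
  proof (rule ccontr)
    assume "\<not> d > 0"
    then obtain a where "P = [:a:]" unfolding d_def by (metis degree_eq_zeroE not_gr_zero)
    then show False using P by simp
  qed
  have "0 = (\<Sum>i<d. coeff P i * x ^ i) + x ^ d"
    using P(1,3) by (simp add: poly_altdef d_def lessThan_Suc_atMost[symmetric])
  then have "x ^ d = - (\<Sum>i<d. coeff P i * x ^ i)" by (simp add: eq_neg_iff_add_eq_0 add.commute)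
  then have "v (x ^ d) = v (\<Sum>i<d. coeff P i * x ^ i)" using v_uminus by simp
  also have "\<dots> \<le> v x ^ (d - 1)"
  proof -
    have "v (\<Sum>i\<in>S. coeff P i * x ^ i) \<le> v x ^ (d - 1)" if "finite S" "S \<subseteq> {..<d}" for S
      using that
    proof (induction S rule: finite_induct)
      case empty
      then show ?case using v_zero_iff[of 0] v_nonneg by simp
    next
      case (insert i S)
      obtain m where "coeff P i = of_int m" using P(2) by (metis Ints_cases)
      then have "v (coeff P i * x ^ i) \<le> v x ^ i"
        using v_of_int[of m] v_nonneg[of x] by (simp add: v_mult v_power mult_left_le_one_le v_nonneg)
      also have "\<dots> \<le> v x ^ (d - 1)" using x insert.prems by (intro power_increasing) auto
      finally show ?case using insert v_add[of "coeff P i * x ^ i" "\<Sum>i\<in>S. coeff P i * x ^ i"] by auto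
    qed
    then show ?thesis by blast
  qed
  finally have "v x ^ d \<le> v x ^ (d - 1)" by (simp add: v_power)
  moreover have "v x ^ (d - 1) < v x ^ d" using x d by (intro power_strict_increasing) auto
  ultimately show False by simp
qed

end

theorem lemma2p1:
  fixes p a n N \<tau> :: nat
    and v :: "'k::field_char_0 \<Rightarrow> real"
    and L :: "'k set"
    and f :: "'k mpoly"
    and W :: "nat \<Rightarrow> 'k ratfun ideal_sheaf"
  assumes "prime p"
    and "unramified_p_adic_field p a v"
    and "n > 0" and "p > n - 1"
    and "number_field L" and "unramified_at p L"
    and "f \<in> polys (integers_of L) (Suc n)" and "homogeneous N f"
    and "equisingular_odps (valuation_ring v) n N f \<tau> W"
  shows
    "let \<O> = valuation_ring v;
         P = proj_space \<O> n;
         X = supp P (hypersurface_ideal \<O> n N f);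
         I\<^sub>W = disjoint_union_ideal {1..\<tau>} W;
         Y = blowup P I\<^sub>W;
         \<rho> = center P;
         D = {y \<in> Y. \<rho> y \<in> X};
         Xhat = zariski Y closure_of {y \<in> Y. \<rho> y \<in> X - supp P I\<^sub>W};
         E = (\<lambda>s. {y \<in> Y. \<rho> y \<in> supp P (W s)})
     in D = Xhat \<union> (\<Union>s\<in>{1..\<tau>}. E s) \<and>
        (\<forall>C\<in>irreducible_components (zariski Y) D. smooth_subscheme \<O> Y (reduced_ideal Y C)) \<and>
        normal_crossings (const_fun ` \<O>) Y D"
proof -
  interpret p_adic_value v p
    by (rule p_adic_value.intro)
      (use assms(1,2) in \<open>simp_all only: unramified_p_adic_field_def\<close>)
  \<comment> \<open>This makes f a polynomial over the base, to which the geometric argument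
    applies.\<close>
  have "integers_of L \<subseteq> valuation_ring v"
    using algebraic_int_valuation_ring by (auto simp: integers_of_def)
  then have f: "f \<in> polys (valuation_ring v) (Suc n)"
    using assms(7) polys_mono[of "integers_of L" "valuation_ring v" "Suc n" "Suc n"] by blast
  interpret nodal "valuation_ring v" n N \<tau> f W
    using factorial_valuation_ring local_valuation_ring assms(3,8,9) f by unfold_locales
  show ?thesis unfolding Let_def by (rule divisor_components)
qed

end
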